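(* Let $\mu>0$ satisfy $2+2\mu(\mu+\sqrt{1+\mu^2})>2m+1$. Let $\alpha_0,\beta,\gamma$ satisfy $$\frac1{1+\mu(\mu+\sqrt{1+\mu^2})}\le\alpha_0\le\frac2{2m+1},\qquad\beta>0,\qquad\frac{\alpha_0+\beta}2<\gamma<\frac1{2m+1}.$$ Then for every $u_0\in\mathcal C^{-\alpha_0}$ and every $\underline Z\in\mathcal L$ there exists a unique $v\in C((0,\infty);\mathcal C^\beta)$ which is a mild solution, up to every time $T>0$, of $\partial_tv=[(\mathrm i+\mu)\Delta-1]v+\Psi(v,\underline Z)$, $v(0)=u_0$.
   Context: $\mathbb T^2=\mathbb R^2/\mathbb Z^2$; $\nu,\tau\in\mathbb C$ with $\mathrm{Re}\,\nu>0$, $m\ge1$ integer. $\mathcal C^\alpha=\mathcal B^\alpha_{\infty,\infty}$ is the complex-valued Besov–Hölder space on $\mathbb T^2$. $A=(\mathrm i+\mu)\Delta-1$, $P_t=e^{tA}$. Let $L=\{(i,j)\in\mathbb N^2:0\le i\le m+1,\ 0\le j\le m,\ i\ge j,\ i+j>1\}$. For $\alpha,\alpha'\in(0,1)$, $T>0$ and $\underline Z=(Z_t,Z^{(i,j)}_t)_{(i,j)\in L}$ with $Z\in C([0,T];\mathcal C^{-\alpha})$, $Z^{(i,j)}\in C((0,T];\mathcal C^{-\alpha})$, set $\|\underline Z\|_{\alpha,\alpha',T}=\sup_{0\le t\le T}\big(\|Z_t\|_{\mathcal C^{-\alpha}}\vee\sup_{(i,j)\in L}t^{(i+j-1)\alpha'}\|Z^{(i,j)}_t\|_{\mathcal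 C^{-\alpha}}\big)$. $\mathcal L$ is the set of such families defined on $(0,\infty)$ with $\|\underline Z\|_{\alpha,\alpha',T}<\infty$ for all $\alpha,\alpha'\in(0,1)$, $T>0$. The (fixed) $\alpha,\alpha'$ used below are sufficiently small. Notation: $Z^{:1,0:}_t=Z_t$, $Z^{:0,1:}_t=\overline{Z_t}$, $Z^{:0,0:}_t=1$, $Z^{:i,j:}_t=Z^{(i,j)}_t$ and $Z^{:j,i:}_t=\overline{Z^{(i,j)}_t}$ for $(i,j)\in L$. Define $\Psi(v_t,\underline Z_t)=-\nu\sum_{i=0}^{m+1}\sum_{j=0}^m\binom{m+1}i\binom mj v_t^i\overline{v_t}^{\,j}Z^{:m+1-i,m-j:}_t+(\tau+1)(v_t+Z_t)$. A mild solution up to time $T$ is $v\in C((0,T];\mathcal C^\beta)$ with $\sup_{0<t\le T}t^\gamma\|v_t\|_{\mathcal C^\beta}<\infty$ and $v_t=P_tu_0+\int_0^tP_{t-s}\Psi(v_s,\underline Z_s)ds$, $t\le T$. *)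

theory Defs
  imports "HOL-Analysis.Analysis"
begin

text \<open>Distributions on the torus T^2 = R^2/Z^2 are represented by their Fourier
coefficients, indexed by Z^2.\<close>
type_synonym distr = "int \<times> int \<Rightarrow> complex"

definition sstep_e :: "real \<Rightarrow> real" where
  "sstep_e x = (if x > 0 then exp (- 1 / x) else 0)"

definition sstep :: "real \<Rightarrow> real" where
  "sstep x = sstep_e x / (sstep_e x + sstep_e (1 - x))"

definition lp_theta :: "real \<times> real \<Rightarrow> real" where
  "lp_theta \<xi> = 1 - sstep (norm \<xi> - 1)"

definition lp_rho :: "real \<times> real \<Rightarrow> real" where
  "lp_rho \<xi> = lp_theta ((1/2) *\<^sub>R \<xi>) - lp_theta \<xi>"

text \<open>Block n corresponds to the Littlewood--Paley index j = n - 1 (n = 0 is chi).\<close>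
definition lp_symbol :: "nat \<Rightarrow> real \<times> real \<Rightarrow> real" where
  "lp_symbol n \<xi> = (if n = 0 then lp_theta \<xi> else lp_rho ((1 / 2 ^ (n - 1)) *\<^sub>R \<xi>))"

definition kvec :: "int \<times> int \<Rightarrow> real \<times> real" where
  "kvec k = (real_of_int (fst k), real_of_int (snd k))"

definition lp_box :: "nat \<Rightarrow> (int \<times> int) set" where
  "lp_box N = {- (2 ^ (N + 2)) .. 2 ^ (N + 2)} \<times> {- (2 ^ (N + 2)) .. 2 ^ (N + 2)}"

text \<open>Delta_j f as a trigonometric polynomial evaluated at x (support of the
symbol lies in lp_box n).\<close>
definition lp_block :: "nat \<Rightarrow> distr \<Rightarrow> real \<times> real \<Rightarrow> complex" where
  "lp_block n f x = (\<Sum>k\<in>lp_box n. complex_of_real (lp_symbol n (kvec k)) * f k *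
      cis (2 * pi * (real_of_int (fst k) * fst x + real_of_int (snd k) * snd x)))"

definition besov_seq :: "real \<Rightarrow> distr \<Rightarrow> nat \<Rightarrow> real" where
  "besov_seq a f n = 2 powr ((real n - 1) * a) * (SUP x. cmod (lp_block n f x))"

definition in_C :: "real \<Rightarrow> distr \<Rightarrow> bool" where
  "in_C a f \<longleftrightarrow> bdd_above (range (besov_seq a f))"

definition Cnorm :: "real \<Rightarrow> distr \<Rightarrow> real" where
  "Cnorm a f = (SUP n. besov_seq a f n)"

definition dconj :: "distr \<Rightarrow> distr" where
  "dconj f = (\<lambda>k. cnj (f (- fst k, - snd k)))"

definition done_one :: distr where
  "done_one = (\<lambda>k. if k = (0, 0) then 1 else 0)"

definition lp_partial :: "nat \<Rightarrow> distr \<Rightarrow> distr" where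
  "lp_partial N f = (\<lambda>k. complex_of_real (\<Sum>n<N. lp_symbol n (kvec k)) * f k)"

definition dmult :: "distr \<Rightarrow> distr \<Rightarrow> distr" where
  "dmult f g = (\<lambda>k. lim (\<lambda>N. \<Sum>l\<in>lp_box N.
        lp_partial N f l * lp_partial N g (fst k - fst l, snd k - snd l)))"

fun dpow :: "distr \<Rightarrow> nat \<Rightarrow> distr" where
  "dpow f 0 = done_one"
| "dpow f (Suc i) = dmult f (dpow f i)"

definition ccont_on :: "real set \<Rightarrow> real \<Rightarrow> (real \<Rightarrow> distr) \<Rightarrow> bool" where
  "ccont_on S a u \<longleftrightarrow> (\<forall>t\<in>S. in_C a (u t)) \<and>
     (\<forall>t\<in>S. \<forall>\<epsilon>>0. \<exists>\<delta>>0. \<forall>s\<in>S. \<bar>s - t\<bar> < \<delta> \<longrightarrow> Cnorm a (\<lambda>k. u s k - u t k) < \<epsilon>)"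

definition Lset :: "nat \<Rightarrow> (nat \<times> nat) set" where
  "Lset m = {(i, j). i \<le> m + 1 \<and> j \<le> m \<and> j \<le> i \<and> i + j > 1}"

definition in_L :: "nat \<Rightarrow> (real \<Rightarrow> distr) \<Rightarrow> (nat \<Rightarrow> nat \<Rightarrow> real \<Rightarrow> distr) \<Rightarrow> bool" where
  "in_L m Z Zh \<longleftrightarrow> (\<forall>a\<in>{0<..<1}. \<forall>a'\<in>{0<..<1}. \<forall>T>0.
      ccont_on {0..T} (- a) Z \<and>
      (\<forall>(i, j)\<in>Lset m. ccont_on {0<..T} (- a) (Zh i j)) \<and>
      bdd_above ((\<lambda>t. Cnorm (- a) (Z t)) ` {0..T}) \<and>
      (\<forall>(i, j)\<in>Lset m. bdd_above
         ((\<lambda>t. t powr (real (i + j - 1) * a') * Cnorm (- a) (Zh i j t)) ` {0<..T})))"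

definition Zcol :: "nat \<Rightarrow> (real \<Rightarrow> distr) \<Rightarrow> (nat \<Rightarrow> nat \<Rightarrow> real \<Rightarrow> distr) \<Rightarrow> nat \<Rightarrow> nat \<Rightarrow> real \<Rightarrow> distr" where
  "Zcol m Z Zh a b t =
     (if (a, b) = (1, 0) then Z t
      else if (a, b) = (0, 1) then dconj (Z t)
      else if (a, b) = (0, 0) then done_one
      else if (a, b) \<in> Lset m then Zh a b t
      else dconj (Zh b a t))"

definition Psi :: "nat \<Rightarrow> complex \<Rightarrow> complex \<Rightarrow> (real \<Rightarrow> distr) \<Rightarrow> (nat \<Rightarrow> nat \<Rightarrow> real \<Rightarrow> distr)
                   \<Rightarrow> distr \<Rightarrow> real \<Rightarrow> distr" where
  "Psi m \<nu> \<tau> Z Zh v t = (\<lambda>k.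
     - \<nu> * (\<Sum>i\<le>m + 1. \<Sum>j\<le>m. of_nat (m + 1 choose i) * of_nat (m choose j) *
          dmult (dmult (dpow v i) (dpow (dconj v) j)) (Zcol m Z Zh (m + 1 - i) (m - j) t) k)
     + (\<tau> + 1) * (v k + Z t k))"

text \<open>Fourier symbol of A = (i + mu) Delta - 1 on T^2.\<close>
definition heat_symbol :: "real \<Rightarrow> int \<times> int \<Rightarrow> complex" where
  "heat_symbol \<mu> k = - (\<i> + complex_of_real \<mu>) *
      complex_of_real (4 * pi ^ 2 * (real_of_int (fst k) ^ 2 + real_of_int (snd k) ^ 2)) - 1"

definition mild_solution ::
  "nat \<Rightarrow> real \<Rightarrow> complex \<Rightarrow> complex \<Rightarrow> real \<Rightarrow> real \<Rightarrow> distr \<Rightarrow> (real \<Rightarrow> distr)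
   \<Rightarrow> (nat \<Rightarrow> nat \<Rightarrow> real \<Rightarrow> distr) \<Rightarrow> real \<Rightarrow> (real \<Rightarrow> distr) \<Rightarrow> bool" where
  "mild_solution m \<mu> \<nu> \<tau> \<beta> \<gamma> u0 Z Zh T v \<longleftrightarrow>
     ccont_on {0<..T} \<beta> v \<and>
     bdd_above ((\<lambda>t. t powr \<gamma> * Cnorm \<beta> (v t)) ` {0<..T}) \<and>
     (\<forall>t\<in>{0<..T}. \<forall>k.
        (\<lambda>s. exp (complex_of_real (t - s) * heat_symbol \<mu> k) * Psi m \<nu> \<tau> Z Zh (v s) s k)
            integrable_on {0..t} \<and>
        v t k = exp (complex_of_real t * heat_symbol \<mu> k) * u0 k +
           integral {0..t} (\<lambda>s. exp (complex_of_real (t - s) * heat_symbol \<mu> k) *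
                                 Psi m \<nu> \<tau> Z Zh (v s) s k))"

end

theory Submission
  imports Defs "HOL-Analysis.Analysis"
begin

text \<open>A contraction argument in the space of paths with \<open>t powr \<gamma> * norm\<close> bounded gives local existence,
  with a time step that depends on \<open>u0\<close> only through its norm in \<open>C^(-a1)\<close>, so a bound of that norm along
  the solution makes it global. Such a bound comes from an \<open>L^(2r)\<close> energy estimate with \<open>r = 1/a1\<close>, since \<open>L^(2r)\<close>
  embeds into \<open>C^(-1/r)\<close> in two dimensions. Pairing the equation with \<open>|v|^(2r-2) cnj v\<close>, the dispersive part of the
  Laplacian is dominated by the dissipative one exactly when \<open>(r-1)^2 < \<mu>^2 (2r-1)\<close>; the leading nonlinearity
  produces \<open>- Re \<nu>\<close> times the \<open>L^(2r+2m)\<close> moment; and every other term is a distribution of regularity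
  \<open>-\<alpha>\<close> tested against a power of \<open>v\<close> whose \<open>L^1\<close> modulus of continuity of order \<open>1/(2m)\<close> is controlled by these
  two quantities. The estimate is carried out on the frequency truncations of \<open>v\<close>, whose commutator with the
  nonlinearity tends to zero. Working with exponents slightly above \<open>\<alpha>0\<close> and \<open>\<beta>\<close> makes the inequalities strict and
  gives continuity in \<open>C^\<beta>\<close> by interpolation.\<close>

subsection \<open>Trigonometric polynomials on the torus\<close>

text \<open>With x = r - 1 the dissipativity condition is x^2 < \<mu>^2 (2x + 1); its positive root
  is \<mu> (\<mu> + sqrt (1 + \<mu>^2)). So the lower bound on \<alpha>0 says exactly that r = 1/a1
  is admissible for every a1 > \<alpha>0. The obstacle is that a solution of small positive
  regularity and coefficients that are distributions cannot be paired with a power of the solution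
  directly. All pairings are therefore integrals of finitely supported Fourier series. The
  commutator of truncation and nonlinearity is measured in a regularity slightly below -al, where it
  tends to zero, and is then treated as one more coefficient of size 1. How far one must truncate
  depends on the solution, but the resulting bound does not, and that is what the continuation
  argument requires. The energy estimate starts at a positive time, because at time 0 the solution
  is only a distribution. Regularity is carried by the predicate \<open>bb\<close> with an explicit
  constant instead of a supremum: it needs no boundedness side condition, it passes to
  coefficientwise limits, and \<open>Cnorm\<close> enters only at the end.\<close>

definition ee :: "int \<times> int \<Rightarrow> real \<times> real \<Rightarrow> complex" where
  "ee k x = cis (2 * pi * (real_of_int (fst k) * fst x + real_of_int (snd k) * snd x))"

lemma ee_simps [simp]: "cmod (ee k x) = 1" "ee 0 x = 1" "ee k 0 = 1" "ee (0,0) x = 1" "ee k (0,0) = 1"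
  by (auto simp: ee_def)

lemma ee_add: "ee k (x + y) = ee k x * ee k y" "ee (k + l) x = ee k x * ee l x"
  by (auto simp: ee_def cis_mult algebra_simps)

lemma ee_minus: "ee k (- x) = cnj (ee k x)" "ee (- k) x = cnj (ee k x)"
  by (simp_all add: ee_def cis_cnj, simp_all add: algebra_simps)

lemma ee_cnj_mult [simp]: "ee k x * cnj (ee k x) = 1" "cnj (ee k x) * ee k x = 1"
  by (simp_all add: complex_norm_square[symmetric] mult.commute[of "cnj _"])

lemma ee_diff: "ee k (x - y) = ee k x * cnj (ee k y)" "ee (k - l) x = ee k x * cnj (ee l x)"
  using ee_add(1)[of k x "-y"] ee_add(2)[of k "-l" x] by (auto simp: ee_minus)

lemma continuous_on_ee [continuous_intros]:
  "continuous_on S g \<Longrightarrow> continuous_on S (\<lambda>x. ee k (g x))"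
  unfolding ee_def cis_conv_exp by (intro continuous_intros)

lemma ee_int [simp]: "ee k (of_int a, of_int b) = 1"
proof -
  have "ee k (of_int a, of_int b) = cis (2 * pi * real_of_int (fst k * a + snd k * b))"
    by (simp add: ee_def)
  then show ?thesis using cis_multiple_2pi by simp
qed

text \<open>The cell is centred at 0, so on it the distance to the lattice is the norm itself;
  \<open>one_minus_ee\<close> relies on coordinates of modulus at most 1/2.\<close>

definition torus :: "(real \<times> real) set" where "torus = cbox (-1/2, -1/2) (1/2, 1/2)"

definition tint :: "(real \<times> real \<Rightarrow> 'a::euclidean_space) \<Rightarrow> 'a" where
  "tint f = integral torus f"

definition per :: "(real \<times> real \<Rightarrow> 'a) \<Rightarrow> bool" where
  "per f \<longleftrightarrow> (\<forall>x y. f (x + 1, y) = f (x, y) \<and> f (x, y + 1) = f (x, y))"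

lemma per_ee: "per (ee k)"
proof -
  have "ee k (1, 0) = 1" "ee k (0, 1) = 1" using ee_int[of k 1 0] ee_int[of k 0 1] by auto
  then show ?thesis unfolding per_def
    using ee_add(1)[of k "(_, _)" "(1,0)"] ee_add(1)[of k "(_, _)" "(0,1)"] by auto
qed

abbreviation "cont f \<equiv> continuous_on UNIV f"

lemma cont_integrable [simp, intro]: "cont f \<Longrightarrow> (f :: _ \<Rightarrow> 'a::euclidean_space) integrable_on torus"
  unfolding torus_def by (rule integrable_continuous, rule continuous_on_subset) auto

lemma tint_add: "cont f \<Longrightarrow> cont g \<Longrightarrow> tint (\<lambda>x. f x + g x) = tint f + tint g"
  unfolding tint_def by (intro integral_add) auto
lemma tint_diff: "cont f \<Longrightarrow> cont g \<Longrightarrow> tint (\<lambda>x. f x - g x) = tint f - tint g"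
  unfolding tint_def by (intro integral_diff) auto
lemma tint_mult: "tint (\<lambda>x. (c::'a::{euclidean_space,real_normed_field}) * f x) = c * tint f"
  unfolding tint_def by (rule integral_mult_right)
lemma tint_sum: "finite I \<Longrightarrow> (\<And>i. i \<in> I \<Longrightarrow> cont (f i)) \<Longrightarrow>
    tint (\<lambda>x. \<Sum>i\<in>I. f i x) = (\<Sum>i\<in>I. tint (f i))"
  unfolding tint_def by (intro integral_sum) auto
lemma tint_const [simp]: "tint (\<lambda>x. c) = c"
proof -
  have "measure lebesgue torus = 1"
    using content_Pair[of "-1/2::real" "-1/2::real" "1/2" "1/2"] by (simp add: torus_def)
  then show ?thesis unfolding tint_def torus_def by (simp del: content_Pair)
qed
lemma tint_mono: "cont f \<Longrightarrow> cont g \<Longrightarrow> (\<And>x. f x \<le> g x) \<Longrightarrow> tint f \<le> tint (g :: _ \<Rightarrow> real)"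
  unfolding tint_def by (intro integral_le) auto
lemma tint_mono_torus: "cont f \<Longrightarrow> cont g \<Longrightarrow> (\<And>x. x \<in> torus \<Longrightarrow> f x \<le> g x) \<Longrightarrow> tint f \<le> tint (g :: _ \<Rightarrow> real)"
  unfolding tint_def by (intro integral_le) auto
lemma tint_nonneg: "cont f \<Longrightarrow> (\<And>x. 0 \<le> f x) \<Longrightarrow> 0 \<le> tint (f :: _ \<Rightarrow> real)"
  unfolding tint_def by (intro integral_nonneg) auto
lemma tint_norm: "cont f \<Longrightarrow> norm (tint f) \<le> tint (\<lambda>x. norm (f x))"
  unfolding tint_def by (intro integral_norm_bound_integral) (auto intro!: continuous_intros)
lemma tint_Re: "cont f \<Longrightarrow> Re (tint f) = tint (\<lambda>x. Re (f x))"
  unfolding tint_def using integral_linear[OF cont_integrable bounded_linear_Re, of f] by (simp add: o_def)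
lemma tint_iterated:
  assumes "cont f"
  shows "tint f = integral {-1/2..1/2} (\<lambda>x. integral {-1/2..1/2} (\<lambda>y. f (x, y)))"
  unfolding tint_def torus_def interval_cbox
  by (rule integral_prod_continuous) (rule continuous_on_subset[OF assms subset_UNIV])

text \<open>As a function of the shift, the integral over a moving unit window has derivative g (1/2
  + u) - g (-1/2 + u), which vanishes by periodicity.\<close>

lemma integral_periodic_shift:
  fixes g :: "real \<Rightarrow> 'a::euclidean_space"
  assumes c: "continuous_on UNIV g" and p: "\<And>x. g (x + 1) = g x"
  shows "integral {-1/2..1/2} (\<lambda>x. g (x + h)) = integral {-1/2..1/2} g"
proof -
  have int: "g integrable_on {a..b}" for a b
    by (intro integrable_continuous_interval continuous_on_subset[OF c]) auto
  define H where "H u = integral {-1/2+u..1/2+u} g" for u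
  have sh: "integral {-1/2..1/2} (\<lambda>x. g (x + u)) = H u" for u
  proof -
    have "(g has_integral H u) (cbox (-1/2+u) (1/2+u))"
      unfolding H_def using int by (simp add: integrable_integral)
    from has_integral_affinity[OF this, of 1 u]
    have "((\<lambda>x. g (x + u)) has_integral H u) ((\<lambda>x. x - u) ` cbox (-1/2+u) (1/2+u))"
      by simp
    moreover have "(\<lambda>x. x - u) ` cbox (-1/2+u) (1/2+u) = {-1/2..1/2}"
      using image_affinity_cbox[of 1 "-u" "-1/2+u" "1/2+u"] by simp
    ultimately show ?thesis by (simp add: integral_unique)
  qed
  have "H u = H 0" for u
  proof -
    define G where "G u = integral {-\<bar>u\<bar>-2..u} g" for u
    have D: "(H has_vector_derivative 0) (at v within {-\<bar>u\<bar>..\<bar>u\<bar>})" if v: "v \<in> {-\<bar>u\<bar>..\<bar>u\<bar>}" for v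
    proof -
      \<comment> \<open>The base point \<open>?a\<close> lies below both window ends for every
        admissible shift, so the window integral is a difference of two indefinite
        integrals.\<close>
      let ?S = "{-\<bar>u\<bar>..\<bar>u\<bar>}" and ?a = "-\<bar>u\<bar>-2" and ?b = "\<bar>u\<bar>+2"
      have base: "((\<lambda>u. integral {?a..u} g) has_vector_derivative g w) (at w within {?a..?b})"
        if "w \<in> {?a..?b}" for w
        using integral_has_vector_derivative[OF continuous_on_subset[OF c], of ?a ?b w] that by auto
      have d1: "((\<lambda>u. integral {?a..c+u} g) has_vector_derivative g (c+v)) (at v within ?S)"
        if "\<bar>c\<bar> \<le> 1" for c
      proof -
        have "((\<lambda>u. c + u) has_vector_derivative 1) (at v within ?S)"
          by (auto intro!: derivative_eq_intros)
        moreover have "((\<lambda>u. integral {?a..u} g) has_vector_derivative g (c+v)) (at (c+v) within ((\<lambda>u. c+u) ` ?S))"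
          by (rule has_vector_derivative_within_subset[OF base]) (use that v in auto)
        ultimately show ?thesis
          using vector_diff_chain_within[of "\<lambda>u. c+u" 1 v ?S "\<lambda>u. integral {?a..u} g" "g (c+v)"]
          by (simp add: o_def)
      qed
      have "g (1/2 + v) = g (-1/2 + v)" using p[of "-1/2+v"] by (simp add: algebra_simps)
      then have "((\<lambda>u. integral {?a..1/2+u} g - integral {?a..-1/2+u} g) has_vector_derivative 0) (at v within ?S)"
        using has_vector_derivative_diff[OF d1[of "1/2"] d1[of "-1/2"]] by simp
      moreover have "integral {?a..1/2+w} g - integral {?a..-1/2+w} g = H w" if "w \<in> ?S" for w
        using Henstock_Kurzweil_Integration.integral_combine[of ?a "-1/2+w" "1/2+w" g] that int
        by (auto simp: H_def algebra_simps)
      ultimately show ?thesis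
        using v by (metis (no_types, lifting) has_vector_derivative_transform)
    qed
    from has_vector_derivative_zero_constant[OF _ this] obtain cc where
      cc: "\<And>x. x \<in> {-\<bar>u\<bar>..\<bar>u\<bar>} \<Longrightarrow> H x = cc" by auto
    have "u \<in> {-\<bar>u\<bar>..\<bar>u\<bar>}" "0 \<in> {-\<bar>u\<bar>..\<bar>u\<bar>}" by auto
    then show ?thesis using cc by metis
  qed
  then show ?thesis using sh[of h] sh[of 0] by simp
qed

lemma tint_shift:
  assumes c: "cont f" and p: "per f"
  shows "tint (\<lambda>x. f (x + h)) = tint f"
proof -
  obtain a b where h: "h = (a, b)" by (cases h)
  have 1: "integral {-1/2..1/2} (\<lambda>y. f (x, y + b)) = integral {-1/2..1/2} (\<lambda>y. f (x, y))" for x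
  proof (rule integral_periodic_shift)
    show "cont (\<lambda>y. f (x, y))" by (auto intro!: continuous_on_compose2[OF c] continuous_intros)
  qed (use p in \<open>auto simp: per_def\<close>)
  have cI: "continuous_on UNIV (\<lambda>x. integral {-1/2..1/2} (\<lambda>y. f (x, y)))"
  proof -
    have "continuous_on (UNIV \<times> cbox (-1/2) (1/2)) (\<lambda>(x, y). f (x, y))"
      by (simp only: case_prod_eta) (rule continuous_on_subset[OF c subset_UNIV])
    then show ?thesis unfolding interval_cbox
      using integral_continuous_on_param[of UNIV "-1/2" "1/2" "\<lambda>x y. f (x, y)"] by blast
  qed
  have "tint (\<lambda>x. f (x + h)) = integral {-1/2..1/2} (\<lambda>x. integral {-1/2..1/2} (\<lambda>y. f (x + a, y + b)))"
  proof -
    have "continuous_on UNIV (\<lambda>x. f (x + h))"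
      by (intro continuous_on_compose2[OF c] continuous_intros) auto
    from tint_iterated[OF this] show ?thesis by (simp add: h)
  qed
  also have "\<dots> = integral {-1/2..1/2} (\<lambda>x. integral {-1/2..1/2} (\<lambda>y. f (x + a, y)))"
    by (simp only: 1)
  also have "\<dots> = integral {-1/2..1/2} (\<lambda>x. integral {-1/2..1/2} (\<lambda>y. f (x, y)))"
    using integral_periodic_shift[OF cI, of a] p by (auto simp: per_def)
  finally show ?thesis by (simp add: tint_iterated[OF c])
qed

text \<open>For k \<noteq> 0 there is a shift h with ee k h = -1; shift invariance then makes the
  integral equal to its own negative.\<close>

lemma tint_ee: "tint (ee k) = (if k = 0 then 1 else 0)"
proof (cases "k = 0")
  case False
  define h :: "real \<times> real" where
    "h = (if fst k \<noteq> 0 then (1 / (2 * of_int (fst k)), 0) else (0, 1 / (2 * of_int (snd k))))"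
  have h: "ee k h = -1"
    using False by (auto simp: h_def ee_def prod_eq_iff)
  have "tint (ee k) = tint (\<lambda>x. ee k (x + h))"
    by (rule tint_shift[symmetric]) (auto intro: continuous_intros per_ee)
  also have "\<dots> = - tint (ee k)" by (simp add: ee_add h tint_def)
  finally show ?thesis using False by simp
qed (simp add: ee_simps(2)[abs_def])

lemma tint_swap:
  fixes f :: "(real \<times> real) \<Rightarrow> (real \<times> real) \<Rightarrow> 'a::euclidean_space"
  assumes "continuous_on UNIV (\<lambda>(x, y). f x y)"
  shows "tint (\<lambda>x. tint (f x)) = tint (\<lambda>y. tint (\<lambda>x. f x y))"
  unfolding tint_def torus_def
  by (rule integral_swap_continuous) (rule continuous_on_subset[OF assms], auto)

lemma cont_tint:
  fixes f :: "'b::topological_space \<Rightarrow> (real \<times> real) \<Rightarrow> 'a::euclidean_space"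
  assumes "continuous_on (S \<times> UNIV) (\<lambda>(x, y). f x y)"
  shows "continuous_on S (\<lambda>x. tint (f x))"
  unfolding tint_def torus_def
  by (rule integral_continuous_on_param) (rule continuous_on_subset[OF assms], auto)

text \<open>A sum over an infinite set is 0, so the value is meaningful only together with
  \<open>fsupp\<close>.\<close>

definition tev :: "distr \<Rightarrow> real \<times> real \<Rightarrow> complex" where
  "tev f x = (\<Sum>k | f k \<noteq> 0. f k * ee k x)"

definition fsupp :: "distr \<Rightarrow> bool" where "fsupp f \<longleftrightarrow> finite {k. f k \<noteq> 0}"

lemma fsuppI: "finite S \<Longrightarrow> (\<And>k. k \<notin> S \<Longrightarrow> f k = 0) \<Longrightarrow> fsupp f"
  unfolding fsupp_def by (rule finite_subset[of _ S]) auto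

lemma tev_on: "finite S \<Longrightarrow> (\<And>k. k \<notin> S \<Longrightarrow> f k = 0) \<Longrightarrow> tev f x = (\<Sum>k\<in>S. f k * ee k x)"
  unfolding tev_def by (rule sum.mono_neutral_left) auto

lemma cont_tev [continuous_intros]: "continuous_on S g \<Longrightarrow> continuous_on S (\<lambda>x. tev f (g x))"
  unfolding tev_def by (intro continuous_intros)

lemma per_tev: "per (tev f)"
  using per_ee unfolding per_def tev_def by simp

lemma fsupp_lin: fixes f g m :: distr shows "fsupp f \<Longrightarrow> fsupp g \<Longrightarrow> fsupp (\<lambda>k. f k + g k)"
  "fsupp f \<Longrightarrow> fsupp g \<Longrightarrow> fsupp (\<lambda>k. f k - g k)"
  "fsupp f \<Longrightarrow> fsupp (\<lambda>k. c * f k)" "fsupp f \<Longrightarrow> fsupp (\<lambda>k. m k * f k)"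
  "fsupp (\<lambda>k. 0)"
  unfolding fsupp_def
  subgoal by (rule finite_subset[of _ "{k. f k \<noteq> 0} \<union> {k. g k \<noteq> 0}"]) auto
  subgoal by (rule finite_subset[of _ "{k. f k \<noteq> 0} \<union> {k. g k \<noteq> 0}"]) auto
  subgoal by (rule finite_subset[of _ "{k. f k \<noteq> 0}"]) auto
  subgoal by (rule finite_subset[of _ "{k. f k \<noteq> 0}"]) auto
  by simp

lemma tev_add: assumes "fsupp f" "fsupp g" shows "tev (\<lambda>k. f k + g k) x = tev f x + tev g x"
proof -
  let ?S = "{k. f k \<noteq> 0} \<union> {k. g k \<noteq> 0}"
  have "finite ?S" using assms by (auto simp: fsupp_def)
  then show ?thesis by (subst (1 2 3) tev_on[of ?S]) (auto simp: algebra_simps sum.distrib)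
qed

lemma tev_cmult: assumes "fsupp f" shows "tev (\<lambda>k. c * f k) x = c * tev f x"
  using assms unfolding fsupp_def
  by (subst (1 2) tev_on[of "{k. f k \<noteq> 0}"]) (auto simp: algebra_simps sum_distrib_left)

lemma tev_diff: assumes "fsupp f" "fsupp g" shows "tev (\<lambda>k. f k - g k) x = tev f x - tev g x"
  using tev_add[OF assms(1) fsupp_lin(3)[OF assms(2), of "-1"], of x] tev_cmult[OF assms(2), of "-1" x] by simp

lemma tev_0 [simp]: "tev (\<lambda>k. 0) x = 0" by (simp add: tev_def)

lemma fsupp_sum: "finite I \<Longrightarrow> (\<And>i. i \<in> I \<Longrightarrow> fsupp (f i)) \<Longrightarrow> fsupp (\<lambda>k. \<Sum>i\<in>I. f i k)"
  by (induction rule: finite_induct) (auto intro: fsupp_lin)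

lemma tev_sum: "finite I \<Longrightarrow> (\<And>i. i \<in> I \<Longrightarrow> fsupp (f i)) \<Longrightarrow> tev (\<lambda>k. \<Sum>i\<in>I. f i k) x = (\<Sum>i\<in>I. tev (f i) x)"
  by (induction rule: finite_induct) (auto simp: tev_add fsupp_sum)

lemma tev_tint: assumes "fsupp f" shows "tint (\<lambda>x. tev f x * ee (- l) x) = f l"
proof -
  have "tint (\<lambda>x. tev f x * ee (- l) x) = tint (\<lambda>x. \<Sum>k | f k \<noteq> 0. f k * ee (k - l) x)"
    unfolding tev_def by (simp add: sum_distrib_right mult.assoc ee_diff ee_minus)
  also have "\<dots> = (\<Sum>k | f k \<noteq> 0. f k * (if k = l then 1 else 0))"
    using assms unfolding fsupp_def
    by (subst tint_sum) (auto simp: tint_mult tint_ee intro!: continuous_intros sum.cong)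
  also have "\<dots> = f l" using assms unfolding fsupp_def by (simp add: if_distrib cong: if_cong)
  finally show ?thesis .
qed

lemma coeff_le: assumes "fsupp f" "\<And>x. cmod (tev f x) \<le> B" shows "cmod (f l) \<le> B"
proof -
  have "cmod (f l) \<le> tint (\<lambda>x. cmod (tev f x * ee (- l) x))"
    using tint_norm[of "\<lambda>x. tev f x * ee (- l) x"] tev_tint[OF assms(1), of l]
    by (simp add: continuous_intros)
  also have "\<dots> \<le> tint (\<lambda>x. B)" by (rule tint_mono) (auto intro!: continuous_intros simp: norm_mult assms)
  finally show ?thesis by simp
qed

lemma tev_le: assumes "finite S" "\<And>k. k \<notin> S \<Longrightarrow> f k = 0"
  shows "cmod (tev f x) \<le> (\<Sum>k\<in>S. cmod (f k))"
  using assms by (subst tev_on[of S]) (auto intro!: sum_norm_le simp: norm_mult)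

lemma parseval: assumes "fsupp f" shows "tint (\<lambda>x. (cmod (tev f x))\<^sup>2) = (\<Sum>k | f k \<noteq> 0. (cmod (f k))\<^sup>2)"
proof -
  let ?S = "{k. f k \<noteq> 0}"
  have fin: "finite ?S" using assms by (simp add: fsupp_def)
  have "complex_of_real (tint (\<lambda>x. (cmod (tev f x))\<^sup>2)) = tint (\<lambda>x. complex_of_real ((cmod (tev f x))\<^sup>2))"
    unfolding tint_def
    using integral_linear[of "\<lambda>x. (cmod (tev f x))\<^sup>2" torus complex_of_real]
    by (simp add: o_def bounded_linear_of_real continuous_intros)
  also have "\<dots> = tint (\<lambda>x. \<Sum>l\<in>?S. cnj (f l) * (tev f x * ee (- l) x))"
  proof (intro arg_cong[where f = tint] ext)
    fix x
    have "cnj (tev f x) = (\<Sum>l\<in>?S. cnj (f l) * ee (- l) x)"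
      by (simp add: tev_def ee_minus)
    then show "complex_of_real ((cmod (tev f x))\<^sup>2) = (\<Sum>l\<in>?S. cnj (f l) * (tev f x * ee (- l) x))"
      by (simp only: complex_norm_square) (simp add: sum_distrib_left mult.left_commute)
  qed
  also have "\<dots> = (\<Sum>l\<in>?S. cnj (f l) * f l)"
    using fin by (subst tint_sum) (auto simp: tint_mult tev_tint[OF assms] intro!: continuous_intros)
  also have "\<dots> = complex_of_real (\<Sum>k\<in>?S. (cmod (f k))\<^sup>2)"
    by (simp add: complex_norm_square mult.commute flip: of_real_power)
  finally show ?thesis using of_real_eq_iff by blast
qed

definition conv :: "distr \<Rightarrow> distr \<Rightarrow> distr" where
  "conv f g k = (\<Sum>l | f l \<noteq> 0. f l * g (k - l))"

lemma conv_on: "finite S \<Longrightarrow> (\<And>k. k \<notin> S \<Longrightarrow> f k = 0) \<Longrightarrow> conv f g k = (\<Sum>l\<in>S. f l * g (k - l))"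
  unfolding conv_def by (rule sum.mono_neutral_left) auto

lemma conv_nz: "conv f g k \<noteq> 0 \<Longrightarrow> \<exists>l. f l \<noteq> 0 \<and> g (k - l) \<noteq> 0"
  unfolding conv_def by (metis (mono_tags, lifting) mem_Collect_eq mult_not_zero sum.neutral)

lemma fsupp_conv: assumes "fsupp f" "fsupp g" shows "fsupp (conv f g)"
proof (rule fsuppI[of "(\<lambda>(a, b). a + b) ` ({k. f k \<noteq> 0} \<times> {k. g k \<noteq> 0})"])
  show "finite ((\<lambda>(a, b). a + b) ` ({k. f k \<noteq> 0} \<times> {k. g k \<noteq> 0}))"
    using assms by (auto simp: fsupp_def)
  show "conv f g k = 0" if "k \<notin> (\<lambda>(a, b). a + b) ` ({k. f k \<noteq> 0} \<times> {k. g k \<noteq> 0})" for k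
  proof (rule ccontr)
    assume "conv f g k \<noteq> 0"
    then obtain l where "f l \<noteq> 0" "g (k - l) \<noteq> 0" using conv_nz by blast
    then have "(l, k - l) \<in> {k. f k \<noteq> 0} \<times> {k. g k \<noteq> 0}" by auto
    then have "k \<in> (\<lambda>(a, b). a + b) ` ({k. f k \<noteq> 0} \<times> {k. g k \<noteq> 0})"
      by (intro image_eqI[where x = "(l, k - l)"]) auto
    then show False using that by blast
  qed
qed

lemma tev_conv: assumes "fsupp f" "fsupp g" shows "tev (conv f g) x = tev f x * tev g x"
proof -
  let ?A = "{k. f k \<noteq> 0}" and ?B = "{k. g k \<noteq> 0}"
  have fin: "finite ?A" "finite ?B" using assms by (auto simp: fsupp_def)
  have z: "g (k - l) = 0" if "k \<notin> (\<lambda>j. j + l) ` ?B" for k l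
    using that image_eqI[of k "\<lambda>j. j + l" "k - l" ?B] by fastforce
  have 1: "tev (\<lambda>k. f l * g (k - l)) x = f l * ee l x * tev g x" for l
  proof -
    have "tev (\<lambda>k. f l * g (k - l)) x = (\<Sum>k\<in>(\<lambda>j. j + l) ` ?B. f l * g (k - l) * ee k x)"
      by (rule tev_on) (use fin z in auto)
    also have "\<dots> = (\<Sum>j\<in>?B. f l * g j * ee (j + l) x)"
      by (subst sum.reindex) (auto simp: inj_on_def)
    finally show ?thesis by (simp add: tev_def ee_add sum_distrib_left algebra_simps)
  qed
  have fs: "fsupp (\<lambda>k. f l * g (k - l))" for l
  proof (rule fsuppI[of "(\<lambda>j. j + l) ` ?B"])
    show "finite ((\<lambda>j. j + l) ` ?B)" using fin by auto
    show "\<And>k. k \<notin> (\<lambda>j. j + l) ` ?B \<Longrightarrow> f l * g (k - l) = 0"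
      using z by simp
  qed
  have "tev (conv f g) x = (\<Sum>l\<in>?A. tev (\<lambda>k. f l * g (k - l)) x)"
    unfolding conv_def using tev_sum[OF fin(1), of "\<lambda>l k. f l * g (k - l)"] fs by simp
  then show ?thesis by (simp add: 1 tev_def[of f] sum_distrib_right)
qed

lemma fsupp_inj: assumes "fsupp f" "fsupp g" "\<And>x. tev f x = tev g x" shows "f = g"
  using tev_tint[OF assms(1)] tev_tint[OF assms(2)] assms(3) by (auto simp: fun_eq_iff)

section \<open>Fourier multipliers and their convolution kernels\<close>

definition mul :: "(int \<times> int \<Rightarrow> complex) \<Rightarrow> distr \<Rightarrow> distr" where "mul m f = (\<lambda>k. m k * f k)"

lemma fsupp_mul: "fsupp f \<Longrightarrow> fsupp (mul m f)" "fsupp m \<Longrightarrow> fsupp (mul m f)"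
  unfolding mul_def using fsupp_lin(4)[of f m] fsupp_lin(4)[of m f] by (auto simp: mult.commute)

lemma tev_mul: assumes m: "fsupp m" and f: "fsupp f"
  shows "tev (mul m f) x = tint (\<lambda>y. tev m y * tev f (x - y))"
proof -
  let ?B = "{k. f k \<noteq> 0}"
  have fin: "finite ?B" using f by (simp add: fsupp_def)
  have "tint (\<lambda>y. tev m y * tev f (x - y)) = tint (\<lambda>y. \<Sum>l\<in>?B. f l * ee l x * (tev m y * ee (- l) y))"
    by (simp add: tev_def[of f] ee_diff ee_minus sum_distrib_left algebra_simps)
  also have "\<dots> = (\<Sum>l\<in>?B. f l * ee l x * m l)"
    using fin by (subst tint_sum) (auto simp: tint_mult tev_tint[OF m] intro!: continuous_intros)
  also have "\<dots> = tev (mul m f) x"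
    using fin by (subst tev_on[of ?B]) (auto simp: mul_def algebra_simps)
  finally show ?thesis by simp
qed

text \<open>Young's inequality. It reduces multiplier estimates to L^1 bounds of kernels that are
  uniform in the dilation.\<close>

lemma tev_mul_le:
  assumes m: "fsupp m" and f: "fsupp f" and K: "tint (\<lambda>y. cmod (tev m y)) \<le> L"
    and B: "\<And>x. cmod (tev f x) \<le> B"
  shows "cmod (tev (mul m f) x) \<le> L * B"
proof -
  have B0: "0 \<le> B" using B[of 0] norm_ge_zero order_trans by blast
  have "cmod (tev (mul m f) x) \<le> tint (\<lambda>y. cmod (tev m y * tev f (x - y)))"
    unfolding tev_mul[OF m f] by (rule tint_norm) (intro continuous_intros)
  also have "\<dots> \<le> tint (\<lambda>y. B * cmod (tev m y))"
  proof (rule tint_mono)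
    show "cmod (tev m y * tev f (x - y)) \<le> B * cmod (tev m y)" for y
      using mult_left_mono[OF B, of "cmod (tev m y)" "x - y"] by (simp add: norm_mult mult.commute)
  qed (intro continuous_intros)+
  also have "\<dots> \<le> L * B" using mult_left_mono[OF K B0] by (simp add: tint_mult mult.commute)
  finally show ?thesis .
qed

text \<open>A weak form of Jordan's inequality: up to pi/3 the cosine is at least 1/2, and beyond it
  sin x \<ge> sqrt 3 / 2 \<ge> 4/5 \<ge> x/2.\<close>

lemma sin_ge_half: assumes "0 \<le> x" "x \<le> pi / 2" shows "x / 2 \<le> sin x"
proof (cases "x \<le> pi / 3")
  case True
  have "\<exists>z>0. z < x \<and> sin x - sin 0 = (x - 0) * cos z" if "x > 0"
    using that by (intro MVT2) (auto intro!: derivative_eq_intros)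
  moreover have "1 / 2 \<le> cos z" if "0 < z" "z < x" for z
    using cos_monotone_0_pi_le[of z "pi/3"] that True by (simp add: cos_60)
  ultimately show ?thesis using assms mult_left_mono[of "1/2" "cos _" x]
    by (cases "x = 0") fastforce+
next
  case False
  have "sin (pi/3) \<le> sin x" using sin_monotone_2pi_le[of "pi/3" x] False assms by auto
  moreover have "x / 2 \<le> 4 / 5" using assms pi_less_4 pi_approx by auto
  moreover have "4 / 5 \<le> sqrt 3 / 2" using real_le_rsqrt[of "8/5" 3] by (simp add: power2_eq_square)
  ultimately show ?thesis by (simp add: sin_60)
qed

lemma one_minus_cis: "(cmod (1 - cis t))\<^sup>2 = 4 * (sin (t / 2))\<^sup>2"
proof -
  have "(cmod (1 - cis t))\<^sup>2 = (1 - cos t)\<^sup>2 + (sin t)\<^sup>2"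
    by (simp add: cmod_power2)
  also have "\<dots> = 2 - 2 * cos t"
    using sin_cos_squared_add[of t] by (simp add: power2_eq_square algebra_simps)
  also have "cos t = 1 - 2 * (sin (t / 2))\<^sup>2" using cos_double_sin[of "t/2"] by simp
  finally show ?thesis by simp
qed

lemma one_minus_ee:
  assumes "y \<in> torus"
  shows "4 * (fst y)\<^sup>2 \<le> (cmod (1 - ee (1, 0) y))\<^sup>2" "4 * (snd y)\<^sup>2 \<le> (cmod (1 - ee (0, 1) y))\<^sup>2"
proof -
  have *: "t\<^sup>2 \<le> (sin (pi * t))\<^sup>2" if "\<bar>t\<bar> \<le> 1/2" for t :: real
  proof -
    have "\<bar>t\<bar> \<le> pi * \<bar>t\<bar> / 2" using pi_ge_two mult_right_mono[of 2 pi "\<bar>t\<bar>"] by auto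
    also have "\<dots> \<le> sin (pi * \<bar>t\<bar>)" using that by (intro sin_ge_half) auto
    finally have "\<bar>t\<bar> \<le> \<bar>sin (pi * t)\<bar>" by (auto simp: abs_if split: if_splits)
    then show ?thesis by (simp add: abs_le_square_iff)
  qed
  obtain a b where y: "y = (a, b)" by (cases y)
  have "\<bar>a\<bar> \<le> 1/2" "\<bar>b\<bar> \<le> 1/2" using assms unfolding y torus_def by auto
  from this[THEN *] show "4 * (fst y)\<^sup>2 \<le> (cmod (1 - ee (1, 0) y))\<^sup>2"
     "4 * (snd y)\<^sup>2 \<le> (cmod (1 - ee (0, 1) y))\<^sup>2"
    by (auto simp: y ee_def one_minus_cis)
qed

subsection \<open>Convolution kernels of dilated symbols\<close>

text \<open>A periodic substitute for 1 + R^2 |y|^2. Written through 1 - ee it is a trigonometric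
  polynomial, so multiplying a kernel by it amounts to taking second differences of the
  symbol.\<close>

definition wt :: "real \<Rightarrow> real \<times> real \<Rightarrow> real" where
  "wt R y = 1 + R\<^sup>2 * ((cmod (1 - ee (1, 0) y))\<^sup>2 + (cmod (1 - ee (0, 1) y))\<^sup>2)"

lemma wt_ge1: "1 \<le> wt R y" by (simp add: wt_def)

lemma cont_wt [continuous_intros]: "continuous_on S g \<Longrightarrow> continuous_on S (\<lambda>x. wt R (g x))"
  unfolding wt_def by (intro continuous_intros)

lemma cont_wt_powr: "cont (\<lambda>y. wt R y powr a)"
proof -
  have "wt R y \<noteq> 0" for y using wt_ge1[of R y] by linarith
  then show ?thesis by (intro continuous_intros) auto
qed

lemma integral_decay:
  fixes R :: real
  assumes R: "R \<ge> 1"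
  shows "integral {-1/2..1/2} (\<lambda>y. (1 + 2 * R * \<bar>y\<bar>) powr (-3/2)) \<le> 2 / R"
proof -
  have "((\<lambda>y. (1 + 2 * R * y) powr (-3/2)) has_integral
      (- ((1 + 2 * R * (1/2)) powr (-1/2)) / R) - (- ((1 + 2 * R * 0) powr (-1/2)) / R)) {0..1/2}"
  proof (rule fundamental_theorem_of_calculus)
    fix y :: real assume "y \<in> {0..1/2}"
    then have p: "1 + 2 * R * y > 0" using R by (simp add: add_pos_nonneg)
    have "((\<lambda>y. (1 + 2 * R * y) powr (-1/2)) has_real_derivative (-1/2) * (1 + 2 * R * y) powr (-1/2 - of_nat 1) * (2 * R)) (at y)"
      by (rule DERIV_fun_powr) (use p in \<open>auto intro!: derivative_eq_intros\<close>)
    then have "((\<lambda>y. (-1/R) * (1 + 2 * R * y) powr (-1/2)) has_real_derivative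
        (-1/R) * ((-1/2) * (1 + 2 * R * y) powr (-1/2 - of_nat 1) * (2 * R))) (at y within {0..1/2})"
      by (intro DERIV_cmult) (rule has_field_derivative_at_within)
    also have "(-1/R) * ((-1/2) * (1 + 2 * R * y) powr (-1/2 - of_nat 1) * (2 * R)) = (1 + 2 * R * y) powr (-3/2)"
      using R by simp
    also have "(\<lambda>y. (-1/R) * (1 + 2 * R * y) powr (-1/2)) = (\<lambda>y. - ((1 + 2 * R * y) powr (-1/2)) / R)"
      by simp
    finally show "((\<lambda>y. - ((1 + 2 * R * y) powr (-1/2)) / R) has_vector_derivative (1 + 2 * R * y) powr (-3/2)) (at y within {0..1/2})"
      by (simp add: has_real_derivative_iff_has_vector_derivative)
  qed simp
  then have 1: "((\<lambda>y. (1 + 2 * R * \<bar>y\<bar>) powr (-3/2)) has_integral (1 - (1 + R) powr (-1/2)) / R) {0..1/2}"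
    by (rule has_integral_eq_rhs[OF has_integral_eq[rotated]]) (auto simp: diff_divide_distrib)
  have "((\<lambda>y. (1 + 2 * R * \<bar>-y\<bar>) powr (-3/2)) has_integral (1 - (1 + R) powr (-1/2)) / R) {-1/2..-0}"
    using has_integral_reflect_real[of "\<lambda>y. (1 + 2 * R * \<bar>y\<bar>) powr (-3/2)" _ "1/2" 0] 1 by simp
  from has_integral_combine[OF _ _ this[simplified abs_minus minus_zero] 1]
  have "integral {-1/2..1/2} (\<lambda>y. (1 + 2 * R * \<bar>y\<bar>) powr (-3/2)) = 2 * (1 - (1 + R) powr (-1/2)) / R"
    by (simp add: integral_unique)
  also have "\<dots> \<le> 2 / R" using R by (intro divide_right_mono) auto
  finally show ?thesis .
qed

text \<open>The product form makes the integral of the weight factorise into one-dimensional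
  integrals; the second bound gives access to moments of the kernel.\<close>

lemma wt_lower: assumes "y \<in> torus" "R \<ge> 1"
  shows "(1 + 2 * R * \<bar>fst y\<bar>) * (1 + 2 * R * \<bar>snd y\<bar>) \<le> 2 * wt R y"
    "(R * norm y)\<^sup>2 \<le> wt R y"
proof -
  define a b where "a = 2 * R * \<bar>fst y\<bar>" and "b = 2 * R * \<bar>snd y\<bar>"
  have "a\<^sup>2 + b\<^sup>2 = R\<^sup>2 * (4 * (fst y)\<^sup>2 + 4 * (snd y)\<^sup>2)" by (simp add: a_def b_def power2_eq_square algebra_simps)
  also have "\<dots> \<le> R\<^sup>2 * ((cmod (1 - ee (1, 0) y))\<^sup>2 + (cmod (1 - ee (0, 1) y))\<^sup>2)"
    using one_minus_ee[OF assms(1)] by (intro mult_left_mono add_mono) auto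
  finally have ab: "1 + a\<^sup>2 + b\<^sup>2 \<le> wt R y" by (simp add: wt_def)
  have "2 * (1 + a) * (1 + b) \<le> (1 + a)\<^sup>2 + (1 + b)\<^sup>2" by (rule sum_squares_bound)
  moreover have "(1 + a)\<^sup>2 \<le> 2 * (1 + a\<^sup>2)" "(1 + b)\<^sup>2 \<le> 2 * (1 + b\<^sup>2)"
    using sum_squares_bound[of 1 a] sum_squares_bound[of 1 b] by (auto simp: power2_eq_square algebra_simps)
  ultimately have "2 * ((1 + a) * (1 + b)) \<le> 2 * (1 + a\<^sup>2) + 2 * (1 + b\<^sup>2)"
    unfolding mult.assoc by (meson add_mono order_trans)
  also have "\<dots> \<le> 2 * (2 * (1 + a\<^sup>2 + b\<^sup>2))" by simp
  also have "\<dots> \<le> 2 * (2 * wt R y)" using ab by simp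
  finally have "2 * ((1 + a) * (1 + b)) \<le> 2 * (2 * wt R y)" .
  then have "(1 + a) * (1 + b) \<le> 2 * wt R y" by simp
  then show "(1 + 2 * R * \<bar>fst y\<bar>) * (1 + 2 * R * \<bar>snd y\<bar>) \<le> 2 * wt R y" by (simp add: a_def b_def)
  have "(R * norm y)\<^sup>2 = (a\<^sup>2 + b\<^sup>2) / 4"
    by (simp add: norm_prod_def a_def b_def power_mult_distrib algebra_simps)
  also have "\<dots> \<le> 1 + (a\<^sup>2 + b\<^sup>2)"
  proof -
    have "s / 4 \<le> 1 + s" if "0 \<le> s" for s :: real using that by simp
    then show ?thesis using sum_power2_ge_zero[of a b] by blast
  qed
  also have "\<dots> \<le> wt R y" using ab by simp
  finally show "(R * norm y)\<^sup>2 \<le> wt R y" .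
qed

text \<open>The constant 16 is 4 * 2 * 2: a factor 2 powr (3/2) \<le> 4 from the product bound and
  2/R from each of the two variables.\<close>

lemma tint_wt: assumes R: "R \<ge> 1" shows "tint (\<lambda>y. wt R y powr (-3/2)) \<le> 16 / R\<^sup>2"
proof -
  define u where "u t = (1 + 2 * R * \<bar>t\<bar>) powr (-3/2)" for t
  have pos: "1 + 2 * R * \<bar>t\<bar> > 0" for t using R by (simp add: add_pos_nonneg)
  have cu: "continuous_on S g \<Longrightarrow> continuous_on S (\<lambda>x. u (g x))" for S and g :: "'b::topological_space \<Rightarrow> real"
  proof -
    assume "continuous_on S g"
    moreover have "1 + 2 * R * \<bar>t\<bar> \<noteq> 0" for t using pos[of t] by simp
    ultimately show ?thesis unfolding u_def by (intro continuous_intros) auto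
  qed
  note cw = cont_wt_powr
  have le: "wt R y powr (-3/2) \<le> 2 powr (3/2) * (u (fst y) * u (snd y))" if "y \<in> torus" for y
  proof -
    let ?p = "(1 + 2 * R * \<bar>fst y\<bar>) * (1 + 2 * R * \<bar>snd y\<bar>)"
    have "(2 * wt R y) powr (-3/2) \<le> ?p powr (-3/2)"
      using wt_lower(1)[OF that R] pos by (intro powr_mono2') auto
    then have "2 powr (-3/2) * wt R y powr (-3/2) \<le> u (fst y) * u (snd y)"
      using pos[of "fst y"] pos[of "snd y"] wt_ge1[of R y] by (simp add: u_def powr_mult)
    then have "2 powr (3/2) * (2 powr (-3/2) * wt R y powr (-3/2)) \<le> 2 powr (3/2) * (u (fst y) * u (snd y))"
      by (intro mult_left_mono) auto
    moreover have "2 powr (3/2) * (2 powr (-3/2) * t) = t" for t :: real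
      by (simp flip: powr_add mult.assoc)
    ultimately show ?thesis by metis
  qed
  have cuu: "cont (\<lambda>y. u (fst y) * u (snd y))" by (intro continuous_intros cu)
  have cu1: "continuous_on {-1/2..1/2} u" using cu[OF continuous_on_id] by simp
  have I: "integral {-1/2..1/2} u \<le> 2 / R" "0 \<le> integral {-1/2..1/2} u"
  proof -
    show "integral {-1/2..1/2} u \<le> 2 / R" using integral_decay[OF R] unfolding u_def[abs_def] .
    show "0 \<le> integral {-1/2..1/2} u"
      by (rule integral_nonneg[OF integrable_continuous_interval[OF cu1]]) (simp add: u_def)
  qed
  have "tint (\<lambda>y. wt R y powr (-3/2)) \<le> tint (\<lambda>y. 2 powr (3/2) * (u (fst y) * u (snd y)))"
    by (rule tint_mono_torus, rule cw, (intro continuous_intros cu)[1], rule le)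
  also have "\<dots> = 2 powr (3/2) * (integral {-1/2..1/2} u * integral {-1/2..1/2} u)"
    by (subst tint_mult, subst tint_iterated[OF cuu]) simp
  also have "\<dots> \<le> 2 powr 2 * (2 / R * (2 / R))"
    using I R by (intro mult_mono powr_mono) auto
  finally show ?thesis by (simp add: power2_eq_square)
qed

lemma tev_shift: assumes "fsupp m" shows "tev (\<lambda>k. m (k + e)) x = cnj (ee e x) * tev m x" and "fsupp (\<lambda>k. m (k + e))"
proof -
  let ?S = "{k. m k \<noteq> 0}"
  have fin: "finite ?S" using assms by (simp add: fsupp_def)
  have z: "m (k + e) = 0" if "k \<notin> (\<lambda>j. j - e) ` ?S" for k
    using that image_eqI[of k "\<lambda>j. j - e" "k + e" ?S] by fastforce
  have "tev (\<lambda>k. m (k + e)) x = (\<Sum>k\<in>(\<lambda>j. j - e) ` ?S. m (k + e) * ee k x)"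
    by (rule tev_on) (use fin z in auto)
  also have "\<dots> = (\<Sum>j\<in>?S. m j * ee (j - e) x)"
    by (subst sum.reindex) (auto simp: inj_on_def)
  finally show "tev (\<lambda>k. m (k + e)) x = cnj (ee e x) * tev m x"
    by (simp add: tev_def ee_diff sum_distrib_left algebra_simps)
  show "fsupp (\<lambda>k. m (k + e))" by (rule fsuppI[of "(\<lambda>j. j - e) ` ?S"]) (use fin z in auto)
qed

section \<open>Second differences of a symbol and the L^1 norm of its kernel\<close>

definition second_diff :: "int \<times> int \<Rightarrow> distr \<Rightarrow> distr" where
  "second_diff e m k = m (k + e) - 2 * m k + m (k - e)"

lemma tev_dd: assumes "fsupp m"
  shows "tev (second_diff e m) x = - complex_of_real ((cmod (1 - ee e x))\<^sup>2) * tev m x" and "fsupp (second_diff e m)"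
proof -
  note s = tev_shift[OF assms, of e] tev_shift[OF assms, of "-e", simplified]
  have "tev (second_diff e m) x = cnj (ee e x) * tev m x - 2 * tev m x + ee e x * tev m x"
    unfolding second_diff_def[abs_def] using s assms
    by (subst tev_add, (intro fsupp_lin; simp), simp, subst tev_diff)
       (auto intro!: fsupp_lin simp: tev_cmult ee_minus)
  then show "tev (second_diff e m) x = - complex_of_real ((cmod (1 - ee e x))\<^sup>2) * tev m x"
    by (simp only: complex_norm_square) (simp add: algebra_simps)
  show "fsupp (second_diff e m)" unfolding second_diff_def[abs_def] using s assms by (auto intro!: fsupp_lin)
qed

text \<open>Bernstein's argument. The coefficients of the kernel times \<open>wt R\<close> are at
  most 3 * A and live on O(R^2) frequencies, so Parseval bounds its L^2 norm. Dividing by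
  \<open>wt R\<close> powr (3/4), whose inverse square has integral O(1/R^2), gives the L^1 bound
  and leaves a weight \<open>wt R\<close> powr (1/4) to spare for moments.\<close>

lemma kernel_bound:
  assumes R: "R \<ge> 1" and A: "A \<ge> 0" and supp: "\<And>k. m k \<noteq> 0 \<Longrightarrow> \<bar>real_of_int (fst k)\<bar> \<le> 4 * R \<and> \<bar>real_of_int (snd k)\<bar> \<le> 4 * R"
    and m: "\<And>k. cmod (m k) \<le> A"
    and d1: "\<And>k. cmod (second_diff (1,0) m k) \<le> A / R\<^sup>2" and d2: "\<And>k. cmod (second_diff (0,1) m k) \<le> A / R\<^sup>2"
  shows "fsupp m" "tint (\<lambda>y. cmod (tev m y) * wt R y powr (1/4)) \<le> 560 * A"
proof -
  \<comment> \<open>The symbol lives within 4 * R; second differences reach one unit further, and R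
    \<ge> 1, so 5 * R contains everything. The box then has at most (10 * R + 1)^2 \<le> (11 * R)^2
    points, whence 121.\<close>
  define N where "N = \<lfloor>5 * R\<rfloor>"
  let ?S = "{-N..N} \<times> {-N..N}"
  have inS: "k \<in> ?S" if "\<bar>real_of_int (fst k)\<bar> \<le> 5 * R" "\<bar>real_of_int (snd k)\<bar> \<le> 5 * R" for k
  proof -
    have "\<bar>fst k\<bar> \<le> N" "\<bar>snd k\<bar> \<le> N" using that by (auto simp: N_def le_floor_iff)
    then show ?thesis by (cases k) auto
  qed
  have m0: "m k = 0" if "k \<notin> ?S" for k using inS[of k] supp[of k] that R by fastforce
  show fm: "fsupp m" by (rule fsuppI[of ?S]) (use m0 in auto)
  define m' where "m' k = m k - complex_of_real (R\<^sup>2) * (second_diff (1,0) m k + second_diff (0,1) m k)" for k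
  have fm': "fsupp m'" unfolding m'_def[abs_def]
    by (intro fsupp_lin fm tev_dd(2))
  have tm': "tev m' x = complex_of_real (wt R x) * tev m x" for x
    unfolding m'_def[abs_def] wt_def
    by (subst tev_diff, intro fm, intro fsupp_lin tev_dd(2) fm, subst tev_cmult, intro fsupp_lin tev_dd(2) fm,
        subst tev_add, intro tev_dd(2) fm, intro tev_dd(2) fm)
       (simp add: tev_dd[OF fm] algebra_simps)
  have bm': "cmod (m' k) \<le> 3 * A" for k
  proof -
    have "cmod (m' k) \<le> cmod (m k) + R\<^sup>2 * (cmod (second_diff (1,0) m k) + cmod (second_diff (0,1) m k))"
      unfolding m'_def
      by (intro order_trans[OF norm_triangle_ineq4] add_left_mono)
         (auto simp: norm_mult norm_power norm_triangle_ineq intro!: mult_left_mono)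
    also have "\<dots> \<le> A + R\<^sup>2 * (A / R\<^sup>2 + A / R\<^sup>2)"
      by (intro add_mono m mult_left_mono d1 d2) auto
    finally show ?thesis using R by (simp add: field_simps)
  qed
  have m'0: "m' k = 0" if "k \<notin> ?S" for k
  proof -
    have "m (k + e) = 0" if "e \<in> {0, (1,0), (0,1), (-1,0), (0,-1)}" for e
    proof (rule ccontr)
      assume "m (k + e) \<noteq> 0"
      then have "\<bar>real_of_int (fst (k + e))\<bar> \<le> 4 * R" "\<bar>real_of_int (snd (k + e))\<bar> \<le> 4 * R" using supp by blast+
      then have "\<bar>real_of_int (fst k)\<bar> \<le> 5 * R" "\<bar>real_of_int (snd k)\<bar> \<le> 5 * R" using that R by auto
      then show False using inS \<open>k \<notin> ?S\<close> by blast
    qed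
    from this[of 0] this[of "(1,0)"] this[of "(0,1)"] this[of "(-1,0)"] this[of "(0,-1)"]
    show ?thesis by (auto simp: m'_def second_diff_def minus_prod_def plus_prod_def)
  qed
  have cardS: "real (card ?S) \<le> 121 * R\<^sup>2"
  proof -
    have "N \<ge> 0" using R by (simp add: N_def)
    then have "real (card ?S) = (2 * real_of_int N + 1)\<^sup>2"
      by (simp add: card_cartesian_product power2_eq_square)
    also have "\<dots> \<le> (11 * R)\<^sup>2"
    proof (rule power_mono)
      have "real_of_int N \<le> 5 * R" unfolding N_def by (rule of_int_floor_le)
      then show "2 * real_of_int N + 1 \<le> 11 * R" using R by linarith
    qed (use \<open>N \<ge> 0\<close> in auto)
    finally show ?thesis by (simp add: power_mult_distrib)
  qed
  have par: "tint (\<lambda>x. (cmod (tev m' x))\<^sup>2) \<le> 1089 * A\<^sup>2 * R\<^sup>2"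
  proof -
    have "tint (\<lambda>x. (cmod (tev m' x))\<^sup>2) = (\<Sum>k | m' k \<noteq> 0. (cmod (m' k))\<^sup>2)" by (rule parseval[OF fm'])
    also have "\<dots> \<le> (\<Sum>k\<in>?S. (cmod (m' k))\<^sup>2)"
      by (rule sum_mono2) (use m'0 in auto)
    also have "\<dots> \<le> (\<Sum>k\<in>?S. (3 * A)\<^sup>2)" by (intro sum_mono power_mono bm') auto
    also have "\<dots> = real (card ?S) * (9 * A\<^sup>2)" by (simp add: power_mult_distrib)
    also have "\<dots> \<le> 121 * R\<^sup>2 * (9 * A\<^sup>2)" by (intro mult_right_mono cardS) auto
    finally show ?thesis by (simp add: algebra_simps)
  qed
  show "tint (\<lambda>y. cmod (tev m y) * wt R y powr (1/4)) \<le> 560 * A"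
  proof (cases "A = 0")
    case True
    then have "m = (\<lambda>k. 0)" using m by auto
    then show ?thesis using True by simp
  next
    case False
    then have A0: "A > 0" using A by simp
    have wp: "wt R y > 0" for y using wt_ge1[of R y] by linarith
    note cw = cont_wt_powr
    have pt: "cmod (tev m y) * wt R y powr (1/4) \<le>
        (A * R\<^sup>2 / 2) * wt R y powr (-3/2) + (1 / (2 * A * R\<^sup>2)) * (cmod (tev m' y))\<^sup>2" for y
    proof -
      define p q where "p = wt R y powr (-3/4)" and "q = cmod (tev m' y)"
      have eq: "cmod (tev m y) * wt R y powr (1/4) = p * q"
      proof -
        have "wt R y powr (1/4) = wt R y powr (-3/4) * wt R y powr 1" by (subst powr_add[symmetric]) simp
        then show ?thesis using wp[of y] by (simp add: p_def q_def tm' norm_mult)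
      qed
      have p2: "wt R y powr (-3/2) = p\<^sup>2" by (simp add: p_def power2_eq_square flip: powr_add)
      \<comment> \<open>Young's inequality p * q \<le> c/2 * p^2 + q^2/(2c), with c chosen so that
        both integrals come out proportional to A.\<close>
      define c where "c = A * R\<^sup>2"
      have c: "c > 0" using A0 R by (simp add: c_def)
      have "2 * (c * p) * q \<le> (c * p)\<^sup>2 + q\<^sup>2" by (rule sum_squares_bound)
      then have "p * q \<le> ((c * p)\<^sup>2 + q\<^sup>2) / (2 * c)" using c by (simp add: field_simps)
      also have "\<dots> = (c / 2) * p\<^sup>2 + (1 / (2 * c)) * q\<^sup>2" using c by (simp add: field_simps power2_eq_square)
      finally show ?thesis unfolding eq p2 by (simp add: c_def q_def mult.assoc)
    qed
    have "tint (\<lambda>y. cmod (tev m y) * wt R y powr (1/4)) \<le>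
       tint (\<lambda>y. (A * R\<^sup>2 / 2) * wt R y powr (-3/2) + (1 / (2 * A * R\<^sup>2)) * (cmod (tev m' y))\<^sup>2)"
      by (rule tint_mono) (intro pt continuous_intros cw)+
    also have "\<dots> = (A * R\<^sup>2 / 2) * tint (\<lambda>y. wt R y powr (-3/2)) + (1 / (2 * A * R\<^sup>2)) * tint (\<lambda>y. (cmod (tev m' y))\<^sup>2)"
      by (subst tint_add) (intro continuous_intros cw, intro continuous_intros, simp only: tint_mult)
    also have "\<dots> \<le> (A * R\<^sup>2 / 2) * (16 / R\<^sup>2) + (1 / (2 * A * R\<^sup>2)) * (1089 * A\<^sup>2 * R\<^sup>2)"
      using A0 by (intro add_mono mult_left_mono tint_wt R par) auto
    \<comment> \<open>The two terms are 8 * A and 544.5 * A.\<close>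
    also have "\<dots> \<le> 560 * A" using A0 R by (simp add: field_simps power2_eq_square)
    finally show ?thesis .
  qed
qed

text \<open>Since (R |y|)^2 is at most \<open>wt R y\<close>, the weight kept in
  \<open>kernel_bound\<close> dominates the square root of R |y|; hence the limit \<sigma> \<le>
  1/2.\<close>

lemma wt_moment: assumes "y \<in> torus" "R \<ge> 1" "0 \<le> \<sigma>" "\<sigma> \<le> 1/2"
  shows "norm y powr \<sigma> \<le> R powr (-\<sigma>) * wt R y powr (1/4)"
proof -
  have "(R * norm y) powr \<sigma> \<le> wt R y powr (1/4)"
  proof (cases "R * norm y \<le> 1")
    case True
    then have "(R * norm y) powr \<sigma> \<le> 1" using assms by (intro powr_le1) auto
    also have "\<dots> \<le> wt R y powr (1/4)" using wt_ge1 by (intro ge_one_powr_ge_zero) auto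
    finally show ?thesis .
  next
    case False
    then have "(R * norm y) powr \<sigma> \<le> (R * norm y) powr (1/2)" using assms by (intro powr_mono) auto
    also have "\<dots> = ((R * norm y)\<^sup>2) powr (1/4)"
      using False powr_powr[of "R * norm y" 2 "1/4"] by (simp add: powr_numeral)
    also have "\<dots> \<le> wt R y powr (1/4)" by (intro powr_mono2 wt_lower(2) assms) auto
    finally show ?thesis .
  qed
  moreover have "(R * norm y) powr \<sigma> = R powr \<sigma> * norm y powr \<sigma>" using assms by (intro powr_mult)
  ultimately show ?thesis using assms by (simp add: powr_minus field_simps)
qed

lemma kernel_moment:
  assumes "fsupp m" "tint (\<lambda>y. cmod (tev m y) * wt R y powr (1/4)) \<le> L" "R \<ge> 1" and s: "0 < \<sigma>" and "\<sigma> \<le> 1/2"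
  shows "tint (\<lambda>y. cmod (tev m y) * norm y powr \<sigma>) \<le> L * R powr (-\<sigma>)"
proof -
  have cn: "cont (\<lambda>y::real\<times>real. norm y powr \<sigma>)" using s by (intro continuous_on_powr') (auto intro!: continuous_intros)
  have cw: "cont (\<lambda>y. wt R y powr (1/4))" by (rule cont_wt_powr)
  have "tint (\<lambda>y. cmod (tev m y) * norm y powr \<sigma>) \<le> tint (\<lambda>y. R powr (-\<sigma>) * (cmod (tev m y) * wt R y powr (1/4)))"
  proof (rule tint_mono_torus)
    show "cmod (tev m y) * norm y powr \<sigma> \<le> R powr (-\<sigma>) * (cmod (tev m y) * wt R y powr (1/4))" if "y \<in> torus" for y
      using mult_left_mono[OF wt_moment[OF that assms(3)], of \<sigma> "cmod (tev m y)"] assms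
      by (auto simp: mult.left_commute)
  qed (intro continuous_intros cn cw)+
  also have "\<dots> \<le> R powr (-\<sigma>) * L" using assms by (subst tint_mult) (auto intro!: mult_left_mono)
  finally show ?thesis by (simp add: mult.commute)
qed

lemma kernel_L1:
  assumes "fsupp m" "tint (\<lambda>y. cmod (tev m y) * wt R y powr (1/4)) \<le> L"
  shows "tint (\<lambda>y. cmod (tev m y)) \<le> L"
proof -
  have "tint (\<lambda>y. cmod (tev m y)) \<le> tint (\<lambda>y. cmod (tev m y) * wt R y powr (1/4))"
  proof (rule tint_mono)
    show "cont (\<lambda>y. cmod (tev m y) * wt R y powr (1/4))"
      by (intro continuous_intros cont_wt_powr)
    show "cmod (tev m y) \<le> cmod (tev m y) * wt R y powr (1/4)" for y
      using mult_left_mono[OF ge_one_powr_ge_zero[OF wt_ge1, of "1/4" R y], of "cmod (tev m y)"] by auto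
  qed (intro continuous_intros)
  then show ?thesis using assms by linarith
qed

text \<open>What \<open>kernel_bound\<close> consumes after dilation, with one constant on which the
  kernel bound depends linearly. Second differences along the axes stand in for second
  derivatives.\<close>

definition profile :: "real \<Rightarrow> (real \<times> real \<Rightarrow> complex) \<Rightarrow> bool" where
  "profile A s \<longleftrightarrow> A \<ge> 0 \<and> (\<forall>\<xi>. s \<xi> \<noteq> 0 \<longrightarrow> norm \<xi> \<le> 4) \<and> (\<forall>\<xi>. cmod (s \<xi>) \<le> A) \<and>
     (\<forall>x y h. cmod (s (x + h, y) - 2 * s (x, y) + s (x - h, y)) \<le> A * h\<^sup>2) \<and>
     (\<forall>x y h. cmod (s (x, y + h) - 2 * s (x, y) + s (x, y - h)) \<le> A * h\<^sup>2)"

definition dilate :: "real \<Rightarrow> (real \<times> real \<Rightarrow> complex) \<Rightarrow> distr" where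
  "dilate R s k = s ((1 / R) *\<^sub>R kvec k)"

lemma prof_kernel:
  assumes "profile A s" "R \<ge> 1"
  shows "fsupp (dilate R s)" "tint (\<lambda>y. cmod (tev (dilate R s) y) * wt R y powr (1/4)) \<le> 560 * A"
proof -
  have R: "R > 0" using assms by simp
  have supp: "\<bar>real_of_int (fst k)\<bar> \<le> 4 * R \<and> \<bar>real_of_int (snd k)\<bar> \<le> 4 * R" if "dilate R s k \<noteq> 0" for k
  proof -
    have "norm ((1 / R) *\<^sub>R kvec k) \<le> 4"
      using that assms(1) unfolding profile_def dilate_def by blast
    then have n: "norm (kvec k) \<le> 4 * R" using R by (simp add: field_simps)
    show ?thesis using n norm_fst_le[of "real_of_int (fst k)" "real_of_int (snd k)"]
        norm_snd_le[of "real_of_int (snd k)" "real_of_int (fst k)"] by (auto simp: kvec_def)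
  qed
  have d: "cmod (second_diff (1,0) (dilate R s) k) \<le> A / R\<^sup>2" "cmod (second_diff (0,1) (dilate R s) k) \<le> A / R\<^sup>2" for k
  proof -
    obtain a b where k: "k = (a, b)" by (cases k)
    have "cmod (s (a/R + 1/R, b/R) - 2 * s (a/R, b/R) + s (a/R - 1/R, b/R)) \<le> A * (1/R)\<^sup>2"
      "cmod (s (a/R, b/R + 1/R) - 2 * s (a/R, b/R) + s (a/R, b/R - 1/R)) \<le> A * (1/R)\<^sup>2"
      using assms(1) unfolding profile_def by blast+
    then show "cmod (second_diff (1,0) (dilate R s) k) \<le> A / R\<^sup>2" "cmod (second_diff (0,1) (dilate R s) k) \<le> A / R\<^sup>2"
      by (auto simp: second_diff_def dilate_def k kvec_def add_divide_distrib diff_divide_distrib power_divide)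
  qed
  have A: "A \<ge> 0" "\<And>k. cmod (dilate R s k) \<le> A" using assms(1) unfolding profile_def dilate_def by blast+
  show "fsupp (dilate R s)" "tint (\<lambda>y. cmod (tev (dilate R s) y) * wt R y powr (1/4)) \<le> 560 * A"
    using kernel_bound[OF assms(2) A(1) supp A(2) d] by blast+
qed

lemma prof_mul_le:
  assumes "profile A s" "R \<ge> 1" "fsupp f" "\<And>x. cmod (tev f x) \<le> B"
  shows "cmod (tev (mul (dilate R s) f) x) \<le> 560 * A * B"
  using tev_mul_le[OF _ assms(3) kernel_L1 assms(4)] prof_kernel[OF assms(1,2)] by blast

lemma exp_ge_pow: assumes "0 \<le> (y::real)" "k > 0" shows "(y / real k) ^ k \<le> exp y"
proof -
  have "(y / real k) ^ k \<le> exp (y / real k) ^ k"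
  proof (rule power_mono)
    show "y / real k \<le> exp (y / real k)" using exp_ge_add_one_self[of "y / real k"] by linarith
  qed (use assms in auto)
  also have "\<dots> = exp y" using assms by (simp flip: exp_of_nat_mult)
  finally show ?thesis .
qed

lemma exp_flat: assumes "(x::real) > 0" "k > 0" shows "exp (- 1 / x) \<le> (real k * x) ^ k"
proof -
  have "(1 / (real k * x)) ^ k \<le> exp (1 / x)"
    using exp_ge_pow[of "1/x" k] assms by (simp add: field_simps)
  then have "inverse (exp (1 / x)) \<le> inverse ((1 / (real k * x)) ^ k)"
    using assms by (intro le_imp_inverse_le) auto
  then show ?thesis using assms by (simp add: exp_minus[symmetric] power_one_over)
qed

text \<open>Used to glue, at 0, the branch exp (-1/x) and its derivative to the zero branch.\<close>

lemma has_derivative_flat: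
  fixes f :: "real \<Rightarrow> real"
  assumes "\<And>x. \<bar>f x\<bar> \<le> C * x\<^sup>2"
  shows "(f has_real_derivative 0) (at 0)"
proof -
  have f0: "f 0 = 0" using assms[of 0] by simp
  have "((\<lambda>h. f h / h) \<longlongrightarrow> 0) (at 0)"
  proof (rule Lim_null_comparison)
    show "\<forall>\<^sub>F h in at 0. norm (f h / h) \<le> C * \<bar>h\<bar>"
      using assms by (intro always_eventually allI) (auto simp: abs_le_iff field_simps power2_eq_square split: if_splits intro!: divide_le_eq[THEN iffD2])
    show "((\<lambda>h. C * \<bar>h\<bar>) \<longlongrightarrow> 0) (at 0)" by (auto intro!: tendsto_eq_intros)
  qed
  then show ?thesis by (simp add: DERIV_def f0)
qed

subsection \<open>Smoothness of the Littlewood--Paley symbol\<close>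

text \<open>\<open>E1\<close> and \<open>E2\<close> are the first two derivatives of
  \<open>sstep_e\<close>; below, \<open>S1\<close>, \<open>S2\<close> play this role for
  \<open>sstep\<close>, and \<open>G1\<close>, \<open>G2\<close> for the cutoff as a function of the
  squared radius.\<close>

definition E1 :: "real \<Rightarrow> real" where "E1 x = (if x > 0 then exp (- 1 / x) / x\<^sup>2 else 0)"
definition E2 :: "real \<Rightarrow> real" where "E2 x = (if x > 0 then exp (- 1 / x) * (1 / x^4 - 2 / x^3) else 0)"

lemma sstep_e_bounds: "\<bar>sstep_e x\<bar> \<le> 4 * x\<^sup>2" "0 \<le> sstep_e x" "sstep_e x \<le> 1"
  using exp_flat[of x 2] by (auto simp: sstep_e_def power_mult_distrib)

lemma E1_bounds: "\<bar>E1 x\<bar> \<le> 256 * x\<^sup>2" "\<bar>E1 x\<bar> \<le> 4"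
proof -
  show "\<bar>E1 x\<bar> \<le> 256 * x\<^sup>2"
    using exp_flat[of x 4] by (auto simp: E1_def field_simps power_mult_distrib power2_eq_square power4_eq_xxxx)
  show "\<bar>E1 x\<bar> \<le> 4" using exp_flat[of x 2] by (auto simp: E1_def field_simps power_mult_distrib)
qed

text \<open>The constants 4^4 = 256 and 3^3 = 27 come from \<open>exp_flat\<close>, and 256 + 2 * 27
  = 310.\<close>

lemma E2_bound: "\<bar>E2 x\<bar> \<le> 310"
proof (cases "x > 0")
  case True
  have "exp (- 1 / x) / x^4 \<le> 256" using exp_flat[of x 4] True by (simp add: field_simps power_mult_distrib)
  moreover have "exp (- 1 / x) / x^3 \<le> 27" using exp_flat[of x 3] True by (simp add: field_simps power_mult_distrib)
  moreover have "exp (- 1 / x) / x^4 \<ge> 0" "exp (- 1 / x) / x^3 \<ge> 0" using True by auto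
  moreover have "E2 x = exp (- 1 / x) / x^4 - 2 * (exp (- 1 / x) / x^3)" using True by (simp add: E2_def right_diff_distrib)
  ultimately show ?thesis by (simp only: abs_le_iff) linarith
qed (simp add: E2_def)

lemma DERIV_near:
  assumes "(g has_real_derivative d) (at x)" "open S" "x \<in> S" "\<And>y. y \<in> S \<Longrightarrow> g y = f y"
  shows "(f has_real_derivative d) (at x)"
  using has_field_derivative_transform_within_open[OF assms(1,2,3,4)] .

lemma DERIV_sstep_e: "(sstep_e has_real_derivative E1 x) (at x)"
proof (cases "x = 0")
  case True
  then show ?thesis using has_derivative_flat[of sstep_e 4] sstep_e_bounds(1) by (simp add: E1_def)
next
  case False
  show ?thesis
  proof (cases "x > 0")
    case True
    have "((\<lambda>x. exp (- 1 / x)) has_real_derivative E1 x) (at x)"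
      using True by (auto intro!: derivative_eq_intros simp: E1_def power2_eq_square)
    then show ?thesis by (rule DERIV_near[of _ _ _ "{0<..}"]) (use True in \<open>auto simp: sstep_e_def\<close>)
  next
    case neg: False
    have "((\<lambda>x. 0) has_real_derivative E1 x) (at x)" using neg by (simp add: E1_def)
    then show ?thesis by (rule DERIV_near[of _ _ _ "{..<0}"]) (use neg False in \<open>auto simp: sstep_e_def\<close>)
  qed
qed

lemma DERIV_E1: "(E1 has_real_derivative E2 x) (at x)"
proof (cases "x = 0")
  case True
  then show ?thesis using has_derivative_flat[of E1 256] E1_bounds(1) by (simp add: E2_def)
next
  case False
  show ?thesis
  proof (cases "x > 0")
    case True
    have "((\<lambda>x. exp (- 1 / x) / x\<^sup>2) has_real_derivative E2 x) (at x)"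
      using True by (auto intro!: derivative_eq_intros simp: E2_def field_simps power2_eq_square power4_eq_xxxx power3_eq_cube)
    then show ?thesis by (rule DERIV_near[of _ _ _ "{0<..}"]) (use True in \<open>auto simp: E1_def\<close>)
  next
    case neg: False
    have "((\<lambda>x. 0) has_real_derivative E2 x) (at x)" using neg by (simp add: E2_def)
    then show ?thesis by (rule DERIV_near[of _ _ _ "{..<0}"]) (use neg False in \<open>auto simp: E1_def\<close>)
  qed
qed

definition S1 :: "real \<Rightarrow> real" where
  "S1 x = (E1 x * sstep_e (1 - x) + sstep_e x * E1 (1 - x)) / (sstep_e x + sstep_e (1 - x))\<^sup>2"
definition S2 :: "real \<Rightarrow> real" where
  "S2 x = (E2 x * sstep_e (1 - x) - sstep_e x * E2 (1 - x)) / (sstep_e x + sstep_e (1 - x))\<^sup>2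
     - 2 * (E1 x * sstep_e (1 - x) + sstep_e x * E1 (1 - x)) * (E1 x - E1 (1 - x)) / (sstep_e x + sstep_e (1 - x)) ^ 3"

text \<open>One of x and 1 - x is at least 1/2, where \<open>sstep_e\<close> is at least exp
  (-2).\<close>

lemma sstep_den: "exp (- 2) \<le> sstep_e x + sstep_e (1 - x)"
proof (cases "x \<ge> 1/2")
  case True
  have "-2 \<le> -1/x" using True by (simp add: field_simps)
  then show ?thesis using True sstep_e_bounds(2)[of "1-x"] by (simp add: sstep_e_def[of x] add_increasing2)
next
  case False
  have "-2 \<le> -1/(1-x)" using False by (simp add: field_simps)
  then show ?thesis using False sstep_e_bounds(2)[of x] by (simp add: sstep_e_def[of "1-x"] add_increasing)
qed

lemma sstep_den_pos: "0 < sstep_e x + sstep_e (1 - x)"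
  using sstep_den[of x] exp_gt_zero[of "-2::real"] by linarith

lemma DERIV_refl: "(f has_real_derivative d) (at (1 - x)) \<Longrightarrow> ((\<lambda>x. f (1 - x)) has_real_derivative - d) (at x)"
  using DERIV_chain2[of f d "\<lambda>x. 1 - x" x "-1" UNIV] DERIV_diff[OF DERIV_const[of 1] DERIV_ident, of x UNIV] by simp

lemma DERIV_sstep: "(sstep has_real_derivative S1 x) (at x)" "(S1 has_real_derivative S2 x) (at x)"
proof -
  define q where "q = sstep_e x + sstep_e (1 - x)"
  have q: "q \<noteq> 0" using sstep_den_pos[of x] by (simp add: q_def)
  note D = DERIV_sstep_e DERIV_E1 DERIV_refl[OF DERIV_sstep_e] DERIV_refl[OF DERIV_E1]
  show "(sstep has_real_derivative S1 x) (at x)"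
    unfolding sstep_def[abs_def] S1_def
    by (rule DERIV_cong[OF DERIV_divide[OF D(1) DERIV_add[OF D(1) D(3)]]])
       (use q in \<open>auto simp: q_def field_simps power2_eq_square\<close>)
  have "((\<lambda>x. (E1 x * sstep_e (1 - x) + sstep_e x * E1 (1 - x)) / (sstep_e x + sstep_e (1 - x))\<^sup>2) has_real_derivative
    ((E2 x * sstep_e (1 - x) - sstep_e x * E2 (1 - x)) * q\<^sup>2 -
      (E1 x * sstep_e (1 - x) + sstep_e x * E1 (1 - x)) * (2 * q * (E1 x - E1 (1 - x)))) / (q\<^sup>2 * q\<^sup>2)) (at x)"
    by (rule DERIV_cong[OF DERIV_divide[OF DERIV_add[OF DERIV_mult[OF D(2) D(3)] DERIV_mult[OF D(1) D(4)]]
         DERIV_power[OF DERIV_add[OF D(1) D(3)], of 2]]])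
       (use q in \<open>auto simp: q_def algebra_simps\<close>)
  moreover have "((E2 x * sstep_e (1 - x) - sstep_e x * E2 (1 - x)) * q\<^sup>2 -
      (E1 x * sstep_e (1 - x) + sstep_e x * E1 (1 - x)) * (2 * q * (E1 x - E1 (1 - x)))) / (q\<^sup>2 * q\<^sup>2) = S2 x"
  proof -
    have "(a * q\<^sup>2 - b * (2 * q * c)) / (q\<^sup>2 * q\<^sup>2) = a / q\<^sup>2 - 2 * b * c / q ^ 3" for a b c
      using q by (simp add: field_simps power2_eq_square power3_eq_cube)
    then show ?thesis unfolding S2_def q_def[symmetric] by simp
  qed
  ultimately show "(S1 has_real_derivative S2 x) (at x)" unfolding S1_def[abs_def] by simp
qed

lemma sstep_const: "x \<le> 0 \<Longrightarrow> sstep x = 0" "x \<ge> 1 \<Longrightarrow> sstep x = 1"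
  by (auto simp: sstep_def sstep_e_def)

lemma sstep_bounds: "0 \<le> sstep x" "sstep x \<le> 1"
  using sstep_e_bounds(2)[of x] sstep_e_bounds(2)[of "1-x"] sstep_den_pos[of x] by (auto simp: sstep_def)

lemma S_zero: "x \<le> 0 \<or> x \<ge> 1 \<Longrightarrow> S1 x = 0" "x \<le> 0 \<or> x \<ge> 1 \<Longrightarrow> S2 x = 0"
  by (auto simp: S1_def S2_def sstep_e_def E1_def E2_def)

lemma S_bounds: "\<exists>M. \<forall>x. \<bar>S1 x\<bar> \<le> M \<and> \<bar>S2 x\<bar> \<le> M"
proof -
  define c :: real where "c = exp (-2)"
  have c: "c > 0" by (simp add: c_def)
  have num: "\<bar>a * b + c' * d\<bar> \<le> 2 * K" if "\<bar>a\<bar> \<le> K" "\<bar>b\<bar> \<le> 1" "\<bar>c'\<bar> \<le> 1" "\<bar>d\<bar> \<le> K" for a b c' d K :: real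
  proof -
    have "\<bar>a * b\<bar> \<le> K * 1" "\<bar>c' * d\<bar> \<le> 1 * K" unfolding abs_mult using that by (intro mult_mono; simp)+
    then show ?thesis by linarith
  qed
  have se: "\<bar>sstep_e x\<bar> \<le> 1" for x using sstep_e_bounds(2,3)[of x] by simp
  have dv: "\<bar>a / q ^ k\<bar> \<le> K / c ^ k" if "\<bar>a\<bar> \<le> K" "c \<le> q" for a q K and k :: nat
  proof -
    have "c ^ k \<le> q ^ k" using that c by (intro power_mono) auto
    then show ?thesis using that c by (auto simp: abs_divide power_abs intro!: frac_le)
  qed
  have B: "\<bar>S1 x\<bar> \<le> 8 / c ^ 2" "\<bar>S2 x\<bar> \<le> 620 / c ^ 2 + 128 / c ^ 3" for x
  proof -
    let ?q = "sstep_e x + sstep_e (1 - x)" and ?n = "E1 x * sstep_e (1 - x) + sstep_e x * E1 (1 - x)"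
    have q: "c \<le> ?q" using sstep_den by (simp add: c_def)
    have n: "\<bar>?n\<bar> \<le> 8" using num[OF E1_bounds(2) se se E1_bounds(2)] by simp
    show "\<bar>S1 x\<bar> \<le> 8 / c ^ 2" unfolding S1_def by (rule dv[OF n q])
    have n2: "\<bar>E2 x * sstep_e (1 - x) - sstep_e x * E2 (1 - x)\<bar> \<le> 620"
      using num[of "E2 x" 310 "sstep_e (1-x)" "sstep_e x" "- E2 (1-x)"] E2_bound se by simp
    have "\<bar>E1 x - E1 (1 - x)\<bar> \<le> 8" using E1_bounds(2)[of x] E1_bounds(2)[of "1-x"] by linarith
    then have n3: "\<bar>2 * ?n * (E1 x - E1 (1 - x))\<bar> \<le> 128"
      using mult_mono[OF n, of "\<bar>E1 x - E1 (1 - x)\<bar>" 8] unfolding mult.assoc abs_mult[of 2] abs_mult[of ?n] by (simp add: mult.commute)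
    show "\<bar>S2 x\<bar> \<le> 620 / c ^ 2 + 128 / c ^ 3" unfolding S2_def
      using dv[OF n2 q, of 2] dv[OF n3 q, of 3] by linarith
  qed
  have "0 \<le> 8 / c ^ 2" "0 \<le> 620 / c ^ 2 + 128 / c ^ 3" using c by auto
  then have "\<bar>S1 x\<bar> \<le> 8 / c ^ 2 + (620 / c ^ 2 + 128 / c ^ 3) \<and> \<bar>S2 x\<bar> \<le> 8 / c ^ 2 + (620 / c ^ 2 + 128 / c ^ 3)" for x
    using B[of x] by linarith
  then show ?thesis by blast
qed

text \<open>Working with the squared radius makes the inner function polynomial. The cutoff is
  locally constant for squared radius below 1, so cutting at 1/2 keeps away from the singularity of
  the square root.\<close>

definition G1 :: "real \<Rightarrow> real" where "G1 r = (if r \<le> 1/2 then 0 else S1 (sqrt r - 1) / (2 * sqrt r))"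
definition G2 :: "real \<Rightarrow> real" where
  "G2 r = (if r \<le> 1/2 then 0 else S2 (sqrt r - 1) / (4 * r) - S1 (sqrt r - 1) / (4 * (sqrt r * r)))"

lemma sqrt_lt1: "r < 1 \<Longrightarrow> sqrt r - 1 \<le> 0" by (simp add: real_sqrt_le_1_iff)

lemma DERIV_G: "((\<lambda>r. sstep (sqrt r - 1)) has_real_derivative G1 r) (at r)" "(G1 has_real_derivative G2 r) (at r)"
proof -
  have z: "G1 r = 0" "G2 r = 0" if "r < 1" for r
    using sqrt_lt1[OF that] by (auto simp: G1_def G2_def S_zero)
  show "((\<lambda>r. sstep (sqrt r - 1)) has_real_derivative G1 r) (at r)"
  proof (cases "r < 1")
    case True
    have "((\<lambda>r. 0) has_real_derivative G1 r) (at r)" using z[OF True] by simp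
    then show ?thesis by (rule DERIV_near[of _ _ _ "{..<1}"]) (use True sqrt_lt1 in \<open>auto simp: sstep_const\<close>)
  next
    case False
    then have "((\<lambda>r. sqrt r - 1) has_real_derivative inverse (sqrt r) / 2) (at r)"
      by (auto intro!: derivative_eq_intros)
    from DERIV_chain2[OF DERIV_sstep(1) this] show ?thesis using False by (simp add: G1_def field_simps)
  qed
  show "(G1 has_real_derivative G2 r) (at r)"
  proof (cases "r < 1")
    case True
    have "((\<lambda>r. 0) has_real_derivative G2 r) (at r)" using z[OF True] by simp
    then show ?thesis by (rule DERIV_near[of _ _ _ "{..<1}"]) (use True z in auto)
  next
    case False
    then have "((\<lambda>r. sqrt r - 1) has_real_derivative inverse (sqrt r) / 2) (at r)"
      by (auto intro!: derivative_eq_intros)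
    note 1 = DERIV_chain2[OF DERIV_sstep(2) this]
    have 2: "((\<lambda>r. 2 * sqrt r) has_real_derivative inverse (sqrt r)) (at r)"
      using False by (auto intro!: derivative_eq_intros)
    have s: "sqrt r > 0" using False by simp
    have "((\<lambda>r. S1 (sqrt r - 1) / (2 * sqrt r)) has_real_derivative G2 r) (at r)"
      by (rule DERIV_cong[OF DERIV_divide[OF 1 2]])
         (use s False in \<open>auto simp: G2_def field_simps\<close>)
    then show ?thesis by (rule DERIV_near[of _ _ _ "{1/2<..}"]) (use False in \<open>auto simp: G1_def\<close>)
  qed
qed

lemma G_zero: "r \<ge> 4 \<Longrightarrow> G1 r = 0 \<and> G2 r = 0"
proof -
  assume "r \<ge> 4"
  then have "sqrt r - 1 \<ge> 1" using real_sqrt_le_mono[of 4 r] by simp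
  then show ?thesis by (simp add: G1_def G2_def S_zero)
qed

lemma G_bounds: "\<exists>M\<ge>0. \<forall>r. \<bar>G1 r\<bar> \<le> M \<and> \<bar>G2 r\<bar> \<le> M"
proof -
  obtain M where M: "\<And>x. \<bar>S1 x\<bar> \<le> M" "\<And>x. \<bar>S2 x\<bar> \<le> M" using S_bounds by blast
  then have M0: "M \<ge> 0" using abs_ge_zero order_trans by blast
  have "\<bar>G1 r\<bar> \<le> 2 * M \<and> \<bar>G2 r\<bar> \<le> 2 * M" for r
  proof (cases "r < 1")
    case True
    then show ?thesis using sqrt_lt1[OF True] M0 by (auto simp: G1_def G2_def S_zero)
  next
    case False
    then have s: "sqrt r \<ge> 1" "r \<ge> 1" by auto
    have "1 \<le> sqrt r * r" using s mult_mono[of 1 "sqrt r" 1 r] by simp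
    have dv: "\<bar>a / b\<bar> \<le> M" if "\<bar>a\<bar> \<le> M" "b \<ge> 1" for a b :: real
    proof -
      have "\<bar>a\<bar> / \<bar>b\<bar> \<le> M / 1" using that M0 by (intro frac_le) auto
      then show ?thesis by (simp add: abs_divide)
    qed
    have "\<bar>G1 r\<bar> \<le> M"
    proof -
      have "1 \<le> 2 * sqrt r" using s by linarith
      then have "\<bar>S1 (sqrt r - 1) / (2 * sqrt r)\<bar> \<le> M" by (intro dv M)
      then show ?thesis using s by (simp add: G1_def)
    qed
    moreover have "\<bar>G2 r\<bar> \<le> M + M"
    proof -
      have "\<bar>S2 (sqrt r - 1) / (4 * r)\<bar> \<le> M" "\<bar>S1 (sqrt r - 1) / (4 * (sqrt r * r))\<bar> \<le> M"
        using s \<open>1 \<le> sqrt r * r\<close> by (intro dv M; simp)+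
      then show ?thesis using s unfolding G2_def by (auto intro: order_trans[OF abs_triangle_ineq4] add_mono)
    qed
    ultimately show ?thesis using M0 by auto
  qed
  then show ?thesis using M0 by (intro exI[of _ "2 * M"]) auto
qed

lemma theta_eq: "lp_theta (x, y) = 1 - sstep (sqrt (x\<^sup>2 + y\<^sup>2) - 1)"
  by (simp add: lp_theta_def norm_prod_def)

lemma theta_range: "0 \<le> lp_theta \<xi>" "lp_theta \<xi> \<le> 1" "norm \<xi> \<le> 1 \<Longrightarrow> lp_theta \<xi> = 1" "norm \<xi> \<ge> 2 \<Longrightarrow> lp_theta \<xi> = 0"
  using sstep_bounds by (auto simp: lp_theta_def sstep_const)

section \<open>Two bounded derivatives along lines: the cutoff and the heat symbol\<close>

definition C2b :: "real \<Rightarrow> (real \<Rightarrow> complex) \<Rightarrow> bool" where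
  "C2b M f \<longleftrightarrow> (\<exists>f1 f2. (\<forall>x. (f has_vector_derivative f1 x) (at x)) \<and> (\<forall>x. (f1 has_vector_derivative f2 x) (at x)) \<and>
     (\<forall>x. cmod (f x) \<le> M \<and> cmod (f1 x) \<le> M \<and> cmod (f2 x) \<le> M))"

lemma vector_derivative_bound:
  fixes f :: "real \<Rightarrow> 'a::real_normed_vector"
  assumes "\<And>x. (f has_vector_derivative f' x) (at x)" "\<And>x. norm (f' x) \<le> M"
  shows "norm (f a - f b) \<le> M * \<bar>a - b\<bar>"
proof -
  have "norm (f a - f b) \<le> M * norm (a - b)"
  proof (rule differentiable_bound[of UNIV f "\<lambda>x h. h *\<^sub>R f' x"])
    show "onorm (\<lambda>h. h *\<^sub>R f' x) \<le> M" for x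
      using onorm_scaleR_left[OF bounded_linear_ident, of "f' x"] onorm_id[where 'a = real] assms(2)[of x] by simp
    show "(f has_derivative (\<lambda>h. h *\<^sub>R f' x)) (at x within UNIV)" for x
      using assms(1)[of x] by (simp add: has_vector_derivative_def)
  qed auto
  then show ?thesis by simp
qed

text \<open>The mean value inequality is used twice, for the first derivative and for the increment
  s \<mapsto> f (x + s) - f (x - h + s), in place of Taylor's formula.\<close>

lemma C2b_second_difference:
  assumes "C2b M f" shows "cmod (f (x + h) - 2 * f x + f (x - h)) \<le> M * h\<^sup>2"
proof -
  obtain f1 f2 where f: "\<And>x. (f has_vector_derivative f1 x) (at x)" "\<And>x. (f1 has_vector_derivative f2 x) (at x)"
    "\<And>x. cmod (f2 x) \<le> M" using assms unfolding C2b_def by blast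
  have L: "cmod (f1 a - f1 b) \<le> M * \<bar>a - b\<bar>" for a b
    by (rule vector_derivative_bound[OF f(2,3)])
  define g where "g s = f (x + s) - f (x - h + s)" for s
  have g: "(g has_vector_derivative f1 (x + s) - f1 (x - h + s)) (at s)" for s
  proof -
    have "((\<lambda>s. f (c + s)) has_vector_derivative f1 (c + s)) (at s)" for c
    proof -
      have "((\<lambda>s. c + s) has_vector_derivative 1) (at s)"
        using DERIV_add[OF DERIV_const[of c] DERIV_ident, of s UNIV]
        by (simp add: has_real_derivative_iff_has_vector_derivative)
      from vector_diff_chain_at[OF this f(1)] show ?thesis by (simp add: o_def)
    qed
    then show ?thesis unfolding g_def by (intro has_vector_derivative_diff)
  qed
  have gb: "cmod (f1 (x + s) - f1 (x - h + s)) \<le> M * \<bar>h\<bar>" for s using L[of "x + s" "x - h + s"] by simp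
  have "cmod (g h - g 0) \<le> (M * \<bar>h\<bar>) * \<bar>h - 0\<bar>"
    by (rule vector_derivative_bound[OF g gb])
  then show ?thesis by (simp add: g_def power2_eq_square algebra_simps)
qed

lemma C2b_theta: "\<exists>M\<ge>1. \<forall>y. C2b M (\<lambda>x. complex_of_real (lp_theta (x, y)))"
proof -
  obtain M where M: "M \<ge> 0" "\<And>r. \<bar>G1 r\<bar> \<le> M" "\<And>r. \<bar>G2 r\<bar> \<le> M" using G_bounds by blast
  \<comment> \<open>18 = 2 + 4 * 4: \<open>G1\<close> and \<open>G2\<close> vanish at squared radius
    4 and beyond, so x^2 \<le> 4 may be assumed when bounding the second derivative.\<close>
  have "C2b (1 + 18 * M) (\<lambda>x. complex_of_real (lp_theta (x, y)))" for y
  proof -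
    define f1 f2 where "f1 x = - (2 * x * G1 (x\<^sup>2 + y\<^sup>2))" and "f2 x = - (2 * G1 (x\<^sup>2 + y\<^sup>2) + 4 * x\<^sup>2 * G2 (x\<^sup>2 + y\<^sup>2))" for x
    have sq: "((\<lambda>x. x\<^sup>2 + y\<^sup>2) has_real_derivative 2 * x) (at x)" for x
      by (auto intro!: derivative_eq_intros)
    have d1: "((\<lambda>x. lp_theta (x, y)) has_real_derivative f1 x) (at x)" for x
      unfolding theta_eq f1_def
      using DERIV_diff[OF DERIV_const[of 1] DERIV_chain2[OF DERIV_G(1) sq], of x] by (simp add: mult.commute)
    have d2: "(f1 has_real_derivative f2 x) (at x)" for x
      unfolding f1_def[abs_def] f2_def
      by (rule DERIV_cong[OF DERIV_minus[OF DERIV_mult[OF DERIV_cmult[OF DERIV_ident, of 2] DERIV_chain2[OF DERIV_G(2) sq]]]])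
         (simp add: algebra_simps power2_eq_square)
    have b: "\<bar>f1 x\<bar> \<le> 4 * M \<and> \<bar>f2 x\<bar> \<le> 18 * M" for x
    proof (cases "x\<^sup>2 + y\<^sup>2 \<ge> 4")
      case True
      then show ?thesis using G_zero[OF True] M(1) by (simp add: f1_def f2_def)
    next
      case False
      then have x4: "x\<^sup>2 \<le> 4" using zero_le_power2[of y] by linarith
      then have x: "\<bar>x\<bar> \<le> 2" using abs_le_square_iff[of x 2] by simp
      have "\<bar>x\<bar> * \<bar>G1 (x\<^sup>2 + y\<^sup>2)\<bar> \<le> 2 * M" using x M by (intro mult_mono) auto
      moreover have "\<bar>x\<^sup>2\<bar> * \<bar>G2 (x\<^sup>2 + y\<^sup>2)\<bar> \<le> 4 * M" using x4 M by (intro mult_mono) auto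
      moreover have "\<bar>f2 x\<bar> \<le> 2 * \<bar>G1 (x\<^sup>2 + y\<^sup>2)\<bar> + 4 * (\<bar>x\<^sup>2\<bar> * \<bar>G2 (x\<^sup>2 + y\<^sup>2)\<bar>)"
        unfolding f2_def abs_minus_cancel by (rule order_trans[OF abs_triangle_ineq]) (simp add: abs_mult)
      ultimately show ?thesis using M(2)[of "x\<^sup>2+y\<^sup>2"] by (simp add: f1_def abs_mult)
    qed
    show ?thesis unfolding C2b_def
    proof (intro exI conjI allI)
      show "((\<lambda>x. complex_of_real (lp_theta (x, y))) has_vector_derivative complex_of_real (f1 x)) (at x)" for x
        using d1[of x] by (simp add: has_vector_derivative_of_real has_real_derivative_iff_has_vector_derivative)
      show "((\<lambda>x. complex_of_real (f1 x)) has_vector_derivative complex_of_real (f2 x)) (at x)" for x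
        using d2[of x] by (simp add: has_vector_derivative_of_real has_real_derivative_iff_has_vector_derivative)
      show "cmod (complex_of_real (lp_theta (x, y))) \<le> 1 + 18 * M" for x
        using theta_range(1,2)[of "(x,y)"] M(1) by simp
      show "cmod (complex_of_real (f1 x)) \<le> 1 + 18 * M" "cmod (complex_of_real (f2 x)) \<le> 1 + 18 * M" for x
        using b[of x] M(1) by auto
    qed
  qed
  then show ?thesis using M(1) by (intro exI[of _ "1 + 18 * M"]) auto
qed

lemma C2b_dil: assumes "C2b M f" "0 \<le> a" "a \<le> 4" shows "C2b (16 * M) (\<lambda>x. f (a * x))"
proof -
  obtain f1 f2 where f: "\<And>x. (f has_vector_derivative f1 x) (at x)" "\<And>x. (f1 has_vector_derivative f2 x) (at x)"
    "\<And>x. cmod (f x) \<le> M" "\<And>x. cmod (f1 x) \<le> M" "\<And>x. cmod (f2 x) \<le> M" using assms(1) unfolding C2b_def by blast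
  have M: "M \<ge> 0" using f(3) norm_ge_zero order_trans by blast
  have ch: "((\<lambda>x. g (a * x)) has_vector_derivative a *\<^sub>R g' (a * x)) (at x)"
    if "\<And>x. (g has_vector_derivative g' x) (at x)" for g g' :: "real \<Rightarrow> complex" and x
  proof -
    have "((\<lambda>x. a * x) has_vector_derivative a) (at x)"
      using DERIV_cmult_Id[of a x UNIV] by (simp only: has_real_derivative_iff_has_vector_derivative)
    from vector_diff_chain_at[OF this that] show ?thesis by (simp add: o_def)
  qed
  have a2: "a * a \<le> 16" using assms mult_mono[of a 4 a 4] by simp
  show ?thesis unfolding C2b_def
  proof (intro exI conjI allI)
    show "((\<lambda>x. f (a * x)) has_vector_derivative a *\<^sub>R f1 (a * x)) (at x)" for x by (rule ch[OF f(1)])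
    show "((\<lambda>x. a *\<^sub>R f1 (a * x)) has_vector_derivative a *\<^sub>R a *\<^sub>R f2 (a * x)) (at x)" for x
      using has_vector_derivative_scaleR[OF DERIV_const[of a] ch[OF f(2)], of x] by simp
    show "cmod (f (a * x)) \<le> 16 * M" for x using f(3)[of "a*x"] M by linarith
    show "cmod (a *\<^sub>R f1 (a * x)) \<le> 16 * M" for x
      using mult_mono[of a 16 "cmod (f1 (a * x))" M] f(4)[of "a*x"] M assms by simp
    show "cmod (a *\<^sub>R a *\<^sub>R f2 (a * x)) \<le> 16 * M" for x
      using mult_mono[OF a2 f(5)[of "a*x"]] M assms by simp
  qed
qed

lemma C2b_diff: assumes "C2b M f" "C2b N g" shows "C2b (M + N) (\<lambda>x. f x - g x)"
proof -
  obtain f1 f2 where f: "\<And>x. (f has_vector_derivative f1 x) (at x)" "\<And>x. (f1 has_vector_derivative f2 x) (at x)"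
    "\<And>x. cmod (f x) \<le> M" "\<And>x. cmod (f1 x) \<le> M" "\<And>x. cmod (f2 x) \<le> M" using assms(1) unfolding C2b_def by blast
  obtain g1 g2 where g: "\<And>x. (g has_vector_derivative g1 x) (at x)" "\<And>x. (g1 has_vector_derivative g2 x) (at x)"
    "\<And>x. cmod (g x) \<le> N" "\<And>x. cmod (g1 x) \<le> N" "\<And>x. cmod (g2 x) \<le> N" using assms(2) unfolding C2b_def by blast
  show ?thesis unfolding C2b_def
    by (intro exI[of _ "\<lambda>x. f1 x - g1 x"] exI[of _ "\<lambda>x. f2 x - g2 x"] conjI allI has_vector_derivative_diff f g
        order_trans[OF norm_triangle_ineq4] add_mono)
qed

text \<open>The third power is needed because two derivatives of the heat symbol cost (1 + \<tau>)^2
  and one further factor 1/(1 + \<tau>) has to remain.\<close>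

lemma exp_poly_decay: fixes b \<tau> :: real assumes "b > 0" "\<tau> \<ge> 0" shows "(1 + \<tau>) ^ 3 * exp (- (b * \<tau>)) \<le> 27 * exp b / b ^ 3"
proof -
  have "(b * (1 + \<tau>) / 3) ^ 3 \<le> exp (b * (1 + \<tau>))"
    using exp_ge_pow[of "b * (1 + \<tau>)" 3] assms by simp
  also have "\<dots> = exp b * exp (b * \<tau>)" by (simp add: algebra_simps flip: exp_add)
  finally have "b ^ 3 * (1 + \<tau>) ^ 3 \<le> 27 * (exp b * exp (b * \<tau>))" by (simp add: power_divide power_mult_distrib)
  then have "b ^ 3 * (1 + \<tau>) ^ 3 * exp (- (b * \<tau>)) \<le> 27 * (exp b * exp (b * \<tau>)) * exp (- (b * \<tau>))"
    by (rule mult_right_mono) simp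
  also have "\<dots> = 27 * exp b" by (simp flip: exp_add)
  finally show ?thesis using assms by (simp add: field_simps)
qed

lemma vector_derivative_locally_zero:
  fixes f :: "real \<Rightarrow> complex"
  assumes "(f has_vector_derivative d) (at x)" "open S" "x \<in> S" "\<And>y. y \<in> S \<Longrightarrow> f y = 0"
  shows "d = 0"
proof -
  have "((\<lambda>y. 0) has_vector_derivative d) (at x)"
    by (rule has_vector_derivative_transform_within_open[OF assms(1,2,3)]) (use assms(4) in auto)
  then show ?thesis using vector_derivative_unique_at[OF _ has_vector_derivative_const[of 0]] by blast
qed

text \<open>On the annulus 1/4 \<le> |\<xi>| \<le> 4 the exponential decays like exp (- \<tau> Re
  \<zeta> / 16) and beats the powers of \<tau> produced by differentiation. The surviving 1/(1 +
  \<tau>) later becomes any power of \<tau> between 0 and -1. Off the annulus the amplitude and its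
  derivatives vanish, so the growth of the exponent there is harmless.\<close>

lemma C2b_gauss:
  fixes \<zeta> :: complex
  assumes \<zeta>: "Re \<zeta> > 0"
  shows "\<exists>C\<ge>0. \<forall>M a y \<tau>. C2b M a \<longrightarrow> (\<forall>x. x\<^sup>2 + y\<^sup>2 < 1/16 \<or> x\<^sup>2 + y\<^sup>2 > 16 \<longrightarrow> a x = 0) \<longrightarrow> \<tau> \<ge> 0 \<longrightarrow>
    C2b (C * M / (1 + \<tau>)) (\<lambda>x. a x * exp (- (complex_of_real \<tau> * \<zeta> * complex_of_real (x\<^sup>2 + y\<^sup>2))))"
proof -
  define b where "b = Re \<zeta> / 16"
  define z where "z = cmod \<zeta>"
  \<comment> \<open>Each derivative of the exponential costs at most X \<le> 8 * \<tau> * z, as |x|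
    \<le> 4. Then 1 + 2 * \<tau> * z + 2 * X + X^2 gives 18 = 2 + 2 * 8 and 64 = 8^2.\<close>
  define C where "C = (1 + 18 * z + 64 * z\<^sup>2) * (27 * exp b / b ^ 3)"
  have b: "b > 0" and z: "z \<ge> 0" using \<zeta> by (auto simp: b_def z_def)
  have C: "C \<ge> 0" using b z by (auto simp: C_def intro!: mult_nonneg_nonneg add_nonneg_nonneg)
  have "C2b (C * M / (1 + \<tau>)) (\<lambda>x. a x * exp (- (complex_of_real \<tau> * \<zeta> * complex_of_real (x\<^sup>2 + y\<^sup>2))))"
    if a: "C2b M a" and sup: "\<And>x. x\<^sup>2 + y\<^sup>2 < 1/16 \<or> x\<^sup>2 + y\<^sup>2 > 16 \<Longrightarrow> a x = 0" and \<tau>: "\<tau> \<ge> 0" for M a y \<tau>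
  proof -
    obtain f1 f2 where f: "\<And>x. (a has_vector_derivative f1 x) (at x)" "\<And>x. (f1 has_vector_derivative f2 x) (at x)"
      "\<And>x. cmod (a x) \<le> M" "\<And>x. cmod (f1 x) \<le> M" "\<And>x. cmod (f2 x) \<le> M" using a unfolding C2b_def by blast
    have M: "M \<ge> 0" using f(3) norm_ge_zero order_trans by blast
    let ?S = "{x. x\<^sup>2 + y\<^sup>2 < 1/16 \<or> x\<^sup>2 + y\<^sup>2 > 16}"
    have opS: "open ?S"
      by (intro open_Collect_disj open_Collect_less continuous_intros)
    have f1z: "f1 x = 0" if "x \<in> ?S" for x
      by (rule vector_derivative_locally_zero[OF f(1) opS that]) (use sup in auto)
    have f2z: "f2 x = 0" if "x \<in> ?S" for x
      by (rule vector_derivative_locally_zero[OF f(2) opS that]) (use f1z in auto)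
    define c where "c = complex_of_real \<tau> * \<zeta>"
    define E where "E x = exp (- (c * complex_of_real (x\<^sup>2 + y\<^sup>2)))" for x
    have dE: "(E has_vector_derivative - 2 * c * of_real x * E x) (at x)" for x
    proof -
      have "((\<lambda>w. exp (- (c * (w\<^sup>2 + of_real (y\<^sup>2))))) has_field_derivative
          - (c * (2 * of_real x)) * exp (- (c * ((of_real x)\<^sup>2 + of_real (y\<^sup>2))))) (at (of_real x))"
        by (auto intro!: derivative_eq_intros)
      from has_vector_derivative_real_field[OF this] show ?thesis
        by (simp add: E_def[abs_def] algebra_simps)
    qed
    define g1 where "g1 x = a x * (- 2 * c * of_real x * E x) + f1 x * E x" for x
    define g2 where "g2 x = a x * ((- 2 * c) * E x + (- 2 * c * of_real x) * (- 2 * c * of_real x * E x))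
        + f1 x * (- 2 * c * of_real x * E x) + (f1 x * (- 2 * c * of_real x * E x) + f2 x * E x)" for x
    have dx: "((\<lambda>x. - 2 * c * complex_of_real x) has_vector_derivative - 2 * c) (at x)" for x
      by (auto intro!: derivative_eq_intros has_vector_derivative_real_field)
    have dxE: "((\<lambda>x. - 2 * c * of_real x * E x) has_vector_derivative
        (- 2 * c * of_real x) * (- 2 * c * of_real x * E x) + (- 2 * c) * E x) (at x)" for x
      by (rule has_vector_derivative_mult[OF dx dE])
    have D1: "((\<lambda>x. a x * E x) has_vector_derivative g1 x) (at x)" for x
      unfolding g1_def by (rule has_vector_derivative_mult[OF f(1) dE])
    have D2: "(g1 has_vector_derivative g2 x) (at x)" for x
      unfolding g1_def[abs_def] g2_def
      by (rule has_vector_derivative_eq_rhs[OF has_vector_derivative_add[OF has_vector_derivative_mult[OF f(1) dxE]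
           has_vector_derivative_mult[OF f(2) dE]]]) (simp add: algebra_simps)
    have bnd: "cmod (a x * E x) \<le> C * M / (1 + \<tau>) \<and> cmod (g1 x) \<le> C * M / (1 + \<tau>) \<and> cmod (g2 x) \<le> C * M / (1 + \<tau>)" for x
    proof (cases "x \<in> ?S")
      case True
      then show ?thesis using f1z[OF True] f2z[OF True] sup[of x] C M \<tau> by (auto simp: g1_def g2_def)
    next
      case False
      then have r: "1/16 \<le> x\<^sup>2 + y\<^sup>2" "x\<^sup>2 + y\<^sup>2 \<le> 16" by auto
      have "x\<^sup>2 \<le> 4\<^sup>2" using order_trans[of "x\<^sup>2" "x\<^sup>2 + y\<^sup>2" 16] r(2) by simp
      then have x: "\<bar>x\<bar> \<le> 4" using abs_le_square_iff[of x 4] by simp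
      define X where "X = 2 * cmod c * \<bar>x\<bar>"
      have cc: "cmod c = \<tau> * z" using \<tau> by (simp add: c_def z_def norm_mult)
      have X: "0 \<le> X" "X \<le> 8 * (\<tau> * z)" using x \<tau> z mult_left_mono[OF x, of "2 * (\<tau> * z)"] by (auto simp: X_def cc)
      define e where "e = exp (- (b * \<tau>))"
      have E: "cmod (E x) \<le> e"
      proof -
        have "cmod (E x) = exp (- (\<tau> * Re \<zeta> * (x\<^sup>2 + y\<^sup>2)))" by (simp add: E_def c_def)
        moreover have "\<tau> * Re \<zeta> * (1/16) \<le> \<tau> * Re \<zeta> * (x\<^sup>2 + y\<^sup>2)"
          using \<tau> \<zeta> r by (intro mult_left_mono) auto
        ultimately show ?thesis by (simp add: e_def b_def mult.commute)
      qed
      have e0: "e \<ge> 0" by (simp add: e_def)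
      have n1: "cmod (a x * E x) \<le> M * e" using f(3) E M by (auto simp: norm_mult intro!: mult_mono)
      have xE: "cmod (- 2 * c * of_real x * E x) \<le> X * e"
        using mult_left_mono[OF E X(1)] by (simp add: norm_mult X_def)
      have n2: "cmod (g1 x) \<le> M * (X * e) + M * e"
        unfolding g1_def
        by (rule order_trans[OF norm_triangle_ineq], intro add_mono; subst norm_mult)
           (use f xE E M in \<open>auto intro!: mult_mono\<close>)
      have t1: "cmod ((- 2 * c) * E x + (- 2 * c * of_real x) * (- 2 * c * of_real x * E x)) \<le> 2 * (\<tau> * z) * e + X * (X * e)"
      proof (rule order_trans[OF norm_triangle_ineq], intro add_mono)
        show "cmod ((- 2 * c) * E x) \<le> 2 * (\<tau> * z) * e"
          using mult_left_mono[OF E, of "2 * (\<tau> * z)"] \<tau> z by (simp add: norm_mult cc)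
        have "cmod (- 2 * c * of_real x) = X" by (simp add: norm_mult X_def)
        then show "cmod ((- 2 * c * of_real x) * (- 2 * c * of_real x * E x)) \<le> X * (X * e)"
          using mult_left_mono[OF xE X(1)] by (simp only: norm_mult[of "- 2 * c * of_real x"])
      qed
      have n3: "cmod (g2 x) \<le> M * (2 * (\<tau> * z) * e + X * (X * e)) + M * (X * e) + (M * (X * e) + M * e)"
        unfolding g2_def
        by (rule order_trans[OF norm_triangle_ineq], intro add_mono order_trans[OF norm_triangle_ineq]; subst norm_mult)
           (use f xE E M t1 in \<open>auto intro!: mult_mono\<close>)
      define B where "B = M * e * (1 + 18 * (\<tau> * z) + 64 * (\<tau> * z)\<^sup>2)"
      have XX: "X * X \<le> 64 * (\<tau> * z)\<^sup>2"
        using mult_mono[OF X(2) X(2)] X \<tau> z by (simp add: power2_eq_square)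
      have Me: "M * e \<ge> 0" using M e0 by simp
      have tz: "\<tau> * z \<ge> 0" using \<tau> z by simp
      have "M * e * (2 * (\<tau> * z) + X * X + X + (X + 1)) \<le> B" unfolding B_def
        by (rule mult_left_mono[OF _ Me]) (use XX X in linarith)
      then have B3: "cmod (g2 x) \<le> B" using n3 by (simp add: algebra_simps)
      have "M * e * (X + 1) \<le> B" unfolding B_def
        by (rule mult_left_mono[OF _ Me]) (use X tz zero_le_power2[of "\<tau> * z"] in linarith)
      then have B2: "cmod (g1 x) \<le> B" using n2 by (simp add: algebra_simps)
      have "M * e * 1 \<le> B" unfolding B_def
        by (rule mult_left_mono[OF _ Me]) (use X tz zero_le_power2[of "\<tau> * z"] in linarith)
      then have B1: "cmod (a x * E x) \<le> B" using n1 by simp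
      have "1 + 18 * (\<tau> * z) + 64 * (\<tau> * z)\<^sup>2 \<le> (1 + 18 * z + 64 * z\<^sup>2) * (1 + \<tau>)\<^sup>2"
      proof -
        have "\<tau> \<le> (1 + \<tau>)\<^sup>2" "\<tau>\<^sup>2 \<le> (1 + \<tau>)\<^sup>2" "1 \<le> (1 + \<tau>)\<^sup>2"
          using \<tau> by (auto simp: power2_eq_square algebra_simps)
        then have "18 * z * \<tau> \<le> 18 * z * (1 + \<tau>)\<^sup>2" "64 * z\<^sup>2 * \<tau>\<^sup>2 \<le> 64 * z\<^sup>2 * (1 + \<tau>)\<^sup>2" "1 \<le> (1 + \<tau>)\<^sup>2"
          using z by (auto intro!: mult_left_mono)
        then have "1 + 18 * z * \<tau> + 64 * z\<^sup>2 * \<tau>\<^sup>2 \<le> (1 + \<tau>)\<^sup>2 + 18 * z * (1 + \<tau>)\<^sup>2 + 64 * z\<^sup>2 * (1 + \<tau>)\<^sup>2" by linarith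
        then show ?thesis by (simp add: algebra_simps power_mult_distrib)
      qed
      then have "B * (1 + \<tau>) \<le> M * e * ((1 + 18 * z + 64 * z\<^sup>2) * (1 + \<tau>)\<^sup>2) * (1 + \<tau>)"
        unfolding B_def using Me \<tau> by (intro mult_right_mono mult_left_mono) auto
      also have "\<dots> = M * (1 + 18 * z + 64 * z\<^sup>2) * ((1 + \<tau>) ^ 3 * e)" by (simp add: power2_eq_square power3_eq_cube algebra_simps)
      also have "\<dots> \<le> M * (1 + 18 * z + 64 * z\<^sup>2) * (27 * exp b / b ^ 3)"
        unfolding e_def using M z by (intro mult_left_mono exp_poly_decay b \<tau>) (auto intro!: mult_nonneg_nonneg add_nonneg_nonneg)
      also have "\<dots> = C * M" by (simp add: C_def)
      finally have "B \<le> C * M / (1 + \<tau>)" using \<tau> by (simp add: field_simps)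
      then show ?thesis using B1 B2 B3 by linarith
    qed
    have "C2b (C * M / (1 + \<tau>)) (\<lambda>x. a x * E x)"
      unfolding C2b_def using D1 D2 bnd by blast
    then show ?thesis by (simp add: E_def[abs_def] c_def)
  qed
  then show ?thesis using C by (intro exI[of _ C]) blast
qed

text \<open>A fattened annular cutoff equal to 1 where a rescaled block symbol lives. Inserting it
  does not change a block but turns the heat multiplier into a compactly supported profile that
  vanishes near frequency 0.\<close>

definition lp_chi :: "real \<times> real \<Rightarrow> real" where
  "lp_chi \<xi> = lp_theta ((1/2) *\<^sub>R \<xi>) - lp_theta (4 *\<^sub>R \<xi>)"

lemma lp_chi_supp: "norm \<xi> \<le> 1/4 \<or> norm \<xi> \<ge> 4 \<Longrightarrow> lp_chi \<xi> = 0"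
  by (auto simp: lp_chi_def theta_range)

lemma lp_chi_one: "1/2 \<le> norm \<xi> \<Longrightarrow> norm \<xi> \<le> 2 \<Longrightarrow> lp_chi \<xi> = 1"
  by (auto simp: lp_chi_def theta_range)

lemma profI:
  assumes "\<And>x y. s (x, y) = s (y, x)" "\<And>\<xi>. norm \<xi> > 4 \<Longrightarrow> s \<xi> = 0" "\<And>y. C2b A (\<lambda>x. s (x, y))"
  shows "profile A s"
proof -
  have b: "cmod (s (x, y)) \<le> A" for x y using assms(3)[of y] unfolding C2b_def by blast
  then have "A \<ge> 0" using norm_ge_zero order_trans by blast
  moreover have "cmod (s (x + h, y) - 2 * s (x, y) + s (x - h, y)) \<le> A * h\<^sup>2" for x y h
    using C2b_second_difference[OF assms(3)[of y]] .
  moreover have "cmod (s (x, y + h) - 2 * s (x, y) + s (x, y - h)) \<le> A * h\<^sup>2" for x y h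
    using C2b_second_difference[OF assms(3)[of x], of y h] by (simp add: assms(1)[of x])
  moreover have "cmod (s \<xi>) \<le> A" for \<xi> using b by (cases \<xi>) auto
  ultimately show ?thesis unfolding profile_def using assms(2) by (metis not_le)
qed

lemma theta_sym: "lp_theta (x, y) = lp_theta (y, x)"
  by (simp add: theta_eq add.commute)

lemma prof_theta: "\<exists>A\<ge>1. profile A (\<lambda>\<xi>. complex_of_real (lp_theta \<xi>))"
proof -
  obtain M where M: "M \<ge> 1" "\<And>y. C2b M (\<lambda>x. complex_of_real (lp_theta (x, y)))" using C2b_theta by blast
  have "profile M (\<lambda>\<xi>. complex_of_real (lp_theta \<xi>))"
    by (rule profI) (use M theta_sym theta_range(4) in auto)
  then show ?thesis using M by blast
qed

definition heat_profile :: "complex \<Rightarrow> real \<Rightarrow> real \<times> real \<Rightarrow> complex" where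
  "heat_profile \<zeta> \<tau> \<xi> = complex_of_real (lp_chi \<xi>) * exp (- (complex_of_real \<tau> * \<zeta> * complex_of_real ((fst \<xi>)\<^sup>2 + (snd \<xi>)\<^sup>2)))"

lemma prof_heat:
  assumes "Re \<zeta> > 0"
  shows "\<exists>C\<ge>0. \<forall>\<tau>\<ge>0. profile (C / (1 + \<tau>)) (heat_profile \<zeta> \<tau>)"
proof -
  obtain M where M: "M \<ge> 1" "\<And>y. C2b M (\<lambda>x. complex_of_real (lp_theta (x, y)))" using C2b_theta by blast
  obtain C where C: "C \<ge> 0" "\<And>M a y \<tau>. C2b M a \<Longrightarrow> (\<And>x. x\<^sup>2 + y\<^sup>2 < 1/16 \<or> x\<^sup>2 + y\<^sup>2 > 16 \<Longrightarrow> a x = 0) \<Longrightarrow> \<tau> \<ge> 0 \<Longrightarrow>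
    C2b (C * M / (1 + \<tau>)) (\<lambda>x. a x * exp (- (complex_of_real \<tau> * \<zeta> * complex_of_real (x\<^sup>2 + y\<^sup>2))))"
    using C2b_gauss[OF assms] by blast
  have chi: "C2b (32 * M) (\<lambda>x. complex_of_real (lp_chi (x, y)))" for y
    using C2b_diff[OF C2b_dil[OF M(2), of "1/2" "y/2"] C2b_dil[OF M(2), of 4 "4*y"]]
    by (simp add: lp_chi_def)
  have supp: "complex_of_real (lp_chi (x, y)) = 0" if "x\<^sup>2 + y\<^sup>2 < 1/16 \<or> x\<^sup>2 + y\<^sup>2 > 16" for x y
  proof -
    have "sqrt (x\<^sup>2 + y\<^sup>2) \<le> sqrt ((1/4)\<^sup>2) \<or> sqrt (x\<^sup>2 + y\<^sup>2) \<ge> sqrt (4\<^sup>2)"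
      using that unfolding real_sqrt_le_iff by (auto simp: power2_eq_square)
    then show ?thesis using lp_chi_supp[of "(x,y)"] by (simp add: norm_prod_def)
  qed
  have "profile ((C * (32 * M)) / (1 + \<tau>)) (heat_profile \<zeta> \<tau>)" if "\<tau> \<ge> 0" for \<tau>
  proof (rule profI)
    show "heat_profile \<zeta> \<tau> (x, y) = heat_profile \<zeta> \<tau> (y, x)" for x y
      using theta_sym by (simp add: heat_profile_def lp_chi_def add.commute)
    show "heat_profile \<zeta> \<tau> \<xi> = 0" if "norm \<xi> > 4" for \<xi> using that by (simp add: heat_profile_def lp_chi_supp)
    show "C2b (C * (32 * M) / (1 + \<tau>)) (\<lambda>x. heat_profile \<zeta> \<tau> (x, y))" for y
      unfolding heat_profile_def fst_conv snd_conv by (rule C(2)[OF chi supp that])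
  qed
  then show ?thesis using C(1) M(1) by (intro exI[of _ "C * (32 * M)"]) auto
qed

text \<open>Frequencies and points of the torus are pairs; quantifiers over them are to stay
  quantifiers over one variable.\<close>

declare split_paired_All [simp del] split_paired_Ex [simp del]

subsection \<open>Littlewood--Paley blocks\<close>

definition sg :: "nat \<Rightarrow> distr" where "sg n k = complex_of_real (lp_symbol n (kvec k))"
definition th :: "nat \<Rightarrow> distr" where "th j = dilate (2 ^ j) (\<lambda>\<xi>. complex_of_real (lp_theta \<xi>))"
definition D :: "nat \<Rightarrow> distr \<Rightarrow> distr" where "D n f = mul (sg n) f"
definition nk :: "int \<times> int \<Rightarrow> real" where "nk k = norm (kvec k)"

lemma sg_th: "sg 0 = th 0" "sg (Suc n) k = th (Suc n) k - th n k"
  by (auto simp: sg_def th_def dilate_def lp_symbol_def lp_rho_def fun_eq_iff)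

lemma sum_sg: "(\<Sum>n<Suc N. sg n k) = th N k"
  by (induction N) (auto simp: sg_th)

lemma th_one: "nk k \<le> 2 ^ j \<Longrightarrow> th j k = 1"
  by (simp add: th_def dilate_def nk_def theta_range field_simps)

lemma th_zero: "nk k \<ge> 2 ^ Suc j \<Longrightarrow> th j k = 0"
  by (simp add: th_def dilate_def nk_def theta_range field_simps)

lemma sg_supp: assumes "sg n k \<noteq> 0" shows "nk k < 2 ^ Suc n" "n \<ge> 1 \<Longrightarrow> 2 ^ (n - 1) < nk k"
proof -
  show "nk k < 2 ^ Suc n"
  proof (rule ccontr)
    assume "\<not> nk k < 2 ^ Suc n"
    then have ge: "nk k \<ge> 2 ^ Suc n" by simp
    have "sg n k = 0"
    proof (cases n)
      case (Suc m)
      have "(2::real) ^ Suc m \<le> 2 ^ Suc n" using Suc by (intro power_increasing) auto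
      then have "nk k \<ge> 2 ^ Suc m" using ge by linarith
      then show ?thesis using ge Suc by (simp add: sg_th th_zero)
    qed (use ge in \<open>simp add: sg_th th_zero\<close>)
    then show False using assms by simp
  qed
  show "2 ^ (n - 1) < nk k" if n1: "n \<ge> 1"
  proof (rule ccontr)
    assume le: "\<not> 2 ^ (n - 1) < nk k"
    obtain m where n: "n = Suc m" using n1 not0_implies_Suc[of n] by auto
    have "(2::real) ^ m \<le> 2 ^ Suc m" by simp
    moreover have "nk k \<le> 2 ^ m" using le n by simp
    ultimately have "nk k \<le> 2 ^ m" "nk k \<le> 2 ^ Suc m" by linarith+
    then have "sg n k = 0" using n by (simp add: sg_th th_one)
    then show False using assms by simp
  qed
qed

lemma nk_coord: "\<bar>real_of_int (fst k)\<bar> \<le> nk k" "\<bar>real_of_int (snd k)\<bar> \<le> nk k"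
  using norm_fst_le[of "real_of_int (fst k)" "real_of_int (snd k)"]
    norm_snd_le[of "real_of_int (snd k)" "real_of_int (fst k)"] by (auto simp: nk_def kvec_def)

lemma in_lp_box: assumes "nk k \<le> 2 ^ (N + 2)" shows "k \<in> lp_box N"
proof -
  have "real_of_int \<bar>fst k\<bar> \<le> real_of_int (2 ^ (N + 2))" "real_of_int \<bar>snd k\<bar> \<le> real_of_int (2 ^ (N + 2))"
    using nk_coord[of k] assms by auto
  then have "\<bar>fst k\<bar> \<le> 2 ^ (N + 2)" "\<bar>snd k\<bar> \<le> 2 ^ (N + 2)" by (auto simp only: of_int_le_iff)
  then show ?thesis unfolding lp_box_def by (cases k) auto
qed

lemma finite_lp_box [simp]: "finite (lp_box N)" by (simp add: lp_box_def)

lemma sg_box: "k \<notin> lp_box n \<Longrightarrow> sg n k = 0"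
proof (rule ccontr)
  assume k: "k \<notin> lp_box n" "sg n k \<noteq> 0"
  have "(2::real) ^ Suc n \<le> 2 ^ (n + 2)" by simp
  then have "nk k \<le> 2 ^ (n + 2)" using sg_supp(1)[OF k(2)] by linarith
  then show False using k in_lp_box by blast
qed

lemma fsupp_sg: "fsupp (sg n)" by (rule fsuppI[of "lp_box n"]) (use sg_box in auto)
lemma fsupp_D [simp]: "fsupp (D n f)" unfolding D_def by (rule fsupp_mul(2)[OF fsupp_sg])

lemma lp_block_eq: "lp_block n f x = tev (D n f) x"
proof -
  have "tev (D n f) x = (\<Sum>k\<in>lp_box n. D n f k * ee k x)"
    by (rule tev_on) (simp_all add: D_def mul_def sg_box)
  then show ?thesis by (simp add: lp_block_def D_def mul_def sg_def ee_def)
qed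

text \<open>The blocks telescope: the first N + 1 of them add up to the low-pass symbol at scale
  2^N, whence the recurring shift by one.\<close>

lemma lp_partial_eq: "lp_partial (Suc N) f = mul (th N) f" "lp_partial 0 f = (\<lambda>k. 0)"
proof -
  have "complex_of_real (\<Sum>n<Suc N. lp_symbol n (kvec k)) = th N k" for k
    using sum_sg[of k N] by (simp only: sg_def of_real_sum)
  then show "lp_partial (Suc N) f = mul (th N) f" by (simp only: lp_partial_def mul_def)
qed (simp add: lp_partial_def)

lemma fsupp_th: "fsupp (th N)"
proof -
  have "th N = (\<lambda>k. \<Sum>n<Suc N. sg n k)" by (simp only: sum_sg)
  moreover have "fsupp (\<lambda>k. \<Sum>n<Suc N. sg n k)" by (intro fsupp_sum fsupp_sg) auto
  ultimately show ?thesis by simp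
qed

lemma fsupp_partial [simp]: "fsupp (lp_partial N f)"
  by (cases N) (auto simp: lp_partial_eq fsupp_mul(2)[OF fsupp_th] fsupp_lin)

lemma D_mul: "D n (mul m f) = mul m (D n f)" by (auto simp: D_def mul_def mult.left_commute)
lemma D_lin: "D n (\<lambda>k. f k + g k) = (\<lambda>k. D n f k + D n g k)" "D n (\<lambda>k. f k - g k) = (\<lambda>k. D n f k - D n g k)"
  "D n (\<lambda>k. c * f k) = (\<lambda>k. c * D n f k)" "D n (\<lambda>k. 0) = (\<lambda>k. 0)"
  by (auto simp: D_def mul_def algebra_simps)
lemma D_sum: "D n (\<lambda>k. \<Sum>i\<in>I. f i k) = (\<lambda>k. \<Sum>i\<in>I. D n (f i) k)"
  by (auto simp: D_def mul_def sum_distrib_left)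

text \<open>All \<open>th j\<close> dilate a single profile, so their kernels share one L^1 bound.
  The same constant then serves blocks, partial sums and tails.\<close>

lemma th_mul_le: "\<exists>C\<ge>1. \<forall>j f B x. fsupp f \<longrightarrow> (\<forall>x. cmod (tev f x) \<le> B) \<longrightarrow> cmod (tev (mul (th j) f) x) \<le> C * B"
proof -
  obtain A where A: "A \<ge> 1" "profile A (\<lambda>\<xi>. complex_of_real (lp_theta \<xi>))" using prof_theta by blast
  show ?thesis
    by (rule exI[of _ "560 * A"]) (use A prof_mul_le[OF A(2)] in \<open>auto simp: th_def\<close>)
qed

lemma sg_mul_le: "\<exists>C\<ge>1. \<forall>n f B x. fsupp f \<longrightarrow> (\<forall>x. cmod (tev f x) \<le> B) \<longrightarrow> cmod (tev (D n f) x) \<le> C * B"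
proof -
  obtain C where C: "C \<ge> 1" "\<And>j f B x. fsupp f \<Longrightarrow> (\<forall>x. cmod (tev f x) \<le> B) \<Longrightarrow> cmod (tev (mul (th j) f) x) \<le> C * B"
    using th_mul_le by blast
  have "cmod (tev (D n f) x) \<le> 2 * C * B" if f: "fsupp f" "\<forall>x. cmod (tev f x) \<le> B" for n f B x
  proof (cases n)
    case 0
    from 0 have "cmod (tev (D n f) x) \<le> C * B" using C(2)[OF f] by (simp add: D_def sg_th)
    then show ?thesis using order_trans[OF norm_ge_zero, of "tev (D n f) x" "C * B"] by linarith
  next
    case (Suc m)
    have "D n f = (\<lambda>k. mul (th (Suc m)) f k - mul (th m) f k)"
      unfolding Suc by (auto simp: D_def mul_def sg_th algebra_simps)
    then have "tev (D n f) x = tev (mul (th (Suc m)) f) x - tev (mul (th m) f) x"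
      using f by (simp add: tev_diff fsupp_mul)
    then show ?thesis using C(2)[OF f, of "Suc m" x] C(2)[OF f, of m x] norm_triangle_ineq4 [of "tev (mul (th (Suc m)) f) x" "tev (mul (th m) f) x"]
      by simp
  qed
  then show ?thesis using C(1) by (intro exI[of _ "2 * C"]) auto
qed

text \<open>The norm of \<open>f\<close> in \<open>C^a\<close> is at most \<open>2 powr (-a) * B\<close>, because block \<open>n\<close> has Littlewood--Paley index \<open>n - 1\<close>.\<close>

definition bb :: "real \<Rightarrow> real \<Rightarrow> distr \<Rightarrow> bool" where
  "bb a B f \<longleftrightarrow> (\<forall>n x. cmod (tev (D n f) x) \<le> B * 2 powr (- a * real n))"

lemma bbD: "bb a B f \<Longrightarrow> cmod (tev (D n f) x) \<le> B * 2 powr (- a * real n)" by (simp add: bb_def)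

lemma bb_nonneg: "bb a B f \<Longrightarrow> 0 \<le> B"
  using bbD[of a B f 0 0] order_trans[OF norm_ge_zero] by fastforce

lemma bb_mono: "bb a B f \<Longrightarrow> B \<le> B' \<Longrightarrow> bb a B' f"
  unfolding bb_def by (meson mult_right_mono order_trans powr_ge_zero)

lemma bb_weaken: "bb a B f \<Longrightarrow> a' \<le> a \<Longrightarrow> bb a' B f"
proof -
  assume f: "bb a B f" "a' \<le> a"
  have "B * 2 powr (- a * real n) \<le> B * 2 powr (- a' * real n)" for n
    using f bb_nonneg[OF f(1)] by (intro mult_left_mono powr_mono) (auto simp: mult_right_mono)
  then show ?thesis using f unfolding bb_def by (meson order_trans)
qed

lemma bb_add: "bb a B f \<Longrightarrow> bb a B' g \<Longrightarrow> bb a (B + B') (\<lambda>k. f k + g k)"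
  unfolding bb_def by (auto simp: D_lin tev_add distrib_right intro!: order_trans[OF norm_triangle_ineq] add_mono)
lemma bb_diff: "bb a B f \<Longrightarrow> bb a B' g \<Longrightarrow> bb a (B + B') (\<lambda>k. f k - g k)"
  unfolding bb_def by (auto simp: D_lin tev_diff distrib_right intro!: order_trans[OF norm_triangle_ineq4] add_mono)
lemma bb_cmult: "bb a B f \<Longrightarrow> bb a (cmod c * B) (\<lambda>k. c * f k)"
  unfolding bb_def by (auto simp: D_lin tev_cmult norm_mult mult.assoc intro!: mult_left_mono)
lemma bb_zero: "0 \<le> B \<Longrightarrow> bb a B (\<lambda>k. 0)" by (simp add: bb_def D_lin)
lemma bb_sum: "finite I \<Longrightarrow> (\<And>i. i \<in> I \<Longrightarrow> bb a (B i) (f i)) \<Longrightarrow> bb a (\<Sum>i\<in>I. B i) (\<lambda>k. \<Sum>i\<in>I. f i k)"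
  by (induction rule: finite_induct) (auto intro: bb_add bb_zero)

lemma nk_bounded: "\<exists>M. \<forall>N\<ge>M. nk k \<le> 2 ^ N"
proof -
  obtain M where M: "nk k < 2 ^ M" using real_arch_pow[of 2 "nk k"] by auto
  have "nk k \<le> 2 ^ N" if "N \<ge> M" for N
  proof -
    have "(2::real) ^ M \<le> 2 ^ N" by (rule power_increasing[OF that]) simp
    then show ?thesis using M by linarith
  qed
  then show ?thesis by blast
qed

lemma D_reconstruct: assumes "nk k \<le> 2 ^ N" shows "f k = (\<Sum>n<Suc N. D n f k)"
  using sum_sg[of k N] th_one[OF assms] by (simp add: D_def mul_def flip: sum_distrib_right distrib_right)

text \<open>The constant depends on the frequency but not on the distribution. This is the bridge
  from block bounds to convergence and continuity of single coefficients.\<close>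

lemma bb_coeff: "\<exists>c\<ge>0. \<forall>f B. bb a B f \<longrightarrow> cmod (f k) \<le> c * B"
proof -
  obtain N where N: "nk k \<le> 2 ^ N" using nk_bounded by blast
  have "cmod (f k) \<le> (\<Sum>n<Suc N. 2 powr (- a * real n)) * B" if "bb a B f" for f B
  proof -
    have "cmod (D n f k) \<le> B * 2 powr (- a * real n)" for n
      by (rule coeff_le) (use that in \<open>auto simp: bb_def\<close>)
    then show ?thesis unfolding D_reconstruct[OF N, of f] sum_distrib_right
      by (intro sum_norm_le) (auto simp: mult.commute)
  qed
  moreover have "0 \<le> (\<Sum>n<Suc N. 2 powr (- a * real n))" by (intro sum_nonneg) simp
  ultimately show ?thesis by blast
qed

lemma bb_eq: assumes "\<And>\<epsilon>. \<epsilon> > 0 \<Longrightarrow> bb a \<epsilon> (\<lambda>k. f k - g k)" shows "f = g"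
proof
  fix k
  obtain c where c: "c \<ge> 0" "\<And>f B. bb a B f \<Longrightarrow> cmod (f k) \<le> c * B" using bb_coeff[of a k] by blast
  have "cmod (f k - g k) \<le> e" if "e > 0" for e
  proof -
    have "cmod (f k - g k) \<le> c * (e / (c + 1))" using c that by (intro c(2) assms) auto
    also have "\<dots> \<le> e" using c(1) that by (simp add: field_simps)
    finally show ?thesis .
  qed
  then have "cmod (f k - g k) \<le> 0" by (rule field_le_epsilon) simp
  then show "f k = g k" by simp
qed

text \<open>A Fatou property: a block involves only finitely many coefficients. It replaces
  completeness of the function space throughout.\<close>

lemma bb_limit:
  assumes "\<And>N. bb a B (F N)" "\<And>k. (\<lambda>N. F N k) \<longlonglongrightarrow> f k"
  shows "bb a B f"
  unfolding bb_def
proof (intro allI)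
  fix n x
  have t: "tev (D n h) x = (\<Sum>k\<in>lp_box n. sg n k * h k * ee k x)" for h
    by (subst tev_on[of "lp_box n"]) (auto simp: D_def mul_def sg_box)
  have "(\<lambda>N. tev (D n (F N)) x) \<longlonglongrightarrow> tev (D n f) x"
    unfolding t by (intro tendsto_intros assms(2))
  then have "(\<lambda>N. cmod (tev (D n (F N)) x)) \<longlonglongrightarrow> cmod (tev (D n f) x)" by (rule tendsto_norm)
  then show "cmod (tev (D n f) x) \<le> B * 2 powr (- a * real n)"
    by (rule LIMSEQ_le_const2) (use bbD[OF assms(1)] in blast)
qed

lemma bb_partial: "\<exists>C\<ge>1. \<forall>a B f N. bb a B f \<longrightarrow> bb a (C * B) (lp_partial N f)"
proof -
  obtain C where C: "C \<ge> 1" "\<And>j f B x. fsupp f \<Longrightarrow> (\<forall>x. cmod (tev f x) \<le> B) \<Longrightarrow> cmod (tev (mul (th j) f) x) \<le> C * B"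
    using th_mul_le by blast
  have "bb a (C * B) (lp_partial N f)" if f: "bb a B f" for a B f N
  proof (cases N)
    case 0
    then show ?thesis using bb_nonneg[OF f] C by (auto simp: lp_partial_eq intro!: bb_zero)
  next
    case (Suc M)
    have "cmod (tev (mul (th M) (D n f)) x) \<le> C * (B * 2 powr (- a * real n))" for n x
      by (rule C(2)) (use f in \<open>auto simp: bb_def\<close>)
    then show ?thesis unfolding Suc bb_def lp_partial_eq D_mul by (simp add: mult.assoc)
  qed
  then show ?thesis using C(1) by blast
qed

text \<open>Block n lives below 2^(n+1), while the partial sum of N blocks is the identity up to
  2^(N-1).\<close>

lemma D_partial_eq: assumes "n + 2 \<le> N" shows "D n (lp_partial N f) = D n f"
proof -
  obtain M where N: "N = Suc M" using assms by (cases N) auto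
  show ?thesis
  proof
    fix k
    show "D n (lp_partial N f) k = D n f k"
    proof (cases "sg n k = 0")
      case False
      have "(2::real) ^ Suc n \<le> 2 ^ M" using assms N by (intro power_increasing) auto
      then have "th M k = 1" using sg_supp(1)[OF False] by (intro th_one) linarith
      then show ?thesis by (simp add: N lp_partial_eq D_def mul_def)
    qed (simp add: D_def mul_def)
  qed
qed

text \<open>Only blocks with n \<ge> N - 1 survive in the tail, and on them the surplus regularity a
  - a' becomes decay in N. The factor 2 powr (a - a') pays for the -1.\<close>

lemma bb_tail: "\<exists>C\<ge>1. \<forall>a a' B f N. bb a B f \<longrightarrow> a' \<le> a \<longrightarrow>
    bb a' (C * 2 powr (a - a') * B * 2 powr (- (a - a') * real N)) (\<lambda>k. f k - lp_partial N f k)"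
proof -
  obtain C where C: "C \<ge> 1" "\<And>a B f N. bb a B f \<Longrightarrow> bb a (C * B) (lp_partial N f)" using bb_partial by blast
  have "bb a' ((1 + C) * 2 powr (a - a') * B * 2 powr (- (a - a') * real N)) (\<lambda>k. f k - lp_partial N f k)"
    if f: "bb a B f" "a' \<le> a" for a a' B f N
    unfolding bb_def
  proof (intro allI)
    fix n x
    have B: "B \<ge> 0" using bb_nonneg f by blast
    show "cmod (tev (D n (\<lambda>k. f k - lp_partial N f k)) x)
       \<le> (1 + C) * 2 powr (a - a') * B * 2 powr (- (a - a') * real N) * 2 powr (- a' * real n)"
    proof (cases "n + 2 \<le> N")
      case True
      then show ?thesis using C(1) B by (simp add: D_lin D_partial_eq)
    next
      case False
      have "bb a (B + C * B) (\<lambda>k. f k - lp_partial N f k)" by (intro bb_diff f C(2))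
      then have "cmod (tev (D n (\<lambda>k. f k - lp_partial N f k)) x) \<le> (1 + C) * B * 2 powr (- a * real n)"
        using bbD[of a "B + C * B" "\<lambda>k. f k - lp_partial N f k" n x] by (simp add: algebra_simps)
      also have "\<dots> \<le> (1 + C) * B * 2 powr ((a - a') + (- (a - a') * real N) + (- a' * real n))"
      proof (intro mult_left_mono powr_mono)
        have "real N - 1 \<le> real n" using False by auto
        then have "(a - a') * (real N - 1) \<le> (a - a') * real n" using f(2) by (intro mult_left_mono) auto
        then show "- a * real n \<le> (a - a') + (- (a - a') * real N) + (- a' * real n)" by (simp add: algebra_simps)
      qed (use B C in auto)
      finally show ?thesis by (simp only: powr_add mult_ac)
    qed
  qed
  then show ?thesis using C(1) by (intro exI[of _ "1 + C"]) auto
qed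

lemma partial_fsupp: assumes "fsupp f" shows "\<exists>M. \<forall>N\<ge>M. lp_partial N f = f"
proof -
  have fin: "finite {k. f k \<noteq> 0}" using assms by (simp add: fsupp_def)
  obtain M where M: "\<And>k N. N \<ge> M k \<Longrightarrow> nk k \<le> 2 ^ N" using nk_bounded by metis
  define M0 where "M0 = Suc (\<Sum>k | f k \<noteq> 0. M k)"
  have "lp_partial N f = f" if N: "N \<ge> M0" for N
  proof
    fix k
    obtain N' where N': "N = Suc N'" using N M0_def by (cases N) auto
    show "lp_partial N f k = f k"
    proof (cases "f k = 0")
      case False
      have "M k \<le> (\<Sum>k | f k \<noteq> 0. M k)" using fin False by (intro member_le_sum) auto
      then have "nk k \<le> 2 ^ N'" using N N' M0_def by (intro M) auto
      then show ?thesis by (simp add: N' lp_partial_eq mul_def th_one)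
    qed (simp add: N' lp_partial_eq mul_def)
  qed
  then show ?thesis by blast
qed

lemma partial_LIMSEQ: "(\<lambda>N. lp_partial N f k) \<longlonglongrightarrow> f k"
proof -
  obtain M where M: "\<And>N. N \<ge> M \<Longrightarrow> nk k \<le> 2 ^ N" using nk_bounded by blast
  have "\<forall>\<^sub>F N in sequentially. lp_partial N f k = f k"
  proof (rule eventually_sequentiallyI[of "Suc M"])
    fix N assume "Suc M \<le> N"
    then obtain N' where "N = Suc N'" "M \<le> N'" by (cases N) auto
    then show "lp_partial N f k = f k" using M by (simp add: lp_partial_eq mul_def th_one)
  qed
  then show ?thesis by (rule tendsto_eventually)
qed

lemma partial_box: "l \<notin> lp_box N \<Longrightarrow> lp_partial N f l = 0"
proof (cases N)
  case (Suc M)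
  assume l: "l \<notin> lp_box N"
  have "\<not> nk l \<le> 2 ^ (N + 2)" using l in_lp_box by blast
  moreover have "(2::real) ^ Suc M \<le> 2 ^ (N + 2)" using Suc by (intro power_increasing) auto
  ultimately have "th M l = 0" by (intro th_zero) linarith
  then show ?thesis by (simp add: Suc lp_partial_eq mul_def)
qed (simp add: lp_partial_eq)

lemma dmult_conv: "dmult f g k = lim (\<lambda>N. conv (lp_partial N f) (lp_partial N g) k)"
proof -
  have "(\<Sum>l\<in>lp_box N. lp_partial N f l * lp_partial N g (fst k - fst l, snd k - snd l)) = conv (lp_partial N f) (lp_partial N g) k" for N
    by (subst conv_on[of "lp_box N"]) (auto simp: partial_box minus_prod_def)
  then show ?thesis unfolding dmult_def by simp
qed

subsection \<open>Products of distributions\<close>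

text \<open>Exponents for which multiplication maps C^a times C^b into C^b: a + b > 0 makes the
  resonant part converge. The value b = 0 is left out because the sum over the low blocks of the
  second factor would lose a logarithm.\<close>

definition mult_exps :: "real \<Rightarrow> real \<Rightarrow> bool" where "mult_exps a b \<longleftrightarrow> 0 < a \<and> b \<le> a \<and> b \<noteq> 0 \<and> 0 < a + b"

definition nbr :: "nat \<Rightarrow> nat \<Rightarrow> bool" where "nbr i j \<longleftrightarrow> i \<le> j + 2 \<and> j \<le> i + 2"

lemma nbr_card: "(\<Sum>j<N. if nbr i j then 1 else 0) \<le> (5::real)"
proof -
  have "(\<Sum>j<N. if nbr i j then 1 else (0::real)) = real (card {j\<in>{..<N}. nbr i j})"
    by (simp add: sum.If_cases Int_def)
  also have "card {j\<in>{..<N}. nbr i j} \<le> card {i - 2..i + 2}"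
    by (rule card_mono) (auto simp: nbr_def)
  also have "\<dots> \<le> 5" by simp
  finally show ?thesis by simp
qed

lemma nbr_sum:
  fixes h :: "nat \<Rightarrow> real"
  assumes "\<And>i. 0 \<le> h i" "\<And>N. (\<Sum>i<N. h i) \<le> H"
  shows "(\<Sum>i<N. \<Sum>j<N. if nbr (w i) j then h i else 0) \<le> 5 * H"
proof -
  have "(\<Sum>j<N. if nbr (w i) j then h i else 0) \<le> 5 * h i" for i
  proof -
    have "(\<Sum>j<N. if nbr (w i) j then h i else 0) = h i * (\<Sum>j<N. if nbr (w i) j then 1 else 0)"
      by (simp add: sum_distrib_left if_distrib cong: if_cong)
    also have "\<dots> \<le> h i * 5" by (intro mult_left_mono nbr_card assms)
    finally show ?thesis by simp
  qed
  then have "(\<Sum>i<N. \<Sum>j<N. if nbr (w i) j then h i else 0) \<le> (\<Sum>i<N. 5 * h i)" by (intro sum_mono)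
  also have "\<dots> \<le> 5 * H" using assms(2)[of N] by (simp flip: sum_distrib_left)
  finally show ?thesis .
qed

definition geo :: "real \<Rightarrow> real" where "geo e = 1 / (1 - 2 powr (- e))"

lemma geo_pos: "e > 0 \<Longrightarrow> geo e > 0"
  using powr_less_one[of 2 "-e"] by (simp add: geo_def)

lemma geo_sum: assumes "e > 0" shows "(\<Sum>i<N. 2 powr (- e * real i)) \<le> geo e"
proof -
  let ?r = "2 powr (- e)"
  have r: "0 < ?r" "?r < 1" using assms by (auto simp: powr_less_one)
  have "(\<Sum>i<N. 2 powr (- e * real i)) = (\<Sum>i<N. ?r ^ i)"
    by (simp add: powr_realpow[symmetric] powr_powr)
  also have "\<dots> = (1 - ?r ^ N) / (1 - ?r)" using r sum_gp_strict[of ?r N] by (metis less_irrefl)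
  also have "\<dots> \<le> geo e" unfolding geo_def using r by (intro divide_right_mono) (simp_all add: less_imp_le)
  finally show ?thesis .
qed

lemma geo_sum_rev: assumes "e > 0" shows "(\<Sum>j<N. if j \<le> i then 2 powr (- e * (real i - real j)) else 0) \<le> geo e"
proof -
  have "(\<Sum>j<N. if j \<le> i then 2 powr (- e * (real i - real j)) else 0) = (\<Sum>j\<in>{..<N} \<inter> {..i}. 2 powr (- e * (real i - real j)))"
    by (subst sum.inter_restrict) (auto simp: Int_def)
  also have "\<dots> \<le> (\<Sum>j\<in>{..i}. 2 powr (- e * (real i - real j)))" by (intro sum_mono2) auto
  also have "\<dots> = (\<Sum>j\<in>{..<Suc i}. 2 powr (- e * real j))"
    by (rule sum.reindex_bij_witness[of _ "\<lambda>j. i - j" "\<lambda>j. i - j"]) (auto simp: of_nat_diff)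
  also have "\<dots> \<le> geo e" by (rule geo_sum[OF assms])
  finally show ?thesis .
qed

text \<open>The index triples permitted by the triangle inequality between an output frequency and
  the two input frequencies that add up to it; see \<open>block_conv_zero\<close>.\<close>

definition interacts :: "nat \<Rightarrow> nat \<Rightarrow> nat \<Rightarrow> bool" where
  "interacts n i j \<longleftrightarrow> n \<le> max i j + 2 \<and> i \<le> max n j + 2 \<and> j \<le> max n i + 2"

text \<open>The three possible regimes of a frequency interaction: one factor carries the output
  frequency, or the two input frequencies are comparable.\<close>

lemma tri_cases: "interacts n i j \<Longrightarrow> nbr n j \<or> (nbr n i \<and> j \<le> i) \<or> (nbr i j \<and> n \<le> i + 4)"
  by (auto simp: interacts_def nbr_def max_def split: if_splits)

text \<open>In each regime of \<open>tri_cases\<close> one index is tied to another up to a bounded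
  shift, and the remaining one runs through a geometric series. In the first and third regimes its
  exponent is e = min a (a + b).\<close>

lemma tri_sum: assumes "mult_exps a b"
  shows "\<exists>C\<ge>0. \<forall>n N. (\<Sum>i<N. \<Sum>j<N. if interacts n i j then 2 powr (- a * real i) * 2 powr (- b * real j) else 0) \<le> C * 2 powr (- b * real n)"
proof -
  have a: "a > 0" "b \<le> a" "b \<noteq> 0" "a + b > 0" using assms by (auto simp: mult_exps_def)
  define e where "e = min a (a + b)"
  have e: "e > 0" "e \<le> a" "e \<le> a + b" using a by (auto simp: e_def)
  \<comment> \<open>Absorbs the powers of 2 lost when an index is replaced by a neighbouring
    one.\<close>
  define K where "K = 2 powr (4 * \<bar>b\<bar> + 4 * a)"
  have K: "K \<ge> 0" by (simp add: K_def)
  \<comment> \<open>In the second regime j \<le> i. For b > 0 the series over j is dominated by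
    small j; for b < 0 it is dominated by j near i, and 2 powr (-b * i) carries the output
    weight.\<close>
  define h2 :: "nat \<Rightarrow> nat \<Rightarrow> real" where "h2 i j = (if b > 0 then 2 powr (- b * real j) else if j \<le> i then 2 powr (- (-b) * (real i - real j)) else 0)" for i j
  have h2s: "(\<Sum>j<N. h2 i j) \<le> geo \<bar>b\<bar>" for i N
    using a(3) geo_sum[of b N] geo_sum_rev[of "-b" i N] by (cases "b > 0") (auto simp: h2_def)
  have h20: "h2 i j \<ge> 0" for i j by (simp add: h2_def)
  have pb: "\<bar>b * (real p - real q)\<bar> \<le> 2 * \<bar>b\<bar>" "\<bar>a * (real p - real q)\<bar> \<le> 2 * a" if "nbr p q" for p q
  proof -
    have "\<bar>real p - real q\<bar> \<le> 2" using that by (auto simp: nbr_def)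
    then show "\<bar>b * (real p - real q)\<bar> \<le> 2 * \<bar>b\<bar>" "\<bar>a * (real p - real q)\<bar> \<le> 2 * a"
      using a mult_left_mono[of "\<bar>real p - real q\<bar>" 2 "\<bar>b\<bar>"] mult_left_mono[of "\<bar>real p - real q\<bar>" 2 a] by (auto simp: abs_mult)
  qed
  have key: "2 powr (- a * real i) * 2 powr (- b * real j) \<le> K * 2 powr (- b * real n) *
      ((if nbr n j then 2 powr (- e * real i) else 0) + (if nbr n i then h2 i j else 0) + (if nbr i j then 2 powr (- e * real i) else 0))"
    (is "?L \<le> ?M * (?t1 + ?t2 + ?t3)") if t: "interacts n i j" for n i j
  proof -
    have M: "?M \<ge> 0" using K by simp
    have nn: "?t1 \<ge> 0" "?t2 \<ge> 0" "?t3 \<ge> 0" using h20 by auto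
    have ei: "e * real i \<le> a * real i" "e * real i \<le> (a + b) * real i" using e by (auto intro!: mult_right_mono)
    have L: "?L = 2 powr (- a * real i - b * real j)" by (simp flip: powr_add)
    have Mx: "?M * 2 powr x = 2 powr (4 * \<bar>b\<bar> + 4 * a - b * real n + x)" for x by (simp add: K_def flip: powr_add)
    from tri_cases[OF t] consider "nbr n j" | "nbr n i \<and> j \<le> i" | "nbr i j \<and> n \<le> i + 4" by blast
    then have "?L \<le> ?M * ?t1 \<or> ?L \<le> ?M * ?t2 \<or> ?L \<le> ?M * ?t3"
    proof cases
      case 1
      have "?L \<le> ?M * 2 powr (- e * real i)" unfolding L Mx
        using pb(1)[OF 1] ei a by (intro powr_mono) (auto simp: algebra_simps abs_le_iff)
      then show ?thesis using 1 by simp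
    next
      case 2
      have an: "\<bar>a * (real n - real i)\<bar> \<le> 2 * a" "\<bar>b * (real n - real i)\<bar> \<le> 2 * \<bar>b\<bar>" using pb 2 by auto
      have "?L \<le> ?M * h2 i j"
      proof (cases "b > 0")
        case True
        have "b * real n \<le> a * real n" using a by (intro mult_right_mono) auto
        then have "?L \<le> ?M * 2 powr (- b * real j)" unfolding L Mx
          using an a by (intro powr_mono) (auto simp: algebra_simps abs_le_iff)
        then show ?thesis using True by (simp add: h2_def)
      next
        case False
        have "0 \<le> a * real i" "b \<le> 0" using a False by auto
        have x: "b * real n - b * real i \<le> 2 * \<bar>b\<bar>" using an(2) by (simp only: abs_le_iff right_diff_distrib)
        have "- a * real i - b * real j \<le> 4 * \<bar>b\<bar> + 4 * a - b * real n + (b * real i - b * real j)"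
          using x \<open>0 \<le> a * real i\<close> a(1) abs_ge_zero[of b] by linarith
        also have "b * real i - b * real j = - (-b) * (real i - real j)" by (simp add: algebra_simps)
        finally have "?L \<le> ?M * 2 powr (- (-b) * (real i - real j))" unfolding L Mx
          by (intro powr_mono) auto
        then show ?thesis using False 2 by (simp add: h2_def)
      qed
      then show ?thesis using 2 by simp
    next
      case 3
      have bj: "\<bar>b * (real i - real j)\<bar> \<le> 2 * \<bar>b\<bar>" using pb 3 by auto
      have "?L \<le> ?M * 2 powr (- e * real i)"
      proof (cases "b > 0")
        case True
        have "b * real n \<le> b * (real i + 4)" using 3 True by (intro mult_left_mono) auto
        then show ?thesis unfolding L Mx
          using bj ei a True by (intro powr_mono) (auto simp: algebra_simps abs_le_iff)
      next
        case False
        have "b * real n \<le> 0" using False by (simp add: mult_nonpos_nonneg)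
        then show ?thesis unfolding L Mx
          using bj ei a False by (intro powr_mono) (auto simp: algebra_simps abs_le_iff)
      qed
      then show ?thesis using 3 by simp
    qed
    moreover have "?M * ?t1 \<le> ?M * (?t1 + ?t2 + ?t3)" "?M * ?t2 \<le> ?M * (?t1 + ?t2 + ?t3)" "?M * ?t3 \<le> ?M * (?t1 + ?t2 + ?t3)"
      using nn by (intro mult_left_mono[OF _ M]; linarith)+
    ultimately show ?thesis by linarith
  qed
  define G where "G = geo e + geo \<bar>b\<bar> + geo e"
  have "(\<Sum>i<N. \<Sum>j<N. if interacts n i j then 2 powr (- a * real i) * 2 powr (- b * real j) else 0) \<le> (5 * K * G) * 2 powr (- b * real n)" for n N
  proof -
    have "(\<Sum>i<N. \<Sum>j<N. if interacts n i j then 2 powr (- a * real i) * 2 powr (- b * real j) else 0) \<le>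
      (\<Sum>i<N. \<Sum>j<N. K * 2 powr (- b * real n) *
      ((if nbr n j then 2 powr (- e * real i) else 0) + (if nbr n i then h2 i j else 0) + (if nbr i j then 2 powr (- e * real i) else 0)))"
      using key K h20 by (intro sum_mono) auto
    also have "\<dots> = K * 2 powr (- b * real n) * ((\<Sum>i<N. \<Sum>j<N. if nbr n j then 2 powr (- e * real i) else 0) +
        (\<Sum>i<N. \<Sum>j<N. if nbr n i then h2 i j else 0) + (\<Sum>i<N. \<Sum>j<N. if nbr i j then 2 powr (- e * real i) else 0))"
      by (simp only: sum_distrib_left[symmetric] sum.distrib)
    also have "\<dots> \<le> K * 2 powr (- b * real n) * (5 * geo e + 5 * geo \<bar>b\<bar> + 5 * geo e)"
    proof (intro mult_left_mono add_mono)
      show "(\<Sum>i<N. \<Sum>j<N. if nbr n j then 2 powr (- e * real i) else 0) \<le> 5 * geo e"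
        by (rule nbr_sum[OF _ geo_sum[OF e(1)]]) simp
      show "(\<Sum>i<N. \<Sum>j<N. if nbr i j then 2 powr (- e * real i) else 0) \<le> 5 * geo e"
        by (rule nbr_sum[OF _ geo_sum[OF e(1)]]) simp
      have "(\<Sum>i<N. \<Sum>j<N. if nbr n i then h2 i j else 0) = (\<Sum>i<N. (if nbr n i then 1 else 0) * (\<Sum>j<N. h2 i j))"
        by (intro sum.cong) auto
      also have "\<dots> \<le> (\<Sum>i<N. (if nbr n i then 1 else 0) * geo \<bar>b\<bar>)"
        by (intro sum_mono mult_left_mono h2s) auto
      also have "\<dots> = (\<Sum>i<N. if nbr n i then 1 else 0) * geo \<bar>b\<bar>" by (simp add: sum_distrib_right)
      also have "\<dots> \<le> 5 * geo \<bar>b\<bar>"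
        using a(3) by (intro mult_right_mono nbr_card less_imp_le[OF geo_pos]) auto
      finally show "(\<Sum>i<N. \<Sum>j<N. if nbr n i then h2 i j else 0) \<le> 5 * geo \<bar>b\<bar>" .
    qed (use K in auto)
    also have "\<dots> = (5 * K * G) * 2 powr (- b * real n)" by (simp add: G_def algebra_simps)
    finally show ?thesis .
  qed
  moreover have "0 \<le> 5 * K * G" using K geo_pos[OF e(1)] geo_pos[of "\<bar>b\<bar>"] a(3) by (auto simp: G_def intro!: mult_nonneg_nonneg)
  ultimately show ?thesis by blast
qed

lemma nk_tri: "nk (k + l) \<le> nk k + nk l" "nk (- k) = nk k"
proof -
  have "kvec (k + l) = kvec k + kvec l" "kvec (- k) = - kvec k" by (auto simp: kvec_def)
  then show "nk (k + l) \<le> nk k + nk l" "nk (- k) = nk k" by (auto simp: nk_def norm_triangle_ineq)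
qed

lemma block_conv_zero:
  assumes "\<not> interacts n i j" shows "D n (conv (D i f) (D j g)) = (\<lambda>k. 0)"
proof (rule ext, rule ccontr)
  fix k assume "D n (conv (D i f) (D j g)) k \<noteq> 0"
  then have n: "sg n k \<noteq> 0" and "conv (D i f) (D j g) k \<noteq> 0" by (auto simp: D_def mul_def)
  then obtain l where l: "sg i l \<noteq> 0" "sg j (k - l) \<noteq> 0" using conv_nz by (fastforce simp: D_def mul_def)
  \<comment> \<open>Stated for an arbitrary triple, since output and input frequencies enter the
    triangle inequality symmetrically up to sign.\<close>
  have gen: "n \<le> max i j + 2" if "n \<ge> 1 \<Longrightarrow> 2 ^ (n - 1) < p" "q < 2 ^ Suc i" "r < 2 ^ Suc j" "p \<le> q + r" for p q r :: real and n i j :: nat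
  proof (rule ccontr)
    assume c: "\<not> n \<le> max i j + 2"
    have "(2::real) ^ Suc i \<le> 2 ^ (max i j + 1)" "(2::real) ^ Suc j \<le> 2 ^ (max i j + 1)" by (intro power_increasing; simp)+
    then have "p < 2 ^ (max i j + 1) + 2 ^ (max i j + 1)" using that by linarith
    also have "\<dots> = (2::real) ^ (max i j + 2)" by simp
    also have "\<dots> \<le> 2 ^ (n - 1)" using c by (intro power_increasing) auto
    finally show False using that(1) c by simp
  qed
  have "nk k \<le> nk l + nk (k - l)" "nk l \<le> nk k + nk (k - l)" "nk (k - l) \<le> nk k + nk l"
    using nk_tri(1)[of l "k - l"] nk_tri(1)[of k "- (k - l)"] nk_tri(1)[of k "- l"] nk_tri(2)[of "k-l"] nk_tri(2)[of l] by auto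
  then have "interacts n i j" unfolding interacts_def
    using gen[of n "nk k" "nk l" i "nk (k-l)" j] gen[of i "nk l" "nk k" n "nk (k-l)" j] gen[of j "nk (k-l)" "nk k" n "nk l" i]
      sg_supp[OF n] sg_supp[OF l(1)] sg_supp[OF l(2)] by blast
  then show False using assms by blast
qed

lemma fsupp_decomp: assumes "fsupp f" shows "\<exists>M. \<forall>N\<ge>M. f = (\<lambda>k. \<Sum>n<N. D n f k)"
proof -
  obtain M where M: "\<And>N. N \<ge> M \<Longrightarrow> lp_partial N f = f" using partial_fsupp[OF assms] by blast
  have "lp_partial N f = (\<lambda>k. \<Sum>n<N. D n f k)" for N
    by (auto simp: lp_partial_def D_def mul_def sg_def sum_distrib_right)
  then show ?thesis using M by metis
qed

lemma conv_bb: assumes "mult_exps a b"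
  shows "\<exists>C\<ge>0. \<forall>f g B B'. fsupp f \<longrightarrow> fsupp g \<longrightarrow> bb a B f \<longrightarrow> bb b B' g \<longrightarrow> bb b (C * B * B') (conv f g)"
proof -
  obtain C0 where C0: "C0 \<ge> 0" "\<And>n N. (\<Sum>i<N. \<Sum>j<N. if interacts n i j then 2 powr (- a * real i) * 2 powr (- b * real j) else 0) \<le> C0 * 2 powr (- b * real n)"
    using tri_sum[OF assms] by blast
  obtain C1 where C1: "C1 \<ge> 1" "\<And>n f B x. fsupp f \<Longrightarrow> (\<forall>x. cmod (tev f x) \<le> B) \<Longrightarrow> cmod (tev (D n f) x) \<le> C1 * B"
    using sg_mul_le by blast
  have "bb b (C1 * C0 * B * B') (conv f g)" if fg: "fsupp f" "fsupp g" and f: "bb a B f" and g: "bb b B' g" for f g B B'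
    unfolding bb_def
  proof (intro allI)
    fix n x
    have B: "B \<ge> 0" "B' \<ge> 0" using f g bb_nonneg by auto
    obtain M1 M2 where M: "\<And>N. N \<ge> M1 \<Longrightarrow> f = (\<lambda>k. \<Sum>n<N. D n f k)" "\<And>N. N \<ge> M2 \<Longrightarrow> g = (\<lambda>k. \<Sum>n<N. D n g k)"
      using fsupp_decomp fg by metis
    define N where "N = max M1 M2"
    have tf: "tev f x = (\<Sum>i<N. tev (D i f) x)" for x
      by (subst M(1)[of N]) (auto simp: N_def tev_sum)
    have tg: "tev g x = (\<Sum>i<N. tev (D i g) x)" for x
      by (subst M(2)[of N]) (auto simp: N_def tev_sum)
    let ?c = "\<lambda>i j. conv (D i f) (D j g)"
    have fc: "fsupp (?c i j)" for i j by (simp add: fsupp_conv)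
    have cg: "conv f g = (\<lambda>k. \<Sum>i<N. \<Sum>j<N. ?c i j k)"
      by (rule fsupp_inj) (auto intro!: fsupp_conv fg fsupp_sum simp: tev_conv fg tf tg tev_sum fsupp_sum fc sum_product)
    have "tev (D n (conv f g)) x = (\<Sum>i<N. \<Sum>j<N. tev (D n (?c i j)) x)"
      unfolding cg D_sum by (simp add: tev_sum fsupp_sum)
    also have "cmod \<dots> \<le> (\<Sum>i<N. \<Sum>j<N. C1 * (B * B') * (if interacts n i j then 2 powr (- a * real i) * 2 powr (- b * real j) else 0))"
    proof (intro sum_norm_le)
      fix i j
      show "cmod (tev (D n (?c i j)) x) \<le> C1 * (B * B') * (if interacts n i j then 2 powr (- a * real i) * 2 powr (- b * real j) else 0)"
      proof (cases "interacts n i j")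
        case True
        have "cmod (tev (?c i j) y) \<le> (B * 2 powr (- a * real i)) * (B' * 2 powr (- b * real j))" for y
          unfolding tev_conv[OF fsupp_D fsupp_D] norm_mult
          using bbD[OF f, of i y] bbD[OF g, of j y] B by (intro mult_mono) auto
        then have "cmod (tev (D n (?c i j)) x) \<le> C1 * ((B * 2 powr (- a * real i)) * (B' * 2 powr (- b * real j)))"
          using C1(2)[OF fc] by blast
        then show ?thesis using True by (simp add: mult_ac)
      qed (simp add: block_conv_zero)
    qed
    also have "\<dots> = C1 * (B * B') * (\<Sum>i<N. \<Sum>j<N. if interacts n i j then 2 powr (- a * real i) * 2 powr (- b * real j) else 0)"
      by (simp only: sum_distrib_left)
    also have "\<dots> \<le> C1 * (B * B') * (C0 * 2 powr (- b * real n))"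
      using C1 B by (intro mult_left_mono C0) auto
    finally show "cmod (tev (D n (conv f g)) x) \<le> C1 * C0 * B * B' * 2 powr (- b * real n)" by (simp add: mult_ac)
  qed
  then show ?thesis using C0(1) C1(1) by (intro exI[of _ "C1 * C0"]) auto
qed

text \<open>The condition is open. Giving up a little regularity in both factors turns boundedness
  of the product into a rate of convergence for truncated products.\<close>

lemma gp_shrink: assumes "mult_exps a b" shows "\<exists>\<delta>>0. mult_exps (a - \<delta>) (b - \<delta>)"
proof -
  define \<delta> where "\<delta> = min (a / 2) (min ((a + b) / 4) (\<bar>b\<bar> / 2))"
  have "\<delta> \<le> a / 2" "\<delta> \<le> (a + b) / 4" "\<delta> \<le> \<bar>b\<bar> / 2" unfolding \<delta>_def by linarith+
  moreover have "\<delta> > 0" using assms by (auto simp: \<delta>_def mult_exps_def)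
  ultimately have "\<delta> > 0 \<and> mult_exps (a - \<delta>) (b - \<delta>)" using assms unfolding mult_exps_def by (auto simp: abs_if split: if_splits)
  then show ?thesis by blast
qed

lemma conv_diff_left: assumes "fsupp f" "fsupp f'"
  shows "conv (\<lambda>k. f k - f' k) g k = conv f g k - conv f' g k"
proof -
  let ?S = "{k. f k \<noteq> 0} \<union> {k. f' k \<noteq> 0}"
  have "finite ?S" using assms by (auto simp: fsupp_def)
  then show ?thesis by (subst (1 2 3) conv_on[of ?S]) (auto simp: algebra_simps sum_subtractf)
qed

lemma conv_diff_right: "conv f (\<lambda>k. g k - g' k) k = conv f g k - conv f g' k"
  by (simp add: conv_def algebra_simps sum_subtractf)

lemma conv_partial_box: "conv (lp_partial N f) g k = (\<Sum>l\<in>lp_box N. lp_partial N f l * g (k - l))"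
  by (rule conv_on) (auto simp: partial_box)

lemma partial_lin: "lp_partial N (\<lambda>k. f k - g k) = (\<lambda>k. lp_partial N f k - lp_partial N g k)"
  by (auto simp: lp_partial_def algebra_simps)

lemma conv_cauchy: assumes "mult_exps a b"
  shows "\<exists>\<delta>>0. \<exists>C\<ge>0. \<forall>f g B B' N M. bb a B f \<longrightarrow> bb b B' g \<longrightarrow> N \<le> M \<longrightarrow>
     bb (b - \<delta>) (C * B * B' * 2 powr (- \<delta> * real N))
       (\<lambda>k. conv (lp_partial M f) (lp_partial M g) k - conv (lp_partial N f) (lp_partial N g) k)"
proof -
  obtain \<delta> where \<delta>: "\<delta> > 0" "mult_exps (a - \<delta>) (b - \<delta>)" using gp_shrink[OF assms] by blast
  obtain C where C: "C \<ge> 0" "\<And>f g B B'. fsupp f \<Longrightarrow> fsupp g \<Longrightarrow> bb (a-\<delta>) B f \<Longrightarrow> bb (b-\<delta>) B' g \<Longrightarrow> bb (b-\<delta>) (C * B * B') (conv f g)"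
    using conv_bb[OF \<delta>(2)] by blast
  obtain C1 where C1: "C1 \<ge> 1" "\<And>a B f N. bb a B f \<Longrightarrow> bb a (C1 * B) (lp_partial N f)" using bb_partial by blast
  obtain C2 where C2: "C2 \<ge> 1" "\<And>a a' B f N. bb a B f \<Longrightarrow> a' \<le> a \<Longrightarrow>
    bb a' (C2 * 2 powr (a - a') * B * 2 powr (- (a - a') * real N)) (\<lambda>k. f k - lp_partial N f k)" using bb_tail by blast
  define K where "K = 2 * (C2 * 2 powr \<delta>)"
  have K: "K \<ge> 0" using C2 by (simp add: K_def)
  have tail: "bb (a - \<delta>) (K * B * 2 powr (- \<delta> * real N)) (\<lambda>k. lp_partial M f k - lp_partial N f k)"
    if f: "bb a B f" "N \<le> M" for a B f and N M :: nat
  proof -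
    have B: "B \<ge> 0" using bb_nonneg f by blast
    have "bb (a - \<delta>) (C2 * 2 powr \<delta> * B * 2 powr (- \<delta> * real N)) (\<lambda>k. f k - lp_partial L f k)" if "N \<le> L" for L
    proof (rule bb_mono)
      show "bb (a - \<delta>) (C2 * 2 powr \<delta> * B * 2 powr (- \<delta> * real L)) (\<lambda>k. f k - lp_partial L f k)"
        using C2(2)[OF f(1), of "a - \<delta>" L] \<delta>(1) by simp
      show "C2 * 2 powr \<delta> * B * 2 powr (- \<delta> * real L) \<le> C2 * 2 powr \<delta> * B * 2 powr (- \<delta> * real N)"
      proof (rule mult_left_mono, rule powr_mono)
        show "- \<delta> * real L \<le> - \<delta> * real N" using \<delta>(1) that by (simp add: mult_left_mono)
      qed (use C2(1) B in auto)
    qed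
    from bb_diff[OF this[of N] this[OF f(2)]] show ?thesis by (simp add: K_def algebra_simps)
  qed
  have "bb (b - \<delta>) ((2 * (C * K * C1)) * B * B' * 2 powr (- \<delta> * real N))
       (\<lambda>k. conv (lp_partial M f) (lp_partial M g) k - conv (lp_partial N f) (lp_partial N g) k)"
    if f: "bb a B f" and g: "bb b B' g" and NM: "N \<le> M" for f g B B' and N M :: nat
  proof -
    let ?q = "2 powr (- \<delta> * real N)"
    have 1: "bb (b-\<delta>) (C * (K * B * ?q) * (C1 * B')) (conv (\<lambda>k. lp_partial M f k - lp_partial N f k) (lp_partial M g))"
      by (rule C(2)[OF _ _ tail[OF f NM]]) (use \<delta>(1) in \<open>auto intro!: fsupp_lin bb_weaken[OF C1(2)[OF g]]\<close>)
    have 2: "bb (b-\<delta>) (C * (C1 * B) * (K * B' * ?q)) (conv (lp_partial N f) (\<lambda>k. lp_partial M g k - lp_partial N g k))"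
      by (rule C(2)[OF _ _ _ tail[OF g NM]]) (use \<delta>(1) in \<open>auto intro!: fsupp_lin bb_weaken[OF C1(2)[OF f]]\<close>)
    have "(\<lambda>k. conv (lp_partial M f) (lp_partial M g) k - conv (lp_partial N f) (lp_partial N g) k) =
      (\<lambda>k. conv (\<lambda>k. lp_partial M f k - lp_partial N f k) (lp_partial M g) k + conv (lp_partial N f) (\<lambda>k. lp_partial M g k - lp_partial N g k) k)"
      by (simp add: conv_diff_left conv_diff_right)
    then show ?thesis using bb_add[OF 1 2] by (simp add: algebra_simps)
  qed
  moreover have "0 \<le> 2 * (C * K * C1)" using C(1) K C1(1) by simp
  ultimately show ?thesis using \<delta>(1) by blast
qed

lemma two_powr_tendsto: "\<delta> > 0 \<Longrightarrow> (\<lambda>N. c * 2 powr (- \<delta> * real N)) \<longlonglongrightarrow> 0"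
proof -
  assume d: "\<delta> > 0"
  have "(\<lambda>N. (2 powr (- \<delta>)) ^ N) \<longlonglongrightarrow> 0" using d powr_less_one[of 2 "-\<delta>"] by (intro LIMSEQ_realpow_zero) auto
  then have "(\<lambda>N. c * (2 powr (- \<delta>)) ^ N) \<longlonglongrightarrow> c * 0" by (rule tendsto_mult_left)
  moreover have "(2 powr (- \<delta>)) ^ N = 2 powr (- \<delta> * real N)" for N
    by (simp add: powr_realpow[symmetric] powr_powr)
  ultimately show ?thesis by (simp only: mult_zero_right)
qed

text \<open>Shows that the \<open>lim\<close> in \<open>dmult\<close> is a genuine limit. The rate
  is uniform over balls, which is what continuity in time needs.\<close>

lemma dmult_rate: assumes "mult_exps a b"
  shows "\<exists>\<delta>>0. \<forall>k. \<exists>c\<ge>0. \<forall>f g B B' N. bb a B f \<longrightarrow> bb b B' g \<longrightarrow>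
     cmod (conv (lp_partial N f) (lp_partial N g) k - dmult f g k) \<le> c * B * B' * 2 powr (- \<delta> * real N)"
proof -
  obtain \<delta> C where \<delta>: "\<delta> > 0" "C \<ge> 0" and C: "\<And>f g B B' N M. bb a B f \<Longrightarrow> bb b B' g \<Longrightarrow> N \<le> M \<Longrightarrow>
     bb (b - \<delta>) (C * B * B' * 2 powr (- \<delta> * real N))
       (\<lambda>k. conv (lp_partial M f) (lp_partial M g) k - conv (lp_partial N f) (lp_partial N g) k)"
    using conv_cauchy[OF assms] by blast
  have "\<exists>c\<ge>0. \<forall>f g B B' N. bb a B f \<longrightarrow> bb b B' g \<longrightarrow>
     cmod (conv (lp_partial N f) (lp_partial N g) k - dmult f g k) \<le> c * B * B' * 2 powr (- \<delta> * real N)" for k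
  proof -
    obtain c where c: "c \<ge> 0" "\<And>f B. bb (b - \<delta>) B f \<Longrightarrow> cmod (f k) \<le> c * B" using bb_coeff[of "b - \<delta>" k] by blast
    have "cmod (conv (lp_partial N f) (lp_partial N g) k - dmult f g k) \<le> (c * C) * B * B' * 2 powr (- \<delta> * real N)"
      if f: "bb a B f" and g: "bb b B' g" for f g B B' N
    proof -
      define F where "F N = conv (lp_partial N f) (lp_partial N g) k" for N
      have est: "cmod (F M - F N) \<le> (c * C * B * B') * 2 powr (- \<delta> * real N)" if "N \<le> M" for N M
        using c(2)[OF C[OF f g that]] by (simp add: F_def mult.assoc)
      have "Cauchy F"
      proof (rule metric_CauchyI)
        fix e :: real assume "e > 0"
        then have "\<forall>\<^sub>F N in sequentially. norm ((c * C * B * B') * 2 powr (- \<delta> * real N)) < e / 2"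
          using two_powr_tendsto[OF \<delta>(1), of "c * C * B * B'"] by (intro order_tendstoD(2)[OF tendsto_norm_zero]) auto
        then obtain N0 where N0: "norm ((c * C * B * B') * 2 powr (- \<delta> * real N0)) < e / 2"
          unfolding eventually_sequentially by blast
        have "dist (F m) (F n) < e" if "m \<ge> N0" "n \<ge> N0" for m n
        proof -
          have "dist (F m) (F N0) < e / 2" "dist (F n) (F N0) < e / 2"
            using est[OF that(1)] est[OF that(2)] N0 unfolding dist_norm by (linarith | simp)+
          then show ?thesis using dist_triangle2[of "F m" "F n" "F N0"] by linarith
        qed
        then show "\<exists>M. \<forall>m\<ge>M. \<forall>n\<ge>M. dist (F m) (F n) < e" by blast
      qed
      then have lim: "F \<longlonglongrightarrow> dmult f g k" unfolding dmult_conv F_def[symmetric]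
        using Cauchy_convergent_iff convergent_LIMSEQ_iff by blast
      have "cmod (F N - dmult f g k) \<le> (c * C * B * B') * 2 powr (- \<delta> * real N)"
      proof (rule LIMSEQ_le_const2)
        show "(\<lambda>M. cmod (F N - F M)) \<longlonglongrightarrow> cmod (F N - dmult f g k)" by (intro tendsto_intros lim)
        show "\<exists>M0. \<forall>M\<ge>M0. cmod (F N - F M) \<le> (c * C * B * B') * 2 powr (- \<delta> * real N)"
          using est by (metis norm_minus_commute)
      qed
      then show ?thesis by (simp add: F_def)
    qed
    then show ?thesis using c(1) \<delta>(2) by (intro exI[of _ "c * C"]) auto
  qed
  then show ?thesis using \<delta>(1) by blast
qed

lemma dmult_LIMSEQ: assumes "mult_exps a b" "bb a B f" "bb b B' g"
  shows "(\<lambda>N. conv (lp_partial N f) (lp_partial N g) k) \<longlonglongrightarrow> dmult f g k"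
proof -
  obtain \<delta> c where \<delta>: "\<delta> > 0" and c: "\<And>f g B B' N. bb a B f \<Longrightarrow> bb b B' g \<Longrightarrow>
     cmod (conv (lp_partial N f) (lp_partial N g) k - dmult f g k) \<le> c * B * B' * 2 powr (- \<delta> * real N)"
    using dmult_rate[OF assms(1)] by blast
  have "(\<lambda>N. conv (lp_partial N f) (lp_partial N g) k - dmult f g k) \<longlonglongrightarrow> 0"
    by (rule Lim_null_comparison[OF always_eventually two_powr_tendsto[OF \<delta>, of "c * B * B'"]])
       (use c[OF assms(2,3)] in auto)
  then show ?thesis by (simp add: LIM_zero_iff)
qed

lemma dmult_bb: assumes "mult_exps a b"
  shows "\<exists>C\<ge>1. \<forall>f g B B'. bb a B f \<longrightarrow> bb b B' g \<longrightarrow> bb b (C * B * B') (dmult f g)"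
proof -
  obtain C where C: "C \<ge> 0" "\<And>f g B B'. fsupp f \<Longrightarrow> fsupp g \<Longrightarrow> bb a B f \<Longrightarrow> bb b B' g \<Longrightarrow> bb b (C * B * B') (conv f g)"
    using conv_bb[OF assms] by blast
  obtain C1 where C1: "C1 \<ge> 1" "\<And>a B f N. bb a B f \<Longrightarrow> bb a (C1 * B) (lp_partial N f)" using bb_partial by blast
  have "bb b ((C * C1 * C1 + 1) * B * B') (dmult f g)" if f: "bb a B f" and g: "bb b B' g" for f g B B'
  proof (rule bb_limit[OF _ dmult_LIMSEQ[OF assms f g]])
    fix N
    have BB: "0 \<le> B * B'" using f g bb_nonneg by (intro mult_nonneg_nonneg) auto
    have "bb b (C * (C1 * B) * (C1 * B')) (conv (lp_partial N f) (lp_partial N g))"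
      by (intro C(2) C1(2) f g) auto
    then show "bb b ((C * C1 * C1 + 1) * B * B') (conv (lp_partial N f) (lp_partial N g))"
      by (rule bb_mono) (use BB in \<open>simp add: algebra_simps\<close>)
  qed
  then show ?thesis using C(1) C1(1) by (intro exI[of _ "C * C1 * C1 + 1"]) auto
qed

lemma dmult_diff: assumes "mult_exps a b" "bb a B f" "bb a B1 f'" "bb b B' g" "bb b B1' g'"
  shows "dmult (\<lambda>k. f k - f' k) g = (\<lambda>k. dmult f g k - dmult f' g k)"
    "dmult f (\<lambda>k. g k - g' k) = (\<lambda>k. dmult f g k - dmult f g' k)"
proof -
  show "dmult (\<lambda>k. f k - f' k) g = (\<lambda>k. dmult f g k - dmult f' g k)"
  proof
    fix k
    show "dmult (\<lambda>k. f k - f' k) g k = dmult f g k - dmult f' g k"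
    proof (rule LIMSEQ_unique[OF dmult_LIMSEQ[OF assms(1) bb_diff[OF assms(2,3)] assms(4)]])
      show "(\<lambda>N. conv (lp_partial N (\<lambda>k. f k - f' k)) (lp_partial N g) k) \<longlonglongrightarrow> dmult f g k - dmult f' g k"
        unfolding partial_lin conv_diff_left[OF fsupp_partial fsupp_partial]
        by (intro tendsto_diff dmult_LIMSEQ[OF assms(1,2,4)] dmult_LIMSEQ[OF assms(1,3,4)])
    qed
  qed
  show "dmult f (\<lambda>k. g k - g' k) = (\<lambda>k. dmult f g k - dmult f g' k)"
  proof
    fix k
    show "dmult f (\<lambda>k. g k - g' k) k = dmult f g k - dmult f g' k"
    proof (rule LIMSEQ_unique[OF dmult_LIMSEQ[OF assms(1,2) bb_diff[OF assms(4,5)]]])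
      show "(\<lambda>N. conv (lp_partial N f) (lp_partial N (\<lambda>k. g k - g' k)) k) \<longlonglongrightarrow> dmult f g k - dmult f g' k"
        unfolding partial_lin conv_diff_right
        by (intro tendsto_diff dmult_LIMSEQ[OF assms(1,2,4)] dmult_LIMSEQ[OF assms(1,2,5)])
    qed
  qed
qed

lemma dmult_fsupp: assumes "fsupp f" "fsupp g" shows "dmult f g = conv f g"
proof
  fix k
  obtain M1 M2 where M: "\<And>N. N \<ge> M1 \<Longrightarrow> lp_partial N f = f" "\<And>N. N \<ge> M2 \<Longrightarrow> lp_partial N g = g"
    using partial_fsupp assms by metis
  have "\<forall>\<^sub>F N in sequentially. conv (lp_partial N f) (lp_partial N g) k = conv f g k"
    by (rule eventually_sequentiallyI[of "max M1 M2"]) (simp add: M)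
  then have "(\<lambda>N. conv (lp_partial N f) (lp_partial N g) k) \<longlonglongrightarrow> conv f g k" by (rule tendsto_eventually)
  then show "dmult f g k = conv f g k" unfolding dmult_conv by (rule limI)
qed

text \<open>Continuity of each coefficient separately: weak enough to survive limits and products,
  strong enough for measurability of the Duhamel integrand. Continuity in norm is recovered by
  \<open>interpolation_cont\<close>.\<close>

definition cf :: "real set \<Rightarrow> (real \<Rightarrow> distr) \<Rightarrow> bool" where
  "cf S u \<longleftrightarrow> (\<forall>k. continuous_on S (\<lambda>t. u t k))"

lemma cf_partial: "cf S u \<Longrightarrow> cf S (\<lambda>t. lp_partial N (u t))"
  unfolding cf_def lp_partial_def by (auto intro!: continuous_intros)

text \<open>For fixed truncation each coefficient of the product is a finite sum of continuous
  functions, and \<open>dmult_rate\<close> makes the passage to the limit uniform in t.\<close>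

lemma cf_dmult: assumes "mult_exps a b" "cf S u" "cf S w" "\<And>t. t \<in> S \<Longrightarrow> bb a B (u t)" "\<And>t. t \<in> S \<Longrightarrow> bb b B' (w t)"
  shows "cf S (\<lambda>t. dmult (u t) (w t))"
  unfolding cf_def
proof
  fix k
  obtain \<delta> c where \<delta>: "\<delta> > 0" and c: "\<And>f g B B' N. bb a B f \<Longrightarrow> bb b B' g \<Longrightarrow>
     cmod (conv (lp_partial N f) (lp_partial N g) k - dmult f g k) \<le> c * B * B' * 2 powr (- \<delta> * real N)"
    using dmult_rate[OF assms(1)] by blast
  have pc: "continuous_on S (\<lambda>t. lp_partial N (u t) l)" "continuous_on S (\<lambda>t. lp_partial N (w t) l)" for N l
    using cf_partial assms(2,3) unfolding cf_def by blast+
  have "uniform_limit S (\<lambda>N t. conv (lp_partial N (u t)) (lp_partial N (w t)) k) (\<lambda>t. dmult (u t) (w t) k) sequentially"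
  proof (rule uniform_limitI)
    fix e :: real assume "e > 0"
    have "\<forall>\<^sub>F N in sequentially. c * B * B' * 2 powr (- \<delta> * real N) < e"
      by (rule order_tendstoD(2)[OF two_powr_tendsto[OF \<delta>] \<open>e > 0\<close>])
    then show "\<forall>\<^sub>F N in sequentially. \<forall>t\<in>S. dist (conv (lp_partial N (u t)) (lp_partial N (w t)) k) (dmult (u t) (w t) k) < e"
    proof eventually_elim
      case (elim N)
      show ?case
      proof
        fix t assume "t \<in> S"
        then show "dist (conv (lp_partial N (u t)) (lp_partial N (w t)) k) (dmult (u t) (w t) k) < e"
          using c[OF assms(4,5), of t t N] elim by (simp add: dist_norm)
      qed
    qed
  qed
  then show "continuous_on S (\<lambda>t. dmult (u t) (w t) k)"
    by (rule uniform_limit_theorem[rotated]) (auto simp: conv_partial_box intro!: always_eventually continuous_intros pc)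
qed

section \<open>Conjugation and the unit\<close>

lemma sg_minus: "sg n (- k) = sg n k"
proof -
  have "kvec (- k) = - kvec k" by (simp add: kvec_def)
  then show ?thesis by (simp add: sg_def lp_symbol_def lp_rho_def lp_theta_def)
qed

lemma dconj_eq: "dconj f k = cnj (f (- k))"
  by (simp add: dconj_def uminus_prod_def)

lemma D_dconj: "D n (dconj f) = dconj (D n f)"
proof
  fix k
  have "cnj (sg n k) = sg n k" by (simp add: sg_def)
  then show "D n (dconj f) k = dconj (D n f) k" by (simp add: D_def mul_def dconj_eq sg_minus)
qed

lemma fsupp_dconj: "fsupp f \<Longrightarrow> fsupp (dconj f)"
proof (rule fsuppI[of "uminus ` {k. f k \<noteq> 0}"])
  show "fsupp f \<Longrightarrow> finite (uminus ` {k. f k \<noteq> 0})" by (simp add: fsupp_def)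
  show "dconj f k = 0" if "k \<notin> uminus ` {k. f k \<noteq> 0}" for k
    using that image_eqI[of k uminus "-k" "{k. f k \<noteq> 0}"] by (auto simp: dconj_eq)
qed

lemma tev_dconj: assumes "fsupp f" shows "tev (dconj f) x = cnj (tev f x)"
proof -
  have "tev (dconj f) x = (\<Sum>k\<in>uminus ` {k. f k \<noteq> 0}. dconj f k * ee k x)"
  proof (rule tev_on)
    show "finite (uminus ` {k. f k \<noteq> 0})" using assms by (simp add: fsupp_def)
    show "dconj f k = 0" if "k \<notin> uminus ` {k. f k \<noteq> 0}" for k
      using that image_eqI[of k uminus "-k" "{k. f k \<noteq> 0}"] by (auto simp: dconj_eq)
  qed
  also have "\<dots> = (\<Sum>k | f k \<noteq> 0. dconj f (- k) * ee (- k) x)"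
    by (subst sum.reindex) (auto simp: inj_on_def)
  finally show ?thesis by (simp add: dconj_eq tev_def ee_minus)
qed

lemma bb_dconj: "bb a B f \<Longrightarrow> bb a B (dconj f)"
  by (simp add: bb_def D_dconj tev_dconj)

lemma dconj_diff: "dconj (\<lambda>k. f k - g k) = (\<lambda>k. dconj f k - dconj g k)" by (auto simp: dconj_eq)

lemma cf_dconj: "cf S u \<Longrightarrow> cf S (\<lambda>t. dconj (u t))"
  unfolding cf_def dconj_eq by (auto intro!: continuous_intros)

lemma done_one_eq: "done_one = (\<lambda>k. if k = 0 then 1 else 0)" by (auto simp: done_one_def zero_prod_def)

lemma fsupp_one: "fsupp done_one" by (rule fsuppI[of "{0}"]) (auto simp: done_one_eq)

lemma tev_one: "tev done_one x = 1" by (subst tev_on[of "{0}"]) (auto simp: done_one_eq)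

lemma bb_one: "bb a 1 done_one"
  unfolding bb_def
proof (intro allI)
  fix n x
  have nk0: "nk 0 = 0" by (simp add: nk_def kvec_def zero_prod_def[symmetric])
  have s0: "sg 0 0 = 1" by (simp add: sg_th th_one nk0)
  have "sg n 0 = 0" if "n \<noteq> 0"
  proof (rule ccontr)
    assume "sg n 0 \<noteq> 0"
    then have "(2::real) ^ (n - 1) < 0" using sg_supp(2)[of n 0] that nk0 by simp
    then show False by (simp add: not_less[symmetric])
  qed
  then have "D n done_one = (if n = 0 then done_one else (\<lambda>k. 0))" by (auto simp: D_def mul_def done_one_eq s0)
  then show "cmod (tev (D n done_one) x) \<le> 1 * 2 powr (- a * real n)" by (simp add: tev_one)
qed

section \<open>Smoothing by the heat semigroup\<close>

definition hs :: "real \<Rightarrow> real \<Rightarrow> distr" where "hs \<mu> t k = exp (complex_of_real t * heat_symbol \<mu> k)"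

lemma cmod_hs: assumes "\<mu> > 0" "t \<ge> 0" shows "cmod (hs \<mu> t k) \<le> exp (- t)"
proof -
  let ?q = "4 * pi ^ 2 * (real_of_int (fst k) ^ 2 + real_of_int (snd k) ^ 2)"
  have "cmod (hs \<mu> t k) = exp (t * (- (\<mu> * ?q) - 1))"
    by (simp add: hs_def heat_symbol_def)
  also have "\<dots> \<le> exp (- t)"
  proof -
    have "0 \<le> t * (\<mu> * ?q)" using assms by (intro mult_nonneg_nonneg add_nonneg_nonneg) auto
    then show ?thesis unfolding exp_le_cancel_iff right_diff_distrib by simp
  qed
  finally show ?thesis .
qed

lemma powr_le_one_plus: fixes x y :: real assumes "0 \<le> x" "x \<le> 1" "y > 0" shows "1 / (1 + y) \<le> y powr (- x)"
proof -
  have "y powr x \<le> 1 + y"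
  proof (cases "y \<le> 1")
    case True then show ?thesis using powr_le1[of x y] assms by linarith
  next
    case False then show ?thesis using powr_mono[of x 1 y] assms by simp
  qed
  then show ?thesis using assms by (simp add: powr_minus field_simps)
qed

text \<open>On block n the semigroup is exp (-t) times the dilation by 2^n of
  \<open>heat_profile\<close> at time t * 4^n. Its kernel has norm O(1/(1 + t * 4^n)), at most (t *
  4^n) powr (-p) with p = (b - a)/2; the requirement p \<le> 1 is the reason for b \<le> a + 2.
  Block 0 has no annular cutoff but only finitely many frequencies, so there the factor exp (-t)
  suffices.\<close>

lemma heat_bb: assumes \<mu>: "\<mu> > 0"
  shows "\<exists>C\<ge>1. \<forall>a b t B f. t > 0 \<longrightarrow> a \<le> b \<longrightarrow> b \<le> a + 2 \<longrightarrow> bb a B f \<longrightarrow>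
     bb b (C * t powr (- ((b - a) / 2)) * B) (mul (hs \<mu> t) f)"
proof -
  define \<zeta> where "\<zeta> = (\<i> + complex_of_real \<mu>) * complex_of_real (4 * pi\<^sup>2)"
  have "Re \<zeta> > 0" using \<mu> by (simp add: \<zeta>_def)
  then obtain C where C: "C \<ge> 0" "\<And>\<tau>. \<tau> \<ge> 0 \<Longrightarrow> profile (C / (1 + \<tau>)) (heat_profile \<zeta> \<tau>)" using prof_heat by blast
  define K where "K = 560 * C + real (card (lp_box 0)) + 1"
  have K: "K \<ge> 1" "560 * C \<le> K" "real (card (lp_box 0)) \<le> K" using C(1) by (auto simp: K_def)
  have "bb b (K * t powr (- ((b - a) / 2)) * B) (mul (hs \<mu> t) f)"
    if t: "t > 0" and ab: "a \<le> b" "b \<le> a + 2" and f: "bb a B f" for a b t B f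
    unfolding bb_def D_mul
  proof (intro allI)
    fix n x
    define p where "p = (b - a) / 2"
    have p: "0 \<le> p" "p \<le> 1" using ab by (auto simp: p_def)
    have B: "B \<ge> 0" using bb_nonneg f by blast
    show "cmod (tev (mul (hs \<mu> t) (D n f)) x) \<le> K * t powr (- ((b - a) / 2)) * B * 2 powr (- b * real n)"
    proof (cases n)
      case 0
      have "cmod (tev (mul (hs \<mu> t) (D 0 f)) x) \<le> (\<Sum>k\<in>lp_box 0. cmod (mul (hs \<mu> t) (D 0 f) k))"
        by (rule tev_le) (auto simp: mul_def D_def sg_box)
      also have "\<dots> \<le> (\<Sum>k\<in>lp_box 0. exp (- t) * B)"
      proof (rule sum_mono)
        fix k
        have "cmod (D 0 f k) \<le> B" by (rule coeff_le) (use bbD[OF f, of 0] in auto)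
        then show "cmod (mul (hs \<mu> t) (D 0 f) k) \<le> exp (- t) * B"
          unfolding mul_def norm_mult using cmod_hs[OF \<mu>, of t k] t by (intro mult_mono) auto
      qed
      also have "\<dots> = real (card (lp_box 0)) * (exp (- t) * B)" by simp
      also have "\<dots> \<le> K * (t powr (- p) * B)"
      proof (intro mult_mono mult_right_mono K B)
        have "exp (- t) \<le> 1 / (1 + t)" using exp_ge_add_one_self[of t] t by (simp add: exp_minus field_simps)
        then show "exp (- t) \<le> t powr (- p)" using powr_le_one_plus[OF p t] by linarith
      qed (use K B in auto)
      finally show ?thesis using 0 by (simp add: p_def mult.assoc)
    next
      case (Suc m)
      let ?\<tau> = "t * 4 ^ n"
      let ?M = "dilate (2 ^ n) (heat_profile \<zeta> ?\<tau>)"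
      have R: "(1::real) \<le> 2 ^ n" by simp
      have eq: "mul (hs \<mu> t) (D n f) = (\<lambda>k. complex_of_real (exp (- t)) * mul ?M (D n f) k)"
      proof
        fix k
        show "mul (hs \<mu> t) (D n f) k = complex_of_real (exp (- t)) * mul ?M (D n f) k"
        proof (cases "sg n k = 0")
          case False
          have "nk k < 2 ^ Suc n" "2 ^ (n - 1) < nk k" using sg_supp[OF False] Suc by auto
          then have "norm ((1 / 2 ^ n) *\<^sub>R kvec k) \<le> 2" "1/2 \<le> norm ((1 / 2 ^ n) *\<^sub>R kvec k)"
            using Suc by (auto simp: nk_def field_simps)
          then have chi: "lp_chi ((1 / 2 ^ n) *\<^sub>R kvec k) = 1" by (intro lp_chi_one)
          have 4: "(4::real) ^ n = (2 ^ n)\<^sup>2" by (simp add: power2_eq_square flip: power_mult_distrib)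
          have "(fst ((1 / 2 ^ n) *\<^sub>R kvec k))\<^sup>2 + (snd ((1 / 2 ^ n) *\<^sub>R kvec k))\<^sup>2 = ((of_int (fst k))\<^sup>2 + (of_int (snd k))\<^sup>2) / 4 ^ n"
            by (simp add: kvec_def power_divide 4 add_divide_distrib)
          then have "?M k = exp (- (complex_of_real ?\<tau> * \<zeta> * complex_of_real (((of_int (fst k))\<^sup>2 + (of_int (snd k))\<^sup>2) / 4 ^ n)))"
            by (simp only: dilate_def heat_profile_def chi) simp
          also have "complex_of_real ?\<tau> * \<zeta> * complex_of_real (((of_int (fst k))\<^sup>2 + (of_int (snd k))\<^sup>2) / 4 ^ n)
             = complex_of_real t * \<zeta> * complex_of_real ((of_int (fst k))\<^sup>2 + (of_int (snd k))\<^sup>2)"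
            by (simp add: field_simps)
          finally have M: "?M k = exp (- (complex_of_real t * \<zeta> * complex_of_real ((of_int (fst k))\<^sup>2 + (of_int (snd k))\<^sup>2)))" .
          have h: "heat_symbol \<mu> k = - (\<zeta> * complex_of_real ((of_int (fst k))\<^sup>2 + (of_int (snd k))\<^sup>2)) - 1"
            by (simp add: heat_symbol_def \<zeta>_def algebra_simps)
          have "complex_of_real t * heat_symbol \<mu> k = complex_of_real (- t) + - (complex_of_real t * \<zeta> * complex_of_real ((of_int (fst k))\<^sup>2 + (of_int (snd k))\<^sup>2))"
            by (simp only: h) (simp add: algebra_simps)
          then have "complex_of_real (exp (- t)) * ?M k = hs \<mu> t k"
            by (simp only: hs_def M exp_add exp_of_real)
          then show ?thesis by (simp add: mul_def mult.assoc[symmetric])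
        qed (simp add: mul_def D_def)
      qed
      have \<tau>0: "?\<tau> \<ge> 0" using t by simp
      have "cmod (tev (mul (hs \<mu> t) (D n f)) x) = exp (- t) * cmod (tev (mul ?M (D n f)) x)"
        unfolding eq by (subst tev_cmult) (auto intro: fsupp_mul simp: norm_mult)
      also have "\<dots> \<le> 1 * (560 * (C / (1 + ?\<tau>)) * (B * 2 powr (- a * real n)))"
        using t by (intro mult_mono prof_mul_le[OF C(2)[OF \<tau>0] R fsupp_D bbD[OF f]]) auto
      also have "\<dots> = (560 * C) * (1 / (1 + ?\<tau>)) * (B * 2 powr (- a * real n))" by simp
      also have "\<dots> \<le> K * ?\<tau> powr (- p) * (B * 2 powr (- a * real n))"
        using t B C(1) K p by (intro mult_right_mono mult_mono powr_le_one_plus) auto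
      also have "?\<tau> powr (- p) = t powr (- p) * 2 powr (- (b - a) * real n)"
      proof -
        have "(4::real) ^ n = 2 powr (2 * real n)" by (simp add: powr_mult_base powr_powr[symmetric] powr_realpow flip: powr_numeral)
        moreover have "2 * real n * - p = - (b - a) * real n"
        proof -
          have "2 * p = b - a" by (simp add: p_def)
          then have "(b - a) * real n = 2 * p * real n" by simp
          then show ?thesis by (simp only: mult_minus_left mult_minus_right) (simp add: mult_ac)
        qed
        ultimately show ?thesis using t by (simp only: powr_mult powr_powr)
      qed
      also have "K * (t powr (- p) * 2 powr (- (b - a) * real n)) * (B * 2 powr (- a * real n)) = K * t powr (- p) * B * 2 powr (- b * real n)"
      proof -
        have "2 powr (- b * real n) = 2 powr (- (b - a) * real n) * 2 powr (- a * real n)"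
          by (simp add: algebra_simps flip: powr_add)
        then show ?thesis by simp
      qed
      finally show ?thesis by (simp add: p_def)
    qed
  qed
  then show ?thesis using K(1) by (intro exI[of _ K]) auto
qed

subsection \<open>Mild solutions of an abstract equation\<close>

definition duhamel :: "real \<Rightarrow> (real \<Rightarrow> distr) \<Rightarrow> real \<Rightarrow> distr" where
  "duhamel \<mu> F t k = integral {0..t} (\<lambda>s. hs \<mu> (t - s) k * F s k)"

lemma hs_add: "hs \<mu> (s + t) k = hs \<mu> s k * hs \<mu> t k"
  by (simp add: hs_def ring_distribs exp_add)

lemma cont_hs [continuous_intros]: "continuous_on S g \<Longrightarrow> continuous_on S (\<lambda>t. hs \<mu> (g t) k)"
  unfolding hs_def by (intro continuous_intros)

text \<open>Nothing is known at time 0. The function is measurable on the half-open interval,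
  dominated by an integrable power, and the point 0 is negligible.\<close>

lemma bounded_integrable:
  fixes f :: "real \<Rightarrow> 'a::euclidean_space"
  assumes "continuous_on {0<..T} f" "\<kappa> < 1" "0 \<le> T" "\<And>s. s \<in> {0<..T} \<Longrightarrow> norm (f s) \<le> c * s powr (- \<kappa>)"
  shows "f integrable_on {0..T}"
proof -
  have "(\<lambda>s. s powr (-\<kappa>)) integrable_on {0..T}" using assms by (intro integrable_on_powr_from_0) auto
  then have "(\<lambda>s. c * s powr (-\<kappa>)) integrable_on {0..T}" by (rule integrable_on_mult_right)
  then have g: "(\<lambda>s. c * s powr (-\<kappa>)) integrable_on {0<..T}"
    by (rule integrable_spike_set) (auto intro: negligible_subset[of "{0}"])
  have "f integrable_on {0<..T}"
    by (rule measurable_bounded_by_integrable_imp_integrable[OF continuous_imp_measurable_on_sets_lebesgue[OF assms(1)] g])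
       (use assms(4) in auto)
  then show ?thesis by (rule integrable_spike_set) (auto intro: negligible_subset[of "{0}"])
qed

definition sing_bound :: "real \<Rightarrow> real \<Rightarrow> real \<Rightarrow> real \<Rightarrow> (real \<Rightarrow> distr) \<Rightarrow> bool" where
  "sing_bound a \<kappa> Q T F \<longleftrightarrow> cf {0<..T} F \<and> (\<forall>s\<in>{0<..T}. bb a (Q * s powr (-\<kappa>)) (F s))"

lemma FB_sub: "sing_bound a \<kappa> Q T F \<Longrightarrow> t \<le> T \<Longrightarrow> sing_bound a \<kappa> Q t F"
  unfolding sing_bound_def cf_def by (auto intro: continuous_on_subset)

lemma FB_integrable:
  assumes F: "sing_bound a \<kappa> Q T F" and "\<kappa> < 1" "0 \<le> T" and g: "continuous_on {0..T} g"
  shows "(\<lambda>s. g s * F s k) integrable_on {0..T}"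
proof -
  obtain c where c: "c \<ge> 0" "\<And>f B. bb a B f \<Longrightarrow> cmod (f k) \<le> c * B" using bb_coeff[of a k] by blast
  have "compact (g ` {0..T})" by (rule compact_continuous_image[OF g]) simp
  then obtain G where "\<forall>x\<in>g ` {0..T}. cmod x \<le> G" using compact_imp_bounded bounded_iff by metis
  then have G: "cmod (g s) \<le> \<bar>G\<bar>" if "s \<in> {0..T}" for s
    using that by (meson abs_ge_self image_eqI order_trans)
  show ?thesis
  proof (rule bounded_integrable[OF _ assms(2,3)])
    show "continuous_on {0<..T} (\<lambda>s. g s * F s k)"
      using F unfolding sing_bound_def cf_def by (auto intro!: continuous_intros continuous_on_subset[OF g])
    fix s assume s: "s \<in> {0<..T}"
    have "cmod (F s k) \<le> c * (Q * s powr (-\<kappa>))" using F s c(2) unfolding sing_bound_def by blast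
    then have "cmod (g s * F s k) \<le> \<bar>G\<bar> * (c * (Q * s powr (-\<kappa>)))"
      unfolding norm_mult using G[of s] s by (intro mult_mono) auto
    then show "cmod (g s * F s k) \<le> (\<bar>G\<bar> * c * Q) * s powr (-\<kappa>)" by (simp add: mult.assoc)
  qed
qed

lemma duh_integrable:
  assumes "sing_bound a \<kappa> Q t F" "\<kappa> < 1" "0 \<le> t"
  shows "(\<lambda>s. hs \<mu> (t - s) k * F s k) integrable_on {0..t}"
  by (rule FB_integrable[OF assms]) (intro continuous_intros)

text \<open>Splitting at s = t/2 freezes one of the two singular factors and replaces the Beta
  integral by two elementary ones.\<close>

lemma kernel_split:
  fixes s t \<theta> \<kappa> :: real
  assumes "0 < s" "s < t" "0 \<le> \<theta>" "0 \<le> \<kappa>"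
  shows "(t - s) powr (-\<theta>) * s powr (-\<kappa>) \<le> (t/2) powr (-\<theta>) * s powr (-\<kappa>) + (t/2) powr (-\<kappa>) * (t - s) powr (-\<theta>)"
proof (cases "s \<le> t / 2")
  case True
  have "(t - s) powr (-\<theta>) \<le> (t/2) powr (-\<theta>)" using assms True by (intro powr_mono2') auto
  then have "(t - s) powr (-\<theta>) * s powr (-\<kappa>) \<le> (t/2) powr (-\<theta>) * s powr (-\<kappa>)" by (intro mult_right_mono) auto
  moreover have "0 \<le> (t/2) powr (-\<kappa>) * (t - s) powr (-\<theta>)" by simp
  ultimately show ?thesis by linarith
next
  case False
  have "s powr (-\<kappa>) \<le> (t/2) powr (-\<kappa>)" using assms False by (intro powr_mono2') auto
  then have "(t - s) powr (-\<theta>) * s powr (-\<kappa>) \<le> (t - s) powr (-\<theta>) * (t/2) powr (-\<kappa>)" by (intro mult_left_mono) auto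
  moreover have "0 \<le> (t/2) powr (-\<theta>) * s powr (-\<kappa>)" by simp
  ultimately show ?thesis unfolding mult.commute[of "(t/2) powr (-\<kappa>)"] by linarith
qed

lemma kernel_integral:
  fixes t \<theta> \<kappa> :: real
  assumes "0 < t" "0 \<le> \<theta>" "\<theta> < 1" "0 \<le> \<kappa>" "\<kappa> < 1"
  shows "((\<lambda>s. (t/2) powr (-\<theta>) * s powr (-\<kappa>) + (t/2) powr (-\<kappa>) * (t - s) powr (-\<theta>)) has_integral
    t powr (1 - \<kappa> - \<theta>) * (2 powr \<theta> / (1 - \<kappa>) + 2 powr \<kappa> / (1 - \<theta>))) {0..t}"
proof -
  have 1: "((\<lambda>s. s powr (-\<kappa>)) has_integral (t powr (1 - \<kappa>) / (1 - \<kappa>))) {0..t}"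
    using has_integral_powr_from_0[of "-\<kappa>" t] assms by (simp add: add.commute)
  have "((\<lambda>s. s powr (-\<theta>)) has_integral (t powr (1 - \<theta>) / (1 - \<theta>))) (cbox 0 t)"
    using has_integral_powr_from_0[of "-\<theta>" t] assms by (simp add: add.commute)
  from has_integral_affinity[OF this, of "-1" t]
  have "((\<lambda>s. (t - s) powr (-\<theta>)) has_integral (t powr (1 - \<theta>) / (1 - \<theta>))) ((\<lambda>x. - x + t) ` {0..t})"
    by (simp add: add.commute[of _ t])
  moreover have "(\<lambda>x. - x + t) ` {0..t} = {0..t}"
    using image_affinity_atLeastAtMost[of "-1" t 0 t] assms(1) by simp
  ultimately have 2: "((\<lambda>s. (t - s) powr (-\<theta>)) has_integral (t powr (1 - \<theta>) / (1 - \<theta>))) {0..t}" by simp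
  have e: "(t/2) powr (-\<theta>) * (t powr (1 - \<kappa>) / (1 - \<kappa>)) = t powr (1 - \<kappa> - \<theta>) * (2 powr \<theta> / (1 - \<kappa>))"
    "(t/2) powr (-\<kappa>) * (t powr (1 - \<theta>) / (1 - \<theta>)) = t powr (1 - \<kappa> - \<theta>) * (2 powr \<kappa> / (1 - \<theta>))"
    using assms by (auto simp: powr_divide powr_minus powr_diff powr_add field_simps)
  show ?thesis
    using has_integral_add[OF has_integral_mult_right[OF 1, of "(t/2) powr (-\<theta>)"] has_integral_mult_right[OF 2, of "(t/2) powr (-\<kappa>)"]]
    unfolding e by (simp add: distrib_left)
qed

lemma tev_D_box: "tev (D n f) x = (\<Sum>k\<in>lp_box n. (sg n k * ee k x) * f k)"
  by (subst tev_on[of "lp_box n"]) (auto simp: D_def mul_def sg_box mult_ac)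

text \<open>The gain of regularity costs (t - s) powr (-(al + be)/2), integrable at s = t, and the
  forcing s powr (-\<kappa>) is integrable at 0; scaling gives the power of t.\<close>

lemma duh_bb:
  assumes \<mu>: "\<mu> > 0" and th: "0 \<le> (al + be) / 2" "(al + be) / 2 < 1" and k: "0 \<le> \<kappa>" "\<kappa> < 1"
  shows "\<exists>C\<ge>1. \<forall>Q F t. 0 < t \<longrightarrow> sing_bound (- al) \<kappa> Q t F \<longrightarrow> bb be (C * Q * t powr (1 - \<kappa> - (al + be) / 2)) (duhamel \<mu> F t)"
proof -
  define \<theta> where "\<theta> = (al + be) / 2"
  obtain C where C: "C \<ge> 1" "\<And>a b t B f. t > 0 \<Longrightarrow> a \<le> b \<Longrightarrow> b \<le> a + 2 \<Longrightarrow> bb a B f \<Longrightarrow>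
     bb b (C * t powr (- ((b - a) / 2)) * B) (mul (hs \<mu> t) f)" using heat_bb[OF \<mu>] by blast
  define K where "K = C * (2 powr \<theta> / (1 - \<kappa>) + 2 powr \<kappa> / (1 - \<theta>))"
  have K0: "K \<ge> 1"
  proof -
    have "1 \<le> 2 powr \<theta>" using th by (simp add: \<theta>_def ge_one_powr_ge_zero)
    then have "1 \<le> 2 powr \<theta> / (1 - \<kappa>)" using k by simp
    moreover have "0 \<le> 2 powr \<kappa> / (1 - \<theta>)" using th by (simp add: \<theta>_def)
    ultimately show ?thesis unfolding K_def using C(1) mult_mono[of 1 C 1 "2 powr \<theta> / (1 - \<kappa>) + 2 powr \<kappa> / (1 - \<theta>)"] by simp
  qed
  have "bb be (K * Q * t powr (1 - \<kappa> - \<theta>)) (duhamel \<mu> F t)" if t: "0 < t" and F: "sing_bound (- al) \<kappa> Q t F" for Q F t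
    unfolding bb_def
  proof (intro allI)
    fix n x
    let ?w = "2 powr (- be * real n)"
    have Q: "Q \<ge> 0"
    proof -
      have "bb (- al) (Q * t powr (-\<kappa>)) (F t)" using F t unfolding sing_bound_def by auto
      then have "0 \<le> Q * t powr (-\<kappa>)" by (rule bb_nonneg)
      then show ?thesis using t by (simp add: zero_le_mult_iff)
    qed
    define g where "g s = tev (D n (mul (hs \<mu> (t - s)) (F s))) x" for s
    have gs: "g s = (\<Sum>k\<in>lp_box n. (sg n k * ee k x) * (hs \<mu> (t - s) k * F s k))" for s
      unfolding g_def tev_D_box by (simp add: mul_def)
    have gi: "g integrable_on {0..t}" unfolding gs[abs_def]
      using duh_integrable[OF F k(2)] t by (intro integrable_sum integrable_on_mult_right) auto
    have eq: "tev (D n (duhamel \<mu> F t)) x = integral {0..t} g"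
      unfolding tev_D_box duhamel_def gs[abs_def]
      using duh_integrable[OF F k(2)] t
      by (subst integral_sum) (auto intro!: integrable_on_mult_right)
    let ?m = "\<lambda>s. (t/2) powr (-\<theta>) * s powr (-\<kappa>) + (t/2) powr (-\<kappa>) * (t - s) powr (-\<theta>)"
    have mi: "(?m has_integral t powr (1 - \<kappa> - \<theta>) * (2 powr \<theta> / (1 - \<kappa>) + 2 powr \<kappa> / (1 - \<theta>))) {0..t}"
      using t th k by (intro kernel_integral) (auto simp: \<theta>_def)
    have gb: "cmod (g s) \<le> (C * Q * ?w) * ?m s" if s: "s \<in> {0<..<t}" for s
    proof -
      have "bb be (C * (t - s) powr (- ((be - - al) / 2)) * (Q * s powr (-\<kappa>))) (mul (hs \<mu> (t - s)) (F s))"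
        using s th F by (intro C(2)) (auto simp: sing_bound_def)
      then have "cmod (g s) \<le> C * (t - s) powr (- \<theta>) * (Q * s powr (-\<kappa>)) * ?w"
        unfolding g_def \<theta>_def by (drule_tac bbD) (simp add: add.commute)
      also have "\<dots> = (C * Q * ?w) * ((t - s) powr (- \<theta>) * s powr (-\<kappa>))" by (simp add: mult_ac)
      also have "\<dots> \<le> (C * Q * ?w) * ?m s"
        using s th k C(1) Q by (intro mult_left_mono kernel_split) (auto simp: \<theta>_def)
      finally show ?thesis .
    qed
    \<comment> \<open>The pointwise bound is available only strictly between 0 and t, hence the open
      interval.\<close>
    have "cmod (integral {0<..<t} g) \<le> integral {0<..<t} (\<lambda>s. (C * Q * ?w) * ?m s)"
      using gi has_integral_integrable[OF mi] gb
      by (intro integral_norm_bound_integral integrable_on_mult_right) (auto simp: integrable_on_open_interval_real)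
    also have "\<dots> = (C * Q * ?w) * (t powr (1 - \<kappa> - \<theta>) * (2 powr \<theta> / (1 - \<kappa>) + 2 powr \<kappa> / (1 - \<theta>)))"
      using mi by (simp only: integral_open_interval_real[symmetric] integral_mult_right integral_unique)
    also have "\<dots> = K * Q * t powr (1 - \<kappa> - \<theta>) * ?w" by (simp add: K_def mult_ac)
    finally show "cmod (tev (D n (duhamel \<mu> F t)) x) \<le> K * Q * t powr (1 - \<kappa> - \<theta>) * ?w"
      unfolding eq by (simp only: integral_open_interval_real)
  qed
  then show ?thesis using K0 unfolding \<theta>_def by blast
qed

text \<open>Running the semigroup backwards removes t from the integrand. The Duhamel term becomes
  an indefinite integral, which yields its continuity and, in \<open>sol_deriv\<close>, its
  derivative.\<close>

lemma duh_factor: "duhamel \<mu> F t k = hs \<mu> t k * integral {0..t} (\<lambda>s. hs \<mu> (- s) k * F s k)"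
proof -
  have "hs \<mu> (t - s) k * F s k = hs \<mu> t k * (hs \<mu> (- s) k * F s k)" for s
    using hs_add[of \<mu> t "-s" k] by simp
  then show ?thesis unfolding duhamel_def by (simp only: integral_mult_right)
qed

lemma duh_cf:
  assumes F: "sing_bound a \<kappa> Q T F" and "\<kappa> < 1"
  shows "cf {0<..T} (duhamel \<mu> F)"
  unfolding cf_def
proof
  fix k
  show "continuous_on {0<..T} (\<lambda>t. duhamel \<mu> F t k)"
  proof (cases "T > 0")
    case True
    then have "(\<lambda>s. hs \<mu> (- s) k * F s k) integrable_on {0..T}"
      by (intro FB_integrable[OF F assms(2)] continuous_intros) auto
    from indefinite_integral_continuous_1[OF this] show ?thesis
      unfolding duh_factor by (intro continuous_intros) (auto elim: continuous_on_subset)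
  qed auto
qed

lemma duh_diff:
  assumes "sing_bound a \<kappa> Q t F" "sing_bound a \<kappa> Q' t G" "\<kappa> < 1" "0 \<le> t"
  shows "duhamel \<mu> (\<lambda>s k. F s k - G s k) t = (\<lambda>k. duhamel \<mu> F t k - duhamel \<mu> G t k)"
  unfolding duhamel_def using duh_integrable[OF assms(1,3,4)] duh_integrable[OF assms(2,3,4)]
  by (auto simp: right_diff_distrib integral_diff)

lemma duh_cong: "(\<And>s. 0 < s \<Longrightarrow> s \<le> t \<Longrightarrow> F s = G s) \<Longrightarrow> duhamel \<mu> F t = duhamel \<mu> G t"
proof
  fix k assume eq: "\<And>s. 0 < s \<Longrightarrow> s \<le> t \<Longrightarrow> F s = G s"
  show "duhamel \<mu> F t k = duhamel \<mu> G t k" unfolding duhamel_def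
    by (rule integral_spike[of "{0}"]) (use eq in auto)
qed

lemma duh_split:
  assumes F: "sing_bound a \<kappa> Q (r + s) F" and "\<kappa> < 1" "0 \<le> r" "0 \<le> s"
  shows "duhamel \<mu> F (r + s) k = hs \<mu> s k * duhamel \<mu> F r k + duhamel \<mu> (\<lambda>\<sigma>. F (r + \<sigma>)) s k"
proof -
  let ?f = "\<lambda>\<sigma>. hs \<mu> (r + s - \<sigma>) k * F \<sigma> k"
  have "duhamel \<mu> F (r + s) k = integral {0..r} ?f + integral {r..r+s} ?f"
    unfolding duhamel_def using duh_integrable[OF F assms(2)] assms
    by (intro Henstock_Kurzweil_Integration.integral_combine[symmetric]) auto
  also have "integral {0..r} ?f = hs \<mu> s k * duhamel \<mu> F r k"
  proof -
    have "?f \<sigma> = hs \<mu> s k * (hs \<mu> (r - \<sigma>) k * F \<sigma> k)" for \<sigma>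
      using hs_add[of \<mu> s "r - \<sigma>" k] by (simp add: algebra_simps)
    then show ?thesis unfolding duhamel_def by (simp only: integral_mult_right)
  qed
  also have "integral {r..r+s} ?f = integral {0..s} (\<lambda>\<sigma>. ?f (\<sigma> + r))"
    using integral_shift_real_ivl[of r r "r+s" ?f] by simp
  also have "\<dots> = duhamel \<mu> (\<lambda>\<sigma>. F (r + \<sigma>)) s k" by (simp add: duhamel_def add.commute)
  finally show ?thesis .
qed

lemma cf_subset: "cf S u \<Longrightarrow> T \<subseteq> S \<Longrightarrow> cf T u"
  unfolding cf_def using continuous_on_subset by blast

lemma cf_local: assumes "\<And>r. 0 < r \<Longrightarrow> r < T \<Longrightarrow> cf {r..T} u" shows "cf {0<..T} u"
  unfolding cf_def continuous_on_eq_continuous_within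
proof (intro allI ballI)
  fix k t assume t: "t \<in> {0<..T}"
  then have "continuous (at t within {t/2..T}) (\<lambda>t. u t k)"
    using assms[of "t/2"] unfolding cf_def continuous_on_eq_continuous_within by auto
  moreover have "at t within {0<..T} = at t within {t/2..T}"
    by (rule at_within_nhd[of t "{t/2<..}"]) (use t in auto)
  ultimately show "continuous (at t within {0<..T}) (\<lambda>t. u t k)" by simp
qed

lemma cf_open_cover: assumes "\<And>t. t \<in> S \<Longrightarrow> \<exists>U. open U \<and> t \<in> U \<and> cf (S \<inter> U) u" shows "cf S u"
  unfolding cf_def continuous_on_eq_continuous_within
proof (intro allI ballI)
  fix k t assume t: "t \<in> S"
  then obtain U where U: "open U" "t \<in> U" "cf (S \<inter> U) u" using assms by blast
  have "continuous (at t within (S \<inter> U)) (\<lambda>t. u t k)"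
    using U t unfolding cf_def continuous_on_eq_continuous_within by auto
  moreover have "at t within S = at t within (S \<inter> U)"
    by (rule at_within_nhd[of t U]) (use t U in auto)
  ultimately show "continuous (at t within S) (\<lambda>t. u t k)" by simp
qed

lemma cf_lim: assumes "\<And>N. cf S (u N)" "\<And>k e. e > 0 \<Longrightarrow> \<exists>N. \<forall>t\<in>S. cmod (u N t k - v t k) < e"
  shows "cf S v"
  unfolding cf_def
proof
  fix k
  show "continuous_on S (\<lambda>t. v t k)"
    unfolding continuous_on_iff
  proof (intro ballI allI impI)
    fix t and e :: real assume t: "t \<in> S" and e: "e > 0"
    then obtain N where N: "\<And>s. s \<in> S \<Longrightarrow> cmod (u N s k - v s k) < e / 3" using assms(2)[of "e/3" k] by auto
    have "continuous_on S (\<lambda>s. u N s k)" using assms(1) unfolding cf_def by blast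
    then obtain d where d: "d > 0" "\<And>s. s \<in> S \<Longrightarrow> dist s t < d \<Longrightarrow> dist (u N s k) (u N t k) < e / 3"
      using t e unfolding continuous_on_iff by (metis divide_pos_pos zero_less_numeral)
    have "dist (v s k) (v t k) < e" if s: "s \<in> S" "dist s t < d" for s
    proof -
      have "cmod (v s k - v t k) \<le> cmod (u N s k - v s k) + (cmod (u N s k - u N t k) + cmod (u N t k - v t k))"
        using norm_triangle_ineq4[of "(u N s k - u N t k) + (u N t k - v t k)" "u N s k - v s k"]
          norm_triangle_ineq[of "u N s k - u N t k" "u N t k - v t k"] by simp
      then show ?thesis using N[OF s(1)] N[OF t] d(2)[OF s] by (simp add: dist_norm)
    qed
    then show "\<exists>d>0. \<forall>s\<in>S. dist s t < d \<longrightarrow> dist (v s k) (v t k) < e" using d(1) by blast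
  qed
qed

text \<open>Coefficients have regularity -al, the solution be, initial data -a1, and p is the
  degree. \<open>gam\<close> puts the free evolution into the weight t powr (-ga);
  \<open>pga\<close> and \<open>th1\<close> make the Duhamel integral converge at its two ends;
  \<open>sub\<close> leaves a positive power \<open>eps\<close> of time, so that short times give a
  contraction.\<close>

locale mild =
  fixes \<mu> al be ga a1 :: real and p :: nat
  assumes \<mu>: "\<mu> > 0" and al: "0 < al" and be: "0 < be" and a1: "0 < a1" and p: "1 \<le> p" and ga: "0 < ga"
    and pga: "real p * ga < 1" and th1: "(al + be) / 2 < 1" and gam: "(a1 + be) / 2 < ga"
    and sub: "(al + be) / 2 + (real p - 1) * ga < 1"
begin

text \<open>Everything the fixed point argument uses about the nonlinearity: growth, Lipschitz bound
  and preservation of continuity. Taking B \<ge> 1 lets terms of lower degree be absorbed into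
  B^p.\<close>

definition NL :: "real \<Rightarrow> real \<Rightarrow> (real \<Rightarrow> distr \<Rightarrow> distr) \<Rightarrow> bool" where
  "NL T L N \<longleftrightarrow> L \<ge> 0 \<and>
    (\<forall>t v B. 0 < t \<longrightarrow> t \<le> T \<longrightarrow> 1 \<le> B \<longrightarrow> bb be (B * t powr (-ga)) v \<longrightarrow>
       bb (-al) (L * B ^ p * t powr (- (real p * ga))) (N t v)) \<and>
    (\<forall>t v w B d. 0 < t \<longrightarrow> t \<le> T \<longrightarrow> 1 \<le> B \<longrightarrow> bb be (B * t powr (-ga)) v \<longrightarrow> bb be (B * t powr (-ga)) w \<longrightarrow>
       bb be (d * t powr (-ga)) (\<lambda>k. v k - w k) \<longrightarrow>
       bb (-al) (L * B ^ (p - 1) * d * t powr (- (real p * ga))) (\<lambda>k. N t v k - N t w k)) \<and>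
    (\<forall>r v B. 0 < r \<longrightarrow> r < T \<longrightarrow> cf {r..T} v \<longrightarrow> (\<forall>t\<in>{r..T}. bb be B (v t)) \<longrightarrow> cf {r..T} (\<lambda>t. N t (v t)))"

text \<open>The singularity of the solution at time \<open>0\<close> is measured by \<open>ga\<close>, that of the nonlinearity by \<open>p * ga\<close>.\<close>

definition wb :: "real \<Rightarrow> real \<Rightarrow> (real \<Rightarrow> distr) \<Rightarrow> bool" where
  "wb T B v \<longleftrightarrow> cf {0<..T} v \<and> (\<forall>t\<in>{0<..T}. bb be (B * t powr (-ga)) (v t))"

definition Phi :: "distr \<Rightarrow> (real \<Rightarrow> distr \<Rightarrow> distr) \<Rightarrow> (real \<Rightarrow> distr) \<Rightarrow> real \<Rightarrow> distr" where
  "Phi u0 N v t k = hs \<mu> t k * u0 k + duhamel \<mu> (\<lambda>s. N s (v s)) t k"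

definition sol :: "distr \<Rightarrow> (real \<Rightarrow> distr \<Rightarrow> distr) \<Rightarrow> real \<Rightarrow> (real \<Rightarrow> distr) \<Rightarrow> bool" where
  "sol u0 N T v \<longleftrightarrow> (\<exists>B\<ge>1. wb T B v) \<and> (\<forall>t\<in>{0<..T}. v t = Phi u0 N v t)"

lemma wb_mono: "wb T B v \<Longrightarrow> B \<le> B' \<Longrightarrow> wb T B' v"
  unfolding wb_def by (auto intro: bb_mono mult_right_mono)

lemma wb_sub: "wb T B v \<Longrightarrow> T' \<le> T \<Longrightarrow> wb T' B v"
  unfolding wb_def cf_def by (auto intro: continuous_on_subset)

lemma sol_sub: "sol u0 N T v \<Longrightarrow> T' \<le> T \<Longrightarrow> sol u0 N T' v"
  unfolding sol_def by (auto intro: wb_sub)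

lemma NL_sub: assumes "NL T L N" "T' \<le> T" shows "NL T' L N"
proof -
  have "cf {r..T'} (\<lambda>t. N t (v t))" if r: "0 < r" "r < T'" and v: "cf {r..T'} v" "\<forall>t\<in>{r..T'}. bb be B (v t)" for r v B
  proof -
    \<comment> \<open>The path is frozen after T' so that the continuity clause on the longer
      interval can be applied.\<close>
    define v' where "v' t = v (min t T')" for t
    have "cf {r..T} v'" unfolding cf_def v'_def
    proof
      fix k
      have "continuous_on {r..T'} (\<lambda>t. v t k)" using v(1) unfolding cf_def by blast
      then show "continuous_on {r..T} (\<lambda>t. v (min t T') k)"
        by (rule continuous_on_compose2) (use r in \<open>auto intro!: continuous_intros\<close>)
    qed
    moreover have "\<forall>t\<in>{r..T}. bb be B (v' t)" using v(2) r by (auto simp: v'_def)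
    ultimately have "cf {r..T} (\<lambda>t. N t (v' t))" using assms r unfolding NL_def by (metis order_less_le_trans)
    then have "cf {r..T'} (\<lambda>t. N t (v' t))" using assms(2) by (auto elim: cf_subset)
    moreover have "continuous_on {r..T'} (\<lambda>t. N t (v' t) k) = continuous_on {r..T'} (\<lambda>t. N t (v t) k)" for k
      by (intro continuous_on_cong) (auto simp: v'_def min_def)
    ultimately show ?thesis by (simp add: cf_def)
  qed
  moreover have "L \<ge> 0 \<and>
    (\<forall>t v B. 0 < t \<longrightarrow> t \<le> T' \<longrightarrow> 1 \<le> B \<longrightarrow> bb be (B * t powr (-ga)) v \<longrightarrow>
       bb (-al) (L * B ^ p * t powr (- (real p * ga))) (N t v)) \<and>
    (\<forall>t v w B d. 0 < t \<longrightarrow> t \<le> T' \<longrightarrow> 1 \<le> B \<longrightarrow> bb be (B * t powr (-ga)) v \<longrightarrow> bb be (B * t powr (-ga)) w \<longrightarrow>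
       bb be (d * t powr (-ga)) (\<lambda>k. v k - w k) \<longrightarrow>
       bb (-al) (L * B ^ (p - 1) * d * t powr (- (real p * ga))) (\<lambda>k. N t v k - N t w k))"
    using assms unfolding NL_def by (meson order_trans)
  ultimately show ?thesis unfolding NL_def by blast
qed

lemma wb_FB: assumes N: "NL T L N" and v: "wb \<delta> B v" and B: "1 \<le> B" and \<delta>: "\<delta> \<le> T"
  shows "sing_bound (-al) (real p * ga) (L * B ^ p) \<delta> (\<lambda>s. N s (v s))"
  unfolding sing_bound_def
proof (intro conjI ballI)
  note N' = NL_sub[OF N \<delta>]
  show "bb (-al) (L * B ^ p * s powr (- (real p * ga))) (N s (v s))" if "s \<in> {0<..\<delta>}" for s
    using N' v B that unfolding NL_def wb_def by auto
  show "cf {0<..\<delta>} (\<lambda>s. N s (v s))"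
  proof (rule cf_local)
    fix r assume r: "0 < r" "r < \<delta>"
    have "cf {r..\<delta>} v" using v r unfolding wb_def by (auto elim: cf_subset)
    moreover have "\<forall>t\<in>{r..\<delta>}. bb be (B * r powr (-ga)) (v t)"
      using v r B ga unfolding wb_def by (auto intro!: bb_mono[of be _ "v _" "B * r powr (-ga)"] mult_left_mono powr_mono2')
    ultimately show "cf {r..\<delta>} (\<lambda>s. N s (v s))" using N' r unfolding NL_def by blast
  qed
qed

definition eps where "eps = 1 - real p * ga - (al + be) / 2 + ga"

lemma eps_pos: "eps > 0" using sub by (simp add: eps_def algebra_simps)

definition lipschitz_const :: "real \<Rightarrow> bool" where
  "lipschitz_const C \<longleftrightarrow> (\<forall>T L N u0 \<delta>. NL T L N \<longrightarrow> 0 < \<delta> \<longrightarrow> \<delta> \<le> T \<longrightarrow>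
     (\<forall>v w B d. 1 \<le> B \<longrightarrow> 0 \<le> d \<longrightarrow> wb \<delta> B v \<longrightarrow> wb \<delta> B w \<longrightarrow> (\<forall>t\<in>{0<..\<delta>}. bb be (d * t powr (-ga)) (\<lambda>k. v t k - w t k)) \<longrightarrow>
       (\<forall>t\<in>{0<..\<delta>}. bb be (C * L * B ^ (p - 1) * \<delta> powr eps * d * t powr (-ga)) (\<lambda>k. Phi u0 N v t k - Phi u0 N w t k))))"

lemma Phi_estimates:
  "\<exists>C\<ge>1. \<forall>T L N u0 U \<delta>. NL T L N \<longrightarrow> 0 < \<delta> \<longrightarrow> \<delta> \<le> T \<longrightarrow> \<delta> \<le> 1 \<longrightarrow> bb (-a1) U u0 \<longrightarrow>
     (\<forall>v B. 1 \<le> B \<longrightarrow> wb \<delta> B v \<longrightarrow> wb \<delta> (C * U + C * L * B ^ p * \<delta> powr eps) (Phi u0 N v))"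
  "\<exists>C\<ge>1. lipschitz_const C"
proof -
  have th0: "0 \<le> (al + be) / 2" using al be by simp
  have k: "0 \<le> real p * ga" using ga by simp
  obtain C1 where C1: "C1 \<ge> 1" "\<And>a b t B f. t > 0 \<Longrightarrow> a \<le> b \<Longrightarrow> b \<le> a + 2 \<Longrightarrow> bb a B f \<Longrightarrow>
     bb b (C1 * t powr (- ((b - a) / 2)) * B) (mul (hs \<mu> t) f)" using heat_bb[OF \<mu>] by blast
  obtain C2 where C2: "C2 \<ge> 1" "\<And>Q F t. 0 < t \<Longrightarrow> sing_bound (- al) (real p * ga) Q t F \<Longrightarrow>
     bb be (C2 * Q * t powr (1 - real p * ga - (al + be) / 2)) (duhamel \<mu> F t)"
    using duh_bb[OF \<mu> th0 th1 k pga] by blast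
  have te: "t powr (1 - real p * ga - (al + be) / 2) \<le> \<delta> powr eps * t powr (-ga)" if "0 < t" "t \<le> \<delta>" for t \<delta>
  proof -
    have "t powr (1 - real p * ga - (al + be) / 2) = t powr eps * t powr (-ga)" by (simp add: eps_def flip: powr_add)
    also have "\<dots> \<le> \<delta> powr eps * t powr (-ga)" using that eps_pos by (intro mult_right_mono powr_mono2) auto
    finally show ?thesis .
  qed
  \<comment> \<open>The restriction of \<open>heat_bb\<close> to a gain of at most two
    derivatives.\<close>
  have "a1 + be \<le> 2"
  proof -
    have "ga \<le> real p * ga" using p ga by simp
    then show ?thesis using gam pga by simp
  qed
  note a1b = this
  have D2: "bb be (C2 * Q * \<delta> powr eps * t powr (-ga)) (duhamel \<mu> F t)" if "0 < t" "t \<le> \<delta>" "sing_bound (- al) (real p * ga) Q \<delta> F" "Q \<ge> 0" for t \<delta> Q F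
  proof -
    have "bb be (C2 * Q * t powr (1 - real p * ga - (al + be) / 2)) (duhamel \<mu> F t)"
      using that by (intro C2(2) FB_sub[OF that(3)]) auto
    then show ?thesis
      by (rule bb_mono) (use te[OF that(1,2)] C2(1) that(4) in \<open>simp only: mult.assoc, intro mult_left_mono, auto\<close>)
  qed
  define C where "C = max C1 C2"
  have C: "C \<ge> 1" "C1 \<le> C" "C2 \<le> C" using C1 C2 by (auto simp: C_def)
  show "\<exists>C\<ge>1. \<forall>T L N u0 U \<delta>. NL T L N \<longrightarrow> 0 < \<delta> \<longrightarrow> \<delta> \<le> T \<longrightarrow> \<delta> \<le> 1 \<longrightarrow> bb (-a1) U u0 \<longrightarrow>
     (\<forall>v B. 1 \<le> B \<longrightarrow> wb \<delta> B v \<longrightarrow> wb \<delta> (C * U + C * L * B ^ p * \<delta> powr eps) (Phi u0 N v))"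
  proof (intro exI[of _ C] conjI C(1) allI impI)
    fix T L N u0 U \<delta> v B
    assume N: "NL T L N" and \<delta>: "0 < \<delta>" "\<delta> \<le> T" "\<delta> \<le> 1" and U: "bb (-a1) U u0" and B: "1 \<le> B" and v: "wb \<delta> B v"
    note F = wb_FB[OF N v B \<delta>(2)]
    have L: "L \<ge> 0" using N by (simp add: NL_def)
    have U0: "U \<ge> 0" using bb_nonneg[OF U] .
    show "wb \<delta> (C * U + C * L * B ^ p * \<delta> powr eps) (Phi u0 N v)"
      unfolding wb_def
    proof (intro conjI ballI)
      show "cf {0<..\<delta>} (Phi u0 N v)" using duh_cf[OF F pga] unfolding cf_def Phi_def by (auto intro!: continuous_intros)
      fix t assume t: "t \<in> {0<..\<delta>}"
      have 1: "bb be (C1 * t powr (- ((be - - a1) / 2)) * U) (mul (hs \<mu> t) u0)"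
        using t a1b a1 be by (intro C1(2) U) auto
      have 1: "bb be (C * U * t powr (-ga)) (mul (hs \<mu> t) u0)"
      proof (rule bb_mono[OF 1])
        \<comment> \<open>Here \<delta> \<le> 1 is used: a larger exponent of 1/t gives a larger
          weight.\<close>
        have "t powr (- ((be - - a1) / 2)) \<le> t powr (-ga)" using gam t \<delta> by (intro powr_mono') (auto simp: add.commute)
        then have "C1 * t powr (- ((be - - a1) / 2)) * U \<le> C * t powr (-ga) * U"
          using C C1 U0 by (intro mult_right_mono mult_mono) auto
        then show "C1 * t powr (- ((be - - a1) / 2)) * U \<le> C * U * t powr (-ga)" by (simp add: mult_ac)
      qed
      have 2: "bb be (C2 * (L * B ^ p) * \<delta> powr eps * t powr (-ga)) (duhamel \<mu> (\<lambda>s. N s (v s)) t)"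
        using t F L B by (intro D2) auto
      have 2: "bb be (C * L * B ^ p * \<delta> powr eps * t powr (-ga)) (duhamel \<mu> (\<lambda>s. N s (v s)) t)"
        by (rule bb_mono[OF 2]) (use C L B in \<open>simp only: mult.assoc[symmetric], intro mult_right_mono, auto\<close>)
      from bb_add[OF 1 2] show "bb be ((C * U + C * L * B ^ p * \<delta> powr eps) * t powr (-ga)) (Phi u0 N v t)"
        by (simp add: Phi_def[abs_def] mul_def distrib_right)
    qed
  qed
  show "\<exists>C\<ge>1. lipschitz_const C" unfolding lipschitz_const_def
  proof (intro exI[of _ C2] conjI C2(1) allI impI ballI)
    fix T L N u0 \<delta> v w B d t
    assume N: "NL T L N" and \<delta>: "0 < \<delta>" "\<delta> \<le> T" and B: "1 \<le> B" "0 \<le> d" and v: "wb \<delta> B v" and w: "wb \<delta> B w"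
      and d: "\<forall>t\<in>{0<..\<delta>}. bb be (d * t powr (-ga)) (\<lambda>k. v t k - w t k)" and t: "t \<in> {0<..\<delta>}"
    have L: "L \<ge> 0" using N by (simp add: NL_def)
    note F = wb_FB[OF N v B(1) \<delta>(2)] and G = wb_FB[OF N w B(1) \<delta>(2)]
    have "sing_bound (-al) (real p * ga) (L * B ^ (p - 1) * d) \<delta> (\<lambda>s k. N s (v s) k - N s (w s) k)"
      unfolding sing_bound_def
    proof (intro conjI ballI)
      show "cf {0<..\<delta>} (\<lambda>s k. N s (v s) k - N s (w s) k)"
        using F G unfolding sing_bound_def cf_def by (auto intro!: continuous_intros)
      fix s assume "s \<in> {0<..\<delta>}"
      then show "bb (-al) (L * B ^ (p - 1) * d * s powr (- (real p * ga))) (\<lambda>k. N s (v s) k - N s (w s) k)"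
        using N v w d B \<delta> unfolding NL_def wb_def by auto
    qed
    then have "bb be (C2 * (L * B ^ (p - 1) * d) * \<delta> powr eps * t powr (-ga)) (duhamel \<mu> (\<lambda>s k. N s (v s) k - N s (w s) k) t)"
      using t L B by (intro D2) auto
    moreover have "duhamel \<mu> (\<lambda>s k. N s (v s) k - N s (w s) k) t = (\<lambda>k. Phi u0 N v t k - Phi u0 N w t k)"
      using duh_diff[OF FB_sub[OF F] FB_sub[OF G] pga, of t] t by (auto simp: Phi_def)
    ultimately show "bb be (C2 * L * B ^ (p - 1) * \<delta> powr eps * d * t powr (-ga)) (\<lambda>k. Phi u0 N v t k - Phi u0 N w t k)"
      by (simp add: mult_ac)
  qed
qed

section \<open>Local fixed points, restarting and continuation\<close>

lemma local_exist:
  assumes "L \<ge> 0" "U \<ge> 0"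
  shows "\<exists>\<delta>0>0. \<forall>T N u0. 0 < T \<longrightarrow> NL T L N \<longrightarrow> bb (-a1) U u0 \<longrightarrow> (\<exists>v. sol u0 N (min \<delta>0 T) v)"
proof -
  obtain C1 where C1: "C1 \<ge> 1" "\<And>T L N u0 U \<delta> v B. NL T L N \<Longrightarrow> 0 < \<delta> \<Longrightarrow> \<delta> \<le> T \<Longrightarrow> \<delta> \<le> 1 \<Longrightarrow> bb (-a1) U u0 \<Longrightarrow>
     1 \<le> B \<Longrightarrow> wb \<delta> B v \<Longrightarrow> wb \<delta> (C1 * U + C1 * L * B ^ p * \<delta> powr eps) (Phi u0 N v)"
    using Phi_estimates(1) by blast
  obtain C2 where C2: "C2 \<ge> 1" "lipschitz_const C2" using Phi_estimates(2) by blast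
  note lip = C2(2)[unfolded lipschitz_const_def, rule_format]
  \<comment> \<open>The ball has room for the free evolution C1 * U with at least 1/2 to spare. The
    number q then bounds both the nonlinear term and the Lipschitz constant on this ball by
    1/2.\<close>
  define B where "B = 1 + 2 * C1 * U"
  have B: "B \<ge> 1" using C1(1) assms by (simp add: B_def)
  define q where "q = 1 / (2 * (C1 + C2) * L * B ^ p + 1)"
  have den: "2 * (C1 + C2) * L * B ^ p \<ge> 0" using C1(1) C2(1) assms B by simp
  have q: "q > 0" "2 * (C1 + C2) * L * B ^ p * q \<le> 1" using den by (auto simp: q_def field_simps)
  define \<delta>0 where "\<delta>0 = min 1 (q powr (1 / eps))"
  have \<delta>0: "\<delta>0 > 0" "\<delta>0 \<le> 1" using q(1) by (auto simp: \<delta>0_def)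
  have small: "\<delta> powr eps \<le> q" if "0 < \<delta>" "\<delta> \<le> \<delta>0" for \<delta>
  proof -
    have "\<delta> powr eps \<le> (q powr (1 / eps)) powr eps" using that eps_pos by (intro powr_mono2) (auto simp: \<delta>0_def)
    also have "\<dots> = q" using q eps_pos by (simp add: powr_powr)
    finally show ?thesis .
  qed
  have "\<exists>v. sol u0 N (min \<delta>0 T) v" if T: "0 < T" and N: "NL T L N" and u0: "bb (-a1) U u0" for T N u0
  proof -
    define \<delta> where "\<delta> = min \<delta>0 T"
    have \<delta>: "0 < \<delta>" "\<delta> \<le> T" "\<delta> \<le> 1" "\<delta> \<le> \<delta>0" using T \<delta>0 by (auto simp: \<delta>_def)
    have dq: "\<delta> powr eps \<le> q" by (rule small[OF \<delta>(1,4)])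
    have Bp: "B ^ (p - 1) \<le> B ^ p" using B by (intro power_increasing) auto
    have ge: "C1 * L * B ^ p * \<delta> powr eps \<le> 1 / 2"
    proof -
      have "C1 * L * B ^ p * \<delta> powr eps \<le> (C1 + C2) * L * B ^ p * q"
        using C1(1) C2(1) assms B dq by (intro mult_mono) auto
      then show ?thesis using q(2) by linarith
    qed
    have ge2: "C2 * L * B ^ (p - 1) * \<delta> powr eps \<le> 1 / 2"
    proof -
      have "C2 * L * B ^ (p - 1) * \<delta> powr eps \<le> (C1 + C2) * L * B ^ p * q"
        using C1(1) C2(1) assms B dq Bp by (intro mult_mono) auto
      then show ?thesis using q(2) by linarith
    qed
    have map: "wb \<delta> B (Phi u0 N v)" if "wb \<delta> B v" for v
    proof (rule wb_mono[OF C1(2)[OF N \<delta>(1-3) u0 B that]])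
      have "0 \<le> C1 * U" using C1(1) assms by simp
      moreover have "B = 1 + 2 * (C1 * U)" by (simp add: B_def)
      ultimately show "C1 * U + C1 * L * B ^ p * \<delta> powr eps \<le> B" using ge by linarith
    qed
    have contr: "\<forall>t\<in>{0<..\<delta>}. bb be (d / 2 * t powr (-ga)) (\<lambda>k. Phi u0 N v t k - Phi u0 N w t k)"
      if "wb \<delta> B v" "wb \<delta> B w" "0 \<le> d" "\<forall>t\<in>{0<..\<delta>}. bb be (d * t powr (-ga)) (\<lambda>k. v t k - w t k)" for v w d
    proof
      fix t assume t: "t \<in> {0<..\<delta>}"
      have "C2 * L * B ^ (p - 1) * \<delta> powr eps * d * t powr (-ga) \<le> 1 / 2 * d * t powr (-ga)"
        using ge2 that(3) by (intro mult_right_mono) auto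
      then show "bb be (d / 2 * t powr (-ga)) (\<lambda>k. Phi u0 N v t k - Phi u0 N w t k)"
        by (intro bb_mono[OF lip[OF N \<delta>(1,2) B that(3,1,2) bspec[OF that(4)] t]]) linarith+
    qed
    define V where "V n = (Phi u0 N ^^ n) (\<lambda>t k. 0)" for n
    have VS: "V (Suc n) = Phi u0 N (V n)" for n by (simp add: V_def)
    have V0: "wb \<delta> B (V 0)" using B by (auto simp: V_def wb_def cf_def intro!: bb_zero)
    have Vw: "wb \<delta> B (V n)" for n by (induction n) (use V0 map VS in auto)
    have Vd: "\<forall>t\<in>{0<..\<delta>}. bb be (2 * B * (1/2) ^ n * t powr (-ga)) (\<lambda>k. V (Suc n) t k - V n t k)" for n
    proof (induction n)
      case 0
      then show ?case using Vw[of 0] Vw[of 1] unfolding wb_def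
        by (auto intro!: bb_mono[OF bb_diff, of be "B * _ powr (-ga)" _ "B * _ powr (-ga)"])
    next
      case (Suc n)
      then show ?case unfolding VS[of "Suc n"] using contr[OF Vw Vw _ Suc] B by (simp add: VS)
    qed
    have Vnm: "bb be (4 * B * (1/2) ^ n * t powr (-ga)) (\<lambda>k. V (n + m) t k - V n t k)" if t: "t \<in> {0<..\<delta>}" for n m t
    proof -
      have "bb be ((\<Sum>i<m. 2 * B * (1/2) ^ (n + i) * t powr (-ga))) (\<lambda>k. \<Sum>i<m. (V (Suc (n + i)) t k - V (n + i) t k))"
        using Vd t by (intro bb_sum) auto
      moreover have "(\<Sum>i<m. (V (Suc (n + i)) t k - V (n + i) t k)) = V (n + m) t k - V n t k" for k
        using sum_lessThan_telescope[of "\<lambda>i. V (n + i) t k" m] by simp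
      moreover have "(\<Sum>i<m. 2 * B * (1/2) ^ (n + i) * t powr (-ga)) \<le> 4 * B * (1/2) ^ n * t powr (-ga)"
      proof -
        have "(\<Sum>i<m. (1/2::real) ^ i) \<le> 2" by (simp add: sum_gp_strict)
        then have "2 * B * (1/2) ^ n * t powr (-ga) * (\<Sum>i<m. (1/2::real) ^ i) \<le> 2 * B * (1/2) ^ n * t powr (-ga) * 2"
          using B by (intro mult_left_mono) auto
        then show ?thesis by (simp add: sum_distrib_left power_add mult_ac)
      qed
      ultimately show ?thesis by (auto intro: bb_mono)
    qed
    \<comment> \<open>The limit is taken coefficient by coefficient; \<open>bb_limit\<close> shows
      that it inherits the bounds of the iterates and their geometric rate.\<close>
    define v where "v t k = lim (\<lambda>n. V n t k)" for t k
    have lim: "(\<lambda>n. V n t k) \<longlonglongrightarrow> v t k" if t: "t \<in> {0<..\<delta>}" for t k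
    proof -
      obtain c where c: "c \<ge> 0" "\<And>f B. bb be B f \<Longrightarrow> cmod (f k) \<le> c * B" using bb_coeff[of be k] by blast
      have "Cauchy (\<lambda>n. V n t k)"
      proof (rule metric_CauchyI)
        fix e :: real assume e: "e > 0"
        have "(\<lambda>n. c * (4 * B * (1/2) ^ n * t powr (-ga))) \<longlonglongrightarrow> c * (4 * B * 0 * t powr (-ga))"
          by (intro tendsto_intros LIMSEQ_realpow_zero) auto
        then have "\<forall>\<^sub>F n in sequentially. c * (4 * B * (1/2) ^ n * t powr (-ga)) < e / 2"
          using e by (intro order_tendstoD(2)) auto
        then obtain M where M: "c * (4 * B * (1/2) ^ M * t powr (-ga)) < e / 2" unfolding eventually_sequentially by blast
        have near: "dist (V n t k) (V M t k) < e / 2" if "n \<ge> M" for n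
          using c(2)[OF Vnm[OF t, of M "n - M"]] M that by (simp add: dist_norm)
        have "dist (V m t k) (V n t k) < e" if "m \<ge> M" "n \<ge> M" for m n
          using near[OF that(1)] near[OF that(2)]
            dist_triangle2[of "V m t k" "V n t k" "V M t k"] by linarith
        then show "\<exists>M. \<forall>m\<ge>M. \<forall>n\<ge>M. dist (V m t k) (V n t k) < e" by blast
      qed
      then show ?thesis unfolding v_def using Cauchy_convergent_iff convergent_LIMSEQ_iff by blast
    qed
    have vV: "bb be (4 * B * (1/2) ^ n * t powr (-ga)) (\<lambda>k. v t k - V n t k)" if t: "t \<in> {0<..\<delta>}" for n t
    proof (rule bb_limit[OF Vnm[OF t, of n]])
      have "(\<lambda>m. V (m + n) t k) \<longlonglongrightarrow> v t k" for k by (rule LIMSEQ_ignore_initial_segment[OF lim[OF t]])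
      then show "(\<lambda>m. V (n + m) t k - V n t k) \<longlonglongrightarrow> v t k - V n t k" for k
        by (intro tendsto_intros) (simp add: add.commute)
    qed
    have vw: "wb \<delta> B v" unfolding wb_def
    proof (intro conjI ballI)
      show "bb be (B * t powr (-ga)) (v t)" if "t \<in> {0<..\<delta>}" for t
        by (rule bb_limit[OF _ lim[OF that]]) (use Vw that in \<open>auto simp: wb_def\<close>)
      show "cf {0<..\<delta>} v"
      proof (rule cf_local)
        fix r assume r: "0 < r" "r < \<delta>"
        show "cf {r..\<delta>} v"
        proof (rule cf_lim)
          show "cf {r..\<delta>} (V n)" for n using Vw[of n] r unfolding wb_def by (auto elim: cf_subset)
          fix k and e :: real assume e: "e > 0"
          obtain c where c: "c \<ge> 0" "\<And>f B. bb be B f \<Longrightarrow> cmod (f k) \<le> c * B" using bb_coeff[of be k] by blast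
          have "(\<lambda>n. c * (4 * B * (1/2) ^ n * r powr (-ga))) \<longlonglongrightarrow> c * (4 * B * 0 * r powr (-ga))"
            by (intro tendsto_intros LIMSEQ_realpow_zero) auto
          then have "\<forall>\<^sub>F n in sequentially. c * (4 * B * (1/2) ^ n * r powr (-ga)) < e"
            using e by (intro order_tendstoD(2)) auto
          then obtain n where n: "c * (4 * B * (1/2) ^ n * r powr (-ga)) < e" unfolding eventually_sequentially by blast
          have "cmod (V n t k - v t k) < e" if t: "t \<in> {r..\<delta>}" for t
          proof -
            have "t powr (-ga) \<le> r powr (-ga)" using t r ga by (intro powr_mono2') auto
            then have "c * (4 * B * (1/2) ^ n * t powr (-ga)) \<le> c * (4 * B * (1/2) ^ n * r powr (-ga))"
              using c(1) B by (intro mult_left_mono) auto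
            moreover have "cmod (v t k - V n t k) \<le> c * (4 * B * (1/2) ^ n * t powr (-ga))"
              using t r by (intro c(2) vV) auto
            ultimately show ?thesis using n norm_minus_commute[of "V n t k" "v t k"] by linarith
          qed
          then show "\<exists>N. \<forall>t\<in>{r..\<delta>}. cmod (V N t k - v t k) < e" by blast
        qed
      qed
    qed
    have "v t = Phi u0 N v t" if t: "t \<in> {0<..\<delta>}" for t
    proof (rule bb_eq[of be])
      fix e :: real assume e: "e > 0"
      have "(\<lambda>n. 4 * B * (1/2) ^ n * t powr (-ga)) \<longlonglongrightarrow> 4 * B * 0 * t powr (-ga)"
        by (intro tendsto_intros LIMSEQ_realpow_zero) auto
      then have "\<forall>\<^sub>F n in sequentially. 4 * B * (1/2) ^ n * t powr (-ga) < e"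
        using e by (intro order_tendstoD(2)) auto
      then obtain n where n: "4 * B * (1/2) ^ n * t powr (-ga) < e" unfolding eventually_sequentially by blast
      have 1: "bb be (4 * B * (1/2) ^ n / 2 * t powr (-ga)) (\<lambda>k. Phi u0 N v t k - Phi u0 N (V n) t k)"
        using contr[OF vw Vw, of "4 * B * (1/2) ^ n" n] vV t B by auto
      have 2: "bb be (4 * B * (1/2) ^ Suc n * t powr (-ga)) (\<lambda>k. v t k - V (Suc n) t k)" by (rule vV[OF t])
      from bb_diff[OF 2 1] have "bb be (4 * B * (1/2) ^ Suc n * t powr (-ga) + 4 * B * (1/2) ^ n / 2 * t powr (-ga)) (\<lambda>k. v t k - Phi u0 N v t k)"
        by (simp add: VS)
      then show "bb be e (\<lambda>k. v t k - Phi u0 N v t k)"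
      proof (rule bb_mono)
        have "4 * B * (1/2) ^ Suc n * t powr (-ga) + 4 * B * (1/2) ^ n / 2 * t powr (-ga) = 4 * B * (1/2) ^ n * t powr (-ga)"
          by simp
        then show "4 * B * (1/2) ^ Suc n * t powr (-ga) + 4 * B * (1/2) ^ n / 2 * t powr (-ga) \<le> e" using n by linarith
      qed
    qed
    then show ?thesis using vw B unfolding sol_def \<delta>_def[symmetric] by blast
  qed
  then show ?thesis using \<delta>0(1) by blast
qed

lemma local_unique:
  assumes "L \<ge> 0" "B \<ge> 1"
  shows "\<exists>\<delta>0>0. \<forall>T N u0 v w. 0 < T \<longrightarrow> NL T L N \<longrightarrow> wb T B v \<longrightarrow> wb T B w \<longrightarrow>
     (\<forall>t\<in>{0<..T}. v t = Phi u0 N v t) \<longrightarrow> (\<forall>t\<in>{0<..T}. w t = Phi u0 N w t) \<longrightarrow> (\<forall>t\<in>{0<..min \<delta>0 T}. v t = w t)"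
proof -
  obtain C2 where C2: "C2 \<ge> 1" "lipschitz_const C2" using Phi_estimates(2) by blast
  note lip = C2(2)[unfolded lipschitz_const_def, rule_format]
  define q where "q = 1 / (2 * C2 * L * B ^ (p - 1) + 1)"
  have den: "2 * C2 * L * B ^ (p - 1) \<ge> 0" using C2(1) assms by simp
  have q: "q > 0" "C2 * L * B ^ (p - 1) * q \<le> 1 / 2" using den by (auto simp: q_def field_simps)
  define \<delta>0 where "\<delta>0 = q powr (1 / eps)"
  have \<delta>0: "\<delta>0 > 0" using q(1) by (auto simp: \<delta>0_def)
  have "\<forall>t\<in>{0<..min \<delta>0 T}. v t = w t"
    if T: "0 < T" and N: "NL T L N" and v: "wb T B v" and w: "wb T B w" and
      eq: "\<forall>t\<in>{0<..T}. v t = Phi u0 N v t" "\<forall>t\<in>{0<..T}. w t = Phi u0 N w t" for T N u0 v w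
  proof
    define \<delta> where "\<delta> = min \<delta>0 T"
    have \<delta>: "0 < \<delta>" "\<delta> \<le> T" "\<delta> \<le> \<delta>0" using T \<delta>0 by (auto simp: \<delta>_def)
    have "\<delta> powr eps \<le> (q powr (1 / eps)) powr eps" using \<delta> eps_pos by (intro powr_mono2) (auto simp: \<delta>0_def)
    also have "\<dots> = q" using q eps_pos by (simp add: powr_powr)
    finally have "C2 * L * B ^ (p - 1) * \<delta> powr eps \<le> C2 * L * B ^ (p - 1) * q" using den by (intro mult_left_mono) auto
    then have half: "C2 * L * B ^ (p - 1) * \<delta> powr eps \<le> 1 / 2" using q(2) by linarith
    have vw: "wb \<delta> B v" "wb \<delta> B w" using v w \<delta> wb_sub by blast+
    have it: "\<forall>t\<in>{0<..\<delta>}. bb be (2 * B * (1/2) ^ n * t powr (-ga)) (\<lambda>k. v t k - w t k)" for n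
    proof (induction n)
      case 0
      then show ?case using vw unfolding wb_def
        by (auto intro!: bb_mono[OF bb_diff, of be "B * _ powr (-ga)" _ "B * _ powr (-ga)"])
    next
      case (Suc n)
      show ?case
      proof
        fix t assume t: "t \<in> {0<..\<delta>}"
        let ?d = "2 * B * (1/2) ^ n"
        have "bb be (C2 * L * B ^ (p - 1) * \<delta> powr eps * ?d * t powr (-ga)) (\<lambda>k. Phi u0 N v t k - Phi u0 N w t k)"
          using lip[OF N \<delta>(1,2) assms(2) _ vw bspec[OF Suc] t] assms by auto
        moreover have "C2 * L * B ^ (p - 1) * \<delta> powr eps * ?d * t powr (-ga) \<le> 1/2 * ?d * t powr (-ga)"
          using half assms by (intro mult_right_mono) auto
        moreover have "v t = Phi u0 N v t" "w t = Phi u0 N w t" using eq t \<delta> by auto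
        ultimately show "bb be (2 * B * (1/2) ^ Suc n * t powr (-ga)) (\<lambda>k. v t k - w t k)"
          by (auto intro: bb_mono)
      qed
    qed
    fix t assume t: "t \<in> {0<..min \<delta>0 T}"
    show "v t = w t"
    proof (rule bb_eq[of be])
      fix e :: real assume e: "e > 0"
      have "(\<lambda>n. 2 * B * (1/2) ^ n * t powr (-ga)) \<longlonglongrightarrow> 2 * B * 0 * t powr (-ga)"
        by (intro tendsto_intros LIMSEQ_realpow_zero) auto
      then have "\<forall>\<^sub>F n in sequentially. 2 * B * (1/2) ^ n * t powr (-ga) < e"
        using e by (intro order_tendstoD(2)) auto
      then obtain n where "2 * B * (1/2) ^ n * t powr (-ga) < e" unfolding eventually_sequentially by blast
      then show "bb be e (\<lambda>k. v t k - w t k)" using it[of n] t unfolding \<delta>_def by (meson bb_mono less_imp_le)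
    qed
  qed
  then show ?thesis using \<delta>0 by blast
qed

text \<open>A bound B * t powr (-ga) is rewritten as B * z t times (r + t) powr (-ga), with z t
  \<ge> 1. The nonlinearity then returns z t ^ p, exactly the factor that restores the weight t powr
  (- p * ga).\<close>

lemma NL_shift: assumes N: "NL T L N" and r: "0 \<le> r" shows "NL (T - r) L (\<lambda>t. N (r + t))"
proof -
  have L: "L \<ge> 0" using N by (simp add: NL_def)
  define z where "z t = ((r + t) / t) powr ga" for t
  have z1: "1 \<le> z t" if "0 < t" for t using that r ga by (auto simp: z_def intro!: ge_one_powr_ge_zero)
  have zt: "z t * (r + t) powr (-ga) = t powr (-ga)" if "0 < t" for t
    using that r by (simp add: z_def powr_divide powr_minus field_simps)
  have zp: "z t ^ p * (r + t) powr (- (real p * ga)) = t powr (- (real p * ga))" if "0 < t" for t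
  proof -
    have "z t ^ p * ((r + t) powr (-ga)) ^ p = (t powr (-ga)) ^ p" by (simp only: zt[OF that] flip: power_mult_distrib)
    moreover have "(x powr (-ga)) ^ p = x powr (- (real p * ga))" if "x > 0" for x
      using that by (simp add: powr_realpow[symmetric] powr_powr mult.commute)
    ultimately show ?thesis using that r by simp
  qed
  have pp: "x * x ^ (p - 1) = x ^ p" for x :: real using p by (cases p) auto
  show ?thesis unfolding NL_def
  proof (intro conjI allI impI L)
    fix t v B assume t: "0 < t" "t \<le> T - r" and B: "1 \<le> B" and v: "bb be (B * t powr (-ga)) v"
    have "bb be ((B * z t) * (r + t) powr (-ga)) v" using v zt[OF t(1)] by (simp add: mult.assoc)
    moreover have "1 \<le> B * z t" using B z1[OF t(1)] mult_mono[of 1 B 1 "z t"] by simp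
    ultimately have "bb (-al) (L * (B * z t) ^ p * (r + t) powr (- (real p * ga))) (N (r + t) v)"
      using N t r unfolding NL_def by auto
    then show "bb (-al) (L * B ^ p * t powr (- (real p * ga))) (N (r + t) v)"
      using zp[OF t(1)] by (simp add: power_mult_distrib mult.assoc)
  next
    fix t v w B d assume t: "0 < t" "t \<le> T - r" and B: "1 \<le> B" and v: "bb be (B * t powr (-ga)) v" "bb be (B * t powr (-ga)) w"
      and d: "bb be (d * t powr (-ga)) (\<lambda>k. v k - w k)"
    have "bb be ((B * z t) * (r + t) powr (-ga)) v" "bb be ((B * z t) * (r + t) powr (-ga)) w"
      "bb be ((d * z t) * (r + t) powr (-ga)) (\<lambda>k. v k - w k)" using v d zt[OF t(1)] by (auto simp: mult.assoc)
    moreover have "1 \<le> B * z t" using B z1[OF t(1)] mult_mono[of 1 B 1 "z t"] by simp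
    ultimately have bd: "bb (-al) (L * (B * z t) ^ (p - 1) * (d * z t) * (r + t) powr (- (real p * ga))) (\<lambda>k. N (r + t) v k - N (r + t) w k)"
      using t r by (intro N[unfolded NL_def, THEN conjunct2, THEN conjunct2, THEN conjunct1, rule_format]) auto
    have "(L * (B * z t) ^ (p - 1)) * (d * z t) * y = L * B ^ (p - 1) * d * ((z t * z t ^ (p - 1)) * y)" for y
      by (simp only: power_mult_distrib mult_ac)
    then have "L * (B * z t) ^ (p - 1) * (d * z t) * (r + t) powr (- (real p * ga)) = L * B ^ (p - 1) * d * t powr (- (real p * ga))"
      by (simp only: pp zp[OF t(1)])
    then show "bb (-al) (L * B ^ (p - 1) * d * t powr (- (real p * ga))) (\<lambda>k. N (r + t) v k - N (r + t) w k)"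
      using bd by (simp only:)
  next
    fix r' v B assume r': "0 < r'" "r' < T - r" and v: "cf {r'..T - r} v" "\<forall>t\<in>{r'..T - r}. bb be B (v t)"
    have cv: "continuous_on {r'..T - r} (\<lambda>t. v t k)" for k using v(1) unfolding cf_def by blast
    have "cf {r + r'..T} (\<lambda>t. v (t - r))"
      unfolding cf_def by (intro allI continuous_on_compose2[OF cv]) (auto intro!: continuous_intros)
    then have "cf {r + r'..T} (\<lambda>t. N t (v (t - r)))"
      by (intro N[unfolded NL_def, THEN conjunct2, THEN conjunct2, THEN conjunct2, rule_format, of "r + r'" "\<lambda>t. v (t - r)" B])
         (use v(2) r r' in auto)
    then have c: "continuous_on {r + r'..T} (\<lambda>t. N t (v (t - r)) k)" for k unfolding cf_def by blast
    have "continuous_on {r'..T - r} (\<lambda>t. N (r + t) (v (r + t - r)) k)" for k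
      by (rule continuous_on_compose2[OF c]) (auto intro!: continuous_intros)
    then show "cf {r'..T - r} (\<lambda>t. N (r + t) (v t))" by (simp add: cf_def)
  qed
qed

lemma wb_shift: assumes v: "wb T B v" and r: "0 \<le> r" and B: "0 \<le> B" shows "wb (T - r) B (\<lambda>t. v (r + t))"
  unfolding wb_def
proof (intro conjI ballI)
  have c: "continuous_on {0<..T} (\<lambda>t. v t k)" for k using v unfolding wb_def cf_def by blast
  show "cf {0<..T - r} (\<lambda>t. v (r + t))" unfolding cf_def
    by (intro allI continuous_on_compose2[OF c]) (use r in \<open>auto intro!: continuous_intros\<close>)
  fix t assume t: "t \<in> {0<..T - r}"
  then have "bb be (B * (r + t) powr (-ga)) (v (r + t))" using v r unfolding wb_def by auto
  then show "bb be (B * t powr (-ga)) (v (r + t))"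
    by (rule bb_mono) (use t r ga B in \<open>auto intro!: mult_left_mono powr_mono2'\<close>)
qed

lemma Phi_shift:
  assumes N: "NL T L N" and v: "wb T B v" "1 \<le> B" and r: "0 < r" and t: "0 < t" "r + t \<le> T"
    and eq: "v r = Phi u0 N v r"
  shows "Phi u0 N v (r + t) = Phi (v r) (\<lambda>t. N (r + t)) (\<lambda>t. v (r + t)) t"
proof
  fix k
  note F = FB_sub[OF wb_FB[OF N v order_refl] t(2)]
  have "v r k = hs \<mu> r k * u0 k + duhamel \<mu> (\<lambda>s. N s (v s)) r k" by (subst eq) (simp add: Phi_def)
  then show "Phi u0 N v (r + t) k = Phi (v r) (\<lambda>t. N (r + t)) (\<lambda>t. v (r + t)) t k"
    using duh_split[OF F pga] r t hs_add[of \<mu> r t k] by (simp add: Phi_def algebra_simps)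
qed

lemma sol_shift:
  assumes N: "NL T L N" and v: "sol u0 N T v" and r: "0 < r" "r < T"
  shows "sol (v r) (\<lambda>t. N (r + t)) (T - r) (\<lambda>t. v (r + t))"
proof -
  obtain B where B: "B \<ge> 1" "wb T B v" using v unfolding sol_def by blast
  have eq: "\<And>t. t \<in> {0<..T} \<Longrightarrow> v t = Phi u0 N v t" using v unfolding sol_def by blast
  have "v (r + t) = Phi (v r) (\<lambda>t. N (r + t)) (\<lambda>t. v (r + t)) t" if t: "t \<in> {0<..T - r}" for t
    using Phi_shift[OF N B(2,1) r(1), of t u0] eq[of "r + t"] eq[of r] t r by simp
  moreover have "wb (T - r) B (\<lambda>t. v (r + t))" using B r by (intro wb_shift) auto
  ultimately show ?thesis unfolding sol_def using B(1) by blast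
qed

text \<open>The time of local uniqueness depends on L and B alone, and by \<open>wb_shift\<close>
  restarted solutions keep the same B, so finitely many steps of equal length reach T.\<close>

lemma unique:
  assumes N: "NL T L N" and v: "sol u0 N T v" and w: "sol u0 N T w"
  shows "\<forall>t\<in>{0<..T}. v t = w t"
proof (cases "T > 0")
  case True
  obtain B1 B2 where "B1 \<ge> 1" "wb T B1 v" "B2 \<ge> 1" "wb T B2 w" using v w unfolding sol_def by blast
  then obtain B where B: "B \<ge> 1" "wb T B v" "wb T B w" using wb_mono[of T B1 v "max B1 B2"] wb_mono[of T B2 w "max B1 B2"]
    by (metis max.cobounded1 max.cobounded2 order_trans)
  have L: "L \<ge> 0" using N by (simp add: NL_def)
  obtain \<delta> where \<delta>: "\<delta> > 0" "\<And>T N u0 v w. 0 < T \<Longrightarrow> NL T L N \<Longrightarrow> wb T B v \<Longrightarrow> wb T B w \<Longrightarrow>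
     (\<forall>t\<in>{0<..T}. v t = Phi u0 N v t) \<Longrightarrow> (\<forall>t\<in>{0<..T}. w t = Phi u0 N w t) \<Longrightarrow> (\<forall>t\<in>{0<..min \<delta> T}. v t = w t)"
    using local_unique[OF L B(1)] by blast
  have eqs: "\<forall>t\<in>{0<..T}. v t = Phi u0 N v t" "\<forall>t\<in>{0<..T}. w t = Phi u0 N w t" using v w unfolding sol_def by auto
  have "\<forall>t\<in>{0<..min (real (Suc j) * \<delta>) T}. v t = w t" for j
  proof (induction j)
    case 0
    then show ?case using \<delta>(2)[OF True N B(2,3) eqs] by simp
  next
    case (Suc j)
    let ?r = "real (Suc j) * \<delta>"
    show ?case
    proof (cases "?r < T")
      case rT: True
      have r: "0 < ?r" using \<delta>(1) by simp
      have vr: "v ?r = w ?r" using Suc rT r by auto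
      have "wb (T - ?r) B (\<lambda>t. v (?r + t))" "wb (T - ?r) B (\<lambda>t. w (?r + t))" using B r by (auto intro!: wb_shift)
      moreover have "\<forall>t\<in>{0<..T - ?r}. v (?r + t) = Phi (v ?r) (\<lambda>t. N (?r + t)) (\<lambda>t. v (?r + t)) t"
        using sol_shift[OF N v r rT] unfolding sol_def by blast
      moreover have "\<forall>t\<in>{0<..T - ?r}. w (?r + t) = Phi (v ?r) (\<lambda>t. N (?r + t)) (\<lambda>t. w (?r + t)) t"
        using sol_shift[OF N w r rT] unfolding sol_def vr by blast
      ultimately have *: "\<forall>t\<in>{0<..min \<delta> (T - ?r)}. v (?r + t) = w (?r + t)"
        using rT by (intro \<delta>(2)[OF _ NL_shift[OF N]]) (use r in auto)
      show ?thesis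
      proof
        fix t assume t: "t \<in> {0<..min (real (Suc (Suc j)) * \<delta>) T}"
        show "v t = w t"
        proof (cases "t \<le> ?r")
          case True
          then show ?thesis using Suc t by auto
        next
          case False
          then have "t - ?r \<in> {0<..min \<delta> (T - ?r)}" using t by (auto simp: algebra_simps)
          then show ?thesis using * by fastforce
        qed
      qed
    next
      case False
      then have "t \<in> {0<..min ?r T}" if "t \<in> {0<..min (real (Suc (Suc j)) * \<delta>) T}" for t using that by auto
      then show ?thesis using Suc by blast
    qed
  qed
  moreover obtain j :: nat where "T < real (Suc j) * \<delta>"
    using reals_Archimedean3[OF \<delta>(1)] by (metis less_trans lessI mult_strict_right_mono of_nat_less_iff \<delta>(1))
  ultimately show ?thesis by (metis less_imp_le min.absorb2)
qed auto

text \<open>The new piece starts at r < T rather than at T. The two pieces then overlap and agree by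
  uniqueness, so continuity at T is automatic, and after T the singularity of the new piece at its
  start is already a positive time away.\<close>

lemma extend:
  assumes N: "NL T' L N" and v: "sol u0 N T v" and r: "0 < r" "r < T" and T': "T' = r + \<delta>" "T \<le> T'"
    and w: "sol (v r) (\<lambda>t. N (r + t)) \<delta> w"
  shows "\<exists>v'. sol u0 N T' v'"
proof -
  have NT: "NL T L N" by (rule NL_sub[OF N T'(2)])
  have sh: "sol (v r) (\<lambda>t. N (r + t)) (T - r) (\<lambda>t. v (r + t))" by (rule sol_shift[OF NT v r])
  have agree: "v (r + t) = w t" if "t \<in> {0<..T - r}" for t
    using unique[OF NL_shift[OF NT, of r] sh sol_sub[OF w, of "T - r"]] that r T' by auto
  obtain B1 B2 where B: "B1 \<ge> 1" "wb T B1 v" "B2 \<ge> 1" "wb \<delta> B2 w" using v w unfolding sol_def by blast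
  define v' where "v' t = (if t \<le> T then v t else w (t - r))" for t
  have v'w: "v' (r + t) = w t" if "0 < t" for t
    using agree[of t] that by (auto simp: v'_def)
  have v'v: "v' t = v t" if "t \<le> T" for t using that by (simp add: v'_def)
  \<comment> \<open>For t > T one has t - r > T - r, which bounds the singular weight of
    \<open>w\<close>; the factor T' powr ga converts that constant into a multiple of t powr
    (-ga).\<close>
  define B where "B = B1 + B2 * (T - r) powr (-ga) * T' powr ga"
  have Tp: "0 < T'" using r T' by simp
  have Bge: "B1 \<le> B" "B \<ge> 1" "B2 * (T - r) powr (-ga) * T' powr ga \<le> B" using B(1,3) by (auto simp: B_def intro!: add_increasing2)
  have "wb T' B v'" unfolding wb_def
  proof (intro conjI ballI)
    show "cf {0<..T'} v'"
    proof (rule cf_open_cover)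
      fix t assume t: "t \<in> {0<..T'}"
      show "\<exists>U. open U \<and> t \<in> U \<and> cf ({0<..T'} \<inter> U) v'"
      proof (cases "t < T")
        case True
        have "cf {0<..T} v" using B(2) unfolding wb_def by blast
        then have "cf ({0<..T'} \<inter> {..<T}) v" by (rule cf_subset) auto
        moreover have "continuous_on ({0<..T'} \<inter> {..<T}) (\<lambda>t. v' t k) = continuous_on ({0<..T'} \<inter> {..<T}) (\<lambda>t. v t k)" for k
          by (intro continuous_on_cong) (auto simp: v'v)
        ultimately have "cf ({0<..T'} \<inter> {..<T}) v'" by (simp add: cf_def)
        then show ?thesis using True by (intro exI[of _ "{..<T}"]) auto
      next
        case False
        have c: "continuous_on {0<..\<delta>} (\<lambda>t. w t k)" for k using B(4) unfolding wb_def cf_def by blast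
        have "continuous_on ({0<..T'} \<inter> {r<..}) (\<lambda>t. w (t - r) k)" for k
          by (rule continuous_on_compose2[OF c]) (use T' in \<open>auto intro!: continuous_intros\<close>)
        moreover have "v' t = w (t - r)" if "t > r" for t using v'w[of "t - r"] that by simp
        moreover from this have "continuous_on ({0<..T'} \<inter> {r<..}) (\<lambda>t. v' t k) = continuous_on ({0<..T'} \<inter> {r<..}) (\<lambda>t. w (t - r) k)" for k
          by (intro continuous_on_cong) auto
        ultimately have "cf ({0<..T'} \<inter> {r<..}) v'" by (simp add: cf_def)
        then show ?thesis using False r by (intro exI[of _ "{r<..}"]) auto
      qed
    qed
    fix t assume t: "t \<in> {0<..T'}"
    show "bb be (B * t powr (-ga)) (v' t)"
    proof (cases "t \<le> T")
      case True
      then have "bb be (B1 * t powr (-ga)) (v t)" using B(2) t unfolding wb_def by auto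
      then have "bb be (B * t powr (-ga)) (v t)" by (rule bb_mono) (use Bge in \<open>auto intro: mult_right_mono\<close>)
      then show ?thesis using True by (simp add: v'v)
    next
      case False
      have "bb be (B2 * (t - r) powr (-ga)) (w (t - r))" using B(4) t False r T' unfolding wb_def by auto
      then have "bb be (B * t powr (-ga)) (w (t - r))"
      proof (rule bb_mono)
        have "(t - r) powr (-ga) \<le> (T - r) powr (-ga)" using False r ga by (intro powr_mono2') auto
        moreover have "1 \<le> T' powr ga * t powr (-ga)"
        proof -
          have "T' powr (-ga) \<le> t powr (-ga)" using t ga by (intro powr_mono2') auto
          then have "T' powr ga * T' powr (-ga) \<le> T' powr ga * t powr (-ga)" by (intro mult_left_mono) auto
          then show ?thesis using Tp by (simp flip: powr_add)
        qed
        ultimately have "B2 * (t - r) powr (-ga) * 1 \<le> B2 * (T - r) powr (-ga) * (T' powr ga * t powr (-ga))"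
          using B(3) by (intro mult_mono) auto
        also have "\<dots> = (B2 * (T - r) powr (-ga) * T' powr ga) * t powr (-ga)" by (simp add: mult_ac)
        also have "\<dots> \<le> B * t powr (-ga)" by (intro mult_right_mono Bge) auto
        finally show "B2 * (t - r) powr (-ga) \<le> B * t powr (-ga)" by simp
      qed
      then show ?thesis using False by (simp add: v'_def)
    qed
  qed
  note wv' = this
  have eqv: "v' t = Phi u0 N v' t" if t: "t \<in> {0<..T}" for t
  proof -
    have "duhamel \<mu> (\<lambda>s. N s (v' s)) t = duhamel \<mu> (\<lambda>s. N s (v s)) t" by (rule duh_cong) (use t in \<open>auto simp: v'v\<close>)
    then have "Phi u0 N v' t = Phi u0 N v t" by (auto simp: Phi_def)
    then show ?thesis using v t unfolding sol_def by (auto simp: v'v)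
  qed
  have "v' t = Phi u0 N v' t" if t: "t \<in> {0<..T'}" for t
  proof (cases "t \<le> T")
    case True then show ?thesis using eqv t by auto
  next
    case False
    define s where "s = t - r"
    have s: "0 < s" "s \<le> \<delta>" "t = r + s" using False r t T' by (auto simp: s_def)
    have vr: "v' r = v r" using r by (simp add: v'v)
    have "Phi u0 N v' (r + s) = Phi (v' r) (\<lambda>t. N (r + t)) (\<lambda>t. v' (r + t)) s"
      by (rule Phi_shift[OF N wv' Bge(2) r(1) s(1)]) (use s t r eqv in auto)
    also have "\<dots> = Phi (v r) (\<lambda>t. N (r + t)) w s"
    proof -
      have "duhamel \<mu> (\<lambda>\<sigma>. N (r + \<sigma>) (v' (r + \<sigma>))) s = duhamel \<mu> (\<lambda>\<sigma>. N (r + \<sigma>) (w \<sigma>)) s"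
        by (rule duh_cong) (auto simp: v'w)
      then show ?thesis by (auto simp: Phi_def vr)
    qed
    also have "\<dots> = w s" using w s unfolding sol_def by auto
    finally show ?thesis using v'w[OF s(1)] s(3) by simp
  qed
  then show ?thesis unfolding sol_def using wv' Bge(2) by blast
qed

text \<open>The a priori hypothesis is phrased from a positive time r with a given bound V on the
  state there. By uniqueness all continuations share that state with the first local solution, so a
  single U1, hence a single step length, serves all of them.\<close>

theorem global_exist:
  assumes N: "NL T L N" and T: "0 < T" and U: "bb (-a1) U u0"
    and apriori: "\<And>r V. 0 < r \<Longrightarrow> r < T \<Longrightarrow> \<exists>U1\<ge>0. \<forall>S v. r < S \<longrightarrow> S \<le> T \<longrightarrow> sol u0 N S v \<longrightarrow> bb be V (v r) \<longrightarrow> (\<forall>t\<in>{r..S}. bb (-a1) U1 (v t))"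
  shows "\<exists>v. sol u0 N T v"
proof -
  have L: "L \<ge> 0" using N by (simp add: NL_def)
  obtain \<delta>0 where \<delta>0: "\<delta>0 > 0" "\<And>T N u0. 0 < T \<Longrightarrow> NL T L N \<Longrightarrow> bb (-a1) U u0 \<Longrightarrow> \<exists>v. sol u0 N (min \<delta>0 T) v"
    using local_exist[OF L bb_nonneg[OF U]] by blast
  define D0 where "D0 = min \<delta>0 T"
  obtain v0 where v0: "sol u0 N D0 v0" using \<delta>0(2)[OF T N U] unfolding D0_def by blast
  have D0: "0 < D0" "D0 \<le> T" using \<delta>0(1) T by (auto simp: D0_def)
  define r where "r = D0 / 2"
  have r: "0 < r" "r < T" "r < D0" using D0 by (auto simp: r_def)
  obtain B0 where B0: "wb D0 B0 v0" using v0 unfolding sol_def by blast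
  define V where "V = B0 * r powr (-ga)"
  have V: "bb be V (v0 r)" using B0 r unfolding wb_def V_def by auto
  obtain U1 where U1: "U1 \<ge> 0" "\<And>S v t. r < S \<Longrightarrow> S \<le> T \<Longrightarrow> sol u0 N S v \<Longrightarrow> bb be V (v r) \<Longrightarrow> t \<in> {r..S} \<Longrightarrow> bb (-a1) U1 (v t)"
    using apriori[OF r(1,2), of V] by blast
  obtain \<delta>1 where \<delta>1: "\<delta>1 > 0" "\<And>T N u0. 0 < T \<Longrightarrow> NL T L N \<Longrightarrow> bb (-a1) U1 u0 \<Longrightarrow> \<exists>v. sol u0 N (min \<delta>1 T) v"
    using local_exist[OF L U1(1)] by blast
  \<comment> \<open>Restarting at S - h and solving for a time \<delta>1 \<ge> 2 * h gains at least
    h, unless T is reached. The bound h \<le> r = D0/2 keeps every restart at or after r.\<close>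
  define h where "h = min (\<delta>1 / 2) r"
  have h: "h > 0" "2 * h \<le> \<delta>1" "h \<le> r" using \<delta>1 r by (auto simp: h_def)
  have "\<exists>v. sol u0 N (min T (D0 + real j * h)) v" for j
  proof (induction j)
    case 0
    then show ?case using v0 D0 by (auto simp: min_def)
  next
    case (Suc j)
    define S where "S = min T (D0 + real j * h)"
    obtain v where v: "sol u0 N S v" using Suc unfolding S_def by blast
    show ?case
    proof (cases "S = T")
      case True
      then have "min T (D0 + real (Suc j) * h) = S" using h(1) by (auto simp: S_def min_def algebra_simps split: if_splits)
      then show ?thesis using v by auto
    next
      case False
      then have S: "S < T" "S = D0 + real j * h" by (auto simp: S_def min_def split: if_splits)
      have SD: "D0 \<le> S" using S h by simp
      define q where "q = S - h"
      have q: "r \<le> q" "0 < q" "q < S" using SD h r unfolding q_def r_def by (auto simp: field_simps)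
      have "v r = v0 r" using unique[OF NL_sub[OF N D0(2)] sol_sub[OF v SD] v0] r by auto
      then have "bb (-a1) U1 (v q)" using V q S SD r by (intro U1(2)[of S]) (use v in auto)
      moreover have "NL (T - q) L (\<lambda>t. N (q + t))" using NL_shift[OF N] q by simp
      ultimately obtain w where w: "sol (v q) (\<lambda>t. N (q + t)) (min \<delta>1 (T - q)) w" using \<delta>1(2)[of "T - q"] q S by auto
      define S' where "S' = q + min \<delta>1 (T - q)"
      have "S \<le> S'" "S' \<le> T" using h q S by (auto simp: S'_def q_def min_def)
      then obtain v' where v': "sol u0 N S' v'"
        using extend[OF NL_sub[OF N] v q(2,3) S'_def _ w] by blast
      have "min T (D0 + real (Suc j) * h) \<le> S'" using h S by (auto simp: S'_def q_def min_def algebra_simps)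
      then show ?thesis using sol_sub[OF v'] by blast
    qed
  qed
  moreover obtain j :: nat where "T < real j * h" using reals_Archimedean3[OF h(1)] by blast
  then have "min T (D0 + real j * h) = T" using D0 by simp
  ultimately show ?thesis by metis
qed

end

subsection \<open>The Wick nonlinearity\<close>

definition dmonomial :: "nat \<Rightarrow> nat \<Rightarrow> distr \<Rightarrow> distr \<Rightarrow> distr" where
  "dmonomial i j v \<zeta> = dmult (dmult (dpow v i) (dpow (dconj v) j)) \<zeta>"

text \<open>The nonlinearity at one time with an arbitrary family of coefficients, so that truncated
  coefficients can be inserted in the energy estimate.\<close>

definition PsiW :: "nat \<Rightarrow> complex \<Rightarrow> complex \<Rightarrow> distr \<Rightarrow> (nat \<Rightarrow> nat \<Rightarrow> distr) \<Rightarrow> distr" where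
  "PsiW m \<nu> \<tau> v W = (\<lambda>k. - \<nu> * (\<Sum>i\<le>m + 1. \<Sum>j\<le>m. of_nat (m + 1 choose i) * of_nat (m choose j) *
      dmonomial i j v (W (m + 1 - i) (m - j)) k) + (\<tau> + 1) * (v k + W 1 0 k))"

lemma Psi_PsiW: "Psi m \<nu> \<tau> Z Zh v t = PsiW m \<nu> \<tau> v (\<lambda>a b. Zcol m Z Zh a b t)"
proof -
  have "Zcol m Z Zh 1 0 t = Z t" by (simp add: Zcol_def)
  then show ?thesis by (simp only: Psi_def PsiW_def dmonomial_def)
qed

text \<open>The derivative of x^i at B applied to d; \<open>pd_Suc\<close> and \<open>pd_add\<close>
  are instances of the product rule.\<close>

definition pd :: "nat \<Rightarrow> real \<Rightarrow> real \<Rightarrow> real" where "pd i B d = real i * B ^ (i - 1) * d"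

lemma pd_Suc: "d * B ^ i + B * pd i B d = pd (Suc i) B d"
  by (cases i) (auto simp: pd_def algebra_simps)

lemma pd_add: "pd i B d * B ^ j + B ^ i * pd j B d = pd (i + j) B d"
  by (cases i; cases j) (auto simp: pd_def algebra_simps power_add)

text \<open>The difference of powers telescopes as (v - w) * v^i + w * (v^i - w^i), matching the
  recursion of \<open>pd\<close>.\<close>

lemma dpow_bb: assumes "be > 0"
  shows "\<exists>A\<ge>1. \<forall>i v w B d. bb be B v \<longrightarrow> bb be (A ^ i * B ^ i) (dpow v i) \<and>
    (bb be B w \<longrightarrow> bb be d (\<lambda>k. v k - w k) \<longrightarrow> bb be (A ^ i * pd i B d) (\<lambda>k. dpow v i k - dpow w i k))"
proof -
  have g: "mult_exps be be" using assms by (simp add: mult_exps_def)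
  obtain A where A: "A \<ge> 1" "\<And>f g B B'. bb be B f \<Longrightarrow> bb be B' g \<Longrightarrow> bb be (A * B * B') (dmult f g)"
    using dmult_bb[OF g] by blast
  have pw: "bb be (A ^ i * B ^ i) (dpow v i)" if "bb be B v" for i v B
  proof (induction i)
    case (Suc i)
    from A(2)[OF that Suc] show ?case by (simp add: mult_ac)
  qed (simp add: bb_one)
  have "bb be (A ^ i * pd i B d) (\<lambda>k. dpow v i k - dpow w i k)"
    if v: "bb be B v" and w: "bb be B w" and d: "bb be d (\<lambda>k. v k - w k)" for i v w B d
  proof (induction i)
    case 0
    then show ?case by (simp add: pd_def bb_zero)
  next
    case (Suc i)
    have "(\<lambda>k. dpow v (Suc i) k - dpow w (Suc i) k) =
      (\<lambda>k. dmult (\<lambda>k. v k - w k) (dpow v i) k + dmult w (\<lambda>k. dpow v i k - dpow w i k) k)"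
      by (simp add: dmult_diff(1)[OF g v w pw[OF v] pw[OF w]] dmult_diff(2)[OF g w w pw[OF v] pw[OF w]])
    then show ?case
      using bb_add[OF A(2)[OF d pw[OF v, of i]] A(2)[OF w Suc]] pd_Suc[of d B i]
      by (simp add: algebra_simps) (metis (no_types, lifting) distrib_left mult.left_commute mult.commute)
  qed
  then show ?thesis using A(1) pw by blast
qed

definition mb :: "real \<Rightarrow> real \<Rightarrow> nat \<Rightarrow> nat \<Rightarrow> real \<Rightarrow> bool" where
  "mb be al i j C \<longleftrightarrow> (\<forall>v \<zeta> B K. bb be B v \<longrightarrow> bb (-al) K \<zeta> \<longrightarrow> bb (-al) (C * B ^ (i + j) * K) (dmonomial i j v \<zeta>)) \<and>
    (\<forall>v w \<zeta> \<eta> B K d e. bb be B v \<longrightarrow> bb be B w \<longrightarrow> bb be d (\<lambda>k. v k - w k) \<longrightarrow> bb (-al) K \<zeta> \<longrightarrow> bb (-al) K \<eta> \<longrightarrow>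
      bb (-al) e (\<lambda>k. \<zeta> k - \<eta> k) \<longrightarrow>
      bb (-al) (C * (pd (i + j) B d * K + B ^ (i + j) * e)) (\<lambda>k. dmonomial i j v \<zeta> k - dmonomial i j w \<eta> k))"

lemmas mbD = mb_def[THEN iffD1, THEN conjunct1, rule_format] mb_def[THEN iffD1, THEN conjunct2, rule_format]

lemma mono_bb: assumes "mult_exps be (- al)" "al > 0"
  shows "\<exists>C\<ge>1. mb be al i j C"
proof -
  have be: "be > 0" using assms by (simp add: mult_exps_def)
  have g: "mult_exps be be" using be by (simp add: mult_exps_def)
  obtain A where A: "A \<ge> 1" "\<And>i v B. bb be B v \<Longrightarrow> bb be (A ^ i * B ^ i) (dpow v i)"
    "\<And>i v w B d. bb be B v \<Longrightarrow> bb be B w \<Longrightarrow> bb be d (\<lambda>k. v k - w k) \<Longrightarrow> bb be (A ^ i * pd i B d) (\<lambda>k. dpow v i k - dpow w i k)"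
    using dpow_bb[OF be] by blast
  obtain A1 where A1: "A1 \<ge> 1" "\<And>f g B B'. bb be B f \<Longrightarrow> bb be B' g \<Longrightarrow> bb be (A1 * B * B') (dmult f g)"
    using dmult_bb[OF g] by blast
  obtain A2 where A2: "A2 \<ge> 1" "\<And>f g B B'. bb be B f \<Longrightarrow> bb (-al) B' g \<Longrightarrow> bb (-al) (A2 * B * B') (dmult f g)"
    using dmult_bb[OF assms(1)] by blast
  define P where "P v = dmult (dpow v i) (dpow (dconj v) j)" for v
  define C where "C = A2 * (A1 * (A ^ i * A ^ j))"
  have Pb: "bb be (A1 * (A ^ i * B ^ i) * (A ^ j * B ^ j)) (P v)" if "bb be B v" for v B
    unfolding P_def by (intro A1(2) A(2) bb_dconj that)
  have Pd: "bb be (A1 * (A ^ i * A ^ j) * pd (i + j) B d) (\<lambda>k. P v k - P w k)"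
    if v: "bb be B v" and w: "bb be B w" and d: "bb be d (\<lambda>k. v k - w k)" for v w B d
  proof -
    note cv = bb_dconj[OF v] and cw = bb_dconj[OF w]
    have cd: "bb be d (\<lambda>k. dconj v k - dconj w k)" using bb_dconj[OF d] by (simp add: dconj_diff)
    have eq: "(\<lambda>k. P v k - P w k) = (\<lambda>k. dmult (\<lambda>k. dpow v i k - dpow w i k) (dpow (dconj v) j) k
        + dmult (dpow w i) (\<lambda>k. dpow (dconj v) j k - dpow (dconj w) j k) k)"
      unfolding P_def by (simp add: dmult_diff(1)[OF g A(2)[OF v] A(2)[OF w] A(2)[OF cv] A(2)[OF cv]]
          dmult_diff(2)[OF g A(2)[OF w] A(2)[OF w] A(2)[OF cv] A(2)[OF cw]])
    have "bb be (A1 * (A ^ i * pd i B d) * (A ^ j * B ^ j) + A1 * (A ^ i * B ^ i) * (A ^ j * pd j B d)) (\<lambda>k. P v k - P w k)"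
      unfolding eq by (intro bb_add A1(2) A(3) A(2) v w d cv cw cd)
    moreover have "A1 * (A ^ i * pd i B d) * (A ^ j * B ^ j) + A1 * (A ^ i * B ^ i) * (A ^ j * pd j B d) = A1 * (A ^ i * A ^ j) * (pd i B d * B ^ j + B ^ i * pd j B d)"
      by (simp add: algebra_simps)
    ultimately show ?thesis by (simp only: pd_add)
  qed
  have m: "dmonomial i j v \<zeta> = dmult (P v) \<zeta>" for v \<zeta> by (simp add: dmonomial_def P_def)
  have 1: "bb (-al) (C * B ^ (i + j) * K) (dmonomial i j v \<zeta>)" if "bb be B v" "bb (-al) K \<zeta>" for v \<zeta> B K
  proof -
    have "bb (-al) (A2 * (A1 * (A ^ i * B ^ i) * (A ^ j * B ^ j)) * K) (dmonomial i j v \<zeta>)"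
      unfolding m by (intro A2(2) Pb that)
    moreover have "A2 * (A1 * (A ^ i * B ^ i) * (A ^ j * B ^ j)) * K = C * B ^ (i + j) * K"
      by (simp add: C_def power_add mult_ac)
    ultimately show ?thesis by (simp only:)
  qed
  have 2: "bb (-al) (C * (pd (i + j) B d * K + B ^ (i + j) * e)) (\<lambda>k. dmonomial i j v \<zeta> k - dmonomial i j w \<eta> k)"
    if v: "bb be B v" and w: "bb be B w" and d: "bb be d (\<lambda>k. v k - w k)" and \<zeta>: "bb (-al) K \<zeta>"
      and \<eta>: "bb (-al) K \<eta>" and e: "bb (-al) e (\<lambda>k. \<zeta> k - \<eta> k)" for v w \<zeta> \<eta> B K d e
  proof -
    have eq: "(\<lambda>k. dmonomial i j v \<zeta> k - dmonomial i j w \<eta> k) = (\<lambda>k. dmult (\<lambda>k. P v k - P w k) \<zeta> k + dmult (P w) (\<lambda>k. \<zeta> k - \<eta> k) k)"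
      unfolding m by (simp add: dmult_diff(1)[OF assms(1) Pb[OF v] Pb[OF w] \<zeta> \<zeta>] dmult_diff(2)[OF assms(1) Pb[OF w] Pb[OF w] \<zeta> \<eta>])
    have "bb (-al) (A2 * (A1 * (A ^ i * A ^ j) * pd (i + j) B d) * K + A2 * (A1 * (A ^ i * B ^ i) * (A ^ j * B ^ j)) * e)
       (\<lambda>k. dmonomial i j v \<zeta> k - dmonomial i j w \<eta> k)"
      unfolding eq by (intro bb_add A2(2) Pd Pb v w d \<zeta> e)
    moreover have "A2 * (A1 * (A ^ i * A ^ j) * pd (i + j) B d) * K + A2 * (A1 * (A ^ i * B ^ i) * (A ^ j * B ^ j)) * e
       = C * (pd (i + j) B d * K + B ^ (i + j) * e)"
      by (simp add: C_def power_add algebra_simps)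
    ultimately show ?thesis by (simp only:)
  qed
  have "C \<ge> 1"
  proof -
    have "1 \<le> A ^ i" "1 \<le> A ^ j" using A(1) by auto
    then have "1 \<le> A ^ i * A ^ j" using mult_mono[of 1 "A ^ i" 1 "A ^ j"] by simp
    then have "1 \<le> A1 * (A ^ i * A ^ j)" using A1(1) mult_mono[of 1 A1 1 "A ^ i * A ^ j"] by simp
    then show ?thesis unfolding C_def using A2(1) mult_mono[of 1 A2 1 "A1 * (A ^ i * A ^ j)"] by simp
  qed
  then show ?thesis unfolding mb_def using 1 2 by blast
qed

lemma mb_mono: assumes "mb be al i j c" "c \<le> C" shows "mb be al i j C"
  unfolding mb_def
proof (intro conjI allI impI)
  fix v \<zeta> B K assume h: "bb be B v" "bb (-al) K \<zeta>"
  show "bb (-al) (C * B ^ (i + j) * K) (dmonomial i j v \<zeta>)"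
    by (rule bb_mono[OF mbD(1)[OF assms(1) h]]) (use h[THEN bb_nonneg] assms(2) in \<open>auto intro!: mult_right_mono\<close>)
next
  fix v w \<zeta> \<eta> B K d e
  assume h: "bb be B v" "bb be B w" "bb be d (\<lambda>k. v k - w k)" "bb (-al) K \<zeta>" "bb (-al) K \<eta>" "bb (-al) e (\<lambda>k. \<zeta> k - \<eta> k)"
  show "bb (-al) (C * (pd (i + j) B d * K + B ^ (i + j) * e)) (\<lambda>k. dmonomial i j v \<zeta> k - dmonomial i j w \<eta> k)"
    by (rule bb_mono[OF mbD(2)[OF assms(1) h]])
       (use h[THEN bb_nonneg] assms(2) in \<open>auto intro!: mult_right_mono add_nonneg_nonneg mult_nonneg_nonneg simp: pd_def\<close>)
qed

lemma mono_bb_all: assumes "mult_exps be (- al)" "al > 0"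
  shows "\<exists>C\<ge>1. \<forall>i\<le>m + 1. \<forall>j\<le>m. mb be al i j C"
proof -
  have "\<forall>i j. \<exists>c\<ge>1. mb be al i j c" using mono_bb[OF assms] by blast
  then obtain c where c: "\<And>i j. c i j \<ge> 1" "\<And>i j. mb be al i j (c i j)" by metis
  define C where "C = (\<Sum>i\<le>m+1. \<Sum>j\<le>m. c i j)"
  have cC: "c i j \<le> C" if "i \<le> m + 1" "j \<le> m" for i j
  proof -
    have c0: "0 \<le> c i j" for i j using c(1)[of i j] by linarith
    have "c i j \<le> (\<Sum>j\<le>m. c i j)" using that by (intro member_le_sum) (auto intro: c0)
    also have "\<dots> \<le> C" unfolding C_def using that by (intro member_le_sum[of i "{..m+1}" "\<lambda>i. \<Sum>j\<le>m. c i j"]) (auto intro!: sum_nonneg c0)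
    finally show ?thesis .
  qed
  have "C \<ge> 1" using cC[of 0 0] c(1)[of 0 0] by simp
  then show ?thesis using mb_mono[OF c(2) cC] by blast
qed

definition binom_sum :: "nat \<Rightarrow> real" where
  "binom_sum m = (\<Sum>i\<le>m + 1. \<Sum>j\<le>m. real (m + 1 choose i) * real (m choose j))"

lemma bb_PsiW:
  assumes "\<And>i j. i \<le> m + 1 \<Longrightarrow> j \<le> m \<Longrightarrow> bb a X (F i j)" "bb a Y G"
  shows "bb a (cmod \<nu> * binom_sum m * X + cmod (\<tau> + 1) * Y)
    (\<lambda>k. - \<nu> * (\<Sum>i\<le>m + 1. \<Sum>j\<le>m. of_nat (m + 1 choose i) * of_nat (m choose j) * F i j k) + (\<tau> + 1) * G k)"
proof -
  have "bb a (\<Sum>i\<le>m + 1. \<Sum>j\<le>m. cmod (of_nat (m + 1 choose i) * of_nat (m choose j)) * X)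
    (\<lambda>k. \<Sum>i\<le>m + 1. \<Sum>j\<le>m. of_nat (m + 1 choose i) * of_nat (m choose j) * F i j k)"
    by (intro bb_sum bb_cmult assms) auto
  moreover have "(\<Sum>i\<le>m + 1. \<Sum>j\<le>m. cmod (of_nat (m + 1 choose i) * of_nat (m choose j)) * X) = binom_sum m * X"
    unfolding binom_sum_def sum_distrib_right by (simp only: norm_mult norm_of_nat)
  ultimately have "bb a (cmod (- \<nu>) * (binom_sum m * X) + cmod (\<tau> + 1) * Y)
    (\<lambda>k. - \<nu> * (\<Sum>i\<le>m + 1. \<Sum>j\<le>m. of_nat (m + 1 choose i) * of_nat (m choose j) * F i j k) + (\<tau> + 1) * G k)"
    by (intro bb_add bb_cmult assms) auto
  then show ?thesis by (simp only: norm_minus_cancel mult.assoc)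
qed

lemma PsiW_minus: "(\<lambda>k. PsiW m \<nu> \<tau> v W k - PsiW m \<nu> \<tau> w W' k) =
   (\<lambda>k. - \<nu> * (\<Sum>i\<le>m + 1. \<Sum>j\<le>m. of_nat (m + 1 choose i) * of_nat (m choose j) *
      (dmonomial i j v (W (m + 1 - i) (m - j)) k - dmonomial i j w (W' (m + 1 - i) (m - j)) k)) + (\<tau> + 1) * ((v k - w k) + (W 1 0 k - W' 1 0 k)))"
  by (auto simp: PsiW_def right_diff_distrib sum_subtractf algebra_simps)

text \<open>Unlike the Lipschitz clause of \<open>NL\<close>, the coefficients vary here too: the
  lemma compares the nonlinearity with the one built from truncated data.\<close>

lemma PsiW_diff:
  assumes "mult_exps be (- al)" "al > 0"
  shows "\<exists>C\<ge>0. \<forall>v w W W' d. 0 \<le> d \<longrightarrow> bb be B v \<longrightarrow> bb be B w \<longrightarrow> bb be d (\<lambda>k. v k - w k) \<longrightarrow>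
     (\<forall>a\<le>m+1. \<forall>b\<le>m. bb (-al) K (W a b) \<and> bb (-al) K (W' a b) \<and> bb (-al) d (\<lambda>k. W a b k - W' a b k)) \<longrightarrow>
     bb (-al) (C * d) (\<lambda>k. PsiW m \<nu> \<tau> v W k - PsiW m \<nu> \<tau> w W' k)"
proof -
  obtain C where C: "C \<ge> 1" "\<And>i j. i \<le> m + 1 \<Longrightarrow> j \<le> m \<Longrightarrow> mb be al i j C"
    using mono_bb_all[OF assms, of m] by blast
  have al: "- al \<le> be" using assms by (simp add: mult_exps_def)
  define X where "X = (\<Sum>i\<le>m+1. \<Sum>j\<le>m. C * (pd (i + j) \<bar>B\<bar> 1 * \<bar>K\<bar> + \<bar>B\<bar> ^ (i + j)))"
  have t0: "0 \<le> C * (pd (i + j) \<bar>B\<bar> 1 * \<bar>K\<bar> + \<bar>B\<bar> ^ (i + j))" for i j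
    using C(1) by (auto simp: pd_def intro!: mult_nonneg_nonneg add_nonneg_nonneg)
  have tX: "C * (pd (i + j) \<bar>B\<bar> 1 * \<bar>K\<bar> + \<bar>B\<bar> ^ (i + j)) \<le> X" if "i \<le> m + 1" "j \<le> m" for i j
  proof -
    have "C * (pd (i + j) \<bar>B\<bar> 1 * \<bar>K\<bar> + \<bar>B\<bar> ^ (i + j)) \<le> (\<Sum>j\<le>m. C * (pd (i + j) \<bar>B\<bar> 1 * \<bar>K\<bar> + \<bar>B\<bar> ^ (i + j)))"
      using that t0 by (intro member_le_sum) auto
    also have "\<dots> \<le> X" unfolding X_def using that
      by (intro member_le_sum[of i "{..m+1}" "\<lambda>i. \<Sum>j\<le>m. C * (pd (i + j) \<bar>B\<bar> 1 * \<bar>K\<bar> + \<bar>B\<bar> ^ (i + j))"]) (auto intro!: sum_nonneg t0)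
    finally show ?thesis .
  qed
  have X0: "X \<ge> 0" unfolding X_def by (intro sum_nonneg t0)
  have "bb (-al) ((cmod \<nu> * binom_sum m * X + cmod (\<tau> + 1) * 2) * d) (\<lambda>k. PsiW m \<nu> \<tau> v W k - PsiW m \<nu> \<tau> w W' k)"
    if d0: "0 \<le> d" and v: "bb be B v" and w: "bb be B w" and d: "bb be d (\<lambda>k. v k - w k)" and
     W: "\<And>a b. a \<le> m+1 \<Longrightarrow> b \<le> m \<Longrightarrow> bb (-al) K (W a b) \<and> bb (-al) K (W' a b) \<and> bb (-al) d (\<lambda>k. W a b k - W' a b k)"
   for v w W W' d
  proof -
    have B: "B \<ge> 0" using bb_nonneg[OF v] .
    have K: "K \<ge> 0" using W[of 0 0] bb_nonneg by blast
    have "bb (-al) (cmod \<nu> * binom_sum m * (X * d) + cmod (\<tau> + 1) * (d + d)) (\<lambda>k. PsiW m \<nu> \<tau> v W k - PsiW m \<nu> \<tau> w W' k)"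
      unfolding PsiW_minus
    proof (rule bb_PsiW)
      fix i j assume ij: "i \<le> m + 1" "j \<le> m"
      have "bb (-al) (C * (pd (i + j) B d * K + B ^ (i + j) * d)) (\<lambda>k. dmonomial i j v (W (m + 1 - i) (m - j)) k - dmonomial i j w (W' (m + 1 - i) (m - j)) k)"
        using W[of "m + 1 - i" "m - j"] by (intro mbD(2)[OF C(2)] ij v w d) auto
      moreover have "C * (pd (i + j) B d * K + B ^ (i + j) * d) = C * (pd (i + j) \<bar>B\<bar> 1 * \<bar>K\<bar> + \<bar>B\<bar> ^ (i + j)) * d"
        using B K by (simp add: pd_def algebra_simps)
      ultimately show "bb (-al) (X * d) (\<lambda>k. dmonomial i j v (W (m + 1 - i) (m - j)) k - dmonomial i j w (W' (m + 1 - i) (m - j)) k)"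
        using mult_right_mono[OF tX[OF ij] d0] by (auto intro: bb_mono)
    next
      show "bb (-al) (d + d) (\<lambda>k. v k - w k + (W 1 0 k - W' 1 0 k))"
        using W[of 1 0] by (intro bb_add bb_weaken[OF d al]) auto
    qed
    then show ?thesis by (simp add: algebra_simps)
  qed
  moreover have "0 \<le> cmod \<nu> * binom_sum m * X + cmod (\<tau> + 1) * 2"
    using X0 by (auto simp: binom_sum_def intro!: add_nonneg_nonneg mult_nonneg_nonneg sum_nonneg)
  ultimately show ?thesis
    by (intro exI[of _ "cmod \<nu> * binom_sum m * X + cmod (\<tau> + 1) * 2"] conjI allI impI) simp_all
qed

lemma cf_dpow: assumes "be > 0" "cf S v" "\<And>t. t \<in> S \<Longrightarrow> bb be B (v t)"
  shows "cf S (\<lambda>t. dpow (v t) i)"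
proof -
  have g: "mult_exps be be" using assms(1) by (simp add: mult_exps_def)
  obtain A where A: "\<And>i v B. bb be B v \<Longrightarrow> bb be (A ^ i * B ^ i) (dpow v i)" using dpow_bb[OF assms(1)] by blast
  show ?thesis
  proof (induction i)
    case (Suc i)
    show ?case unfolding dpow.simps by (rule cf_dmult[OF g assms(2) Suc assms(3) A[OF assms(3)]])
  qed (simp add: cf_def)
qed

lemma cf_PsiW:
  assumes g: "mult_exps be (- al)" and v: "cf S v" "\<And>t. t \<in> S \<Longrightarrow> bb be B (v t)"
    and W: "\<And>a b. a \<le> m+1 \<Longrightarrow> b \<le> m \<Longrightarrow> cf S (W a b)" "\<And>a b t. a \<le> m+1 \<Longrightarrow> b \<le> m \<Longrightarrow> t \<in> S \<Longrightarrow> bb (-al) K (W a b t)"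
  shows "cf S (\<lambda>t. PsiW m \<nu> \<tau> (v t) (\<lambda>a b. W a b t))"
proof -
  have be: "be > 0" using g by (simp add: mult_exps_def)
  have gb: "mult_exps be be" using be by (simp add: mult_exps_def)
  obtain A where A: "\<And>i v B. bb be B v \<Longrightarrow> bb be (A ^ i * B ^ i) (dpow v i)" using dpow_bb[OF be] by blast
  obtain A1 where A1: "\<And>f g B B'. bb be B f \<Longrightarrow> bb be B' g \<Longrightarrow> bb be (A1 * B * B') (dmult f g)"
    using dmult_bb[OF gb] by blast
  have "cf S (\<lambda>t. dmonomial i j (v t) (W a b t))" if "a \<le> m+1" "b \<le> m" for i j a b
    unfolding dmonomial_def
  proof (rule cf_dmult[OF g _ W(1)[OF that] _ W(2)[OF that]])
    show "cf S (\<lambda>t. dmult (dpow (v t) i) (dpow (dconj (v t)) j))"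
      by (rule cf_dmult[OF gb cf_dpow[OF be v] cf_dpow[OF be cf_dconj[OF v(1)] bb_dconj[OF v(2)]] A[OF v(2)] A[OF bb_dconj[OF v(2)]]])
    show "bb be (A1 * (A ^ i * B ^ i) * (A ^ j * B ^ j)) (dmult (dpow (v t) i) (dpow (dconj (v t)) j))" if "t \<in> S" for t
      by (rule A1[OF A[OF v(2)[OF that]] A[OF bb_dconj[OF v(2)[OF that]]]])
  qed
  then have "continuous_on S (\<lambda>t. dmonomial i j (v t) (W (m + 1 - i) (m - j) t) k)" for i j k unfolding cf_def by auto
  moreover have "continuous_on S (\<lambda>t. v t k)" "continuous_on S (\<lambda>t. W 1 0 t k)" for k using v(1) W(1)[of 1 0] unfolding cf_def by auto
  ultimately show ?thesis unfolding cf_def PsiW_def by (intro allI continuous_intros)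
qed

text \<open>Each missing factor of the solution costs one ga. A monomial of degree i + j together
  with its coefficient then always has total singularity p * ga, as \<open>NL\<close>
  demands.\<close>

definition coeff_bound :: "nat \<Rightarrow> real \<Rightarrow> real \<Rightarrow> real \<Rightarrow> real \<Rightarrow> (nat \<Rightarrow> nat \<Rightarrow> real \<Rightarrow> distr) \<Rightarrow> bool" where
  "coeff_bound m al ga T K W \<longleftrightarrow> K \<ge> 0 \<and> (\<forall>a\<le>m+1. \<forall>b\<le>m. cf {0<..T} (W a b) \<and> (\<forall>t\<in>{0<..T}. bb (-al) (K * t powr (- (real (a + b) * ga))) (W a b t)))"

lemma ZB_bound: assumes Z: "coeff_bound m al ga T K W" and ga: "0 < ga" and r: "0 < r0"
  shows "\<exists>K1\<ge>0. \<forall>t a b. t \<in> {r0..T} \<longrightarrow> a \<le> m + 1 \<longrightarrow> b \<le> m \<longrightarrow> bb (-al) K1 (W a b t)"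
proof (intro exI conjI allI impI)
  let ?q = "min 1 r0 powr (- (real (2 * m + 1) * ga))"
  have K: "K \<ge> 0" using Z by (simp add: coeff_bound_def)
  then show "0 \<le> K * ?q" by simp
  fix t a b assume t: "t \<in> {r0..T}" and ab: "a \<le> m + 1" "b \<le> m"
  have "t powr (- (real (a + b) * ga)) \<le> min 1 r0 powr (- (real (a + b) * ga))" using t r ga by (intro powr_mono2') auto
  also have "\<dots> \<le> ?q"
  proof (rule powr_mono')
    have "real (a + b) \<le> real (2 * m + 1)" using ab by linarith
    then show "- (real (2 * m + 1) * ga) \<le> - (real (a + b) * ga)" using ga by (simp only: neg_le_iff_le mult_right_mono less_imp_le)
  qed (use r in auto)
  finally have "K * t powr (- (real (a + b) * ga)) \<le> K * ?q" using K by (intro mult_left_mono)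
  moreover have "bb (-al) (K * t powr (- (real (a + b) * ga))) (W a b t)" using Z t r ab unfolding coeff_bound_def by auto
  ultimately show "bb (-al) (K * ?q) (W a b t)" by (rule bb_mono[rotated])
qed

context mild begin

lemma NL_PsiW:
  assumes pm: "p = 2 * m + 1" and ab: "al < be" and Z: "coeff_bound m al ga T K W"
  shows "\<exists>L. NL T L (\<lambda>t v. PsiW m \<nu> \<tau> v (\<lambda>a b. W a b t))"
proof -
  have g: "mult_exps be (- al)" using al be ab by (simp add: mult_exps_def)
  obtain C where C: "C \<ge> 1" "\<And>i j. i \<le> m + 1 \<Longrightarrow> j \<le> m \<Longrightarrow> mb be al i j C"
    using mono_bb_all[OF g al, of m] by blast
  have K: "K \<ge> 0" using Z by (simp add: coeff_bound_def)
  have W: "cf {0<..T} (W a b)" "t \<in> {0<..T} \<Longrightarrow> bb (-al) (K * t powr (- (real (a + b) * ga))) (W a b t)" if "a \<le> m+1" "b \<le> m" for a b t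
    using Z that unfolding coeff_bound_def by auto
  \<comment> \<open>The linear term is less singular than t powr (- p * ga); on a bounded time
    interval \<open>M\<close> makes up the difference.\<close>
  define M where "M = \<bar>T\<bar> powr (real (p - 1) * ga)"
  have lin: "t powr (-ga) \<le> M * t powr (- (real p * ga))" if "0 < t" "t \<le> T" for t
  proof -
    have "t powr (-ga) = t powr (real (p - 1) * ga) * t powr (- (real p * ga))"
      using p by (simp add: of_nat_diff algebra_simps flip: powr_add)
    also have "\<dots> \<le> M * t powr (- (real p * ga))"
      unfolding M_def using that ga by (intro mult_right_mono powr_mono2) auto
    finally show ?thesis .
  qed
  have M0: "M \<ge> 0" by (simp add: M_def)
  have tp: "(B * t powr (-ga)) ^ q * (K * t powr (- (real s * ga))) = B ^ q * K * t powr (- (real p * ga))"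
    if "0 < t" "q + s = p" for t B q s
  proof -
    have "(t powr (-ga)) ^ q = t powr (- (real q * ga))"
      using that by (simp add: powr_realpow[symmetric] powr_powr mult.commute)
    moreover have "t powr (- (real q * ga)) * t powr (- (real s * ga)) = t powr (- (real p * ga))"
    proof -
      have "real p = real q + real s" using that(2) by linarith
      then show ?thesis by (simp add: algebra_simps flip: powr_add)
    qed
    ultimately show ?thesis by (simp add: power_mult_distrib mult_ac)
  qed
  have ex: "(i + j) + ((m + 1 - i) + (m - j)) = p" if "i \<le> m + 1" "j \<le> m" for i j using that pm by simp
  define X where "X = C * K * real p"
  define L where "L = cmod \<nu> * binom_sum m * X + cmod (\<tau> + 1) * (M + K * M)"
  have X0: "X \<ge> 0" using C(1) K by (simp add: X_def)
  have L0: "L \<ge> 0" unfolding L_def binom_sum_def using X0 K M0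
    by (intro add_nonneg_nonneg mult_nonneg_nonneg sum_nonneg) auto
  have "NL T L (\<lambda>t v. PsiW m \<nu> \<tau> v (\<lambda>a b. W a b t))"
    unfolding NL_def
  proof (intro conjI allI impI L0)
    fix t v B assume t: "0 < t" "t \<le> T" and B: "1 \<le> B" and v: "bb be (B * t powr (-ga)) v"
    let ?w = "t powr (- (real p * ga))"
    have Bp: "B ^ q \<le> B ^ p" if "q \<le> p" for q using that B by (intro power_increasing) auto
    have "bb (-al) (cmod \<nu> * binom_sum m * (X * B ^ p * ?w) + cmod (\<tau> + 1) * ((M + K * M) * B ^ p * ?w)) (PsiW m \<nu> \<tau> v (\<lambda>a b. W a b t))"
      unfolding PsiW_def
    proof (rule bb_PsiW)
      fix i j assume ij: "i \<le> m + 1" "j \<le> m"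
      have b1: "bb (-al) (C * (B * t powr (-ga)) ^ (i + j) * (K * t powr (- (real (m + 1 - i + (m - j)) * ga)))) (dmonomial i j v (W (m + 1 - i) (m - j) t))"
        using t by (intro mbD(1)[OF C(2)] ij v W) auto
      have e1: "C * (B * t powr (-ga)) ^ (i + j) * (K * t powr (- (real (m + 1 - i + (m - j)) * ga))) = C * (B ^ (i + j) * K * ?w)"
        using tp[OF t(1) ex[OF ij], of B] by (simp only: mult.assoc)
      have l1: "C * (B ^ (i + j) * K * ?w) \<le> X * B ^ p * ?w"
      proof -
        have "B ^ (i + j) \<le> real p * B ^ p" using Bp[of "i + j"] ij pm B p mult_mono[of 1 "real p" "B ^ (i+j)" "B ^ p"] by simp
        then have "C * K * ?w * B ^ (i + j) \<le> C * K * ?w * (real p * B ^ p)" using C(1) K by (intro mult_left_mono) auto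
        then show ?thesis by (simp add: X_def mult_ac)
      qed
      show "bb (-al) (X * B ^ p * ?w) (dmonomial i j v (W (m + 1 - i) (m - j) t))"
        by (rule bb_mono[OF b1]) (simp only: e1 l1)
    next
      have 1: "bb (-al) (B * t powr (-ga)) v" using bb_weaken[OF v, of "-al"] al be by simp
      have 2: "bb (-al) (K * t powr (-ga)) (W 1 0 t)" using W(2)[of 1 0 t] t by simp
      have B1: "B \<le> B ^ p" "1 \<le> B ^ p" using B p Bp[of 1] by auto
      have "B * t powr (-ga) + K * t powr (-ga) \<le> B ^ p * (M * ?w) + (K * B ^ p) * (M * ?w)"
        using lin[OF t] B1 K B mult_left_mono[OF B1(2) K] by (intro add_mono mult_mono) auto
      also have "\<dots> = (M + K * M) * B ^ p * ?w" by (simp add: algebra_simps)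
      finally show "bb (-al) ((M + K * M) * B ^ p * ?w) (\<lambda>k. v k + W 1 0 t k)"
        using bb_add[OF 1 2] by (auto intro: bb_mono)
    qed
    then show "bb (-al) (L * B ^ p * ?w) (PsiW m \<nu> \<tau> v (\<lambda>a b. W a b t))" by (simp add: L_def algebra_simps)
  next
    fix t v w B d assume t: "0 < t" "t \<le> T" and B: "1 \<le> B" and v: "bb be (B * t powr (-ga)) v" and w: "bb be (B * t powr (-ga)) w"
      and d: "bb be (d * t powr (-ga)) (\<lambda>k. v k - w k)"
    let ?w = "t powr (- (real p * ga))"
    have d0: "0 \<le> d" using bb_nonneg[OF d] t by (simp add: zero_le_mult_iff)
    have Bp: "B ^ q \<le> B ^ (p - 1)" if "q \<le> p - 1" for q using that B by (intro power_increasing) auto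
    have "bb (-al) (cmod \<nu> * binom_sum m * (X * B ^ (p - 1) * d * ?w) + cmod (\<tau> + 1) * ((M + K * M) * B ^ (p - 1) * d * ?w))
       (\<lambda>k. PsiW m \<nu> \<tau> v (\<lambda>a b. W a b t) k - PsiW m \<nu> \<tau> w (\<lambda>a b. W a b t) k)"
      unfolding PsiW_minus
    proof (rule bb_PsiW)
      fix i j assume ij: "i \<le> m + 1" "j \<le> m"
      let ?s = "m + 1 - i + (m - j)"
      let ?K = "K * t powr (- (real ?s * ga))"
      have z: "bb (-al) 0 (\<lambda>k. W (m + 1 - i) (m - j) t k - W (m + 1 - i) (m - j) t k)" by (simp add: bb_zero)
      have "bb (-al) (C * (pd (i + j) (B * t powr (-ga)) (d * t powr (-ga)) * ?K + (B * t powr (-ga)) ^ (i + j) * 0))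
         (\<lambda>k. dmonomial i j v (W (m + 1 - i) (m - j) t) k - dmonomial i j w (W (m + 1 - i) (m - j) t) k)"
        using t by (intro mbD(2)[OF C(2)] ij v w d W z) auto
      moreover have "C * (pd (i + j) (B * t powr (-ga)) (d * t powr (-ga)) * ?K + (B * t powr (-ga)) ^ (i + j) * 0) \<le> X * B ^ (p - 1) * d * ?w"
      proof (cases "i + j")
        case 0
        then show ?thesis using X0 B d0 by (simp add: pd_def)
      next
        case (Suc q)
        have "(1 * t powr (-ga)) ^ 1 * ((B * t powr (-ga)) ^ q * ?K) = B ^ q * K * ?w"
        proof -
          have "q + (?s + 1) = p" using ex[OF ij] Suc by simp
          note tp[OF t(1) this, of B]
          moreover have "t powr (- (real (?s + 1) * ga)) = t powr (-ga) * t powr (- (real ?s * ga))"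
            unfolding powr_add[symmetric] by (simp add: algebra_simps)
          ultimately show ?thesis by (simp only: mult_ac power_one_right mult_1)
        qed
        note eqX = this
        have "pd (i + j) (B * t powr (-ga)) (d * t powr (-ga)) * ?K = real (i + j) * d * ((1 * t powr (-ga)) ^ 1 * ((B * t powr (-ga)) ^ q * ?K))"
          unfolding Suc pd_def by (simp only: mult_ac power_one_right mult_1 diff_Suc_1)
        then have pdE: "pd (i + j) (B * t powr (-ga)) (d * t powr (-ga)) * ?K = real (i + j) * d * (B ^ q * K * ?w)"
          unfolding eqX .
        have "real (i + j) * B ^ q \<le> real p * B ^ (p - 1)"
          using Bp[of q] ij pm B Suc by (intro mult_mono) auto
        then have "(C * K * d * ?w) * (real (i + j) * B ^ q) \<le> (C * K * d * ?w) * (real p * B ^ (p - 1))"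
          using C(1) K d0 by (intro mult_left_mono) auto
        moreover have "C * (pd (i + j) (B * t powr (-ga)) (d * t powr (-ga)) * ?K + (B * t powr (-ga)) ^ (i + j) * 0) = (C * K * d * ?w) * (real (i + j) * B ^ q)"
          unfolding pdE mult_zero_right add_0_right by (simp only: mult_ac)
        moreover have "(C * K * d * ?w) * (real p * B ^ (p - 1)) = X * B ^ (p - 1) * d * ?w"
          by (simp only: X_def mult_ac)
        ultimately show ?thesis by linarith
      qed
      ultimately show "bb (-al) (X * B ^ (p - 1) * d * ?w) (\<lambda>k. dmonomial i j v (W (m + 1 - i) (m - j) t) k - dmonomial i j w (W (m + 1 - i) (m - j) t) k)"
        by (rule bb_mono)
    next
      have 1: "bb (-al) (d * t powr (-ga)) (\<lambda>k. v k - w k)" using bb_weaken[OF d, of "-al"] al be by simp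
      have B1: "1 \<le> B ^ (p - 1)" using B by simp
      have "d * t powr (-ga) \<le> (d * (1 + K) * B ^ (p - 1)) * (M * ?w)"
      proof (rule mult_mono[OF _ lin[OF t]])
        have "1 \<le> (1 + K) * B ^ (p - 1)" using B1 K mult_mono[of 1 "1 + K" 1 "B ^ (p-1)"] by simp
        then show "d \<le> d * (1 + K) * B ^ (p - 1)" using d0 mult_left_mono[of 1 "(1 + K) * B ^ (p - 1)" d] by (simp add: mult.assoc)
      qed (use d0 K B in auto)
      also have "\<dots> = (M + K * M) * B ^ (p - 1) * d * ?w" by (simp add: algebra_simps)
      finally show "bb (-al) ((M + K * M) * B ^ (p - 1) * d * ?w) (\<lambda>k. v k - w k + (W 1 0 t k - W 1 0 t k))"
        using 1 by (auto intro: bb_mono)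
    qed
    then show "bb (-al) (L * B ^ (p - 1) * d * ?w) (\<lambda>k. PsiW m \<nu> \<tau> v (\<lambda>a b. W a b t) k - PsiW m \<nu> \<tau> w (\<lambda>a b. W a b t) k)"
      by (simp add: L_def algebra_simps)
  next
    fix r v B assume r: "0 < r" "r < T" and v: "cf {r..T} v" "\<forall>t\<in>{r..T}. bb be B (v t)"
    obtain K1 where "\<And>t a b. t \<in> {r..T} \<Longrightarrow> a \<le> m + 1 \<Longrightarrow> b \<le> m \<Longrightarrow> bb (-al) K1 (W a b t)"
      using ZB_bound[OF Z ga r(1)] by blast
    moreover have "cf {r..T} (W a b)" if "a \<le> m+1" "b \<le> m" for a b
      by (rule cf_subset[OF W(1)[OF that]]) (use r in auto)
    ultimately show "cf {r..T} (\<lambda>t. PsiW m \<nu> \<tau> (v t) (\<lambda>a b. W a b t))"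
      using v by (intro cf_PsiW[OF g]) blast+
  qed
  then show ?thesis by blast
qed

end

subsection \<open>Dissipativity of the complex Laplacian\<close>

definition ph :: "real \<Rightarrow> complex \<Rightarrow> complex" where "ph x z = complex_of_real (cmod z powr x) * z"

lemma cmod_ph: "cmod (ph x z) = cmod z powr (x + 1)"
  by (cases "z = 0") (auto simp: ph_def norm_mult powr_add)

lemma cont_ph [continuous_intros]: "x > 0 \<Longrightarrow> continuous_on S g \<Longrightarrow> continuous_on S (\<lambda>t. ph x (g t))"
  unfolding ph_def by (intro continuous_intros continuous_on_powr') auto

lemma MVT_open:
  fixes f :: "real \<Rightarrow> real"
  assumes "a < b" "continuous_on {a..b} f" "\<And>x. a < x \<Longrightarrow> x < b \<Longrightarrow> (f has_real_derivative f' x) (at x)"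
  shows "\<exists>z. a < z \<and> z < b \<and> f b - f a = (b - a) * f' z"
proof -
  have "\<exists>l z. a < z \<and> z < b \<and> (f has_real_derivative l) (at z) \<and> f b - f a = (b - a) * l"
    using assms by (intro MVT) (auto simp: real_differentiable_def)
  then show ?thesis using assms(3) DERIV_unique by metis
qed

text \<open>The mean value theorem is applied to the power x + 1, not x, whose derivative would blow
  up at 0 for x < 1. The extra factor t = |b| makes this possible.\<close>

lemma ph_upper_aux:
  assumes "cmod b \<le> cmod a" "0 \<le> x"
  shows "cmod (ph x a - ph x b) \<le> (x + 2) * cmod a powr x * cmod (a - b)"
proof (cases "a = 0")
  case False
  define s t where "s = cmod a" and "t = cmod b"
  have st: "0 \<le> t" "t \<le> s" "0 < s" using assms False by (auto simp: s_def t_def)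
  have "t * (s powr x - t powr x) \<le> (x + 1) * s powr x * (s - t)"
  proof (cases "t = s")
    case False
    then have ts: "t < s" using st by simp
    have "\<exists>z. t < z \<and> z < s \<and> s powr (x+1) - t powr (x+1) = (s - t) * ((x + 1) * z powr x)"
    proof (rule MVT_open[OF ts])
      show "continuous_on {t..s} (\<lambda>u. u powr (x + 1))" using st assms by (intro continuous_on_powr') (auto intro!: continuous_intros)
      fix z assume "t < z" "z < s"
      then show "((\<lambda>u. u powr (x+1)) has_real_derivative (x + 1) * z powr x) (at z)"
      proof -
        have "((\<lambda>u. u powr (x+1)) has_real_derivative (x + 1) * z powr (x + 1 - of_nat 1) * 1) (at z)"
          by (rule DERIV_fun_powr) (use st \<open>t < z\<close> in auto)
        then show ?thesis by simp
      qed
    qed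
    then obtain z where z: "t < z" "z < s" "s powr (x+1) - t powr (x+1) = (s - t) * ((x + 1) * z powr x)" by blast
    have "z powr x \<le> s powr x" using z st assms by (intro powr_mono2) auto
    then have "s powr (x+1) - t powr (x+1) \<le> (s - t) * ((x + 1) * s powr x)"
      unfolding z(3) using st assms by (intro mult_left_mono) auto
    moreover have "t * s powr x \<le> s powr (x + 1)" using st by (simp add: powr_add)
    moreover have "t * t powr x = t powr (x + 1)" using st by (cases "t = 0") (auto simp: powr_add)
    ultimately show ?thesis by (simp add: algebra_simps)
  qed auto
  moreover have "s - t \<le> cmod (a - b)" unfolding s_def t_def by (rule norm_triangle_ineq2)
  then have "(x + 1) * s powr x * (s - t) \<le> (x + 1) * s powr x * cmod (a - b)"
    using assms by (intro mult_left_mono) auto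
  moreover have "ph x a - ph x b = complex_of_real (s powr x) * (a - b) + complex_of_real (s powr x - t powr x) * b"
    by (simp add: ph_def s_def t_def algebra_simps)
  then have "cmod (ph x a - ph x b) \<le> s powr x * cmod (a - b) + \<bar>s powr x - t powr x\<bar> * t"
    by (metis (no_types, lifting) norm_triangle_ineq norm_mult norm_of_real t_def abs_of_nonneg powr_ge_zero)
  moreover have "t powr x \<le> s powr x" using st assms by (intro powr_mono2) auto
  ultimately have "cmod (ph x a - ph x b) \<le> s powr x * cmod (a - b) + (x + 1) * s powr x * cmod (a - b)"
    by (simp add: mult.commute)
  then show ?thesis by (simp add: s_def algebra_simps)
qed (use assms in \<open>simp add: ph_def\<close>)

lemma ph_upper: assumes "0 \<le> x" shows "cmod (ph x a - ph x b) \<le> (x + 2) * max (cmod a) (cmod b) powr x * cmod (a - b)"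
  using ph_upper_aux[of b a x] ph_upper_aux[of a b x] assms
  by (cases "cmod b \<le> cmod a") (auto simp: max_def norm_minus_commute)

text \<open>Monotonicity: with s, t the powers of |a|, |b|, twice the real pairing of the two
  differences equals (s + t) |a - b|^2 + (s - t) (|a|^2 - |b|^2), and both terms are
  nonnegative.\<close>

lemma ph_lower: assumes "0 \<le> x" shows "max (cmod a) (cmod b) powr x * cmod (a - b) \<le> 2 * cmod (ph x a - ph x b)"
proof (cases "a = b")
  case False
  define s t where "s = cmod a powr x" and "t = cmod b powr x"
  have mx: "max (cmod a) (cmod b) powr x \<le> s + t" by (auto simp: s_def t_def max_def)
  have "2 * Re ((ph x a - ph x b) * cnj (a - b)) = (s + t) * (cmod (a - b))\<^sup>2 + (s - t) * ((cmod a)\<^sup>2 - (cmod b)\<^sup>2)"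
    unfolding ph_def s_def[symmetric] t_def[symmetric] cmod_power2
    by (simp add: power2_eq_square algebra_simps)
  moreover have "0 \<le> (s - t) * ((cmod a)\<^sup>2 - (cmod b)\<^sup>2)"
  proof (cases "cmod a \<le> cmod b")
    case True
    then have "s \<le> t" "(cmod a)\<^sup>2 \<le> (cmod b)\<^sup>2" using assms by (auto simp: s_def t_def intro: powr_mono2 power_mono)
    then show ?thesis by (simp add: mult_nonpos_nonpos)
  next
    case False
    then have "t \<le> s" "(cmod b)\<^sup>2 \<le> (cmod a)\<^sup>2" using assms by (auto simp: s_def t_def intro: powr_mono2 power_mono)
    then show ?thesis by simp
  qed
  moreover have "Re ((ph x a - ph x b) * cnj (a - b)) \<le> cmod (ph x a - ph x b) * cmod (a - b)"
    using complex_Re_le_cmod[of "(ph x a - ph x b) * cnj (a - b)"] by (simp only: norm_mult complex_mod_cnj)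
  ultimately have "(s + t) * cmod (a - b) * cmod (a - b) \<le> 2 * cmod (ph x a - ph x b) * cmod (a - b)"
    by (simp add: power2_eq_square)
  then have "(s + t) * cmod (a - b) \<le> 2 * cmod (ph x a - ph x b)" using False by simp
  then show ?thesis using mult_right_mono[OF mx, of "cmod (a - b)"] by simp
qed simp

lemma powr_square: "0 \<le> x \<Longrightarrow> (x\<^sup>2) powr a = x powr (2 * a)" for x :: real
  by (cases "x = 0") (auto simp: powr_powr powr_numeral[symmetric] simp del: powr_numeral)

text \<open>The hypothesis says that the determinant of the form is positive. Its trace is 2 * r *
  \<mu>, and c = determinant / trace lies below the smaller eigenvalue: subtracting c from the
  diagonal leaves determinant c^2.\<close>

lemma quad_form_lower:
  fixes \<mu> r :: real
  assumes "\<mu> > 0" "r > 1" "(r - 1)\<^sup>2 < \<mu>\<^sup>2 * (2 * r - 1)"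
  shows "\<exists>c>0. \<forall>X Y. c * (X\<^sup>2 + Y\<^sup>2) \<le> \<mu> * (2 * r - 1) * X\<^sup>2 - 2 * (r - 1) * X * Y + \<mu> * Y\<^sup>2"
proof -
  define c where "c = (\<mu>\<^sup>2 * (2 * r - 1) - (r - 1)\<^sup>2) / (2 * r * \<mu>)"
  have c: "c > 0" using assms by (simp add: c_def)
  define al be ga where "al = \<mu> * (2 * r - 1) - c" and "be = r - 1" and "ga = \<mu> - c"
  have "2 * r * \<mu> * c = \<mu>\<^sup>2 * (2 * r - 1) - (r - 1)\<^sup>2" using assms by (simp add: c_def)
  moreover have "al * ga = \<mu>\<^sup>2 * (2 * r - 1) - 2 * r * \<mu> * c + c\<^sup>2"
    by (simp add: al_def ga_def power2_eq_square algebra_simps)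
  ultimately have ag: "al * ga \<ge> be\<^sup>2" by (simp add: be_def)
  have "c \<le> \<mu>\<^sup>2 * (2 * r - 1) / (2 * r * \<mu>)" unfolding c_def using assms by (intro divide_right_mono) auto
  also have "\<dots> = \<mu> * (2 * r - 1) / (2 * r)" using assms by (simp add: power2_eq_square)
  also have "\<dots> < \<mu> * (2 * r - 1)"
  proof -
    have "0 < \<mu> * (2 * r - 1)" using assms by simp
    from mult_strict_left_mono[OF _ this, of 1 "2 * r"] show ?thesis using assms(2) by (simp add: divide_less_eq)
  qed
  finally have al0: "al > 0" by (simp add: al_def)
  have "c * (X\<^sup>2 + Y\<^sup>2) \<le> \<mu> * (2 * r - 1) * X\<^sup>2 - 2 * (r - 1) * X * Y + \<mu> * Y\<^sup>2" for X Y
  proof -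
    have "al * (al * X\<^sup>2 - 2 * be * X * Y + ga * Y\<^sup>2) = (al * X - be * Y)\<^sup>2 + (al * ga - be\<^sup>2) * Y\<^sup>2"
      by (simp add: power2_eq_square algebra_simps)
    moreover have "0 \<le> (al * X - be * Y)\<^sup>2 + (al * ga - be\<^sup>2) * Y\<^sup>2" using ag by simp
    ultimately have "0 \<le> al * X\<^sup>2 - 2 * be * X * Y + ga * Y\<^sup>2" using al0 by (metis zero_le_mult_iff not_le)
    then show ?thesis by (simp add: al_def be_def ga_def algebra_simps)
  qed
  then show ?thesis using c by blast
qed

text \<open>Along the segment from \<open>b\<close> to \<open>a\<close> the real part below has derivative at least a multiple of
  \<open>cmod z powr (2 * r - 2) * (cmod (a - b))\<^sup>2\<close>; the last quarter of the segment, where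
  \<open>cmod z\<close> is comparable to \<open>cmod a\<close>, already gives the claim.\<close>

lemma elliptic_aux:
  fixes \<mu> r :: real
  assumes \<mu>: "\<mu> > 0" and r: "r > 1" and c: "c > 0" "\<And>X Y. c * (X\<^sup>2 + Y\<^sup>2) \<le> \<mu> * (2 * r - 1) * X\<^sup>2 - 2 * (r - 1) * X * Y + \<mu> * Y\<^sup>2"
    and ab: "cmod b \<le> cmod a"
  shows "(c / 4) * (1/2) powr (2 * r - 2) * cmod a powr (2 * r - 2) * (cmod (a - b))\<^sup>2 \<le> Re ((\<i> + of_real \<mu>) * (a - b) * cnj (ph (2*r-2) a - ph (2*r-2) b))"
proof (cases "a = b")
  case False
  define \<xi> where "\<xi> = a - b"
  define z where "z s = b + of_real s * \<xi>" for s :: real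
  define h where "h s = (cmod (z s))\<^sup>2" for s
  define e where "e s = Re ((\<i> + of_real \<mu>) * \<xi> * cnj (z s))" for s
  define g where "g s = h s powr (r - 1) * e s" for s
  have \<xi>: "\<xi> \<noteq> 0" using False by (simp add: \<xi>_def)
  have a0: "cmod a > 0" using False ab by (metis norm_le_zero_iff not_le norm_zero order.trans zero_less_norm_iff)
  have h0: "h s \<ge> 0" for s by (simp add: h_def)
  have zeq: "Re (z s) = Re b + s * Re \<xi>" "Im (z s) = Im b + s * Im \<xi>" for s by (auto simp: z_def)
  have dh: "(h has_real_derivative 2 * Re (\<xi> * cnj (z s))) (at s)" for s
    unfolding h_def[abs_def] cmod_power2 zeq
    by (auto intro!: derivative_eq_intros simp: zeq algebra_simps)
  have eeq: "e s = \<mu> * (Re \<xi> * Re (z s) + Im \<xi> * Im (z s)) - (Im \<xi> * Re (z s) - Re \<xi> * Im (z s))" for s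
    by (simp add: e_def algebra_simps)
  have de: "(e has_real_derivative \<mu> * (cmod \<xi>)\<^sup>2) (at s)" for s
    unfolding eeq[abs_def] cmod_power2 zeq
    by (auto intro!: derivative_eq_intros simp: power2_eq_square algebra_simps)
  define g' where "g' s = h s powr (r - 1) * (\<mu> * (cmod \<xi>)\<^sup>2) + (r - 1) * h s powr (r - 1 - 1) * (2 * Re (\<xi> * cnj (z s))) * e s" for s
  have dg: "(g has_real_derivative g' s) (at s)" if "h s > 0" for s
  proof -
    have "((\<lambda>s. h s powr (r - 1)) has_real_derivative (r - 1) * h s powr (r - 1 - of_nat 1) * (2 * Re (\<xi> * cnj (z s)))) (at s)"
      by (rule DERIV_fun_powr[OF dh that])
    from DERIV_mult[OF this de] show ?thesis unfolding g_def[abs_def] g'_def by (simp add: algebra_simps)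
  qed
  have g'_ge: "c * h s powr (r - 1) * (cmod \<xi>)\<^sup>2 \<le> g' s" if "h s > 0" for s
  proof -
    \<comment> \<open>Up to the factor |z s|, these are the components of the direction along and
      across z s; the chain rule then produces the form of \<open>quad_form_lower\<close>.\<close>
    define X Y where "X = Re (\<xi> * cnj (z s))" and "Y = Im (\<xi> * cnj (z s))"
    have XY: "X\<^sup>2 + Y\<^sup>2 = (cmod \<xi>)\<^sup>2 * h s"
    proof -
      have "X\<^sup>2 + Y\<^sup>2 = (cmod (\<xi> * cnj (z s)))\<^sup>2" by (simp only: cmod_power2 X_def Y_def)
      then show ?thesis by (simp only: norm_mult complex_mod_cnj power_mult_distrib h_def)
    qed
    have e: "e s = \<mu> * X - Y" unfolding X_def Y_def eeq by (simp add: algebra_simps)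
    have hh: "h s powr (r - 1) = h s powr (r - 1 - 1) * h s" 
    proof -
      have "r - 1 = (r - 1 - 1) + 1" by simp
      then have "h s powr (r - 1) = h s powr (r - 1 - 1) * h s powr 1" by (metis powr_add)
      then show ?thesis using that by simp
    qed
    have "g' s = h s powr (r - 1 - 1) * (\<mu> * ((cmod \<xi>)\<^sup>2 * h s) + (r - 1) * 2 * X * (\<mu> * X - Y))"
      unfolding g'_def hh e X_def[symmetric] by (simp add: algebra_simps)
    also have "\<dots> = h s powr (r - 1 - 1) * (\<mu> * (2 * r - 1) * X\<^sup>2 - 2 * (r - 1) * X * Y + \<mu> * Y\<^sup>2)"
      unfolding XY[symmetric] by (simp add: power2_eq_square algebra_simps)
    also have "\<dots> \<ge> h s powr (r - 1 - 1) * (c * (X\<^sup>2 + Y\<^sup>2))" by (intro mult_left_mono c(2)) auto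
    finally show ?thesis unfolding XY hh by (simp add: mult_ac)
  qed
  have gc: "continuous_on S g" for S
    unfolding g_def[abs_def] h_def e_def z_def using r by (intro continuous_intros continuous_on_powr') auto
  have mono1: "g s \<le> g t" if "s \<le> t" "\<And>u. s < u \<Longrightarrow> u < t \<Longrightarrow> h u > 0" for s t
  proof (cases "s = t")
    case False
    show ?thesis
    proof (rule DERIV_nonneg_imp_increasing_open[OF that(1) _ gc])
      fix u assume u: "s < u" "u < t"
      have "0 \<le> g' u" using g'_ge[OF that(2)[OF u]] c(1) by (meson mult_nonneg_nonneg order_trans powr_ge_zero zero_le_power2 less_imp_le)
      then show "\<exists>y. (g has_real_derivative y) (at u) \<and> 0 \<le> y" using dg[OF that(2)[OF u]] by blast
    qed
  qed simp
  have uniq: "s = t" if "h s = 0" "h t = 0" for s t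
  proof -
    have "z s = z t" using that by (simp add: h_def)
    then show ?thesis using \<xi> by (simp add: z_def)
  qed
  \<comment> \<open>The segment meets 0 at most once. There \<open>g\<close> may fail to be
    differentiable, but it is continuous and increasing on either side.\<close>
  have mono: "g s \<le> g t" if "s \<le> t" for s t
  proof (cases "\<exists>u. s < u \<and> u < t \<and> h u = 0")
    case True
    then obtain u where u: "s < u" "u < t" "h u = 0" by blast
    have "h w > 0" if "w \<noteq> u" for w using uniq[of w u] u(3) that h0[of w] by fastforce
    then have "g s \<le> g u" "g u \<le> g t" using u by (auto intro!: mono1)
    then show ?thesis by simp
  next
    case False
    then have "h u > 0" if "s < u" "u < t" for u using that h0[of u] by (metis less_eq_real_def)
    then show ?thesis by (intro mono1 that)
  qed
  \<comment> \<open>|a - b| \<le> 2 |a|, so in the last quarter of the segment the distance to a is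
    at most |a| / 2.\<close>
  have zl: "cmod a / 2 \<le> cmod (z s)" if "3/4 \<le> s" "s \<le> 1" for s
  proof -
    have "a = z s + of_real (1 - s) * \<xi>" by (simp add: z_def \<xi>_def algebra_simps)
    then have "cmod a \<le> cmod (z s) + (1 - s) * cmod \<xi>"
    proof -
      have "cmod (of_real (1 - s)) = 1 - s" using that unfolding norm_of_real by simp
      then show ?thesis using norm_triangle_ineq[of "z s" "of_real (1 - s) * \<xi>"] \<open>a = _\<close> by (simp only: norm_mult)
    qed
    moreover have "cmod \<xi> \<le> 2 * cmod a" unfolding \<xi>_def using norm_triangle_ineq4[of a b] ab by linarith
    then have "(1 - s) * cmod \<xi> \<le> (1/4) * (2 * cmod a)" using that by (intro mult_mono) auto
    ultimately show ?thesis by linarith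
  qed
  have zp: "h s > 0" if "3/4 \<le> s" "s \<le> 1" for s using zl[OF that] a0 by (auto simp: h_def)
  have "\<exists>s. 3/4 < s \<and> s < 1 \<and> g 1 - g (3/4) = (1 - 3/4) * g' s"
    by (rule MVT2) (auto intro!: dg zp)
  then obtain s where s: "3/4 < s" "s < 1" "g 1 - g (3/4) = (1/4) * g' s" by auto
  have "(1/2) powr (2 * r - 2) * cmod a powr (2 * r - 2) \<le> h s powr (r - 1)"
  proof -
    have "(cmod a / 2) powr (2 * r - 2) \<le> cmod (z s) powr (2 * r - 2)" using zl[of s] s r by (intro powr_mono2) auto
    also have "\<dots> = h s powr (r - 1)" unfolding h_def by (subst powr_square) (auto simp: algebra_simps)
    finally show ?thesis by (simp add: powr_divide powr_mult[symmetric])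
  qed
  then have "c * ((1/2) powr (2 * r - 2) * cmod a powr (2 * r - 2)) * (cmod \<xi>)\<^sup>2 \<le> c * h s powr (r - 1) * (cmod \<xi>)\<^sup>2"
    using c(1) by (intro mult_right_mono mult_left_mono) auto
  also have "\<dots> \<le> g' s" using s by (intro g'_ge zp) auto
  finally have "(1/4) * (c * ((1/2) powr (2 * r - 2) * cmod a powr (2 * r - 2)) * (cmod \<xi>)\<^sup>2) \<le> g 1 - g 0"
    using s(3) mono[of 0 "3/4"] by linarith
  also have "g 1 - g 0 = Re ((\<i> + of_real \<mu>) * (a - b) * cnj (ph (2*r-2) a - ph (2*r-2) b))"
  proof -
    have "h s powr (r - 1) = cmod (z s) powr (2 * r - 2)" for s
      unfolding h_def by (subst powr_square) (auto simp: algebra_simps)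
    moreover have "z 1 = a" "z 0 = b" by (auto simp: z_def \<xi>_def)
    ultimately have "g 1 = cmod a powr (2 * r - 2) * Re ((\<i> + of_real \<mu>) * \<xi> * cnj a)"
      "g 0 = cmod b powr (2 * r - 2) * Re ((\<i> + of_real \<mu>) * \<xi> * cnj b)" by (auto simp: g_def e_def)
    then show ?thesis unfolding ph_def \<xi>_def[symmetric] by (simp add: algebra_simps)
  qed
  finally show ?thesis by (simp add: \<xi>_def mult_ac)
qed simp

lemma elliptic:
  fixes \<mu> r :: real
  assumes "\<mu> > 0" "r > 1" "(r - 1)\<^sup>2 < \<mu>\<^sup>2 * (2 * r - 1)"
  shows "\<exists>c>0. \<forall>a b. c * (max (cmod a) (cmod b) powr (2 * r - 2) * (cmod (a - b))\<^sup>2) \<le> Re ((\<i> + of_real \<mu>) * (a - b) * cnj (ph (2*r-2) a - ph (2*r-2) b))"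
proof -
  obtain c where c: "c > 0" "\<And>X Y. c * (X\<^sup>2 + Y\<^sup>2) \<le> \<mu> * (2 * r - 1) * X\<^sup>2 - 2 * (r - 1) * X * Y + \<mu> * Y\<^sup>2"
    using quad_form_lower[OF assms] by blast
  note aux = elliptic_aux[OF assms(1,2) c]
  define d where "d = (c / 4) * (1/2) powr (2 * r - 2)"
  have "d * (max (cmod a) (cmod b) powr (2 * r - 2) * (cmod (a - b))\<^sup>2) \<le> Re ((\<i> + of_real \<mu>) * (a - b) * cnj (ph (2*r-2) a - ph (2*r-2) b))" for a b
  proof (cases "cmod b \<le> cmod a")
    case True
    then show ?thesis using aux[OF True] by (simp add: d_def max_def mult.assoc)
  next
    case False
    then have "(c / 4) * (1/2) powr (2 * r - 2) * cmod b powr (2 * r - 2) * (cmod (b - a))\<^sup>2 \<le> Re ((\<i> + of_real \<mu>) * (b - a) * cnj (ph (2*r-2) b - ph (2*r-2) a))"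
      by (intro aux) auto
    moreover have "(\<i> + of_real \<mu>) * (b - a) * cnj (ph (2*r-2) b - ph (2*r-2) a) = (\<i> + of_real \<mu>) * (a - b) * cnj (ph (2*r-2) a - ph (2*r-2) b)"
      by (simp add: algebra_simps)
    ultimately have "(c / 4) * (1/2) powr (2 * r - 2) * cmod b powr (2 * r - 2) * (cmod (a - b))\<^sup>2 \<le> Re ((\<i> + of_real \<mu>) * (a - b) * cnj (ph (2*r-2) a - ph (2*r-2) b))"
      by (simp only: norm_minus_commute[of b a])
    moreover have "max (cmod a) (cmod b) = cmod b" using False by simp
    ultimately show ?thesis unfolding d_def by (simp only: mult.assoc)
  qed
  moreover have "d > 0" using c(1) by (simp add: d_def)
  ultimately show ?thesis by blast
qed

section \<open>Dissipation controls increments of the solution\<close>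

definition laplacian :: "distr \<Rightarrow> distr" where
  "laplacian V k = - complex_of_real (4 * pi\<^sup>2 * ((real_of_int (fst k))\<^sup>2 + (real_of_int (snd k))\<^sup>2)) * V k"

definition Dn :: "real \<Rightarrow> real \<Rightarrow> distr \<Rightarrow> real" where
  "Dn \<mu> r V = - Re (tint (\<lambda>x. (\<i> + of_real \<mu>) * tev (laplacian V) x * cnj (ph (2*r-2) (tev V x))))"

lemma per_comp: "per f \<Longrightarrow> per (\<lambda>x. g (f x))" by (simp add: per_def)
lemma per_shift: "per f \<Longrightarrow> per (\<lambda>x. f (x + h))"
proof -
  assume "per f"
  then have "f (x + 1, y) = f (x, y)" "f (x, y + 1) = f (x, y)" for x y by (auto simp: per_def)
  moreover obtain a b where "h = (a, b)" by (cases h)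
  ultimately show ?thesis unfolding per_def by (auto simp: add.commute add.left_commute) (metis add.assoc add.commute)+
qed

lemma sum_square_le: "(cmod (\<Sum>l<N. a l))\<^sup>2 \<le> real N * (\<Sum>l<N. (cmod (a l))\<^sup>2)"
proof -
  have "cmod (\<Sum>l<N. a l) \<le> (\<Sum>l<N. cmod (a l))" by (rule norm_sum)
  then have "(cmod (\<Sum>l<N. a l))\<^sup>2 \<le> (\<Sum>l<N. cmod (a l))\<^sup>2" by (intro power_mono) auto
  also have "\<dots> \<le> real N * (\<Sum>l<N. (cmod (a l))\<^sup>2)"
    using sum_squared_le_sum_of_squares[of "\<lambda>l. cmod (a l)" "{..<N}"] by (simp add: mult.commute)
  finally show ?thesis .
qed

text \<open>Telescoping, Cauchy-Schwarz and translation invariance. It leads from the short shifts,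
  for which difference quotients approximate the Laplacian, back to the full shift.\<close>

lemma shift_iterate:
  assumes "cont g" "per g"
  shows "tint (\<lambda>x. (cmod (g (x + real N *\<^sub>R h) - g x))\<^sup>2) \<le> (real N)\<^sup>2 * tint (\<lambda>x. (cmod (g (x + h) - g x))\<^sup>2)"
proof -
  have cs: "cont (\<lambda>x. g (x + k))" for k by (intro continuous_on_compose2[OF assms(1)] continuous_intros) auto
  define d where "d l x = g (x + real (Suc l) *\<^sub>R h) - g (x + real l *\<^sub>R h)" for l x
  have cd: "cont (d l)" for l unfolding d_def by (intro continuous_intros cs)
  have dl: "d l x = d 0 (x + real l *\<^sub>R h)" for l x by (simp add: d_def algebra_simps)
  have pd: "per (d 0)"
    using per_shift[OF assms(2), of "real (Suc 0) *\<^sub>R h"] per_shift[OF assms(2), of "real 0 *\<^sub>R h"]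
    by (simp add: per_def d_def)
  have tel: "g (x + real N *\<^sub>R h) - g x = (\<Sum>l<N. d l x)" for x
    using sum_lessThan_telescope[of "\<lambda>l. g (x + real l *\<^sub>R h)" N] by (simp add: d_def)
  have "tint (\<lambda>x. (cmod (g (x + real N *\<^sub>R h) - g x))\<^sup>2) \<le> tint (\<lambda>x. real N * (\<Sum>l<N. (cmod (d l x))\<^sup>2))"
  proof (rule tint_mono)
    show "(cmod (g (x + real N *\<^sub>R h) - g x))\<^sup>2 \<le> real N * (\<Sum>l<N. (cmod (d l x))\<^sup>2)" for x
      by (simp only: tel sum_square_le)
    show "cont (\<lambda>x. (cmod (g (x + real N *\<^sub>R h) - g x))\<^sup>2)" by (intro continuous_intros cs assms)
    show "cont (\<lambda>x. real N * (\<Sum>l<N. (cmod (d l x))\<^sup>2))" by (intro continuous_intros cd)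
  qed
  also have "\<dots> = real N * (\<Sum>l<N. tint (\<lambda>x. (cmod (d l x))\<^sup>2))"
    by (subst tint_mult, subst tint_sum) (auto intro!: continuous_intros cd)
  also have "(\<Sum>l<N. tint (\<lambda>x. (cmod (d l x))\<^sup>2)) = (\<Sum>l<N. tint (\<lambda>x. (cmod (d 0 x))\<^sup>2))"
  proof (rule sum.cong[OF refl])
    fix l
    show "tint (\<lambda>x. (cmod (d l x))\<^sup>2) = tint (\<lambda>x. (cmod (d 0 x))\<^sup>2)"
    proof -
      have "tint (\<lambda>x. (cmod (d 0 (x + real l *\<^sub>R h)))\<^sup>2) = tint (\<lambda>x. (cmod (d 0 x))\<^sup>2)"
      proof (rule tint_shift)
        show "cont (\<lambda>x. (cmod (d 0 x))\<^sup>2)" by (intro continuous_intros cd)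
        show "per (\<lambda>x. (cmod (d 0 x))\<^sup>2)" using pd by (rule per_comp)
      qed
      then show ?thesis by (simp only: dl[of l])
    qed
  qed
  finally show ?thesis by (simp add: d_def power2_eq_square mult.assoc)
qed

lemma summation_by_parts:
  fixes c :: complex
  assumes "cont v" "per v" "cont w" "per w"
  shows "tint (\<lambda>x. c * (v (x + h) - 2 * v x + v (x - h)) * cnj (w x)) = - tint (\<lambda>x. c * (v (x + h) - v x) * cnj (w (x + h) - w x))"
proof -
  have cs: "cont (\<lambda>x. v (x + k))" "cont (\<lambda>x. w (x + k))" for k
    by (intro continuous_on_compose2[OF assms(1)] continuous_on_compose2[OF assms(3)] continuous_intros; auto)+
  have cm: "cont (\<lambda>x. v (x - k))" for k using cs(1)[of "-k"] by simp
  have 1: "tint (\<lambda>x. c * (v (x + h) - v x) * cnj (w (x + h))) = tint (\<lambda>x. c * (v x - v (x - h)) * cnj (w x))"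
  proof -
    have "tint (\<lambda>x. (\<lambda>x. c * (v x - v (x - h)) * cnj (w x)) (x + h)) = tint (\<lambda>x. c * (v x - v (x - h)) * cnj (w x))"
    proof (rule tint_shift)
      show "cont (\<lambda>x. c * (v x - v (x - h)) * cnj (w x))" by (intro continuous_intros assms cm)
      have "per (\<lambda>x. v (x - h))" using per_shift[OF assms(2), of "-h"] by simp
      then show "per (\<lambda>x. c * (v x - v (x - h)) * cnj (w x))" using assms by (simp add: per_def)
    qed
    then show ?thesis by simp
  qed
  have "- tint (\<lambda>x. c * (v (x + h) - v x) * cnj (w (x + h) - w x)) = tint (\<lambda>x. c * (v (x + h) - v x) * cnj (w x)) - tint (\<lambda>x. c * (v (x + h) - v x) * cnj (w (x + h)))"
    by (subst tint_diff[symmetric]) (auto intro!: continuous_intros cs assms simp: algebra_simps tint_def simp flip: integral_neg)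
  also have "\<dots> = tint (\<lambda>x. c * (v (x + h) - 2 * v x + v (x - h)) * cnj (w x))"
    unfolding 1 by (subst tint_diff[symmetric]) (auto intro!: continuous_intros cs cm assms arg_cong[where f = tint] simp: algebra_simps)
  finally show ?thesis by simp
qed

lemma powr_power2: "0 \<le> (x::real) \<Longrightarrow> (x powr a)\<^sup>2 = x powr (2 * a)"
  by (simp add: power2_eq_square flip: powr_add)

lemma tev_second_difference:
  "tev V (x + h) - 2 * tev V x + tev V (x - h) = (\<Sum>k | V k \<noteq> 0. (- complex_of_real ((cmod (1 - ee k h))\<^sup>2) * V k) * ee k x)"
proof -
  have "V k * ee k (x + h) - 2 * (V k * ee k x) + V k * ee k (x - h) = (- complex_of_real ((cmod (1 - ee k h))\<^sup>2) * V k) * ee k x" for k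
    by (simp only: complex_norm_square) (simp add: ee_add ee_diff algebra_simps)
  then show ?thesis by (simp add: tev_def sum_distrib_left flip: sum.distrib sum_subtractf)
qed

lemma sin_quotient: fixes c h :: real assumes "h \<noteq> 0" shows "(\<lambda>N. (sin (c * (h / real (Suc N))) / (h / real (Suc N)))\<^sup>2) \<longlonglongrightarrow> c\<^sup>2"
proof -
  have "((\<lambda>x. sin (c * x)) has_real_derivative c) (at 0)"
    by (auto intro!: derivative_eq_intros)
  then have "((\<lambda>x. sin (c * x) / x) \<longlongrightarrow> c) (at 0)" by (simp add: DERIV_def)
  moreover have "filterlim (\<lambda>N. h / real (Suc N)) (at 0) sequentially"
    unfolding filterlim_at using assms LIMSEQ_Suc[OF lim_const_over_n[of h]] by (auto intro!: always_eventually)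
  ultimately have "(\<lambda>N. sin (c * (h / real (Suc N))) / (h / real (Suc N))) \<longlonglongrightarrow> c"
    by (rule filterlim_compose)
  then show ?thesis by (intro tendsto_power)
qed

text \<open>No derivative of a power of |v| is taken. The pointwise inequality
  \<open>elliptic\<close> is applied to increments after discrete summation by parts; as the step
  tends to 0 the multipliers |1 - ee k h|^2 / |h|^2 of the two axes add up to the symbol of the
  Laplacian. A general shift is composed of one step along each axis.\<close>

lemma dissip:
  fixes \<mu> r :: real
  assumes \<mu>: "\<mu> > 0" and r: "r > 1" and cond: "(r - 1)\<^sup>2 < \<mu>\<^sup>2 * (2 * r - 1)"
  shows "\<exists>C\<ge>0. \<forall>V h. fsupp V \<longrightarrow> 0 \<le> Dn \<mu> r V \<and>
    tint (\<lambda>x. max (cmod (tev V (x + h))) (cmod (tev V x)) powr (2 * r - 2) * (cmod (tev V (x + h) - tev V x))\<^sup>2) \<le> C * (norm h)\<^sup>2 * Dn \<mu> r V"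
proof -
  obtain c where c: "c > 0" "\<And>a b. c * (max (cmod a) (cmod b) powr (2 * r - 2) * (cmod (a - b))\<^sup>2) \<le> Re ((\<i> + of_real \<mu>) * (a - b) * cnj (ph (2*r-2) a - ph (2*r-2) b))"
    using elliptic[OF assms] by blast
  define c1 where "c1 = c / (r + 1)\<^sup>2"
  have c1: "c1 > 0" using c(1) r by (simp add: c1_def)
  have mx2: "max (cmod a) (cmod b) powr (2 * r - 2) = (max (cmod a) (cmod b) powr (r - 1))\<^sup>2" for a b
    by (subst powr_power2) (auto simp: le_max_iff_disj algebra_simps)
  have up: "c1 * (cmod (ph (r-1) a - ph (r-1) b))\<^sup>2 \<le> Re ((\<i> + of_real \<mu>) * (a - b) * cnj (ph (2*r-2) a - ph (2*r-2) b))" for a b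
  proof -
    have "cmod (ph (r-1) a - ph (r-1) b) \<le> (r - 1 + 2) * max (cmod a) (cmod b) powr (r-1) * cmod (a - b)"
      using r by (intro ph_upper) auto
    then have "(cmod (ph (r-1) a - ph (r-1) b))\<^sup>2 \<le> ((r + 1) * max (cmod a) (cmod b) powr (r-1) * cmod (a - b))\<^sup>2"
      by (intro power_mono) (auto simp: algebra_simps)
    also have "\<dots> = (r + 1)\<^sup>2 * (max (cmod a) (cmod b) powr (2 * r - 2) * (cmod (a - b))\<^sup>2)"
      by (simp only: power_mult_distrib mx2 mult.assoc)
    finally have "c1 * (cmod (ph (r-1) a - ph (r-1) b))\<^sup>2 \<le> c1 * ((r + 1)\<^sup>2 * (max (cmod a) (cmod b) powr (2 * r - 2) * (cmod (a - b))\<^sup>2))"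
      using c1 by (intro mult_left_mono) auto
    also have "\<dots> = c * (max (cmod a) (cmod b) powr (2 * r - 2) * (cmod (a - b))\<^sup>2)" using r by (simp add: c1_def)
    finally show ?thesis using c(2)[of a b] by linarith
  qed
  have low: "max (cmod a) (cmod b) powr (2 * r - 2) * (cmod (a - b))\<^sup>2 \<le> 4 * (cmod (ph (r-1) a - ph (r-1) b))\<^sup>2" for a b
  proof -
    have "(max (cmod a) (cmod b) powr (r-1) * cmod (a - b))\<^sup>2 \<le> (2 * cmod (ph (r-1) a - ph (r-1) b))\<^sup>2"
      using r by (intro power_mono ph_lower) auto
    then show ?thesis by (simp add: power_mult_distrib mx2)
  qed
  have main: "c1 * tint (\<lambda>x. (cmod (ph (r-1) (tev V (x + e)) - ph (r-1) (tev V x)))\<^sup>2) \<le> (norm e)\<^sup>2 * Dn \<mu> r V"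
    if V: "fsupp V" and e: "e = (t, 0) \<or> e = (0, t)" for V e t
  proof (cases "t = 0")
    case True
    then have "e = 0" using e by (auto simp: zero_prod_def)
    then show ?thesis by simp
  next
    case t: False
    let ?v = "tev V" and ?w = "\<lambda>x. ph (2*r-2) (tev V x)" and ?g = "\<lambda>x. ph (r-1) (tev V x)"
    have cv: "cont ?v" "cont ?w" "cont ?g" using r by (auto intro!: continuous_intros)
    have pv: "per ?v" "per ?w" "per ?g" using per_tev per_comp by blast+
    define S where "S = {k. V k \<noteq> 0}"
    have fin: "finite S" using V by (simp add: S_def fsupp_def)
    define I where "I k = (\<i> + of_real \<mu>) * V k * tint (\<lambda>x. ee k x * cnj (?w x))" for k
    define E where "E k = tint (\<lambda>x. (cmod (?g (x + k) - ?g x))\<^sup>2)" for k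
    have E0: "E k \<ge> 0" for k unfolding E_def
      by (intro tint_nonneg continuous_intros) (use r in auto)
    have expand: "tint (\<lambda>x. (\<i> + of_real \<mu>) * (\<Sum>k\<in>S. (s k * V k) * ee k x) * cnj (?w x)) = (\<Sum>k\<in>S. s k * I k)" for s
    proof -
      have "(\<lambda>x. (\<i> + of_real \<mu>) * (\<Sum>k\<in>S. (s k * V k) * ee k x) * cnj (?w x)) =
         (\<lambda>x. \<Sum>k\<in>S. (s k * ((\<i> + of_real \<mu>) * V k)) * (ee k x * cnj (?w x)))"
        by (simp add: sum_distrib_left sum_distrib_right mult_ac)
      then have "tint (\<lambda>x. (\<i> + of_real \<mu>) * (\<Sum>k\<in>S. (s k * V k) * ee k x) * cnj (?w x)) =
         tint (\<lambda>x. \<Sum>k\<in>S. (s k * ((\<i> + of_real \<mu>) * V k)) * (ee k x * cnj (?w x)))" by (simp only:)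
      also have "\<dots> = (\<Sum>k\<in>S. tint (\<lambda>x. (s k * ((\<i> + of_real \<mu>) * V k)) * (ee k x * cnj (?w x))))"
        using fin r by (intro tint_sum continuous_intros) auto
      also have "\<dots> = (\<Sum>k\<in>S. (s k * ((\<i> + of_real \<mu>) * V k)) * tint (\<lambda>x. ee k x * cnj (?w x)))"
        by (simp only: tint_mult)
      finally show ?thesis by (simp only: I_def mult.assoc)
    qed
    have DnI: "Dn \<mu> r V = - Re (\<Sum>k\<in>S. (- complex_of_real (4 * pi\<^sup>2 * ((real_of_int (fst k))\<^sup>2 + (real_of_int (snd k))\<^sup>2))) * I k)"
    proof -
      have "tev (laplacian V) x = (\<Sum>k\<in>S. (- complex_of_real (4 * pi\<^sup>2 * ((real_of_int (fst k))\<^sup>2 + (real_of_int (snd k))\<^sup>2)) * V k) * ee k x)" for x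
        by (subst tev_on[of S]) (use fin in \<open>auto simp: laplacian_def S_def\<close>)
      then show ?thesis unfolding Dn_def by (simp only: expand)
    qed
    have ineq: "c1 * E h \<le> - Re (\<Sum>k\<in>S. (- complex_of_real ((cmod (1 - ee k h))\<^sup>2)) * I k)" for h
    proof -
      have "(\<Sum>k\<in>S. (- complex_of_real ((cmod (1 - ee k h))\<^sup>2)) * I k) =
        tint (\<lambda>x. (\<i> + of_real \<mu>) * (?v (x + h) - 2 * ?v x + ?v (x - h)) * cnj (?w x))"
        unfolding tev_second_difference S_def[symmetric] by (rule expand[symmetric])
      also have "\<dots> = - tint (\<lambda>x. (\<i> + of_real \<mu>) * (?v (x + h) - ?v x) * cnj (?w (x + h) - ?w x))"
        by (rule summation_by_parts[OF cv(1) pv(1) cv(2) pv(2)])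
      finally have "- Re (\<Sum>k\<in>S. (- complex_of_real ((cmod (1 - ee k h))\<^sup>2)) * I k) =
        tint (\<lambda>x. Re ((\<i> + of_real \<mu>) * (?v (x + h) - ?v x) * cnj (?w (x + h) - ?w x)))"
        using r by (simp only: uminus_complex.sel minus_minus) (rule tint_Re, auto intro!: continuous_intros)
      also have "\<dots> \<ge> tint (\<lambda>x. c1 * (cmod (?g (x + h) - ?g x))\<^sup>2)"
        using r by (intro tint_mono up continuous_intros) auto
      finally show ?thesis by (simp only: E_def tint_mult)
    qed
    have ineq2: "c1 * E (q, 0) + c1 * E (0, q) \<le> - Re (\<Sum>k\<in>S. (- complex_of_real (4 * (sin (pi * real_of_int (fst k) * q))\<^sup>2 + 4 * (sin (pi * real_of_int (snd k) * q))\<^sup>2)) * I k)" for q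
    proof -
      have "(cmod (1 - ee k (q, 0)))\<^sup>2 = 4 * (sin (pi * real_of_int (fst k) * q))\<^sup>2"
        "(cmod (1 - ee k (0, q)))\<^sup>2 = 4 * (sin (pi * real_of_int (snd k) * q))\<^sup>2" for k
        by (auto simp: ee_def one_minus_cis mult.assoc)
      then have "(\<Sum>k\<in>S. (- complex_of_real (4 * (sin (pi * real_of_int (fst k) * q))\<^sup>2 + 4 * (sin (pi * real_of_int (snd k) * q))\<^sup>2)) * I k)
         = (\<Sum>k\<in>S. (- complex_of_real ((cmod (1 - ee k (q, 0)))\<^sup>2)) * I k) + (\<Sum>k\<in>S. (- complex_of_real ((cmod (1 - ee k (0, q)))\<^sup>2)) * I k)"
        by (simp add: algebra_simps flip: sum.distrib)
      then show ?thesis using ineq[of "(q, 0)"] ineq[of "(0, q)"] by (simp only: plus_complex.sel)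
    qed
    \<comment> \<open>The shift along the axis is cut into N + 1 equal steps of length q N.\<close>
    define q where "q N = t / real (Suc N)" for N
    have "c1 * E e \<le> (norm e)\<^sup>2 * (- Re (\<Sum>k\<in>S. (- complex_of_real (4 * (sin (pi * real_of_int (fst k) * q N) / q N)\<^sup>2 + 4 * (sin (pi * real_of_int (snd k) * q N) / q N)\<^sup>2)) * I k))" for N
    proof -
      define f where "f = (if e = (t, 0) then (q N, 0) else (0, q N))"
      have ef: "e = real (Suc N) *\<^sub>R f" using e t by (auto simp: f_def q_def)
      have ne: "(norm e)\<^sup>2 = t\<^sup>2" using e by (auto simp: norm_prod_def)
      have "E e \<le> (real (Suc N))\<^sup>2 * E f" unfolding E_def ef by (rule shift_iterate[OF cv(3) pv(3)])
      also have "real (Suc N) = t / q N" using t by (simp add: q_def)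
      also have "(t / q N)\<^sup>2 * E f = (norm e)\<^sup>2 * (E f / (q N)\<^sup>2)" by (simp add: ne power_divide)
      finally have "c1 * E e \<le> c1 * ((norm e)\<^sup>2 * (E f / (q N)\<^sup>2))" using c1 by (intro mult_left_mono) auto
      then have "c1 * E e \<le> (norm e)\<^sup>2 * (c1 * E f / (q N)\<^sup>2)" by (simp add: mult_ac)
      also have "c1 * E f \<le> c1 * E (q N, 0) + c1 * E (0, q N)" using E0 c1 by (auto simp: f_def)
      then have "c1 * E f \<le> - Re (\<Sum>k\<in>S. (- complex_of_real (4 * (sin (pi * real_of_int (fst k) * q N))\<^sup>2 + 4 * (sin (pi * real_of_int (snd k) * q N))\<^sup>2)) * I k)"
        using ineq2[of "q N"] by linarith
      then have "(norm e)\<^sup>2 * (c1 * E f / (q N)\<^sup>2) \<le> (norm e)\<^sup>2 * (- Re (\<Sum>k\<in>S. (- complex_of_real (4 * (sin (pi * real_of_int (fst k) * q N))\<^sup>2 + 4 * (sin (pi * real_of_int (snd k) * q N))\<^sup>2)) * I k) / (q N)\<^sup>2)"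
        by (intro mult_left_mono divide_right_mono) auto
      also have "- Re (\<Sum>k\<in>S. (- complex_of_real (4 * (sin (pi * real_of_int (fst k) * q N))\<^sup>2 + 4 * (sin (pi * real_of_int (snd k) * q N))\<^sup>2)) * I k) / (q N)\<^sup>2
        = - Re (\<Sum>k\<in>S. (- complex_of_real (4 * (sin (pi * real_of_int (fst k) * q N) / q N)\<^sup>2 + 4 * (sin (pi * real_of_int (snd k) * q N) / q N)\<^sup>2)) * I k)"
      proof -
        have *: "(a + b) / x\<^sup>2 = (a / x\<^sup>2 + b / x\<^sup>2)" for a b x :: real by (simp add: add_divide_distrib)
        show ?thesis by (simp add: sum_divide_distrib power_divide add_divide_distrib sum_negf algebra_simps)
            (rule sum.cong[OF refl], simp add: diff_divide_distrib)
      qed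
      finally show ?thesis .
    qed
    moreover have "(\<lambda>N. (norm e)\<^sup>2 * (- Re (\<Sum>k\<in>S. (- complex_of_real (4 * (sin (pi * real_of_int (fst k) * q N) / q N)\<^sup>2 + 4 * (sin (pi * real_of_int (snd k) * q N) / q N)\<^sup>2)) * I k)))
       \<longlonglongrightarrow> (norm e)\<^sup>2 * (- Re (\<Sum>k\<in>S. (- complex_of_real (4 * (pi * real_of_int (fst k))\<^sup>2 + 4 * (pi * real_of_int (snd k))\<^sup>2)) * I k))"
      unfolding q_def by (intro tendsto_intros sin_quotient[OF t])
    ultimately have "c1 * E e \<le> (norm e)\<^sup>2 * (- Re (\<Sum>k\<in>S. (- complex_of_real (4 * (pi * real_of_int (fst k))\<^sup>2 + 4 * (pi * real_of_int (snd k))\<^sup>2)) * I k))"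
      by (intro LIMSEQ_le_const) auto
    moreover have "4 * (pi * a)\<^sup>2 + 4 * (pi * b)\<^sup>2 = 4 * pi\<^sup>2 * (a\<^sup>2 + b\<^sup>2)" for a b :: real
      by (simp add: power_mult_distrib algebra_simps)
    ultimately show ?thesis unfolding DnI E_def by (simp only:)
  qed
  \<comment> \<open>8 = 4 * 2: a factor 4 from \<open>low\<close> and a factor 2 from squaring the
    sum of the two axis increments.\<close>
  have "0 \<le> Dn \<mu> r V \<and> tint (\<lambda>x. max (cmod (tev V (x + h))) (cmod (tev V x)) powr (2 * r - 2) * (cmod (tev V (x + h) - tev V x))\<^sup>2) \<le> (8 / c1) * (norm h)\<^sup>2 * Dn \<mu> r V"
    if V: "fsupp V" for V h
  proof
    have r1: "r - 1 > 0" using r by simp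
    have r2: "2 * r - 2 > 0" using r by simp
    have "0 \<le> c1 * tint (\<lambda>x. (cmod (ph (r-1) (tev V (x + (1, 0))) - ph (r-1) (tev V x)))\<^sup>2)"
      using c1 by (intro mult_nonneg_nonneg tint_nonneg continuous_intros r1) auto
    then show "0 \<le> Dn \<mu> r V" using main[OF V, of "(1, 0)" 1] by (simp add: norm_prod_def)
    let ?g = "\<lambda>x. ph (r-1) (tev V x)"
    obtain a b where h: "h = (a, b)" by (cases h)
    have "tint (\<lambda>x. max (cmod (tev V (x + h))) (cmod (tev V x)) powr (2 * r - 2) * (cmod (tev V (x + h) - tev V x))\<^sup>2)
       \<le> tint (\<lambda>x. 8 * (cmod (?g (x + (a, 0) + (0, b)) - ?g (x + (a, 0))))\<^sup>2 + 8 * (cmod (?g (x + (a, 0)) - ?g x))\<^sup>2)"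
    proof (rule tint_mono)
      show "cont (\<lambda>x. max (cmod (tev V (x + h))) (cmod (tev V x)) powr (2 * r - 2) * (cmod (tev V (x + h) - tev V x))\<^sup>2)"
        using r2 by (intro continuous_intros continuous_on_powr') (auto simp: le_max_iff_disj)
      show "cont (\<lambda>x. 8 * (cmod (?g (x + (a, 0) + (0, b)) - ?g (x + (a, 0))))\<^sup>2 + 8 * (cmod (?g (x + (a, 0)) - ?g x))\<^sup>2)"
        by (intro continuous_intros r1)
      fix x
      have eq: "x + h = x + (a, 0) + (0, b)" by (cases x) (simp add: h)
      have "max (cmod (tev V (x + h))) (cmod (tev V x)) powr (2 * r - 2) * (cmod (tev V (x + h) - tev V x))\<^sup>2 \<le> 4 * (cmod (?g (x + h) - ?g x))\<^sup>2"
        by (rule low)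
      also have "(cmod (?g (x + h) - ?g x))\<^sup>2 \<le> (cmod (?g (x + (a, 0) + (0, b)) - ?g (x + (a, 0))) + cmod (?g (x + (a, 0)) - ?g x))\<^sup>2"
        unfolding eq using norm_triangle_ineq[of "?g (x + (a, 0) + (0, b)) - ?g (x + (a, 0))" "?g (x + (a, 0)) - ?g x"]
        by (intro power_mono) auto
      also have "\<dots> \<le> 2 * (cmod (?g (x + (a, 0) + (0, b)) - ?g (x + (a, 0))))\<^sup>2 + 2 * (cmod (?g (x + (a, 0)) - ?g x))\<^sup>2"
        using sum_squares_bound[of "cmod (?g (x + (a, 0) + (0, b)) - ?g (x + (a, 0)))" "cmod (?g (x + (a, 0)) - ?g x)"]
        by (simp add: power2_sum)
      finally show "max (cmod (tev V (x + h))) (cmod (tev V x)) powr (2 * r - 2) * (cmod (tev V (x + h) - tev V x))\<^sup>2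
        \<le> 8 * (cmod (?g (x + (a, 0) + (0, b)) - ?g (x + (a, 0))))\<^sup>2 + 8 * (cmod (?g (x + (a, 0)) - ?g x))\<^sup>2" by simp
    qed
    also have "\<dots> = 8 * tint (\<lambda>x. (cmod (?g (x + (a, 0) + (0, b)) - ?g (x + (a, 0))))\<^sup>2) + 8 * tint (\<lambda>x. (cmod (?g (x + (a, 0)) - ?g x))\<^sup>2)"
      by (subst tint_add) (intro continuous_intros r1, intro continuous_intros r1, simp only: tint_mult)
    also have "tint (\<lambda>x. (cmod (?g (x + (a, 0) + (0, b)) - ?g (x + (a, 0))))\<^sup>2) = tint (\<lambda>x. (cmod (?g (x + (0, b)) - ?g x))\<^sup>2)"
    proof -
      have "per (\<lambda>x. (cmod (?g (x + (0, b)) - ?g x))\<^sup>2)"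
        using per_shift[OF per_tev, of V "(0, b)"] per_tev[of V] by (simp add: per_def)
      moreover have "cont (\<lambda>x. (cmod (?g (x + (0, b)) - ?g x))\<^sup>2)" by (intro continuous_intros r1)
      ultimately have "tint (\<lambda>x. (cmod (?g ((x + (a, 0)) + (0, b)) - ?g (x + (a, 0))))\<^sup>2) = tint (\<lambda>x. (cmod (?g (x + (0, b)) - ?g x))\<^sup>2)"
        by (intro tint_shift[of "\<lambda>x. (cmod (?g (x + (0, b)) - ?g x))\<^sup>2"])
      then show ?thesis .
    qed
    finally have "tint (\<lambda>x. max (cmod (tev V (x + h))) (cmod (tev V x)) powr (2 * r - 2) * (cmod (tev V (x + h) - tev V x))\<^sup>2)
      \<le> (8 / c1) * (c1 * tint (\<lambda>x. (cmod (?g (x + (0, b)) - ?g x))\<^sup>2) + c1 * tint (\<lambda>x. (cmod (?g (x + (a, 0)) - ?g x))\<^sup>2))"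
      using c1 by (simp add: distrib_left)
    also have "\<dots> \<le> (8 / c1) * (b\<^sup>2 * Dn \<mu> r V + a\<^sup>2 * Dn \<mu> r V)"
      using c1 main[OF V, of "(0, b)" b] main[OF V, of "(a, 0)" a] by (intro mult_left_mono add_mono) (auto simp: norm_prod_def)
    also have "\<dots> = (8 / c1) * (norm h)\<^sup>2 * Dn \<mu> r V"
      by (simp add: h norm_prod_def algebra_simps)
    finally show "tint (\<lambda>x. max (cmod (tev V (x + h))) (cmod (tev V x)) powr (2 * r - 2) * (cmod (tev V (x + h) - tev V x))\<^sup>2) \<le> (8 / c1) * (norm h)\<^sup>2 * Dn \<mu> r V" .
  qed
  then show ?thesis using c1 by (intro exI[of _ "8 / c1"]) auto
qed

text \<open>Testing a monomial in \<open>v\<close> and its conjugate against \<open>|v|^(2r-2) cnj v\<close> produces this function of \<open>v\<close>.\<close>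

definition fm :: "real \<Rightarrow> nat \<Rightarrow> nat \<Rightarrow> complex \<Rightarrow> complex" where
  "fm r i j z = cnj (ph (2*r-2) z) * z ^ i * cnj z ^ j"

lemma powr_Suc_mult: "0 \<le> (W::real) \<Longrightarrow> W * W powr s = W powr (s + 1)"
  by (cases "W = 0") (auto simp: powr_add)

lemma cmod_fm: "cmod (fm r i j z) = cmod z powr (2 * r - 1 + real (i + j))"
proof (cases "z = 0")
  case False
  then show ?thesis by (simp add: fm_def norm_mult norm_power cmod_ph powr_add powr_realpow powr_diff)
qed (simp add: fm_def ph_def)

text \<open>The induction step for \<open>fm\<close>: another factor z or cnj z raises both the
  exponent and the Lipschitz constant by one.\<close>

lemma lipschitz_times:
  assumes F: "cmod (F a - F b) \<le> L * max (cmod a) (cmod b) powr s * cmod (a - b)" "cmod (F b) \<le> cmod b powr (s + 1)"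
    and g: "cmod (g a) \<le> cmod a" "cmod (g a - g b) \<le> cmod (a - b)" and "0 \<le> s + 1"
  shows "cmod (F a * g a - F b * g b) \<le> (L + 1) * max (cmod a) (cmod b) powr (s + 1) * cmod (a - b)"
proof -
  define W where "W = max (cmod a) (cmod b)"
  have W: "cmod a \<le> W" "cmod b \<le> W" "0 \<le> W" by (auto simp: W_def le_max_iff_disj)
  have "F a * g a - F b * g b = g a * (F a - F b) + F b * (g a - g b)" by (simp add: algebra_simps)
  then have "cmod (F a * g a - F b * g b) \<le> cmod (g a) * cmod (F a - F b) + cmod (F b) * cmod (g a - g b)"
    by (metis norm_triangle_ineq norm_mult)
  also have "\<dots> \<le> W * (L * W powr s * cmod (a - b)) + W powr (s + 1) * cmod (a - b)"
  proof (intro add_mono mult_mono)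
    have "cmod b powr (s + 1) \<le> W powr (s + 1)" using W assms(5) by (intro powr_mono2) auto
    then show "cmod (F b) \<le> W powr (s + 1)" using F(2) by linarith
  qed (use F(1) g W in \<open>auto simp: W_def\<close>)
  also have "\<dots> = (L + 1) * W powr (s + 1) * cmod (a - b)"
    using powr_Suc_mult[OF W(3), of s, symmetric] by (simp add: algebra_simps)
  finally show ?thesis by (simp add: W_def)
qed

lemma fm_lipschitz: assumes r: "r > 1"
  shows "cmod (fm r i j a - fm r i j b) \<le> (2 * r + real (i + j)) * max (cmod a) (cmod b) powr (2 * r - 2 + real (i + j)) * cmod (a - b)"
proof -
  have 0: "cmod (fm r 0 0 a - fm r 0 0 b) \<le> (2 * r) * max (cmod a) (cmod b) powr (2 * r - 2) * cmod (a - b)"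
    using ph_upper[of "2*r-2" a b] r unfolding fm_def by (simp flip: complex_cnj_diff)
  have 1: "cmod (fm r i 0 a - fm r i 0 b) \<le> (2 * r + real i) * max (cmod a) (cmod b) powr (2 * r - 2 + real i) * cmod (a - b)"
    for i :: nat
  proof (induction i)
    case (Suc i)
    have "cmod (fm r i 0 a * a - fm r i 0 b * b) \<le> ((2 * r + real i) + 1) * max (cmod a) (cmod b) powr ((2 * r - 2 + real i) + 1) * cmod (a - b)"
      by (rule lipschitz_times[OF Suc]) (use r in \<open>auto simp: cmod_fm algebra_simps\<close>)
    then show ?case by (simp add: fm_def algebra_simps)
  qed (use 0 in simp)
  show ?thesis
  proof (induction j)
    case (Suc j)
    have "cmod (fm r i j a * cnj a - fm r i j b * cnj b) \<le> ((2 * r + real (i + j)) + 1) * max (cmod a) (cmod b) powr ((2 * r - 2 + real (i + j)) + 1) * cmod (a - b)"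
      by (rule lipschitz_times[OF Suc]) (use r in \<open>auto simp: cmod_fm algebra_simps simp flip: complex_cnj_diff\<close>)
    then show ?case by (simp add: fm_def algebra_simps)
  qed (use 1[of i] in simp)
qed

lemma powr_le_one_plus_powr: fixes W :: real assumes "0 \<le> W" "0 \<le> e" "e \<le> P" shows "W powr e \<le> 1 + W powr P"
proof (cases "W \<le> 1")
  case True then show ?thesis using powr_le1[of e W] assms by (smt (verit) powr_ge_zero)
next
  case False
  then have "W powr e \<le> W powr P" by (intro powr_mono assms) simp
  then show ?thesis by simp
qed

text \<open>If the increment \<open>d\<close> dominates \<open>W ^ q * \<eta>\<close> the gradient term absorbs the left side; otherwise a
  small power of \<open>d\<close> is traded for a power of \<open>\<eta>\<close> and the total power of \<open>W\<close> stays below \<open>2 * r + 2 * m\<close>.\<close>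

lemma young_increment:
  fixes W d \<eta> r :: real
  assumes "0 \<le> W" "0 \<le> d" "d \<le> 2 * W" "0 < \<eta>" "\<eta> \<le> 1" "r > 1" "q \<le> 2 * m" "1 \<le> m"
  shows "W powr (2 * r - 2 + real q) * d \<le> (1 / \<eta>) * (W powr (2 * r - 2) * d\<^sup>2) + 2 * \<eta> powr (1 / (2 * real m)) * (1 + W powr (2 * r + 2 * real m))"
proof (cases "d = 0")
  case False
  define \<sigma> where "\<sigma> = 1 / (2 * real m)"
  have \<sigma>: "0 < \<sigma>" "\<sigma> \<le> 1" "\<sigma> * (2 * real m) = 1" using assms(8) by (auto simp: \<sigma>_def)
  have d: "d > 0" and W: "W > 0" using False assms by auto
  have Wq: "W powr (2 * r - 2 + real q) = W powr (2 * r - 2) * W powr real q" by (rule powr_add)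
  show ?thesis
  proof (cases "W powr real q * \<eta> \<le> d")
    case True
    have "W powr real q \<le> d / \<eta>" using True assms(4) by (simp add: field_simps)
    then have "W powr (2 * r - 2) * W powr real q * d \<le> W powr (2 * r - 2) * (d / \<eta>) * d"
      using d by (intro mult_right_mono mult_left_mono) auto
    also have "\<dots> = (1 / \<eta>) * (W powr (2 * r - 2) * d\<^sup>2)" by (simp add: power2_eq_square)
    also have "\<dots> \<le> (1 / \<eta>) * (W powr (2 * r - 2) * d\<^sup>2) + 2 * \<eta> powr (1 / (2 * real m)) * (1 + W powr (2 * r + 2 * real m))" by simp
    finally show ?thesis unfolding Wq .
  next
    case c2: False
    have "d = d powr \<sigma> * d powr (1 - \<sigma>)" using d by (simp flip: powr_add)
    also have "\<dots> \<le> (W powr real q * \<eta>) powr \<sigma> * (2 * W) powr (1 - \<sigma>)"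
      using c2 d \<sigma> assms by (intro mult_mono powr_mono2) auto
    also have "\<dots> = \<eta> powr \<sigma> * 2 powr (1 - \<sigma>) * W powr (real q * \<sigma> + 1 - \<sigma>)"
      using W assms by (simp add: powr_mult powr_powr powr_add powr_diff)
    also have "\<dots> \<le> \<eta> powr \<sigma> * 2 * W powr (real q * \<sigma> + 1 - \<sigma>)"
      using \<sigma> powr_mono[of "1 - \<sigma>" 1 "2::real"] by (intro mult_right_mono mult_left_mono) auto
    finally have "W powr (2 * r - 2 + real q) * d \<le> W powr (2 * r - 2 + real q) * (\<eta> powr \<sigma> * 2 * W powr (real q * \<sigma> + 1 - \<sigma>))"
      by (intro mult_left_mono) auto
    also have "\<dots> = 2 * \<eta> powr \<sigma> * W powr (2 * r - 2 + real q + (real q * \<sigma> + 1 - \<sigma>))"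
      using powr_add[of W "2 * r - 2 + real q" "real q * \<sigma> + 1 - \<sigma>"] by (simp only: mult_ac)
    also have "\<dots> \<le> 2 * \<eta> powr \<sigma> * (1 + W powr (2 * r + 2 * real m))"
    proof (intro mult_left_mono powr_le_one_plus_powr)
      have "real q * \<sigma> \<le> (2 * real m) * \<sigma>" using assms \<sigma> by (intro mult_right_mono) auto
      moreover have "real q \<le> 2 * real m" using assms(7) by (simp flip: of_nat_le_iff[where 'a=real])
      moreover have "(2 * real m) * \<sigma> = 1" using \<sigma> by (simp add: mult.commute)
      ultimately show "2 * r - 2 + real q + (real q * \<sigma> + 1 - \<sigma>) \<le> 2 * r + 2 * real m" using \<sigma>(1) by linarith
      have "0 \<le> real q * \<sigma>" using \<sigma> by simp
      then show "0 \<le> 2 * r - 2 + real q + (real q * \<sigma> + 1 - \<sigma>)" using \<sigma> assms by linarith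
    qed (use W in auto)
    also have "\<dots> \<le> (1 / \<eta>) * (W powr (2 * r - 2) * d\<^sup>2) + 2 * \<eta> powr \<sigma> * (1 + W powr (2 * r + 2 * real m))" using assms by simp
    finally show ?thesis by (simp add: \<sigma>_def)
  qed
qed (use assms in simp)

subsection \<open>Duality with negative regularity\<close>

definition Xn :: "real \<Rightarrow> nat \<Rightarrow> distr \<Rightarrow> real" where
  "Xn r m V = tint (\<lambda>x. cmod (tev V x) powr (2 * r + 2 * real m))"

lemma cont_fm [continuous_intros]: "r > 1 \<Longrightarrow> continuous_on S g \<Longrightarrow> continuous_on S (\<lambda>x. fm r i j (g x))"
  unfolding fm_def by (intro continuous_intros) auto

lemma cont_cmod_powr [continuous_intros]: "a > 0 \<Longrightarrow> continuous_on S g \<Longrightarrow> continuous_on S (\<lambda>x. cmod (g x) powr a)"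
  by (intro continuous_on_powr' continuous_intros) auto

lemma Xn_nonneg: "r > 1 \<Longrightarrow> 0 \<le> Xn r m V"
  unfolding Xn_def by (intro tint_nonneg continuous_intros) auto

lemma torus_norm: "h \<in> torus \<Longrightarrow> norm h \<le> 1"
proof -
  assume h: "h \<in> torus"
  obtain a b where [simp]: "h = (a, b)" by (cases h)
  have "\<bar>a\<bar> \<le> 1/2" "\<bar>b\<bar> \<le> 1/2" using h by (auto simp: torus_def)
  then have "a\<^sup>2 \<le> (1/2)\<^sup>2" "b\<^sup>2 \<le> (1/2)\<^sup>2" by (metis abs_le_square_iff abs_of_pos half_gt_zero_iff zero_less_one)+
  then have "a\<^sup>2 + b\<^sup>2 \<le> 1" by (simp add: power_divide)
  then show ?thesis by (simp add: norm_prod_def)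
qed

text \<open>\<open>young_increment\<close> is used with \<eta> = |h|. The gradient part contributes
  |h|^2 / |h| times the dissipation, and the rest |h| powr (1/(2m)) times moments; for |h| \<le> 1
  the latter power dominates.\<close>

lemma fm_holder:
  fixes \<mu> r :: real
  assumes "\<mu> > 0" "r > 1" "(r - 1)\<^sup>2 < \<mu>\<^sup>2 * (2 * r - 1)" "1 \<le> m"
  shows "\<exists>C\<ge>0. \<forall>V h i j. fsupp V \<longrightarrow> i + j \<le> 2 * m \<longrightarrow> h \<in> torus \<longrightarrow>
    tint (\<lambda>x. cmod (fm r i j (tev V (x + h)) - fm r i j (tev V x))) \<le> C * (1 + Dn \<mu> r V + Xn r m V) * norm h powr (1 / (2 * real m))"
proof -
  note r = assms(2)
  obtain C where C: "C \<ge> 0" "\<And>V h. fsupp V \<Longrightarrow> 0 \<le> Dn \<mu> r V"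
    "\<And>V h. fsupp V \<Longrightarrow> tint (\<lambda>x. max (cmod (tev V (x + h))) (cmod (tev V x)) powr (2 * r - 2) * (cmod (tev V (x + h) - tev V x))\<^sup>2) \<le> C * (norm h)\<^sup>2 * Dn \<mu> r V"
    using dissip[OF assms(1-3)] by blast
  define \<sigma> where "\<sigma> = 1 / (2 * real m)"
  have \<sigma>: "0 < \<sigma>" "\<sigma> \<le> 1" using assms(4) by (auto simp: \<sigma>_def)
  define P where "P = 2 * r + 2 * real m"
  have P: "P > 0" using r by (simp add: P_def)
  define L where "L = 2 * r + 2 * real m"
  have L: "L \<ge> 0" using r by (simp add: L_def)
  have "tint (\<lambda>x. cmod (fm r i j (tev V (x + h)) - fm r i j (tev V x))) \<le> (L * (C + 4)) * (1 + Dn \<mu> r V + Xn r m V) * norm h powr \<sigma>"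
    if V: "fsupp V" and ij: "i + j \<le> 2 * m" and h: "h \<in> torus" for V h i j
  proof (cases "h = 0")
    case True
    then show ?thesis by simp
  next
    case False
    define \<eta> where "\<eta> = norm h"
    have \<eta>: "0 < \<eta>" "\<eta> \<le> 1" using False torus_norm[OF h] by (auto simp: \<eta>_def)
    define W where "W x = max (cmod (tev V (x + h))) (cmod (tev V x))" for x
    define d where "d x = cmod (tev V (x + h) - tev V x)" for x
    have W0: "0 \<le> W x" for x by (simp add: W_def le_max_iff_disj)
    have dW: "0 \<le> d x" "d x \<le> 2 * W x" for x
      using norm_triangle_ineq4[of "tev V (x + h)" "tev V x"] by (auto simp: W_def d_def)
    have cW: "cont W" "cont d" unfolding W_def d_def by (intro continuous_intros)+
    have cWp: "cont (\<lambda>x. W x powr a)" if "a > 0" for a using that W0 by (intro continuous_on_powr' cW continuous_intros) auto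
    have cf: "cont (\<lambda>x. cmod (tev V (x + h)) powr P)" "cont (\<lambda>x. cmod (tev V x) powr P)" by (intro continuous_intros P)+
    have Xs: "tint (\<lambda>x. cmod (tev V (x + h)) powr P) = Xn r m V"
      unfolding Xn_def P_def[symmetric] by (rule tint_shift[of "\<lambda>x. cmod (tev V x) powr P"]) (use per_tev in \<open>auto intro!: continuous_intros P simp: per_def\<close>)
    have pt: "cmod (fm r i j (tev V (x + h)) - fm r i j (tev V x)) \<le>
       (L / \<eta>) * (W x powr (2 * r - 2) * (d x)\<^sup>2) + (2 * L * \<eta> powr \<sigma>) * (1 + cmod (tev V (x + h)) powr P + cmod (tev V x) powr P)" for x
    proof -
      have "cmod (fm r i j (tev V (x + h)) - fm r i j (tev V x)) \<le> (2 * r + real (i + j)) * W x powr (2 * r - 2 + real (i + j)) * d x"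
        unfolding W_def d_def by (rule fm_lipschitz[OF r])
      also have "\<dots> \<le> L * (W x powr (2 * r - 2 + real (i + j)) * d x)"
        unfolding mult.assoc using ij dW by (intro mult_right_mono) (auto simp: L_def)
      also have "\<dots> \<le> L * ((1 / \<eta>) * (W x powr (2 * r - 2) * (d x)\<^sup>2) + 2 * \<eta> powr \<sigma> * (1 + W x powr P))"
        unfolding \<sigma>_def P_def by (intro mult_left_mono young_increment W0 dW \<eta> r ij assms L)
      also have "\<dots> \<le> L * ((1 / \<eta>) * (W x powr (2 * r - 2) * (d x)\<^sup>2) + 2 * \<eta> powr \<sigma> * (1 + cmod (tev V (x + h)) powr P + cmod (tev V x) powr P))"
        by (intro mult_left_mono add_left_mono L) (auto simp: W_def max_def)
      also have "\<dots> = (L / \<eta>) * (W x powr (2 * r - 2) * (d x)\<^sup>2) + (2 * L * \<eta> powr \<sigma>) * (1 + cmod (tev V (x + h)) powr P + cmod (tev V x) powr P)"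
        by (simp add: algebra_simps)
      finally show ?thesis .
    qed
    have c1: "cont (\<lambda>x. (L / \<eta>) * (W x powr (2 * r - 2) * (d x)\<^sup>2))" using r by (intro continuous_intros cW cWp) auto
    have c2: "cont (\<lambda>x. (2 * L * \<eta> powr \<sigma>) * (1 + cmod (tev V (x + h)) powr P + cmod (tev V x) powr P))" by (intro continuous_intros P)
    have c3: "cont (\<lambda>x. 1 + cmod (tev V (x + h)) powr P)" by (intro continuous_intros P)
    have "tint (\<lambda>x. cmod (fm r i j (tev V (x + h)) - fm r i j (tev V x))) \<le>
      tint (\<lambda>x. (L / \<eta>) * (W x powr (2 * r - 2) * (d x)\<^sup>2) + (2 * L * \<eta> powr \<sigma>) * (1 + cmod (tev V (x + h)) powr P + cmod (tev V x) powr P))"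
      by (rule tint_mono, (intro continuous_intros r)[1], rule continuous_on_add[OF c1 c2], rule pt)
    also have "\<dots> = (L / \<eta>) * tint (\<lambda>x. W x powr (2 * r - 2) * (d x)\<^sup>2) + (2 * L * \<eta> powr \<sigma>) * (1 + Xn r m V + Xn r m V)"
      unfolding tint_add[OF c1 c2] tint_mult tint_add[OF c3 cf(2)] tint_add[OF continuous_on_const cf(1)] Xs tint_const
      by (simp add: Xn_def P_def)
    also have "\<dots> \<le> (L / \<eta>) * (C * \<eta>\<^sup>2 * Dn \<mu> r V) + (2 * L * \<eta> powr \<sigma>) * (1 + Xn r m V + Xn r m V)"
      using C(3)[OF V, of h] L \<eta> unfolding W_def d_def \<eta>_def by (intro add_right_mono mult_left_mono) auto
    also have "(L / \<eta>) * (C * \<eta>\<^sup>2 * Dn \<mu> r V) = L * C * Dn \<mu> r V * \<eta>" using \<eta> by (simp add: power2_eq_square)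
    also have "\<dots> \<le> L * C * Dn \<mu> r V * \<eta> powr \<sigma>"
      using \<eta> \<sigma> powr_mono'[of \<sigma> 1 \<eta>] L C(1) C(2)[OF V] by (intro mult_left_mono) auto
    also have "L * C * Dn \<mu> r V * \<eta> powr \<sigma> + (2 * L * \<eta> powr \<sigma>) * (1 + Xn r m V + Xn r m V) = L * (C * Dn \<mu> r V + (2 + 4 * Xn r m V)) * \<eta> powr \<sigma>"
      by (simp add: algebra_simps)
    also have "\<dots> \<le> L * ((C + 4) * (1 + Dn \<mu> r V + Xn r m V)) * \<eta> powr \<sigma>"
    proof (intro mult_right_mono mult_left_mono L)
      have "0 \<le> C * Xn r m V" "0 \<le> Dn \<mu> r V" using C(1) C(2)[OF V] Xn_nonneg[OF r, of m V] by auto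
      then show "C * Dn \<mu> r V + (2 + 4 * Xn r m V) \<le> (C + 4) * (1 + Dn \<mu> r V + Xn r m V)"
        using C(1) by (simp add: algebra_simps)
    qed auto
    finally show ?thesis by (simp add: \<eta>_def mult.assoc)
  qed
  then show ?thesis using L C(1) unfolding \<sigma>_def by (intro exI[of _ "L * (C + 4)"]) auto
qed

text \<open>After the convolution is moved onto f, the kernel has mean zero because M 0 = 0, so f (x
  + y) may be replaced by its increment. The modulus of continuity is then integrated against the
  kernel, whose moment of order \<sigma> is O(R powr (-\<sigma>)).\<close>

lemma block_pairing:
  assumes s: "0 < \<sigma>" "\<sigma> \<le> 1/2" and f: "cont f" "per f"
    and m: "fsupp M" "M 0 = 0" "tint (\<lambda>y. cmod (tev M y) * wt R y powr (1/4)) \<le> L" and R: "R \<ge> 1"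
    and hol: "\<And>h. h \<in> torus \<Longrightarrow> tint (\<lambda>x. cmod (f (x + h) - f x)) \<le> A * norm h powr \<sigma>"
    and g: "fsupp g" "\<And>x. cmod (tev g x) \<le> B"
  shows "cmod (tint (\<lambda>x. f x * tev (mul M g) x)) \<le> A * B * (L * R powr (-\<sigma>))"
proof -
  have cs: "cont (\<lambda>x. f (x + h))" for h by (intro continuous_on_compose2[OF f(1)] continuous_intros) auto
  have B: "B \<ge> 0" using g(2)[of 0] norm_ge_zero order_trans by blast
  have A: "A \<ge> 0"
  proof -
    have "(1/2, 0) \<in> torus" by (auto simp: torus_def)
    from hol[OF this] have "0 \<le> A * norm (1/2::real, 0::real) powr \<sigma>"
      by (rule order_trans[rotated]) (intro tint_nonneg continuous_intros cs f; simp)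
    then show ?thesis by (simp add: zero_le_mult_iff)
  qed
  have j1: "cont (\<lambda>(x, y). f x * (tev M y * tev g (x - y)))"
    unfolding split_beta by (intro continuous_intros continuous_on_compose2[OF f(1)]) auto
  have "tint (\<lambda>x. f x * tev (mul M g) x) = tint (\<lambda>x. tint (\<lambda>y. f x * (tev M y * tev g (x - y))))"
    unfolding tev_mul[OF m(1) g(1)] by (simp add: tint_mult)
  also have "\<dots> = tint (\<lambda>y. tint (\<lambda>x. f x * (tev M y * tev g (x - y))))" by (rule tint_swap[OF j1])
  also have "\<dots> = tint (\<lambda>y. tev M y * tint (\<lambda>x. f (x + y) * tev g x))"
  proof (intro arg_cong[where f = tint] ext)
    fix y
    have "tint (\<lambda>x. f x * (tev M y * tev g (x - y))) = tev M y * tint (\<lambda>x. f x * tev g (x - y))"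
    proof -
      have "(\<lambda>x. f x * (tev M y * tev g (x - y))) = (\<lambda>x. tev M y * (f x * tev g (x - y)))" by (simp add: mult_ac)
      then show ?thesis by (simp only: tint_mult)
    qed
    also have "tint (\<lambda>x. f x * tev g (x - y)) = tint (\<lambda>x. f (x + y) * tev g (x + y - y))"
    proof (rule tint_shift[symmetric, of "\<lambda>x. f x * tev g (x - y)"])
      show "cont (\<lambda>x. f x * tev g (x - y))" by (intro continuous_intros f)
      show "per (\<lambda>x. f x * tev g (x - y))" using f(2) per_shift[OF per_tev, of g "-y"] by (simp add: per_def)
    qed
    finally show "tint (\<lambda>x. f x * (tev M y * tev g (x - y))) = tev M y * tint (\<lambda>x. f (x + y) * tev g x)" by simp
  qed
  also have "\<dots> = tint (\<lambda>y. tev M y * tint (\<lambda>x. (f (x + y) - f x) * tev g x))"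
  proof -
    define c where "c = tint (\<lambda>x. f x * tev g x)"
    have z: "tint (tev M) = 0" using tev_tint[OF m(1), of 0] m(2) by simp
    have c1: "cont (\<lambda>y. tint (\<lambda>x. f (x + y) * tev g x))"
      by (rule cont_tint) (unfold split_beta, intro continuous_intros continuous_on_compose2[OF f(1)], auto)
    have "tint (\<lambda>x. (f (x + y) - f x) * tev g x) = tint (\<lambda>x. f (x + y) * tev g x) - c" for y
      unfolding c_def by (subst tint_diff[symmetric]) (auto intro!: continuous_intros cs f simp: algebra_simps)
    then have "tint (\<lambda>y. tev M y * tint (\<lambda>x. (f (x + y) - f x) * tev g x)) = tint (\<lambda>y. tev M y * tint (\<lambda>x. f (x + y) * tev g x) - c * tev M y)"
      by (simp only: right_diff_distrib mult.commute[of c])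
    also have "\<dots> = tint (\<lambda>y. tev M y * tint (\<lambda>x. f (x + y) * tev g x)) - c * tint (tev M)"
      by (subst tint_diff) (auto intro!: continuous_intros c1 simp: tint_mult)
    finally show ?thesis by (simp add: z)
  qed
  also have "cmod \<dots> \<le> tint (\<lambda>y. cmod (tev M y * tint (\<lambda>x. (f (x + y) - f x) * tev g x)))"
  proof (rule tint_norm)
    have "cont (\<lambda>y. tint (\<lambda>x. (f (x + y) - f x) * tev g x))"
      by (rule cont_tint) (unfold split_beta, intro continuous_intros continuous_on_compose2[OF f(1)], auto)
    then show "cont (\<lambda>y. tev M y * tint (\<lambda>x. (f (x + y) - f x) * tev g x))" by (intro continuous_intros)
  qed
  also have "\<dots> \<le> tint (\<lambda>y. (A * B) * (cmod (tev M y) * norm y powr \<sigma>))"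
  proof (rule tint_mono_torus)
    have "cont (\<lambda>y. tint (\<lambda>x. (f (x + y) - f x) * tev g x))"
      by (rule cont_tint) (unfold split_beta, intro continuous_intros continuous_on_compose2[OF f(1)], auto)
    then show "cont (\<lambda>y. cmod (tev M y * tint (\<lambda>x. (f (x + y) - f x) * tev g x)))" by (intro continuous_intros)
    show "cont (\<lambda>y. (A * B) * (cmod (tev M y) * norm y powr \<sigma>))"
      using s by (intro continuous_intros continuous_on_powr') auto
    fix y :: "real \<times> real" assume y: "y \<in> torus"
    have "cmod (tint (\<lambda>x. (f (x + y) - f x) * tev g x)) \<le> tint (\<lambda>x. cmod ((f (x + y) - f x) * tev g x))"
      by (rule tint_norm) (intro continuous_intros cs f)
    also have "\<dots> \<le> tint (\<lambda>x. B * cmod (f (x + y) - f x))"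
    proof (rule tint_mono)
      show "cmod ((f (x + y) - f x) * tev g x) \<le> B * cmod (f (x + y) - f x)" for x
        using mult_left_mono[OF g(2)[of x], of "cmod (f (x + y) - f x)"] by (simp add: norm_mult mult.commute)
    qed (intro continuous_intros cs f)+
    also have "\<dots> \<le> B * (A * norm y powr \<sigma>)" unfolding tint_mult by (intro mult_left_mono hol y B)
    finally have "cmod (tev M y) * cmod (tint (\<lambda>x. (f (x + y) - f x) * tev g x)) \<le> cmod (tev M y) * (B * (A * norm y powr \<sigma>))"
      by (intro mult_left_mono) auto
    then show "cmod (tev M y * tint (\<lambda>x. (f (x + y) - f x) * tev g x)) \<le> (A * B) * (cmod (tev M y) * norm y powr \<sigma>)"
      by (simp add: norm_mult mult_ac)
  qed
  also have "\<dots> \<le> (A * B) * (L * R powr (-\<sigma>))"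
    unfolding tint_mult using A B by (intro mult_left_mono kernel_moment m R s) auto
  finally show ?thesis .
qed

lemma D_chi: assumes "n \<ge> 1" shows "D n Z = mul (dilate (2 ^ n) (\<lambda>\<xi>. complex_of_real (lp_chi \<xi>))) (D n Z)"
proof
  fix k
  show "D n Z k = mul (dilate (2 ^ n) (\<lambda>\<xi>. complex_of_real (lp_chi \<xi>))) (D n Z) k"
  proof (cases "sg n k = 0")
    case False
    obtain l where n: "n = Suc l" using assms by (cases n) auto
    have "nk k < 2 ^ Suc n" "2 ^ (n - 1) < nk k" using sg_supp[OF False] assms by auto
    then have "norm ((1 / 2 ^ n) *\<^sub>R kvec k) \<le> 2" "1/2 \<le> norm ((1 / 2 ^ n) *\<^sub>R kvec k)"
      using n by (auto simp: nk_def field_simps)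
    then have "lp_chi ((1 / 2 ^ n) *\<^sub>R kvec k) = 1" by (intro lp_chi_one)
    then show ?thesis by (simp add: mul_def dilate_def)
  qed (simp add: mul_def D_def)
qed

lemma prof_chi: "\<exists>C\<ge>0. profile C (\<lambda>\<xi>. complex_of_real (lp_chi \<xi>))"
proof -
  obtain C where C: "C \<ge> 0" "\<forall>\<tau>\<ge>0. profile (C / (1 + \<tau>)) (heat_profile 1 \<tau>)" using prof_heat[of 1] by auto
  then have "profile (C / (1 + 0)) (heat_profile 1 0)" by blast
  moreover have "heat_profile 1 0 = (\<lambda>\<xi>. complex_of_real (lp_chi \<xi>))" by (auto simp: heat_profile_def)
  ultimately show ?thesis using C(1) by auto
qed

text \<open>Low blocks only see the L^1 norm of f. High blocks see its modulus of continuity and sum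
  geometrically with rate \<sigma> - al; starting them late enough makes the constant in front of A
  as small as desired, at the expense of C.\<close>

lemma duality:
  assumes s: "0 < \<sigma>" "\<sigma> \<le> 1/2" and al: "0 < al" "al < \<sigma>" and \<epsilon>: "\<epsilon> > 0"
  shows "\<exists>C\<ge>0. \<forall>f A A' K Z. cont f \<longrightarrow> per f \<longrightarrow> (\<forall>h\<in>torus. tint (\<lambda>x. cmod (f (x + h) - f x)) \<le> A * norm h powr \<sigma>) \<longrightarrow>
    tint (\<lambda>x. cmod (f x)) \<le> A' \<longrightarrow> fsupp Z \<longrightarrow> bb (-al) K Z \<longrightarrow> cmod (tint (\<lambda>x. f x * tev Z x)) \<le> K * (\<epsilon> * A + C * A')"
proof -
  obtain Q where Q: "Q \<ge> 0" "profile Q (\<lambda>\<xi>. complex_of_real (lp_chi \<xi>))" using prof_chi by blast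
  define e where "e = \<sigma> - al"
  have e: "e > 0" using al by (simp add: e_def)
  define H where "H = 560 * Q * geo e"
  have H: "H \<ge> 0" using Q geo_pos[OF e] by (simp add: H_def)
  have "\<forall>\<^sub>F N in sequentially. H * 2 powr (- e * real N) < \<epsilon>"
    by (rule order_tendstoD(2)[OF two_powr_tendsto[OF e] \<epsilon>])
  then obtain N1' where "H * 2 powr (- e * real N1') < \<epsilon>" unfolding eventually_sequentially by blast
  then obtain N1 where N1: "N1 \<ge> 1" "H * 2 powr (- e * real N1) \<le> \<epsilon>"
  proof -
    assume a: "H * 2 powr (- e * real N1') < \<epsilon>" and t: "\<And>N1. 1 \<le> N1 \<Longrightarrow> H * 2 powr (- e * real N1) \<le> \<epsilon> \<Longrightarrow> thesis"
    have "- e * real (Suc N1') \<le> - e * real N1'" using e by (simp add: algebra_simps)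
    then have "2 powr (- e * real (Suc N1')) \<le> 2 powr (- e * real N1')" by (rule powr_mono) simp
    then have "H * 2 powr (- e * real (Suc N1')) \<le> H * 2 powr (- e * real N1')" by (rule mult_left_mono[OF _ H])
    then show thesis using a by (intro t[of "Suc N1'"]) auto
  qed
  define C where "C = (\<Sum>n<N1. 2 powr (al * real n))"
  have C: "C \<ge> 0" unfolding C_def by (intro sum_nonneg) auto
  have "cmod (tint (\<lambda>x. f x * tev Z x)) \<le> K * (\<epsilon> * A + C * A')"
    if f: "cont f" "per f" and hol: "\<And>h. h \<in> torus \<Longrightarrow> tint (\<lambda>x. cmod (f (x + h) - f x)) \<le> A * norm h powr \<sigma>"
    and A': "tint (\<lambda>x. cmod (f x)) \<le> A'" and Z: "fsupp Z" "bb (-al) K Z" for f A A' K Z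
  proof -
    have K: "K \<ge> 0" by (rule bb_nonneg[OF Z(2)])
    have A0: "A \<ge> 0"
    proof -
      have t: "(1/2, 0) \<in> torus" by (auto simp: torus_def)
      have "0 \<le> tint (\<lambda>x. cmod (f (x + (1/2, 0)) - f x))"
        by (intro tint_nonneg continuous_intros f continuous_on_compose2[OF f(1)]) auto
      then have "0 \<le> A * norm (1/2::real, 0::real) powr \<sigma>" using hol[OF t] by linarith
      then show ?thesis by (simp add: zero_le_mult_iff)
    qed
    obtain M where M: "\<And>N. N \<ge> M \<Longrightarrow> Z = (\<lambda>k. \<Sum>n<N. D n Z k)" using fsupp_decomp[OF Z(1)] by blast
    define N2 where "N2 = max M N1"
    have tZ: "tev Z x = (\<Sum>n<N2. tev (D n Z) x)" for x
      by (subst M[of N2]) (auto simp: N2_def tev_sum)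
    have low: "cmod (tint (\<lambda>x. f x * tev (D n Z) x)) \<le> K * A' * 2 powr (al * real n)" for n
    proof -
      have "cmod (tint (\<lambda>x. f x * tev (D n Z) x)) \<le> tint (\<lambda>x. cmod (f x * tev (D n Z) x))"
        by (rule tint_norm) (intro continuous_intros f)
      also have "\<dots> \<le> tint (\<lambda>x. (K * 2 powr (al * real n)) * cmod (f x))"
      proof (rule tint_mono)
        show "cmod (f x * tev (D n Z) x) \<le> (K * 2 powr (al * real n)) * cmod (f x)" for x
          using mult_left_mono[OF bbD[OF Z(2), of n x], of "cmod (f x)"] by (simp add: norm_mult mult.commute)
      qed (intro continuous_intros f)+
      also have "\<dots> \<le> (K * 2 powr (al * real n)) * A'" unfolding tint_mult using K by (intro mult_left_mono A') auto
      finally show ?thesis by (simp add: mult_ac)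
    qed
    have high: "cmod (tint (\<lambda>x. f x * tev (D n Z) x)) \<le> K * A * (560 * Q) * 2 powr (- e * real n)" if n: "n \<ge> 1" for n
    proof -
      have R: "(1::real) \<le> 2 ^ n" by simp
      have "cmod (tint (\<lambda>x. f x * tev (D n Z) x)) = cmod (tint (\<lambda>x. f x * tev (mul (dilate (2 ^ n) (\<lambda>\<xi>. complex_of_real (lp_chi \<xi>))) (D n Z)) x))"
        by (simp only: D_chi[OF n, symmetric])
      also have "\<dots> \<le> A * (K * 2 powr (- (- al) * real n)) * ((560 * Q) * (2 ^ n) powr (-\<sigma>))"
      proof (rule block_pairing[OF s f prof_kernel(1)[OF Q(2) R] _ prof_kernel(2)[OF Q(2) R] R hol fsupp_D bbD[OF Z(2)]])
        show "dilate (2 ^ n) (\<lambda>\<xi>. complex_of_real (lp_chi \<xi>)) 0 = 0"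
          by (simp add: dilate_def kvec_def lp_chi_supp zero_prod_def[symmetric])
      qed
      also have "(2 ^ n) powr (-\<sigma>) = 2 powr (- \<sigma> * real n)" by (simp add: powr_realpow[symmetric] powr_powr mult.commute)
      also have "A * (K * 2 powr (- (- al) * real n)) * ((560 * Q) * 2 powr (- \<sigma> * real n)) = K * A * (560 * Q) * (2 powr (al * real n) * 2 powr (- \<sigma> * real n))"
        by simp
      also have "2 powr (al * real n) * 2 powr (- \<sigma> * real n) = 2 powr (- e * real n)"
        by (simp add: e_def algebra_simps flip: powr_add)
      finally show ?thesis .
    qed
    have "tint (\<lambda>x. f x * tev Z x) = (\<Sum>n<N2. tint (\<lambda>x. f x * tev (D n Z) x))"
      unfolding tZ sum_distrib_left by (rule tint_sum) (auto intro!: continuous_intros f)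
    also have "cmod \<dots> \<le> (\<Sum>n<N2. cmod (tint (\<lambda>x. f x * tev (D n Z) x)))" by (rule norm_sum)
    also have "\<dots> = (\<Sum>n<N1. cmod (tint (\<lambda>x. f x * tev (D n Z) x))) + (\<Sum>n\<in>{N1..<N2}. cmod (tint (\<lambda>x. f x * tev (D n Z) x)))"
      by (subst sum.union_disjoint[symmetric]) (auto simp: N2_def intro!: sum.cong)
    also have "\<dots> \<le> (\<Sum>n<N1. K * A' * 2 powr (al * real n)) + (\<Sum>n\<in>{N1..<N2}. K * A * (560 * Q) * 2 powr (- e * real n))"
      using N1(1) by (intro add_mono sum_mono low high) auto
    also have "(\<Sum>n<N1. K * A' * 2 powr (al * real n)) = K * (C * A')" by (simp add: C_def sum_distrib_left sum_distrib_right mult_ac)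
    also have "(\<Sum>n\<in>{N1..<N2}. K * A * (560 * Q) * 2 powr (- e * real n)) \<le> K * (\<epsilon> * A)"
    proof -
      have "(\<Sum>n\<in>{N1..<N2}. 2 powr (- e * real n)) = (\<Sum>i<N2 - N1. 2 powr (- e * real (i + N1)))"
        by (rule sum.reindex_bij_witness[of _ "\<lambda>i. i + N1" "\<lambda>n. n - N1"]) auto
      also have "\<dots> = 2 powr (- e * real N1) * (\<Sum>i<N2 - N1. 2 powr (- e * real i))"
        unfolding sum_distrib_left by (intro sum.cong refl) (simp add: algebra_simps flip: powr_add)
      also have "\<dots> \<le> 2 powr (- e * real N1) * geo e" by (intro mult_left_mono geo_sum e) auto
      finally have "K * A * (560 * Q) * (\<Sum>n\<in>{N1..<N2}. 2 powr (- e * real n)) \<le> K * A * (560 * Q) * (2 powr (- e * real N1) * geo e)"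
        using K A0 Q by (intro mult_left_mono) auto
      also have "\<dots> = (K * A) * (H * 2 powr (- e * real N1))" by (simp add: H_def)
      also have "\<dots> \<le> (K * A) * \<epsilon>" using K A0 N1(2) by (intro mult_left_mono) auto
      finally show ?thesis by (simp add: sum_distrib_left mult_ac)
    qed
    finally show ?thesis by (simp add: algebra_simps)
  qed
  then show ?thesis using C by blast
qed

section \<open>Embedding of L^(2r) and pairing with the nonlinearity\<close>

lemma tint_reflect: assumes "cont f" shows "tint (\<lambda>y. f (- y)) = tint (f :: real \<times> real \<Rightarrow> real)"
proof -
  have "torus = cbox (- (1/2, 1/2)) (- (-1/2, -1/2))" by (simp add: torus_def)
  then show ?thesis unfolding tint_def using integral_reflect[of "(1/2, 1/2)" "(-1/2,-1/2)::real\<times>real" f]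
    by (simp add: torus_def)
qed

lemma card_box: "real (card (lp_box n)) \<le> 256 * 4 ^ n"
proof -
  have "real (card (lp_box n)) = (2 * 2 ^ (n + 2) + 1)\<^sup>2"
  proof -
    have "card {- (2 ^ (n + 2)) .. (2 ^ (n + 2) :: int)} = 2 * 2 ^ (n + 2) + 1"
      by (simp add: nat_add_distrib nat_mult_distrib nat_power_eq)
    then show ?thesis by (simp add: lp_box_def card_cartesian_product power2_eq_square algebra_simps)
  qed
  also have "\<dots> \<le> (16 * 2 ^ n)\<^sup>2"
  proof (rule power_mono)
    have "(1::real) \<le> 2 ^ n" by simp
    moreover have "2 * 2 ^ (n + 2) = 8 * (2::real) ^ n" by (simp add: power_add)
    ultimately show "2 * 2 ^ (n + 2) + 1 \<le> 16 * (2::real) ^ n" by linarith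
  qed simp
  also have "\<dots> = 256 * 4 ^ n" by (simp add: power2_eq_square mult_ac flip: power_mult_distrib)
  finally show ?thesis .
qed

lemma sg_le_1: "cmod (sg n k) \<le> 1"
proof -
  have "\<bar>lp_theta a - lp_theta b\<bar> \<le> 1" for a b using theta_range(1,2)[of a] theta_range(1,2)[of b] by linarith
  then show ?thesis using theta_range(1,2)[of "kvec k"] by (auto simp: sg_def lp_symbol_def lp_rho_def)
qed

lemma kernel_sg: "\<exists>L\<ge>0. \<forall>n. tint (\<lambda>y. cmod (tev (sg n) y)) \<le> L"
proof -
  obtain A where A: "A \<ge> 1" "profile A (\<lambda>\<xi>. complex_of_real (lp_theta \<xi>))" using prof_theta by blast
  have th: "tint (\<lambda>y. cmod (tev (th j) y)) \<le> 560 * A" for j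
    unfolding th_def by (rule kernel_L1[OF prof_kernel[OF A(2)]]) auto
  have "tint (\<lambda>y. cmod (tev (sg n) y)) \<le> 2 * (560 * A)" for n
  proof (cases n)
    case 0
    then show ?thesis using th[of 0] A(1) by (simp add: sg_th)
  next
    case (Suc l)
    have "tev (sg n) y = tev (th (Suc l)) y - tev (th l) y" for y
      unfolding Suc by (simp add: sg_th[abs_def] tev_diff[OF fsupp_th fsupp_th, symmetric])
    then have "tint (\<lambda>y. cmod (tev (sg n) y)) \<le> tint (\<lambda>y. cmod (tev (th (Suc l)) y) + cmod (tev (th l) y))"
      by (intro tint_mono) (auto intro!: continuous_intros norm_triangle_ineq4)
    also have "\<dots> = tint (\<lambda>y. cmod (tev (th (Suc l)) y)) + tint (\<lambda>y. cmod (tev (th l) y))" by (intro tint_add continuous_intros)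
    finally show ?thesis using th[of l] th[of "Suc l"] by linarith
  qed
  then show ?thesis using A(1) by (intro exI[of _ "2 * (560 * A)"]) auto
qed

text \<open>Instead of Hoelder's inequality the pointwise split s \<le> lam + lam powr (1 - 2r) * s
  powr (2r) is used, with lam = 2 powr (n/r). The kernel of block n is O(4^n), the number of its
  modes, and 4^n * lam powr (1 - 2r) = lam. The bound is therefore linear in the moment itself
  rather than in its root.\<close>

lemma Lp_embedding:
  assumes r: "r > 1"
  shows "\<exists>C\<ge>0. \<forall>V Y. fsupp V \<longrightarrow> tint (\<lambda>x. cmod (tev V x) powr (2 * r)) \<le> Y \<longrightarrow> bb (- (1 / r)) (C + 256 * Y) V"
proof -
  obtain L where L: "L \<ge> 0" "\<And>n. tint (\<lambda>y. cmod (tev (sg n) y)) \<le> L" using kernel_sg by blast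
  have "bb (- (1 / r)) (L + 256 * Y) V" if V: "fsupp V" and Y: "tint (\<lambda>x. cmod (tev V x) powr (2 * r)) \<le> Y" for V Y
    unfolding bb_def
  proof (intro allI)
    fix n x
    define lam where "lam = 2 powr (1 / r * real n)"
    have lam: "lam > 0" by (simp add: lam_def)
    have Kb: "cmod (tev (sg n) y) \<le> 256 * 4 ^ n" for y
    proof -
      have "cmod (tev (sg n) y) \<le> (\<Sum>k\<in>lp_box n. cmod (sg n k))" by (rule tev_le) (auto simp: sg_box)
      also have "\<dots> \<le> (\<Sum>k\<in>lp_box n. 1)" by (intro sum_mono sg_le_1)
      finally show ?thesis using card_box[of n] by simp
    qed
    have sp: "s \<le> lam + lam powr (1 - 2 * r) * s powr (2 * r)" if "0 \<le> s" for s
    proof (cases "s \<le> lam")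
      case True
      then show ?thesis by (simp add: add_increasing2)
    next
      case False
      then have s: "s > 0" "lam \<le> s" using lam by auto
      have "s = s powr (1 - 2 * r) * s powr (2 * r)" using s by (simp flip: powr_add)
      also have "\<dots> \<le> lam powr (1 - 2 * r) * s powr (2 * r)" using s lam r by (intro mult_right_mono powr_mono2') auto
      finally show ?thesis using lam by linarith
    qed
    let ?q = "256 * 4 ^ n * lam powr (1 - 2 * r)"
    have cp: "cont (\<lambda>y. cmod (tev V (x - y)) powr (2 * r))" using r by (intro continuous_intros) auto
    have "cmod (tev (D n V) x) \<le> tint (\<lambda>y. cmod (tev (sg n) y * tev V (x - y)))"
      unfolding D_def tev_mul[OF fsupp_sg V] by (rule tint_norm) (intro continuous_intros)
    also have "\<dots> \<le> tint (\<lambda>y. lam * cmod (tev (sg n) y) + ?q * cmod (tev V (x - y)) powr (2 * r))"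
    proof (rule tint_mono)
      show "cont (\<lambda>y. lam * cmod (tev (sg n) y) + ?q * cmod (tev V (x - y)) powr (2 * r))" by (intro continuous_intros cp)
      fix y
      have "cmod (tev (sg n) y * tev V (x - y)) \<le> cmod (tev (sg n) y) * (lam + lam powr (1 - 2 * r) * cmod (tev V (x - y)) powr (2 * r))"
        unfolding norm_mult by (intro mult_left_mono sp) auto
      also have "\<dots> = lam * cmod (tev (sg n) y) + cmod (tev (sg n) y) * (lam powr (1 - 2 * r) * cmod (tev V (x - y)) powr (2 * r))"
        by (simp add: algebra_simps)
      also have "\<dots> \<le> lam * cmod (tev (sg n) y) + (256 * 4 ^ n) * (lam powr (1 - 2 * r) * cmod (tev V (x - y)) powr (2 * r))"
        by (intro add_left_mono mult_right_mono Kb) auto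
      finally show "cmod (tev (sg n) y * tev V (x - y)) \<le> lam * cmod (tev (sg n) y) + ?q * cmod (tev V (x - y)) powr (2 * r)"
        by (simp add: mult.assoc)
    qed (intro continuous_intros)
    also have "\<dots> = lam * tint (\<lambda>y. cmod (tev (sg n) y)) + ?q * tint (\<lambda>y. cmod (tev V (x - y)) powr (2 * r))"
      by (subst tint_add) (intro continuous_intros, intro continuous_intros cp, simp only: tint_mult)
    also have "tint (\<lambda>y. cmod (tev V (x - y)) powr (2 * r)) = tint (\<lambda>y. cmod (tev V y) powr (2 * r))"
    proof -
      have "tint (\<lambda>y. (\<lambda>y. cmod (tev V (y + x)) powr (2 * r)) (- y)) = tint (\<lambda>y. cmod (tev V (y + x)) powr (2 * r))"
        using r by (intro tint_reflect continuous_intros) auto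
      also have "\<dots> = tint (\<lambda>y. cmod (tev V y) powr (2 * r))"
        by (rule tint_shift[of "\<lambda>y. cmod (tev V y) powr (2 * r)"]) (use r per_tev in \<open>auto intro!: continuous_intros simp: per_def\<close>)
      finally show ?thesis by (simp add: add.commute)
    qed
    also have "lam * tint (\<lambda>y. cmod (tev (sg n) y)) + ?q * tint (\<lambda>y. cmod (tev V y) powr (2 * r)) \<le> lam * L + ?q * Y"
      using lam by (intro add_mono mult_left_mono L Y) auto
    also have "?q = 256 * lam"
    proof -
      have "(4::real) ^ n = 2 powr (2 * real n)"
        by (simp add: powr_powr[symmetric] powr_realpow)
      moreover have "lam powr (1 - 2 * r) = 2 powr (1 / r * real n - 2 * real n)"
        unfolding lam_def powr_powr using r by (simp add: field_simps)
      ultimately have "4 ^ n * lam powr (1 - 2 * r) = lam" by (simp add: lam_def flip: powr_add)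
      then show ?thesis by simp
    qed
    finally show "cmod (tev (D n V) x) \<le> (L + 256 * Y) * 2 powr (- (- (1 / r)) * real n)"
      by (simp add: lam_def algebra_simps)
  qed
  then show ?thesis using L(1) by blast
qed

lemma dpow_fsupp: assumes "fsupp V" shows "fsupp (dpow V i)" "tev (dpow V i) x = tev V x ^ i"
proof -
  have "fsupp (dpow V i) \<and> tev (dpow V i) x = tev V x ^ i"
  proof (induction i)
    case (Suc i)
    then show ?case using assms by (simp add: dmult_fsupp fsupp_conv tev_conv)
  qed (simp add: fsupp_one tev_one)
  then show "fsupp (dpow V i)" "tev (dpow V i) x = tev V x ^ i" by auto
qed

lemma mono_fsupp: assumes "fsupp V" "fsupp \<zeta>"
  shows "fsupp (dmonomial i j V \<zeta>)" "tev (dmonomial i j V \<zeta>) x = tev V x ^ i * cnj (tev V x) ^ j * tev \<zeta> x"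
proof -
  note f = dpow_fsupp[OF assms(1)] dpow_fsupp[OF fsupp_dconj[OF assms(1)]] fsupp_dconj[OF assms(1)] tev_dconj[OF assms(1)]
  show "fsupp (dmonomial i j V \<zeta>)" "tev (dmonomial i j V \<zeta>) x = tev V x ^ i * cnj (tev V x) ^ j * tev \<zeta> x"
    unfolding dmonomial_def using assms(2) by (simp_all add: f dmult_fsupp fsupp_conv tev_conv)
qed

lemma PsiW_fsupp:
  assumes V: "fsupp V" and W: "\<And>a b. a \<le> m + 1 \<Longrightarrow> b \<le> m \<Longrightarrow> fsupp (W a b)"
  shows "fsupp (PsiW m \<nu> \<tau> V W)"
    "tev (PsiW m \<nu> \<tau> V W) x = - \<nu> * (\<Sum>i\<le>m + 1. \<Sum>j\<le>m. of_nat (m + 1 choose i) * of_nat (m choose j) *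
      (tev V x ^ i * cnj (tev V x) ^ j * tev (W (m + 1 - i) (m - j)) x)) + (\<tau> + 1) * (tev V x + tev (W 1 0) x)"
proof -
  have fm: "fsupp (dmonomial i j V (W (m + 1 - i) (m - j)))" for i j by (intro mono_fsupp V W) auto
  have f1: "fsupp (\<lambda>k. of_nat (m + 1 choose i) * of_nat (m choose j) * dmonomial i j V (W (m + 1 - i) (m - j)) k)" for i j
    by (intro fsupp_lin(3) fm)
  have f2: "fsupp (\<lambda>k. \<Sum>j\<le>m. of_nat (m + 1 choose i) * of_nat (m choose j) * dmonomial i j V (W (m + 1 - i) (m - j)) k)" for i
    by (intro fsupp_sum f1) auto
  have f3: "fsupp (\<lambda>k. \<Sum>i\<le>m+1. \<Sum>j\<le>m. of_nat (m + 1 choose i) * of_nat (m choose j) * dmonomial i j V (W (m + 1 - i) (m - j)) k)"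
    by (intro fsupp_sum f2) auto
  have W10: "fsupp (W 1 0)" by (intro W) auto
  have f4: "fsupp (\<lambda>k. V k + W 1 0 k)" by (intro fsupp_lin V W10)
  show "fsupp (PsiW m \<nu> \<tau> V W)" unfolding PsiW_def by (intro fsupp_lin(1,3) f3 f4)
  show "tev (PsiW m \<nu> \<tau> V W) x = - \<nu> * (\<Sum>i\<le>m + 1. \<Sum>j\<le>m. of_nat (m + 1 choose i) * of_nat (m choose j) *
      (tev V x ^ i * cnj (tev V x) ^ j * tev (W (m + 1 - i) (m - j)) x)) + (\<tau> + 1) * (tev V x + tev (W 1 0) x)"
    unfolding PsiW_def tev_add[OF fsupp_lin(3)[OF f3] fsupp_lin(3)[OF f4]] tev_cmult[OF f3] tev_cmult[OF f4]
      tev_sum[OF finite_atMost f2] tev_sum[OF finite_atMost f1] tev_cmult[OF fm] tev_add[OF V W10]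
    by (simp only: mono_fsupp(2)[OF V W] diff_le_self)
qed

lemma tint_of_real: "cont f \<Longrightarrow> tint (\<lambda>x. complex_of_real (f x)) = of_real (tint f)"
  unfolding tint_def using integral_linear[OF cont_integrable bounded_linear_of_real[where 'a=complex], of f] by (simp add: o_def)

text \<open>Above the threshold 1 + 1/d one has d * y \<ge> 1 and y \<ge> 1, so a gap of one between
  the exponents suffices.\<close>

lemma powr_young:
  fixes y s P d :: real
  assumes "0 \<le> y" "0 \<le> s" "s \<le> P - 1" "d > 0"
  shows "y powr s \<le> d * y powr P + (1 + 1 / d) powr P"
proof (cases "y \<le> 1 + 1 / d")
  case True
  have "y powr s \<le> (1 + 1 / d) powr s" using True assms by (intro powr_mono2) auto
  also have "\<dots> \<le> (1 + 1 / d) powr P" using assms by (intro powr_mono) auto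
  finally show ?thesis using assms by (simp add: add_increasing)
next
  case False
  have "0 < 1 / d" using assms by simp
  then have y: "1 \<le> y" "1 / d \<le> y" "0 < y" using False by linarith+
  have "y powr s \<le> y powr (P - 1)" using y assms by (intro powr_mono) auto
  also have "\<dots> \<le> (d * y) * y powr (P - 1)"
    using mult_right_mono[of 1 "d * y" "y powr (P - 1)"] y assms by (simp add: field_simps)
  also have "\<dots> = d * y powr P" using y powr_add[of y 1 "P - 1"] by simp
  finally show ?thesis by (simp add: add_increasing2)
qed

text \<open>Half of e is reserved for the modulus of continuity through e1, the other half for the
  L^1 norm through d. The latter works because |fm| has degree at most 2r - 1 + 2m, one less than
  the moment \<open>Xn\<close>.\<close>

lemma pairing:
  fixes \<mu> r :: real
  assumes "\<mu> > 0" "r > 1" "(r - 1)\<^sup>2 < \<mu>\<^sup>2 * (2 * r - 1)" "1 \<le> m" "0 < al" "al < 1 / (2 * real m)" and K: "0 \<le> K" and e: "0 < e"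
  shows "\<exists>C\<ge>0. \<forall>V \<zeta> i j. fsupp V \<longrightarrow> i + j \<le> 2 * m \<longrightarrow> fsupp \<zeta> \<longrightarrow> bb (-al) K \<zeta> \<longrightarrow>
    cmod (tint (\<lambda>x. fm r i j (tev V x) * tev \<zeta> x)) \<le> e * (Dn \<mu> r V + Xn r m V) + C"
proof -
  note r = assms(2)
  obtain C1 where C1: "C1 \<ge> 0" "\<And>V h i j. fsupp V \<Longrightarrow> i + j \<le> 2 * m \<Longrightarrow> h \<in> torus \<Longrightarrow>
    tint (\<lambda>x. cmod (fm r i j (tev V (x + h)) - fm r i j (tev V x))) \<le> C1 * (1 + Dn \<mu> r V + Xn r m V) * norm h powr (1 / (2 * real m))"
    using fm_holder[OF assms(1-4)] by blast
  have Dn: "0 \<le> Dn \<mu> r V" if "fsupp V" for V using dissip[OF assms(1-3)] that by blast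
  define \<sigma> where "\<sigma> = 1 / (2 * real m)"
  have \<sigma>: "0 < \<sigma>" "\<sigma> \<le> 1/2" using assms(4) by (auto simp: \<sigma>_def)
  define e1 where "e1 = e / (2 * (K * C1 + 1))"
  have KC: "K * C1 \<ge> 0" using K C1 by simp
  have e1: "e1 > 0" unfolding e1_def using e KC by (intro divide_pos_pos) auto
  obtain C2 where C2: "C2 \<ge> 0" "\<And>f A A' Z. cont f \<Longrightarrow> per f \<Longrightarrow> \<forall>h\<in>torus. tint (\<lambda>x. cmod (f (x + h) - f x)) \<le> A * norm h powr \<sigma> \<Longrightarrow>
    tint (\<lambda>x. cmod (f x)) \<le> A' \<Longrightarrow> fsupp Z \<Longrightarrow> bb (-al) K Z \<Longrightarrow> cmod (tint (\<lambda>x. f x * tev Z x)) \<le> K * (e1 * A + C2 * A')"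
    using duality[OF \<sigma> assms(5) _ e1] assms(6) unfolding \<sigma>_def by meson
  define d where "d = e / (2 * (K * C2 + 1))"
  have KC2: "K * C2 \<ge> 0" using K C2 by simp
  have d: "d > 0" unfolding d_def using e KC2 by (intro divide_pos_pos) auto
  define P where "P = 2 * r + 2 * real m"
  have P: "P > 0" using r by (simp add: P_def)
  define Q where "Q = (1 + 1 / d) powr P"
  have "cmod (tint (\<lambda>x. fm r i j (tev V x) * tev \<zeta> x)) \<le> e * (Dn \<mu> r V + Xn r m V) + (e + K * C2 * Q)"
    if V: "fsupp V" and ij: "i + j \<le> 2 * m" and z: "fsupp \<zeta>" "bb (-al) K \<zeta>" for V \<zeta> i j
  proof -
    let ?f = "\<lambda>x. fm r i j (tev V x)"
    let ?X = "Xn r m V" and ?D = "Dn \<mu> r V"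
    have X: "0 \<le> ?X" by (rule Xn_nonneg[OF r])
    have cf: "cont ?f" by (intro continuous_intros r)
    have cP: "cont (\<lambda>x. d * cmod (tev V x) powr P)" by (intro continuous_intros P)
    have ijr: "real (i + j) \<le> 2 * real m" using ij by (simp flip: of_nat_le_iff[where 'a=real])
    have A': "tint (\<lambda>x. cmod (?f x)) \<le> d * ?X + Q"
    proof -
      have "tint (\<lambda>x. cmod (?f x)) \<le> tint (\<lambda>x. d * cmod (tev V x) powr P + Q)"
      proof (rule tint_mono)
        show "cmod (?f x) \<le> d * cmod (tev V x) powr P + Q" for x
          unfolding cmod_fm Q_def using r ijr by (intro powr_young d) (auto simp: P_def)
      qed (intro continuous_intros cf P)+
      also have "\<dots> = d * ?X + Q" unfolding tint_add[OF cP continuous_on_const] tint_mult tint_const by (simp only: Xn_def P_def)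
      finally show ?thesis .
    qed
    have "cmod (tint (\<lambda>x. ?f x * tev \<zeta> x)) \<le> K * (e1 * (C1 * (1 + ?D + ?X)) + C2 * (d * ?X + Q))"
    proof (rule C2(2)[OF cf _ _ A' z])
      show "per ?f" by (rule per_comp[OF per_tev])
      show "\<forall>h\<in>torus. tint (\<lambda>x. cmod (?f (x + h) - ?f x)) \<le> C1 * (1 + ?D + ?X) * norm h powr \<sigma>"
        unfolding \<sigma>_def using C1(2)[OF V ij] by blast
    qed
    also have "\<dots> = ((K * C1) * e1) * (1 + ?D + ?X) + (K * C2 * d) * ?X + K * C2 * Q" by (simp add: algebra_simps)
    also have "\<dots> \<le> (e/2) * (1 + ?D + ?X) + (e/2) * ?X + K * C2 * Q"
    proof (intro add_mono mult_right_mono)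
      show "(K * C1) * e1 \<le> e/2" unfolding e1_def using e KC by (simp add: field_simps)
      show "K * C2 * d \<le> e/2" unfolding d_def using e KC2 by (simp add: field_simps)
    qed (use X Dn[OF V] C2(1) in \<open>auto simp: Q_def\<close>)
    also have "\<dots> \<le> e * (?D + ?X) + (e + K * C2 * Q)"
    proof -
      have "0 \<le> e * ?D" using e Dn[OF V] by simp
      then show ?thesis using e by (simp add: algebra_simps)
    qed
    finally show ?thesis .
  qed
  moreover have "0 \<le> e + K * C2 * Q" using e KC2 by (simp add: Q_def)
  ultimately show ?thesis by blast
qed

lemma cnj_ph_mult: "cnj (ph (2*r-2) z) * (z ^ i * cnj z ^ j * w) = fm r i j z * w"
  by (simp add: fm_def mult_ac)

lemma fm_top: "r > 1 \<Longrightarrow> fm r (m + 1) m z = of_real (cmod z powr (2 * r + 2 * real m))"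
proof -
  assume r: "r > 1"
  show ?thesis
  proof (cases "z = 0")
    case False
    have "z ^ m * cnj z ^ m = (z * cnj z) ^ m" by (simp only: power_mult_distrib)
    then have "z ^ m * cnj z ^ m = of_real (cmod z ^ (2 * m))"
      by (simp only: power_mult of_real_power[symmetric] complex_norm_square[symmetric])
    moreover have "cnj z * z = of_real (cmod z ^ 2)" using complex_norm_square[of z] by (simp add: mult.commute)
    moreover have "fm r (m + 1) m z = of_real (cmod z powr (2 * r - 2)) * (cnj z * z) * (z ^ m * cnj z ^ m)"
      by (simp add: fm_def ph_def mult_ac)
    ultimately have "fm r (m + 1) m z = of_real (cmod z powr (2 * r - 2) * cmod z ^ 2 * cmod z ^ (2 * m))" by (simp only: of_real_mult)
    also have "cmod z powr (2 * r - 2) * cmod z ^ 2 * cmod z ^ (2 * m) = cmod z powr (2 * r + 2 * real m)"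
    proof -
      have p: "cmod z ^ n = cmod z powr real n" for n using False by (simp add: powr_realpow)
      show ?thesis unfolding p powr_add[symmetric] by (simp add: algebra_simps)
    qed
    finally show ?thesis .
  qed (simp add: fm_def ph_def)
qed

lemma reaction:
  fixes \<mu> r :: real
  assumes "\<mu> > 0" "r > 1" "(r - 1)\<^sup>2 < \<mu>\<^sup>2 * (2 * r - 1)" "1 \<le> m" "0 < al" "al < 1 / (2 * real m)" and K: "1 \<le> K" and e: "0 < e"
  shows "\<exists>C\<ge>0. \<forall>V W. fsupp V \<longrightarrow> (\<forall>a\<le>m+1. \<forall>b\<le>m. fsupp (W a b) \<and> bb (-al) K (W a b)) \<longrightarrow> W 0 0 = done_one \<longrightarrow>
    Re (tint (\<lambda>x. tev (PsiW m \<nu> \<tau> V W) x * cnj (ph (2*r-2) (tev V x)))) \<le> - Re \<nu> * Xn r m V + e * (Dn \<mu> r V + Xn r m V) + C"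
proof -
  note r = assms(2)
  \<comment> \<open>The total weight of the pairings to be bounded: the binomial sum for the
    monomials and 2 for the two parts of the linear term; the added 1 keeps Q positive.\<close>
  define Q where "Q = cmod \<nu> * binom_sum m + cmod (\<tau> + 1) * 2 + 1"
  have bs: "binom_sum m \<ge> 0" unfolding binom_sum_def by (intro sum_nonneg) auto
  have Q: "Q > 0" unfolding Q_def using bs by (simp add: add_nonneg_pos)
  have eQ: "e / Q > 0" using e Q by simp
  obtain C where C: "C \<ge> 0" "\<And>V \<zeta> i j. fsupp V \<Longrightarrow> i + j \<le> 2 * m \<Longrightarrow> fsupp \<zeta> \<Longrightarrow> bb (-al) K \<zeta> \<Longrightarrow>
    cmod (tint (\<lambda>x. fm r i j (tev V x) * tev \<zeta> x)) \<le> (e/Q) * (Dn \<mu> r V + Xn r m V) + C"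
    using pairing[OF assms(1-6) _ eQ, of K] K by auto
  have Dn: "0 \<le> Dn \<mu> r V" if "fsupp V" for V using dissip[OF assms(1-3)] that by blast
  have "Re (tint (\<lambda>x. tev (PsiW m \<nu> \<tau> V W) x * cnj (ph (2*r-2) (tev V x)))) \<le> - Re \<nu> * Xn r m V + e * (Dn \<mu> r V + Xn r m V) + Q * C"
    if V: "fsupp V" and W: "\<forall>a\<le>m+1. \<forall>b\<le>m. fsupp (W a b) \<and> bb (-al) K (W a b)" and W0: "W 0 0 = done_one" for V W
  proof -
    define E where "E = (e/Q) * (Dn \<mu> r V + Xn r m V) + C"
    have E0: "E \<ge> 0" unfolding E_def using eQ Dn[OF V] Xn_nonneg[OF r, of m V] C(1) by (intro add_nonneg_nonneg mult_nonneg_nonneg) auto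
    define w where "w i j = W (m + 1 - i) (m - j)" for i j
    have wW: "fsupp (w i j)" "bb (-al) K (w i j)" for i j using W by (auto simp: w_def)
    define T where "T i j = tint (\<lambda>x. fm r i j (tev V x) * tev (w i j) x)" for i j
    \<comment> \<open>The monomial of full degree has coefficient \<open>W 0 0\<close> = 1 and
      yields the damping \<open>Xn\<close>; it is removed here, and all others have i + j \<le> 2 *
      m.\<close>
    define T' where "T' i j = (if i = m + 1 \<and> j = m then 0 else T i j)" for i j
    define bc :: "nat \<Rightarrow> nat \<Rightarrow> complex" where "bc i j = of_nat (m + 1 choose i) * of_nat (m choose j)" for i j
    \<comment> \<open>The linear term in v is the monomial (1, 0) with coefficient 1, so
      \<open>pairing\<close> covers it as well.\<close>
    define L where "L = tint (\<lambda>x. fm r 1 0 (tev V x) * tev done_one x) + tint (\<lambda>x. fm r 0 0 (tev V x) * tev (W 1 0) x)"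
    have cfm: "cont (\<lambda>x. fm r i j (tev V x) * tev u x)" for i j u by (intro continuous_intros r)
    have top: "T (m + 1) m = of_real (Xn r m V)"
    proof -
      have "T (m + 1) m = tint (\<lambda>x. of_real (cmod (tev V x) powr (2 * r + 2 * real m)) :: complex)"
        by (simp add: T_def w_def W0 tev_one fm_top[OF r, simplified])
      also have "\<dots> = of_real (Xn r m V)"
        unfolding Xn_def by (rule tint_of_real) (intro continuous_intros, use r in simp)
      finally show ?thesis .
    qed
    have Tb: "cmod (T' i j) \<le> E" if "i \<le> m + 1" "j \<le> m" for i j
    proof (cases "i = m + 1 \<and> j = m")
      case False
      then have "i + j \<le> 2 * m" using that by auto
      then show ?thesis unfolding T'_def T_def E_def using False C(2)[OF V _ wW] by simp
    qed (simp add: T'_def E0)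
    have Lb: "cmod L \<le> E + E"
    proof -
      have "bb (-al) K done_one" by (rule bb_mono[OF bb_one K])
      then have "cmod (tint (\<lambda>x. fm r 1 0 (tev V x) * tev done_one x)) \<le> E" "cmod (tint (\<lambda>x. fm r 0 0 (tev V x) * tev (W 1 0) x)) \<le> E"
        unfolding E_def using assms(4) W by (intro C(2)[OF V] fsupp_one; simp)+
      then show ?thesis unfolding L_def by (intro norm_triangle_le add_mono)
    qed
    have pt: "tev (PsiW m \<nu> \<tau> V W) x * cnj (ph (2*r-2) (tev V x)) =
       - \<nu> * (\<Sum>i\<le>m + 1. \<Sum>j\<le>m. bc i j * (fm r i j (tev V x) * tev (w i j) x)) +
       (\<tau> + 1) * (fm r 1 0 (tev V x) * tev done_one x + fm r 0 0 (tev V x) * tev (W 1 0) x)" for x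
    proof -
      let ?z = "tev V x" and ?c = "cnj (ph (2*r-2) (tev V x))"
      have "tev (PsiW m \<nu> \<tau> V W) x * ?c = - \<nu> * ((\<Sum>i\<le>m + 1. \<Sum>j\<le>m. bc i j * (?z ^ i * cnj ?z ^ j * tev (w i j) x)) * ?c) + (\<tau> + 1) * (?z * ?c + tev (W 1 0) x * ?c)"
        using PsiW_fsupp(2)[of V m W \<nu> \<tau> x] V W by (simp only: bc_def w_def distrib_right mult.assoc)
      also have "(\<Sum>i\<le>m + 1. \<Sum>j\<le>m. bc i j * (?z ^ i * cnj ?z ^ j * tev (w i j) x)) * ?c = (\<Sum>i\<le>m + 1. \<Sum>j\<le>m. bc i j * (fm r i j ?z * tev (w i j) x))"
        unfolding sum_distrib_right cnj_ph_mult[symmetric] by (intro sum.cong refl) (simp only: mult_ac)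
      also have "?z * ?c + tev (W 1 0) x * ?c = fm r 1 0 ?z * tev done_one x + fm r 0 0 ?z * tev (W 1 0) x"
        by (simp add: tev_one fm_def mult_ac)
      finally show ?thesis .
    qed
    have int: "tint (\<lambda>x. tev (PsiW m \<nu> \<tau> V W) x * cnj (ph (2*r-2) (tev V x))) = - \<nu> * (\<Sum>i\<le>m + 1. \<Sum>j\<le>m. bc i j * T i j) + (\<tau> + 1) * L"
    proof -
      have s0: "cont (\<lambda>x. bc i j * (fm r i j (tev V x) * tev (w i j) x))" for i j by (intro continuous_intros cfm)
      have s1: "cont (\<lambda>x. \<Sum>j\<le>m. bc i j * (fm r i j (tev V x) * tev (w i j) x))" for i by (intro continuous_intros s0)
      have s2: "cont (\<lambda>x. \<Sum>i\<le>m+1. \<Sum>j\<le>m. bc i j * (fm r i j (tev V x) * tev (w i j) x))" by (intro continuous_intros s1)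
      have s3: "cont (\<lambda>x. fm r 1 0 (tev V x) * tev done_one x + fm r 0 0 (tev V x) * tev (W 1 0) x)" by (intro continuous_intros cfm)
      have "tint (\<lambda>x. \<Sum>i\<le>m+1. \<Sum>j\<le>m. bc i j * (fm r i j (tev V x) * tev (w i j) x)) = (\<Sum>i\<le>m+1. \<Sum>j\<le>m. bc i j * T i j)"
        unfolding tint_sum[OF finite_atMost s1] tint_sum[OF finite_atMost s0] tint_mult T_def ..
      moreover have "tint (\<lambda>x. fm r 1 0 (tev V x) * tev done_one x + fm r 0 0 (tev V x) * tev (W 1 0) x) = L"
        unfolding L_def by (rule tint_add[OF cfm cfm])
      ultimately show ?thesis
        unfolding pt tint_add[OF continuous_on_mult[OF continuous_on_const s2] continuous_on_mult[OF continuous_on_const s3]] tint_mult by simp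
    qed
    have split: "(\<Sum>i\<le>m + 1. \<Sum>j\<le>m. bc i j * T i j) = of_real (Xn r m V) + (\<Sum>i\<le>m + 1. \<Sum>j\<le>m. bc i j * T' i j)"
    proof -
      have "bc i j * T i j = (if i = m + 1 then (if j = m then of_real (Xn r m V) else 0) else 0) + bc i j * T' i j" for i j
        using top by (simp add: T'_def bc_def)
      then have "(\<Sum>i\<le>m + 1. \<Sum>j\<le>m. bc i j * T i j) = (\<Sum>i\<le>m + 1. \<Sum>j\<le>m. (if i = m + 1 then (if j = m then of_real (Xn r m V) else 0) else 0) + bc i j * T' i j)"
        by presburger
      also have "\<dots> = (\<Sum>i\<le>m + 1. \<Sum>j\<le>m. (if i = m + 1 then (if j = m then of_real (Xn r m V) else 0) else 0)) + (\<Sum>i\<le>m + 1. \<Sum>j\<le>m. bc i j * T' i j)"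
        by (simp only: sum.distrib)
      also have "(\<Sum>i\<le>m + 1. \<Sum>j\<le>m. (if i = m + 1 then (if j = m then complex_of_real (Xn r m V) else 0) else 0)) = (\<Sum>i\<le>m+1. if i = m + 1 then of_real (Xn r m V) else 0)"
        by (intro sum.cong refl) (simp add: sum.delta)
      also have "\<dots> = of_real (Xn r m V)" by (subst sum.delta) auto
      finally show ?thesis .
    qed
    have Sb: "cmod (\<Sum>i\<le>m + 1. \<Sum>j\<le>m. bc i j * T' i j) \<le> binom_sum m * E"
    proof -
      have "cmod (\<Sum>i\<le>m + 1. \<Sum>j\<le>m. bc i j * T' i j) \<le> (\<Sum>i\<le>m + 1. \<Sum>j\<le>m. real (m + 1 choose i) * real (m choose j) * E)"
      proof (intro sum_norm_le)
        fix i j assume "i \<in> {..m+1}" "j \<in> {..m}"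
        then have "cmod (bc i j) * cmod (T' i j) \<le> cmod (bc i j) * E" by (intro mult_left_mono Tb) auto
        then show "cmod (bc i j * T' i j) \<le> real (m + 1 choose i) * real (m choose j) * E"
          by (simp only: norm_mult bc_def norm_of_nat)
      qed
      then show ?thesis by (simp only: binom_sum_def sum_distrib_right)
    qed
    let ?R = "- \<nu> * (\<Sum>i\<le>m + 1. \<Sum>j\<le>m. bc i j * T' i j) + (\<tau> + 1) * L"
    have "tint (\<lambda>x. tev (PsiW m \<nu> \<tau> V W) x * cnj (ph (2*r-2) (tev V x))) = - \<nu> * of_real (Xn r m V) + ?R"
      unfolding int split by (simp add: algebra_simps)
    then have "Re (tint (\<lambda>x. tev (PsiW m \<nu> \<tau> V W) x * cnj (ph (2*r-2) (tev V x)))) = - Re \<nu> * Xn r m V + Re ?R" by simp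
    also have "Re ?R \<le> Q * E"
    proof -
      have "Re ?R \<le> cmod ?R" by (rule complex_Re_le_cmod)
      also have "\<dots> \<le> cmod \<nu> * (binom_sum m * E) + cmod (\<tau> + 1) * (E + E)"
        by (rule norm_triangle_le) (intro add_mono, simp_all only: norm_mult norm_minus_cancel, (intro mult_left_mono Sb Lb; simp)+)
      also have "\<dots> \<le> Q * E" using E0 by (simp add: Q_def algebra_simps)
      finally show ?thesis .
    qed
    also have "Q * E = e * (Dn \<mu> r V + Xn r m V) + Q * C" using Q by (simp add: E_def distrib_left)
    finally show ?thesis by simp
  qed
  moreover have "0 \<le> Q * C" using Q C(1) by simp
  ultimately show ?thesis by blast
qed

subsection \<open>The energy estimate\<close>

text \<open>The absolute value extends the power to negative arguments, so that a two-sided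
  derivative exists at 0, where r > 1 makes it vanish.\<close>

lemma abs_powr_deriv:
  fixes u r :: real
  assumes r: "r > 1" and u: "u \<ge> 0"
  shows "((\<lambda>w. \<bar>w\<bar> powr r) has_real_derivative r * u powr (r - 1)) (at u)"
proof (cases "u = 0")
  case False
  then have u: "u > 0" using u by simp
  show ?thesis
    by (rule has_field_derivative_transform_within_open[OF has_real_derivative_powr[OF u], of "{0<..}"]) (use u in auto)
next
  case True
  have "((\<lambda>y. \<bar>y\<bar> powr (r - 1)) \<longlongrightarrow> 0) (at (0::real))"
    by (rule tendsto_zero_powrI[where b = "r - 1"]) (use r in \<open>auto intro!: tendsto_eq_intros\<close>)
  moreover have "\<bar>\<bar>y\<bar> powr r / y\<bar> \<le> \<bar>y\<bar> powr (r - 1)" for y :: real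
  proof (cases "y = 0")
    case False
    then show ?thesis by (simp add: powr_diff abs_divide)
  qed simp
  ultimately have "((\<lambda>y. \<bar>y\<bar> powr r / y) \<longlongrightarrow> 0) (at (0::real))"
    by (intro Lim_null_comparison[of "\<lambda>y. \<bar>y\<bar> powr r / y"]) auto
  then show ?thesis using True r by (simp add: has_field_derivative_iff)
qed

lemma cmod_powr_deriv:
  fixes z :: "real \<Rightarrow> complex"
  assumes r: "r > 1" and z: "(z has_vector_derivative z') (at t within S)"
  shows "((\<lambda>t. cmod (z t) powr (2*r)) has_real_derivative 2 * r * Re (z' * cnj (ph (2*r-2) (z t)))) (at t within S)"
proof -
  define u where "u t = (Re (z t))\<^sup>2 + (Im (z t))\<^sup>2" for t
  have u0: "u t \<ge> 0" for t by (simp add: u_def)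
  have uz: "u t = (cmod (z t))\<^sup>2" for t by (simp add: u_def cmod_power2)
  have up: "u t powr x = cmod (z t) powr (2 * x)" for t x
    unfolding uz by (cases "z t = 0") (simp_all add: powr_powr flip: powr_numeral)
  have "((\<lambda>t. Re (z t)) has_real_derivative Re z') (at t within S)" "((\<lambda>t. Im (z t)) has_real_derivative Im z') (at t within S)"
    unfolding has_real_derivative_iff_has_vector_derivative
    using bounded_linear.has_vector_derivative[OF bounded_linear_Re z] bounded_linear.has_vector_derivative[OF bounded_linear_Im z] by auto
  note d = this
  have du: "(u has_real_derivative 2 * (Re (z t) * Re z' + Im (z t) * Im z')) (at t within S)"
    using DERIV_add[OF DERIV_power[OF d(1), of 2] DERIV_power[OF d(2), of 2]] unfolding u_def by (simp add: algebra_simps)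
  have "((\<lambda>t. \<bar>u t\<bar> powr r) has_real_derivative r * u t powr (r - 1) * (2 * (Re (z t) * Re z' + Im (z t) * Im z'))) (at t within S)"
    by (rule DERIV_chain2[OF abs_powr_deriv[OF r u0] du])
  moreover have "\<bar>u t\<bar> powr r = cmod (z t) powr (2*r)" for t using u0[of t] up by simp
  moreover have "r * u t powr (r - 1) * (2 * (Re (z t) * Re z' + Im (z t) * Im z')) = 2 * r * Re (z' * cnj (ph (2*r-2) (z t)))"
  proof -
    have "u t powr (r - 1) = cmod (z t) powr (2 * r - 2)" unfolding up by (simp add: algebra_simps)
    then show ?thesis by (simp add: ph_def algebra_simps)
  qed
  ultimately show ?thesis by (simp only:)
qed

lemma energy_deriv:
  assumes r: "r > 1" and S: "finite S" "\<And>t k. k \<notin> S \<Longrightarrow> V t k = 0" "\<And>t k. k \<notin> S \<Longrightarrow> V' t k = 0"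
    and d: "\<And>t k. t \<in> {a..b} \<Longrightarrow> ((\<lambda>t. V t k) has_vector_derivative V' t k) (at t within {a..b})"
    and c: "\<And>k. continuous_on {a..b} (\<lambda>t. V' t k)" and t: "t \<in> {a..b}"
  shows "((\<lambda>t. tint (\<lambda>x. cmod (tev (V t) x) powr (2*r))) has_real_derivative
    2 * r * Re (tint (\<lambda>x. tev (V' t) x * cnj (ph (2*r-2) (tev (V t) x))))) (at t within {a..b})"
proof -
  have cV: "continuous_on {a..b} (\<lambda>t. V t k)" for k
    unfolding continuous_on_eq_continuous_within using has_vector_derivative_continuous[OF d] by blast
  have tV: "tev (V t) = (\<lambda>x. \<Sum>k\<in>S. V t k * ee k x)" and tV': "tev (V' t) = (\<lambda>x. \<Sum>k\<in>S. V' t k * ee k x)" for t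
    using S by (auto intro!: tev_on)
  have r2: "2 * r > 0" "2 * r - 2 > 0" using r by auto
  have dt: "((\<lambda>t. tev (V t) x) has_vector_derivative tev (V' t) x) (at t within {a..b})" if "t \<in> {a..b}" for t x
    unfolding tV tV' using d[OF that] by (intro has_vector_derivative_sum has_vector_derivative_mult_left)
  have cfst: "continuous_on ({a..b} \<times> torus) (\<lambda>p. f (fst p))" if "continuous_on {a..b} f" for f :: "real \<Rightarrow> complex"
    by (rule continuous_on_compose2[OF that]) (auto intro!: continuous_intros)
  have cc: "continuous_on ({a..b} \<times> torus) (\<lambda>p. 2 * r * Re (tev (V' (fst p)) (snd p) * cnj (ph (2*r-2) (tev (V (fst p)) (snd p)))))"
    unfolding tV tV' by (intro continuous_intros cfst c cV r2)
  have cn: "cont (\<lambda>x. tev (V' t) x * cnj (ph (2*r-2) (tev (V t) x)))" for t by (intro continuous_intros r2)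
  have "((\<lambda>t. integral (cbox (-1/2, -1/2) (1/2, 1/2)) (\<lambda>x. cmod (tev (V t) x) powr (2*r))) has_real_derivative
    integral (cbox (-1/2, -1/2) (1/2, 1/2)) (\<lambda>x. 2 * r * Re (tev (V' t) x * cnj (ph (2*r-2) (tev (V t) x))))) (at t within {a..b})"
  proof (rule leibniz_rule_field_derivative)
    show "((\<lambda>t. cmod (tev (V t) x) powr (2*r)) has_real_derivative 2 * r * Re (tev (V' t) x * cnj (ph (2*r-2) (tev (V t) x)))) (at t within {a..b})"
      if "t \<in> {a..b}" for t x by (rule cmod_powr_deriv[OF r dt[OF that]])
    show "(\<lambda>x. cmod (tev (V t) x) powr (2*r)) integrable_on cbox (-1/2, -1/2) (1/2, 1/2)" for t
      unfolding torus_def[symmetric] by (intro cont_integrable continuous_intros r2)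
    show "continuous_on ({a..b} \<times> cbox (-1/2, -1/2) (1/2, 1/2)) (\<lambda>(t, x). 2 * r * Re (tev (V' t) x * cnj (ph (2*r-2) (tev (V t) x))))"
      using cc unfolding torus_def split_beta .
  qed (use t in auto)
  then show ?thesis
    unfolding torus_def[symmetric] tint_def[symmetric] tint_mult tint_Re[OF cn, symmetric] .
qed

text \<open>Linear growth without a Gronwall factor: the damping will already have been spent on
  making the rate at most a constant.\<close>

lemma growth_bound:
  fixes y D :: "real \<Rightarrow> real"
  assumes d: "\<And>t. t \<in> {a..b} \<Longrightarrow> (y has_real_derivative D t) (at t within {a..b})"
    and C: "\<And>t. t \<in> {a..b} \<Longrightarrow> D t \<le> C" and t: "t \<in> {a..b}"
  shows "y t \<le> y a + C * (t - a)"
proof (cases "t = a")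
  case False
  then have at: "a < t" "t \<le> b" using t by auto
  have "continuous_on {a..b} y" by (rule DERIV_continuous_on[OF d])
  then have "continuous_on {a..t} y" by (rule continuous_on_subset) (use at in auto)
  moreover have "(y has_real_derivative D x) (at x)" if "a < x" "x < t" for x
    using d[of x] that at by (simp add: at_within_Icc_at)
  ultimately obtain z where z: "a < z" "z < t" "y t - y a = (t - a) * D z" using MVT_open[of a t y D] at by blast
  have "(t - a) * D z \<le> (t - a) * C" using C[of z] z at by (intro mult_left_mono) auto
  then show ?thesis using z(3) by (simp add: algebra_simps)
qed simp

lemma energy_rate:
  assumes r: "r > 1" and V: "fsupp V" and P: "fsupp P" and R: "fsupp R"
    and a: "Re (tint (\<lambda>x. tev P x * cnj (ph (2*r-2) (tev V x)))) \<le> A"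
    and b: "cmod (tint (\<lambda>x. fm r 0 0 (tev V x) * tev R x)) \<le> B"
  shows "Re (tint (\<lambda>x. tev (\<lambda>k. heat_symbol \<mu> k * V k + (P k + R k)) x * cnj (ph (2*r-2) (tev V x)))) \<le> - Dn \<mu> r V + A + B"
proof -
  have r2: "2 * r - 2 > 0" using r by simp
  let ?c = "\<lambda>x. cnj (ph (2*r-2) (tev V x))"
  have fl: "fsupp (laplacian V)" unfolding laplacian_def[abs_def] by (rule fsupp_lin(4)[OF V])
  have eq: "(\<lambda>k. heat_symbol \<mu> k * V k + (P k + R k)) = (\<lambda>k. (\<i> + of_real \<mu>) * laplacian V k + ((P k + R k) - V k))"
    by (auto simp: heat_symbol_def laplacian_def algebra_simps)
  have tv: "tev (\<lambda>k. heat_symbol \<mu> k * V k + (P k + R k)) x = (\<i> + of_real \<mu>) * tev (laplacian V) x + ((tev P x + tev R x) - tev V x)" for x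
    unfolding eq tev_add[OF fsupp_lin(3)[OF fl] fsupp_lin(2)[OF fsupp_lin(1)[OF P R] V]]
      tev_diff[OF fsupp_lin(1)[OF P R] V] tev_add[OF P R] tev_cmult[OF fl] ..
  have c1: "cont (\<lambda>x. (\<i> + of_real \<mu>) * tev (laplacian V) x * ?c x)" and c2: "cont (\<lambda>x. tev P x * ?c x)" and c3: "cont (\<lambda>x. fm r 0 0 (tev V x) * tev R x)"
    and c4: "cont (\<lambda>x. tev V x * ?c x)" by (intro continuous_intros r r2)+
  have "(\<lambda>x. tev (\<lambda>k. heat_symbol \<mu> k * V k + (P k + R k)) x * ?c x) =
     (\<lambda>x. ((\<i> + of_real \<mu>) * tev (laplacian V) x * ?c x + (tev P x * ?c x + fm r 0 0 (tev V x) * tev R x)) - tev V x * ?c x)"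
    unfolding tv by (simp add: fm_def algebra_simps)
  then have "tint (\<lambda>x. tev (\<lambda>k. heat_symbol \<mu> k * V k + (P k + R k)) x * ?c x) =
    tint (\<lambda>x. (\<i> + of_real \<mu>) * tev (laplacian V) x * ?c x) + (tint (\<lambda>x. tev P x * ?c x) + tint (\<lambda>x. fm r 0 0 (tev V x) * tev R x)) - tint (\<lambda>x. tev V x * ?c x)"
    using tint_diff[OF continuous_on_add[OF c1 continuous_on_add[OF c2 c3]] c4] tint_add[OF c1 continuous_on_add[OF c2 c3]] tint_add[OF c2 c3] by simp
  moreover have "Re (tint (\<lambda>x. (\<i> + of_real \<mu>) * tev (laplacian V) x * ?c x)) = - Dn \<mu> r V" by (simp add: Dn_def)
  moreover have "Re (tint (\<lambda>x. fm r 0 0 (tev V x) * tev R x)) \<le> B" using b complex_Re_le_cmod order_trans by blast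
  \<comment> \<open>This is the contribution of the -1 in the heat symbol, which enters the rate
    with a minus sign.\<close>
  moreover have "0 \<le> Re (tint (\<lambda>x. tev V x * ?c x))"
  proof -
    have "0 \<le> Re (tev V x * ?c x)" for x
    proof -
      have "Re (tev V x * ?c x) = cmod (tev V x) powr (2 * r - 2) * ((Re (tev V x))\<^sup>2 + (Im (tev V x))\<^sup>2)"
        by (simp add: ph_def power2_eq_square algebra_simps)
      then show ?thesis by simp
    qed
    then show ?thesis unfolding tint_Re[OF c4] by (intro tint_nonneg continuous_intros c4) auto
  qed
  ultimately show ?thesis using a by simp
qed

text \<open>Truncation must leave the coefficient 1 of the leading monomial untouched, otherwise the
  damping term would be lost; the empty partial sum would annihilate it.\<close>

lemma partial_one: "1 \<le> M \<Longrightarrow> lp_partial M done_one = done_one"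
  by (cases M) (auto simp: lp_partial_eq mul_def done_one_eq th_one nk_def kvec_def zero_prod_def[symmetric])

lemma hs_deriv: "((\<lambda>t. hs \<mu> t k) has_vector_derivative hs \<mu> t k * heat_symbol \<mu> k) (at t within S)"
proof -
  have "((\<lambda>z. exp (z * heat_symbol \<mu> k)) has_field_derivative exp (of_real t * heat_symbol \<mu> k) * heat_symbol \<mu> k) (at (of_real t))"
    by (auto intro!: derivative_eq_intros)
  then show ?thesis unfolding hs_def by (rule has_vector_derivative_real_field)
qed

section \<open>A priori bound along a solution\<close>

context mild begin

text \<open>At a fixed frequency the mild equation is an ordinary differential equation, away from
  time 0 where the forcing is singular.\<close>

lemma sol_deriv:
  assumes N: "NL T L N" and v: "sol u0 N S v" and S: "S \<le> T" and a: "0 < a" "a < S" and t: "t \<in> {a..S}"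
  shows "((\<lambda>t. v t k) has_vector_derivative heat_symbol \<mu> k * v t k + N t (v t) k) (at t within {a..S})"
proof -
  obtain B where B: "B \<ge> 1" "wb S B v" using v unfolding sol_def by blast
  define F where "F s = N s (v s)" for s
  have sing_bound: "sing_bound (-al) (real p * ga) (L * B ^ p) S F" unfolding F_def by (rule wb_FB[OF N B(2,1) S])
  define G where "G s = hs \<mu> (- s) k * F s k" for s
  have Gi: "G integrable_on {0..S}" unfolding G_def using a by (intro FB_integrable[OF sing_bound pga] continuous_intros) auto
  have tS: "0 < t" "t \<le> S" using t a by auto
  have "continuous_on {0<..S} G" using sing_bound unfolding G_def sing_bound_def cf_def by (auto intro!: continuous_intros)
  then have "continuous (at t within {0<..S}) G" using tS by (auto simp: continuous_on_eq_continuous_within)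
  moreover have "at t within {0<..S} = at t within {0..S}" by (rule at_within_nhd[of _ "{0<..}"]) (use tS in auto)
  ultimately have "((\<lambda>u. integral {0..u} G) has_vector_derivative G t) (at t within {0..S})"
    using integral_has_vector_derivative_continuous_at[OF Gi, of t "{}"] tS by simp
  then have dG: "((\<lambda>u. integral {0..u} G) has_vector_derivative G t) (at t within {a..S})"
    by (rule has_vector_derivative_within_subset) (use a in auto)
  have vE: "v s k = hs \<mu> s k * (u0 k + integral {0..s} G)" if "s \<in> {a..S}" for s
  proof -
    have "v s = Phi u0 N v s" using v that a unfolding sol_def by auto
    then have "v s k = hs \<mu> s k * u0 k + duhamel \<mu> F s k" unfolding F_def by (simp add: Phi_def)
    then show ?thesis unfolding duh_factor G_def by (simp add: algebra_simps)
  qed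
  have hh: "hs \<mu> t k * hs \<mu> (- t) k = 1" using hs_add[of \<mu> t "-t" k] by (simp add: hs_def)
  have "((\<lambda>s. hs \<mu> s k * (u0 k + integral {0..s} G)) has_vector_derivative
      hs \<mu> t k * (0 + G t) + hs \<mu> t k * heat_symbol \<mu> k * (u0 k + integral {0..t} G)) (at t within {a..S})"
    by (intro has_vector_derivative_mult hs_deriv has_vector_derivative_add has_vector_derivative_const dG)
  moreover have "hs \<mu> t k * (0 + G t) = N t (v t) k"
    unfolding G_def F_def using hh by (simp flip: mult.assoc)
  moreover have "hs \<mu> t k * heat_symbol \<mu> k * (u0 k + integral {0..t} G) = heat_symbol \<mu> k * v t k"
    by (simp only: vE[OF t] mult_ac)
  ultimately have "((\<lambda>s. hs \<mu> s k * (u0 k + integral {0..s} G)) has_vector_derivative heat_symbol \<mu> k * v t k + N t (v t) k) (at t within {a..S})"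
    by (simp add: add.commute)
  then show ?thesis by (rule has_vector_derivative_transform[OF t, rotated]) (rule vE)
qed

text \<open>The order of quantifiers is the point: U1 is fixed by T, r0, V0 and the coefficients.
  The constants B, C5 and M0 introduced inside depend on the solution, but they only decide how far
  to truncate.\<close>

lemma apriori_bound:
  assumes pm: "p = 2 * m + 1" and m: "1 \<le> m" and ab: "al < be" and als: "al < 1 / (2 * real m)" and Z: "coeff_bound m al ga T K W"
    and W0: "\<And>t. W 0 0 t = done_one" and nu: "Re \<nu> > 0"
    and a11: "a1 < 1" and cond: "(1 / a1 - 1)\<^sup>2 < \<mu>\<^sup>2 * (2 * (1 / a1) - 1)" and r0: "0 < r0" "r0 < T"
  shows "\<exists>U1\<ge>0. \<forall>S v. r0 < S \<longrightarrow> S \<le> T \<longrightarrow> sol u0 (\<lambda>t v. PsiW m \<nu> \<tau> v (\<lambda>a b. W a b t)) S v \<longrightarrow> bb be V0 (v r0) \<longrightarrow>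
    (\<forall>t\<in>{r0..S}. bb (-a1) U1 (v t))"
proof -
  define N where "N = (\<lambda>t v. PsiW m \<nu> \<tau> v (\<lambda>a b. W a b t))"
  obtain L where L: "NL T L N" using NL_PsiW[OF pm ab Z] unfolding N_def by blast
  define r where "r = 1 / a1"
  have r: "r > 1" using a1 a11 by (simp add: r_def)
  obtain K1 where K1: "K1 \<ge> 0" "\<And>t a b. t \<in> {r0..T} \<Longrightarrow> a \<le> m + 1 \<Longrightarrow> b \<le> m \<Longrightarrow> bb (-al) K1 (W a b t)"
    using ZB_bound[OF Z ga r0(1)] by blast
  obtain Cp where Cp: "Cp \<ge> 1" "\<And>a B f N. bb a B f \<Longrightarrow> bb a (Cp * B) (lp_partial N f)" using bb_partial by blast
  obtain Ct where Ct: "Ct \<ge> 1" "\<And>a a' B f N. bb a B f \<Longrightarrow> a' \<le> a \<Longrightarrow>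
    bb a' (Ct * 2 powr (a - a') * B * 2 powr (- (a - a') * real N)) (\<lambda>k. f k - lp_partial N f k)" using bb_tail by blast
  \<comment> \<open>The regularity given up to obtain decay of the truncation error; small enough
    that al2 stays below be2 and below 1/(2m).\<close>
  define \<delta> where "\<delta> = min ((be - al) / 4) ((1 / (2 * real m) - al) / 2)"
  define al2 where "al2 = al + \<delta>"
  define be2 where "be2 = be - \<delta>"
  have \<delta>: "0 < \<delta>" "4 * \<delta> \<le> be - al" "2 * \<delta> \<le> 1 / (2 * real m) - al" using ab als by (auto simp: \<delta>_def min_def field_simps)
  have al2: "0 < al2" "al2 < 1 / (2 * real m)" using \<delta> al als unfolding al2_def by linarith+
  have g2: "mult_exps be2 (- al2)" using \<delta> al be ab by (simp add: mult_exps_def al2_def be2_def)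
  \<comment> \<open>e is spent twice, on the reaction and on the commutator, so twice e has to fit
    below both the dissipation and the damping.\<close>
  define e where "e = min 1 (Re \<nu>) / 2"
  have e: "e > 0" "2 * e \<le> 1" "2 * e \<le> Re \<nu>" using nu by (auto simp: e_def)
  \<comment> \<open>At least 1, because the coefficient \<open>done_one\<close> has to satisfy the
    same bound.\<close>
  define K2 where "K2 = max 1 (Cp * K1)"
  have cond': "(r - 1)\<^sup>2 < \<mu>\<^sup>2 * (2 * r - 1)" using cond by (simp add: r_def)
  obtain C1 where C1: "C1 \<ge> 0" "\<And>V W. fsupp V \<Longrightarrow> \<forall>a\<le>m+1. \<forall>b\<le>m. fsupp (W a b) \<and> bb (-al2) K2 (W a b) \<Longrightarrow> W 0 0 = done_one \<Longrightarrow>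
    Re (tint (\<lambda>x. tev (PsiW m \<nu> \<tau> V W) x * cnj (ph (2*r-2) (tev V x)))) \<le> - Re \<nu> * Xn r m V + e * (Dn \<mu> r V + Xn r m V) + C1"
    using reaction[OF \<mu> r cond' m al2 _ e(1), of K2 \<nu> \<tau>] by (auto simp: K2_def)
  obtain C2 where C2: "C2 \<ge> 0" "\<And>V \<zeta> i j. fsupp V \<Longrightarrow> i + j \<le> 2 * m \<Longrightarrow> fsupp \<zeta> \<Longrightarrow> bb (-al2) 1 \<zeta> \<Longrightarrow>
    cmod (tint (\<lambda>x. fm r i j (tev V x) * tev \<zeta> x)) \<le> e * (Dn \<mu> r V + Xn r m V) + C2"
    using pairing[OF \<mu> r cond' m al2 zero_le_one e(1)] by blast
  obtain C4 where C4: "C4 \<ge> 0" "\<And>V Y. fsupp V \<Longrightarrow> tint (\<lambda>x. cmod (tev V x) powr (2 * r)) \<le> Y \<Longrightarrow> bb (- (1 / r)) (C4 + 256 * Y) V"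
    using Lp_embedding[OF r] by blast
  define C3 where "C3 = 2 * r * (C1 + C2)"
  have C3: "C3 \<ge> 0" using r C1 C2 by (simp add: C3_def)
  \<comment> \<open>Positive regularity bounds the supremum at time r0 by a geometric series of
    blocks, uniformly in the truncation; this controls the initial energy.\<close>
  define Y where "Y = \<bar>Cp * V0 * geo be\<bar> powr (2 * r) + C3 * T"
  define U1 where "U1 = C4 + 256 * Y"
  have Y0: "Y \<ge> 0" unfolding Y_def using C3 r0 by simp
  have "bb (-a1) U1 (v t)" if S: "r0 < S" "S \<le> T" and v: "sol u0 N S v" and v0: "bb be V0 (v r0)" and t: "t \<in> {r0..S}" for S v t
  proof -
    obtain B where B: "B \<ge> 1" "wb S B v" using v unfolding sol_def by blast
    define F where "F s = N s (v s)" for s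
    have sing_bound: "sing_bound (-al) (real p * ga) (L * B ^ p) S F" unfolding F_def by (rule wb_FB[OF L B(2,1) S(2)])
    have L0: "L * B ^ p \<ge> 0" using L B(1) by (simp add: NL_def)
    define B1 where "B1 = B * r0 powr (-ga)"
    define B3 where "B3 = L * B ^ p * r0 powr (- (real p * ga))"
    have vB: "bb be B1 (v t)" if "t \<in> {r0..S}" for t
    proof (rule bb_mono)
      show "bb be (B * t powr (-ga)) (v t)" using B(2) that r0 unfolding wb_def by auto
      show "B * t powr (-ga) \<le> B1" unfolding B1_def using that r0 ga B by (intro mult_left_mono powr_mono2') auto
    qed
    have FB3: "bb (-al) B3 (F t)" if "t \<in> {r0..S}" for t
    proof (rule bb_mono)
      show "bb (-al) (L * B ^ p * t powr (- (real p * ga))) (F t)" using sing_bound that r0 unfolding sing_bound_def by auto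
      show "L * B ^ p * t powr (- (real p * ga)) \<le> B3" unfolding B3_def using that r0 ga L0 by (intro mult_left_mono powr_mono2') auto
    qed
    have B10: "B1 \<ge> 0" "B3 \<ge> 0" using B(1) L0 by (auto simp: B1_def B3_def)
    obtain C5 where C5: "C5 \<ge> 0" "\<And>v w W W' d. 0 \<le> d \<Longrightarrow> bb be2 (Cp * B1) v \<Longrightarrow> bb be2 (Cp * B1) w \<Longrightarrow> bb be2 d (\<lambda>k. v k - w k) \<Longrightarrow>
       (\<forall>a\<le>m+1. \<forall>b\<le>m. bb (-al2) K2 (W a b) \<and> bb (-al2) K2 (W' a b) \<and> bb (-al2) d (\<lambda>k. W a b k - W' a b k)) \<Longrightarrow>
       bb (-al2) (C5 * d) (\<lambda>k. PsiW m \<nu> \<tau> v W k - PsiW m \<nu> \<tau> w W' k)"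
      using PsiW_diff[OF g2 al2(1), of "Cp * B1" m K2 \<nu> \<tau>] by blast
    \<comment> \<open>The size of the commutator before the factor 2 powr (-\<delta> * M): the
      truncation of solution and coefficients, propagated by C5, plus that of the forcing.\<close>
    define c where "c = C5 * (Ct * 2 powr \<delta> * (B1 + K1)) + Ct * 2 powr \<delta> * B3"
    have "\<forall>\<^sub>F M in sequentially. c * 2 powr (- \<delta> * real M) < 1" by (rule order_tendstoD(2)[OF two_powr_tendsto[OF \<delta>(1)]]) simp
    then obtain M0 where M0: "\<And>M. M \<ge> M0 \<Longrightarrow> c * 2 powr (- \<delta> * real M) < 1" unfolding eventually_sequentially by blast
    have main: "bb (-a1) U1 (lp_partial M (v t))" if M: "M \<ge> max 1 M0" for M
    proof -
      define V where "V t = lp_partial M (v t)" for t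
      define WM where "WM t a b = lp_partial M (W a b t)" for t a b
      define P where "P t = PsiW m \<nu> \<tau> (V t) (WM t)" for t
      \<comment> \<open>The commutator. For M \<ge> M0 its bound is below 1, so
        \<open>pairing\<close> applies to it with the fixed constant 1.\<close>
      define R where "R t = (\<lambda>k. lp_partial M (F t) k - P t k)" for t
      define d where "d = Ct * 2 powr \<delta> * (B1 + K1) * 2 powr (- \<delta> * real M)"
      have d0: "d \<ge> 0" using Ct(1) B10 K1(1) by (simp add: d_def)
      have fV: "fsupp (V t)" and fW: "fsupp (WM t a b)" for t a b by (auto simp: V_def WM_def)
      have fP: "fsupp (P t)" for t unfolding P_def by (rule PsiW_fsupp(1)[OF fV fW])
      have fR: "fsupp (R t)" for t unfolding R_def by (rule fsupp_lin(2)[OF fsupp_partial fP])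
      have WK: "bb (-al) K2 (W a b t)" "bb (-al) K2 (WM t a b)" if "t \<in> {r0..S}" "a \<le> m + 1" "b \<le> m" for t a b
      proof -
        have w: "bb (-al) K1 (W a b t)" using that S by (intro K1) auto
        have "K1 \<le> K2" using mult_right_mono[OF Cp(1) K1(1)] by (simp add: K2_def)
        then show "bb (-al) K2 (W a b t)" by (rule bb_mono[OF w])
        show "bb (-al) K2 (WM t a b)" unfolding WM_def by (rule bb_mono[OF Cp(2)[OF w]]) (simp add: K2_def)
      qed
      have wk: "- al2 \<le> - al" "be2 \<le> be" using \<delta> by (auto simp: al2_def be2_def)
      have Rb: "bb (-al2) 1 (R t)" if t: "t \<in> {r0..S}" for t
      proof -
        have "bb (-al2) (C5 * d) (\<lambda>k. PsiW m \<nu> \<tau> (v t) (\<lambda>a b. W a b t) k - PsiW m \<nu> \<tau> (V t) (WM t) k)"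
        proof (rule C5(2)[OF d0])
          have "B1 \<le> Cp * B1" using mult_right_mono[OF Cp(1) B10(1)] by simp
          then show "bb be2 (Cp * B1) (v t)" by (intro bb_mono[OF bb_weaken[OF vB[OF t] wk(2)]])
          show "bb be2 (Cp * B1) (V t)" unfolding V_def by (rule bb_weaken[OF Cp(2)[OF vB[OF t]] wk(2)])
          have "bb be2 (Ct * 2 powr (be - be2) * B1 * 2 powr (- (be - be2) * real M)) (\<lambda>k. v t k - V t k)"
            unfolding V_def by (rule Ct(2)[OF vB[OF t] wk(2)])
          then show "bb be2 d (\<lambda>k. v t k - V t k)"
            by (rule bb_mono) (use Ct(1) K1(1) in \<open>auto simp: d_def be2_def intro!: mult_right_mono mult_left_mono\<close>)
          have "bb (-al2) d (\<lambda>k. W a b t k - WM t a b k)" if "a \<le> m + 1" "b \<le> m" for a b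
          proof -
            have "bb (-al2) (Ct * 2 powr (-al - -al2) * K1 * 2 powr (- (-al - -al2) * real M)) (\<lambda>k. W a b t k - WM t a b k)"
              unfolding WM_def using that t S by (intro Ct(2) wk K1) auto
            then show ?thesis
              by (rule bb_mono) (use Ct(1) B10 in \<open>auto simp: d_def al2_def intro!: mult_right_mono mult_left_mono\<close>)
          qed
          then show "\<forall>a\<le>m+1. \<forall>b\<le>m. bb (-al2) K2 (W a b t) \<and> bb (-al2) K2 (WM t a b) \<and> bb (-al2) d (\<lambda>k. W a b t k - WM t a b k)"
            using bb_weaken[OF WK(1)[OF t] wk(1)] bb_weaken[OF WK(2)[OF t] wk(1)] by blast
        qed
        moreover have "bb (-al2) (Ct * 2 powr (-al - -al2) * B3 * 2 powr (- (-al - -al2) * real M)) (\<lambda>k. F t k - lp_partial M (F t) k)"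
          by (rule Ct(2)[OF FB3[OF t] wk(1)])
        ultimately have "bb (-al2) (C5 * d + Ct * 2 powr (-al - -al2) * B3 * 2 powr (- (-al - -al2) * real M))
          (\<lambda>k. (PsiW m \<nu> \<tau> (v t) (\<lambda>a b. W a b t) k - PsiW m \<nu> \<tau> (V t) (WM t) k) - (F t k - lp_partial M (F t) k))"
          by (rule bb_diff)
        moreover have "(\<lambda>k. (PsiW m \<nu> \<tau> (v t) (\<lambda>a b. W a b t) k - PsiW m \<nu> \<tau> (V t) (WM t) k) - (F t k - lp_partial M (F t) k)) = R t"
          by (auto simp: R_def P_def F_def N_def)
        moreover have "C5 * d + Ct * 2 powr (-al - -al2) * B3 * 2 powr (- (-al - -al2) * real M) = c * 2 powr (- \<delta> * real M)"
          by (simp add: c_def d_def al2_def algebra_simps)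
        ultimately show ?thesis using M0[of M] M by (auto intro: bb_mono)
      qed
      define V' where "V' t = (\<lambda>k. heat_symbol \<mu> k * V t k + lp_partial M (F t) k)" for t
      have V'eq: "V' t = (\<lambda>k. heat_symbol \<mu> k * V t k + (P t k + R t k))" for t by (simp add: V'_def R_def)
      have dV: "((\<lambda>t. V t k) has_vector_derivative V' t k) (at t within {r0..S})" if "t \<in> {r0..S}" for t k
      proof -
        have "((\<lambda>t. v t k) has_vector_derivative heat_symbol \<mu> k * v t k + F t k) (at t within {r0..S})"
          unfolding F_def by (rule sol_deriv[OF L v S(2) r0(1) S(1) that])
        from has_vector_derivative_mult_right[OF this, of "complex_of_real (\<Sum>n<M. lp_symbol n (kvec k))"]
        show ?thesis by (simp add: V_def V'_def lp_partial_def algebra_simps)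
      qed
      have cv: "cf {0<..S} v" "cf {0<..S} F" using B(2) sing_bound unfolding wb_def sing_bound_def by auto
      have cV': "continuous_on {r0..S} (\<lambda>t. V' t k)" for k
      proof -
        have "continuous_on {r0..S} (\<lambda>t. V t k)" "continuous_on {r0..S} (\<lambda>t. lp_partial M (F t) k)"
          using cf_subset[OF cf_partial[OF cv(1), of M], of "{r0..S}"] cf_subset[OF cf_partial[OF cv(2), of M], of "{r0..S}"] r0 unfolding cf_def V_def by (force, force)
        then show ?thesis unfolding V'_def by (intro continuous_intros)
      qed
      have z: "V t k = 0" "V' t k = 0" if "k \<notin> lp_box M" for t k using partial_box[OF that] by (auto simp: V_def V'_def)
      define y where "y t = tint (\<lambda>x. cmod (tev (V t) x) powr (2*r))" for t
      define Dv where "Dv t = 2 * r * Re (tint (\<lambda>x. tev (V' t) x * cnj (ph (2*r-2) (tev (V t) x))))" for t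
      have dy: "(y has_real_derivative Dv t) (at t within {r0..S})" if "t \<in> {r0..S}" for t
        unfolding y_def Dv_def by (rule energy_deriv[OF r finite_lp_box z dV cV' that])
      have Dv: "Dv t \<le> C3" if t: "t \<in> {r0..S}" for t
      proof -
        let ?X = "Xn r m (V t)" and ?D = "Dn \<mu> r (V t)"
        have D0: "0 \<le> ?D" using dissip[OF \<mu> r cond'] fV by blast
        have X0: "0 \<le> ?X" by (rule Xn_nonneg[OF r])
        have "WM t 0 0 = done_one" using M by (simp add: WM_def W0 partial_one)
        moreover have "\<forall>a\<le>m+1. \<forall>b\<le>m. fsupp (WM t a b) \<and> bb (-al2) K2 (WM t a b)"
          using bb_weaken[OF WK(2)[OF t] wk(1)] fW by blast
        ultimately have "Re (tint (\<lambda>x. tev (P t) x * cnj (ph (2*r-2) (tev (V t) x)))) \<le> - Re \<nu> * ?X + e * (?D + ?X) + C1"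
          unfolding P_def by (intro C1(2) fV)
        moreover have "cmod (tint (\<lambda>x. fm r 0 0 (tev (V t) x) * tev (R t) x)) \<le> e * (?D + ?X) + C2"
          by (intro C2(2) fV fR Rb t) simp
        ultimately have "Re (tint (\<lambda>x. tev (V' t) x * cnj (ph (2*r-2) (tev (V t) x)))) \<le> - ?D + (- Re \<nu> * ?X + e * (?D + ?X) + C1) + (e * (?D + ?X) + C2)"
          unfolding V'eq by (rule energy_rate[OF r fV fP fR])
        also have "\<dots> = (C1 + C2) - (1 - 2 * e) * ?D - (Re \<nu> - 2 * e) * ?X" by (simp add: algebra_simps)
        also have "\<dots> \<le> C1 + C2"
        proof -
          have "0 \<le> (1 - 2 * e) * ?D" "0 \<le> (Re \<nu> - 2 * e) * ?X" using e D0 X0 by (intro mult_nonneg_nonneg; simp)+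
          then show ?thesis by linarith
        qed
        finally show ?thesis unfolding Dv_def C3_def using r by (intro mult_left_mono) auto
      qed
      have y0: "y r0 \<le> \<bar>Cp * V0 * geo be\<bar> powr (2 * r)"
      proof -
        have "cmod (tev (V r0) x) \<le> \<bar>Cp * V0 * geo be\<bar>" for x
        proof -
          obtain M' where M': "V r0 = (\<lambda>k. \<Sum>n<M'. D n (V r0) k)" using fsupp_decomp[OF fV] by blast
          have bV: "bb be (Cp * V0) (V r0)" unfolding V_def by (rule Cp(2)[OF v0])
          have "tev (V r0) x = (\<Sum>n<M'. tev (D n (V r0)) x)" by (subst M') (auto intro!: tev_sum)
          also have "cmod \<dots> \<le> (\<Sum>n<M'. (Cp * V0) * 2 powr (- be * real n))" by (intro sum_norm_le bbD[OF bV])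
          also have "\<dots> \<le> (Cp * V0) * geo be"
            unfolding sum_distrib_left[symmetric] by (intro mult_left_mono geo_sum be bb_nonneg[OF bV])
          finally show ?thesis by linarith
        qed
        then have "y r0 \<le> tint (\<lambda>x. \<bar>Cp * V0 * geo be\<bar> powr (2 * r))"
          unfolding y_def using r by (intro tint_mono continuous_intros powr_mono2) auto
        then show ?thesis by simp
      qed
      have "y t \<le> y r0 + C3 * (t - r0)" by (rule growth_bound[OF dy Dv t])
      also have "\<dots> \<le> Y" unfolding Y_def using t S r0 C3 by (intro add_mono y0 mult_left_mono) auto
      finally have "bb (- (1 / r)) (C4 + 256 * Y) (V t)" unfolding y_def by (intro C4(2) fV)
      then show ?thesis using a1 by (simp add: r_def U1_def V_def)
    qed
    show ?thesis
    proof (rule bb_limit)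
      show "bb (-a1) U1 (lp_partial (n + max 1 M0) (v t))" for n by (rule main) simp
      show "(\<lambda>n. lp_partial (n + max 1 M0) (v t) k) \<longlonglongrightarrow> v t k" for k by (rule LIMSEQ_ignore_initial_segment[OF partial_LIMSEQ])
    qed
  qed
  moreover have "U1 \<ge> 0" unfolding U1_def using C4(1) Y0 by simp
  ultimately show ?thesis unfolding N_def by blast
qed

end

subsection \<open>Global existence and uniqueness\<close>

lemma block_bdd: "bdd_above (range (\<lambda>x. cmod (lp_block n f x)))"
proof -
  have "cmod (lp_block n f x) \<le> (\<Sum>k\<in>lp_box n. cmod (D n f k))" for x
    unfolding lp_block_eq by (rule tev_le) (auto simp: D_def mul_def sg_box)
  then show ?thesis by (intro bdd_aboveI2)
qed

lemma in_C_bb: assumes "in_C a f" shows "bb a (2 powr a * Cnorm a f) f"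
  unfolding bb_def
proof (intro allI)
  fix n x
  let ?S = "SUP x. cmod (lp_block n f x)"
  have "cmod (tev (D n f) x) \<le> ?S" unfolding lp_block_eq[symmetric] by (intro cSUP_upper block_bdd) simp
  also have "?S = 2 powr (- ((real n - 1) * a)) * besov_seq a f n"
    by (simp add: besov_seq_def powr_minus)
  also have "\<dots> \<le> 2 powr (- ((real n - 1) * a)) * Cnorm a f"
    using assms unfolding in_C_def Cnorm_def by (intro mult_left_mono cSUP_upper) auto
  also have "2 powr (- ((real n - 1) * a)) = 2 powr a * 2 powr (- a * real n)"
    by (simp add: algebra_simps flip: powr_add)
  finally show "cmod (tev (D n f) x) \<le> 2 powr a * Cnorm a f * 2 powr (- a * real n)" by (simp add: mult_ac)
qed

lemma bb_in_C: assumes "bb a B f" shows "in_C a f" "Cnorm a f \<le> 2 powr (-a) * B"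
proof -
  have *: "besov_seq a f n \<le> 2 powr (-a) * B" for n
  proof -
    have "(SUP x. cmod (lp_block n f x)) \<le> B * 2 powr (- a * real n)"
      unfolding lp_block_eq by (intro cSUP_least bbD[OF assms]) auto
    then have "besov_seq a f n \<le> 2 powr ((real n - 1) * a) * (B * 2 powr (- a * real n))"
      unfolding besov_seq_def by (intro mult_left_mono) auto
    also have "\<dots> = (2 powr ((real n - 1) * a) * 2 powr (- a * real n)) * B" by simp
    also have "2 powr ((real n - 1) * a) * 2 powr (- a * real n) = 2 powr (-a)" by (simp add: algebra_simps flip: powr_add)
    finally show ?thesis .
  qed
  show "in_C a f" unfolding in_C_def by (rule bdd_aboveI2[OF *])
  show "Cnorm a f \<le> 2 powr (-a) * B" unfolding Cnorm_def by (intro cSUP_least *) auto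
qed

lemma ccont_cf: assumes "ccont_on S a u" shows "cf S u"
  unfolding cf_def continuous_on_iff
proof (intro allI ballI impI)
  fix k t e assume t: "t \<in> S" and e: "(0::real) < e"
  obtain c where c: "c \<ge> 0" "\<And>f B. bb a B f \<Longrightarrow> cmod (f k) \<le> c * B" using bb_coeff[of a k] by blast
  define e' where "e' = e / (c * 2 powr a + 1)"
  have c1: "c * 2 powr a + 1 > 0" using c(1) by (simp add: add_nonneg_pos)
  have "e' > 0" using e c1 by (simp add: e'_def)
  then obtain d where d: "d > 0" "\<forall>s\<in>S. \<bar>s - t\<bar> < d \<longrightarrow> Cnorm a (\<lambda>k. u s k - u t k) < e'"
    using assms t unfolding ccont_on_def by blast
  have "dist (u s k) (u t k) < e" if s: "s \<in> S" "dist s t < d" for s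
  proof -
    have "in_C a (u s)" "in_C a (u t)" using assms s t unfolding ccont_on_def by auto
    then have "in_C a (\<lambda>k. u s k - u t k)" using bb_in_C(1)[OF bb_diff[OF in_C_bb in_C_bb]] by blast
    then have "cmod (u s k - u t k) \<le> c * (2 powr a * Cnorm a (\<lambda>k. u s k - u t k))" by (rule c(2)[OF in_C_bb])
    also have "\<dots> \<le> c * (2 powr a * e')" using d(2) s c(1) by (intro mult_left_mono) (auto simp: dist_real_def intro: less_imp_le)
    also have "\<dots> < (c * 2 powr a + 1) * e'" using \<open>e' > 0\<close> by (simp add: algebra_simps)
    also have "\<dots> = e" using c1 by (simp add: e'_def)
    finally show ?thesis by (simp add: dist_norm)
  qed
  then show "\<exists>d>0. \<forall>s\<in>S. dist s t < d \<longrightarrow> dist (u s k) (u t k) < e" using d(1) by blast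
qed

lemma ccont_bb: "ccont_on S a u \<Longrightarrow> t \<in> S \<Longrightarrow> bb a (2 powr a * Cnorm a (u t)) (u t)"
  unfolding ccont_on_def using in_C_bb by blast

lemma Cnorm_weighted_bb:
  assumes "ccont_on {0<..T} a u" "bdd_above ((\<lambda>t. t powr x * Cnorm a (u t)) ` {0<..T})"
  shows "\<exists>K\<ge>0. \<forall>t\<in>{0<..T}. bb a (K * t powr (-x)) (u t)"
proof -
  obtain C where "\<forall>y\<in>(\<lambda>t. t powr x * Cnorm a (u t)) ` {0<..T}. y \<le> C" using assms(2) unfolding bdd_above_def by blast
  then have C: "\<And>t. t \<in> {0<..T} \<Longrightarrow> t powr x * Cnorm a (u t) \<le> C" by blast
  have "bb a (2 powr a * \<bar>C\<bar> * t powr (-x)) (u t)" if t: "t \<in> {0<..T}" for t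
  proof (rule bb_mono[OF ccont_bb[OF assms(1) t]])
    have "Cnorm a (u t) = (t powr x * Cnorm a (u t)) * t powr (-x)" using t by (simp add: powr_minus)
    also have "\<dots> \<le> \<bar>C\<bar> * t powr (-x)" using C[OF t] by (intro mult_right_mono) auto
    finally show "2 powr a * Cnorm a (u t) \<le> 2 powr a * \<bar>C\<bar> * t powr (-x)" by (simp add: mult.assoc)
  qed
  then show ?thesis by (intro exI[of _ "2 powr a * \<bar>C\<bar>"]) auto
qed

text \<open>The class of coefficients allows every \<alpha>' in (0, 1); here it is taken to be ga.
  Conjugation fills in the index pairs outside \<open>Lset\<close>.\<close>

lemma ZB_Zcol:
  assumes L: "in_L m Z Zh" and al: "0 < al" "al < 1" and ga: "0 < ga" "ga < 1" and T: "0 < T"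
  shows "\<exists>K. coeff_bound m al ga T K (Zcol m Z Zh)"
proof -
  define G where "G a b K = (cf {0<..T} (Zcol m Z Zh a b) \<and> (\<forall>t\<in>{0<..T}. bb (-al) (K * t powr (- (real (a + b) * ga))) (Zcol m Z Zh a b t)))" for a b K
  have Gm: "G a b K'" if "G a b K" "K \<le> K'" for a b K K'
    using that unfolding G_def by (auto intro: bb_mono mult_right_mono)
  \<comment> \<open>The norm of the family has exponent a + b - 1, whereas
    \<open>coeff_bound\<close> asks for a + b; on a bounded interval the difference costs T powr
    ga.\<close>
  have gain: "\<exists>K\<ge>0. \<forall>t\<in>{0<..T}. bb (-al) (K * t powr (- (real q * ga))) (u t)"
    if "q \<ge> 1" "K \<ge> 0" and g: "\<forall>t\<in>{0<..T}. bb (-al) (K * t powr (- (real (q - 1) * ga))) (u t)" for q K u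
  proof -
    have "bb (-al) (K * T powr ga * t powr (- (real q * ga))) (u t)" if t: "t \<in> {0<..T}" for t
    proof (rule bb_mono[OF g[rule_format, OF t]])
      have "t powr (- (real (q - 1) * ga)) = t powr ga * t powr (- (real q * ga))"
        using \<open>q \<ge> 1\<close> by (simp add: of_nat_diff algebra_simps flip: powr_add)
      also have "\<dots> \<le> T powr ga * t powr (- (real q * ga))" using t ga by (intro mult_right_mono powr_mono2) auto
      finally show "K * t powr (- (real (q - 1) * ga)) \<le> K * T powr ga * t powr (- (real q * ga))"
        using \<open>K \<ge> 0\<close> by (simp add: mult.assoc mult_left_mono)
    qed
    then show ?thesis using \<open>K \<ge> 0\<close> by (intro exI[of _ "K * T powr ga"]) auto
  qed
  note L' = L[unfolded in_L_def, rule_format, of al ga T]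
  have Zc: "ccont_on {0..T} (-al) Z" and Zb: "bdd_above ((\<lambda>t. Cnorm (-al) (Z t)) ` {0..T})" using L' al ga T by auto
  have Hc: "ccont_on {0<..T} (-al) (Zh i j)"
    and Hb: "bdd_above ((\<lambda>t. t powr (real (i + j - 1) * ga) * Cnorm (-al) (Zh i j t)) ` {0<..T})" if "(i, j) \<in> Lset m" for i j
    using L' al ga T that by auto
  have cfZ: "cf {0<..T} Z" by (rule cf_subset[OF ccont_cf[OF Zc]]) auto
  obtain KZ where KZ: "KZ \<ge> 0" "\<forall>t\<in>{0<..T}. bb (-al) (KZ * t powr (- (real 1 * ga))) (Z t)"
  proof -
    obtain C where "\<forall>y\<in>(\<lambda>t. Cnorm (-al) (Z t)) ` {0..T}. y \<le> C" using Zb unfolding bdd_above_def by blast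
    then have C: "\<And>t. t \<in> {0..T} \<Longrightarrow> Cnorm (-al) (Z t) \<le> C" by blast
    have "\<forall>t\<in>{0<..T}. bb (-al) (2 powr (-al) * \<bar>C\<bar> * t powr (- (real (1 - 1) * ga))) (Z t)"
    proof
      fix t assume t: "t \<in> {0<..T}"
      then have "Cnorm (-al) (Z t) \<le> \<bar>C\<bar>" using C[of t] by simp
      then show "bb (-al) (2 powr (-al) * \<bar>C\<bar> * t powr (- (real (1 - 1) * ga))) (Z t)"
        using t by (intro bb_mono[OF ccont_bb[OF Zc]]) auto
    qed
    from gain[OF _ _ this] that show thesis by auto
  qed
  have H: "\<exists>K\<ge>0. \<forall>t\<in>{0<..T}. bb (-al) (K * t powr (- (real (i + j) * ga))) (Zh i j t)" if ij: "(i, j) \<in> Lset m" for i j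
  proof -
    obtain K where "K \<ge> 0" "\<forall>t\<in>{0<..T}. bb (-al) (K * t powr (- (real (i + j - 1) * ga))) (Zh i j t)"
      using Cnorm_weighted_bb[OF Hc[OF ij] Hb[OF ij]] by blast
    moreover have "1 \<le> i + j" using ij by (auto simp: Lset_def)
    ultimately show ?thesis by (intro gain)
  qed
  have "\<exists>K\<ge>0. G a b K" if ab: "a \<le> m + 1" "b \<le> m" for a b
  proof -
    consider "a = 1 \<and> b = 0" | "a = 0 \<and> b = 1" | "a = 0 \<and> b = 0" | "a + b > 1 \<and> (a, b) \<in> Lset m" | "a + b > 1 \<and> (a, b) \<notin> Lset m \<and> (b, a) \<in> Lset m"
    proof -
      have "a = 1 \<and> b = 0 \<or> a = 0 \<and> b = 1 \<or> a = 0 \<and> b = 0 \<or> a + b > 1" by arith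
      moreover have "(a, b) \<in> Lset m \<or> (b, a) \<in> Lset m" if "a + b > 1"
      proof (cases "b \<le> a")
        case True
        then show ?thesis using ab that by (simp add: Lset_def)
      next
        case False
        then have "b \<le> m + 1" "a \<le> m" "a \<le> b" "b + a > 1" using ab that by auto
        then show ?thesis by (simp add: Lset_def)
      qed
      ultimately show ?thesis using that by blast
    qed
    then show ?thesis
    proof cases
      case 1
      then have "Zcol m Z Zh a b = Z" by (auto simp: Zcol_def)
      then show ?thesis using KZ cfZ 1 unfolding G_def by auto
    next
      case 2
      then have "Zcol m Z Zh a b = (\<lambda>t. dconj (Z t))" by (auto simp: Zcol_def)
      then show ?thesis using KZ cf_dconj[OF cfZ] 2 unfolding G_def by (auto intro: bb_dconj)
    next
      case 3
      then have "Zcol m Z Zh a b = (\<lambda>t. done_one)" by (auto simp: Zcol_def)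
      then show ?thesis using 3 unfolding G_def cf_def by (intro exI[of _ 1]) (auto intro: bb_one)
    next
      case 4
      then have "(a, b) \<noteq> (1, 0)" "(a, b) \<noteq> (0, 1)" "(a, b) \<noteq> (0, 0)" by auto
      then have "Zcol m Z Zh a b = Zh a b" using 4 by (intro ext) (simp only: Zcol_def if_False if_True)
      then show ?thesis using H[of a b] ccont_cf[OF Hc, of a b] 4 unfolding G_def by auto
    next
      case 5
      then have "(a, b) \<noteq> (1, 0)" "(a, b) \<noteq> (0, 1)" "(a, b) \<noteq> (0, 0)" by auto
      then have "Zcol m Z Zh a b = (\<lambda>t. dconj (Zh b a t))" using 5 by (intro ext) (simp only: Zcol_def if_False)
      then show ?thesis using H[of b a] cf_dconj[OF ccont_cf[OF Hc, of b a]] 5 unfolding G_def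
        by (auto intro: bb_dconj simp: add.commute)
    qed
  qed
  then have "\<forall>a b. \<exists>K\<ge>0. a \<le> m + 1 \<longrightarrow> b \<le> m \<longrightarrow> G a b K" by (metis order_refl)
  then obtain K where K: "\<And>a b. K a b \<ge> 0" "\<And>a b. a \<le> m + 1 \<Longrightarrow> b \<le> m \<Longrightarrow> G a b (K a b)" by metis
  define KK where "KK = (\<Sum>a\<le>m+1. \<Sum>b\<le>m. K a b)"
  have "K a b \<le> KK" if "a \<le> m + 1" "b \<le> m" for a b
  proof -
    have "K a b \<le> (\<Sum>b\<le>m. K a b)" using that K(1) by (intro member_le_sum) auto
    also have "\<dots> \<le> KK" unfolding KK_def using that K(1)
      by (intro member_le_sum[of a "{..m+1}" "\<lambda>a. \<Sum>b\<le>m. K a b"]) (auto intro!: sum_nonneg)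
    finally show ?thesis .
  qed
  then have "G a b KK" if "a \<le> m + 1" "b \<le> m" for a b using that Gm K(2) by blast
  moreover have "KK \<ge> 0" unfolding KK_def by (intro sum_nonneg K(1))
  ultimately show ?thesis unfolding coeff_bound_def G_def by blast
qed

text \<open>High blocks of the difference are uniformly small thanks to the surplus b1 - b; the
  finitely many low blocks involve finitely many coefficients, each continuous.\<close>

lemma interpolation_cont:
  assumes v: "cf S v" "\<And>t. t \<in> S \<Longrightarrow> bb b1 B (v t)" and b: "b < b1" and t: "t \<in> S" and e: "e > 0"
  shows "\<exists>d>0. \<forall>s\<in>S. \<bar>s - t\<bar> < d \<longrightarrow> bb b e (\<lambda>k. v s k - v t k)"
proof -
  have "\<forall>\<^sub>F N in sequentially. (2 * B) * 2 powr (- (b1 - b) * real N) < e"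
    by (rule order_tendstoD(2)[OF two_powr_tendsto]) (use b e in auto)
  then obtain N where N: "\<And>n. n \<ge> N \<Longrightarrow> (2 * B) * 2 powr (- (b1 - b) * real n) < e" unfolding eventually_sequentially by blast
  have "\<forall>\<^sub>F s in at t within S. (\<Sum>k\<in>lp_box n. cmod (v s k - v t k)) < e * 2 powr (- b * real n)" for n
  proof (rule order_tendstoD(2))
    have "((\<lambda>s. v s k) \<longlongrightarrow> v t k) (at t within S)" for k using v(1) t unfolding cf_def continuous_on_def by blast
    then have "((\<lambda>s. \<Sum>k\<in>lp_box n. cmod (v s k - v t k)) \<longlongrightarrow> (\<Sum>k\<in>lp_box n. cmod (v t k - v t k))) (at t within S)"
      by (intro tendsto_intros)
    then show "((\<lambda>s. \<Sum>k\<in>lp_box n. cmod (v s k - v t k)) \<longlongrightarrow> 0) (at t within S)" by simp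
  qed (use e in simp)
  then have "\<forall>\<^sub>F s in at t within S. \<forall>n\<in>{..<N}. (\<Sum>k\<in>lp_box n. cmod (v s k - v t k)) < e * 2 powr (- b * real n)"
    by (intro eventually_ball_finite) auto
  then obtain d where d: "d > 0" "\<And>s n. s \<in> S \<Longrightarrow> s \<noteq> t \<Longrightarrow> dist s t < d \<Longrightarrow> n < N \<Longrightarrow> (\<Sum>k\<in>lp_box n. cmod (v s k - v t k)) < e * 2 powr (- b * real n)"
    unfolding eventually_at by (metis lessThan_iff)
  have "bb b e (\<lambda>k. v s k - v t k)" if s: "s \<in> S" "\<bar>s - t\<bar> < d" for s
  proof (cases "s = t")
    case True
    then show ?thesis using e by (simp add: bb_zero)
  next
    case False
    show ?thesis unfolding bb_def
    proof (intro allI)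
      fix n x
      show "cmod (tev (D n (\<lambda>k. v s k - v t k)) x) \<le> e * 2 powr (- b * real n)"
      proof (cases "n < N")
        case True
        have "cmod (tev (D n (\<lambda>k. v s k - v t k)) x) \<le> (\<Sum>k\<in>lp_box n. cmod (D n (\<lambda>k. v s k - v t k) k))"
          by (rule tev_le) (auto simp: D_def mul_def sg_box)
        also have "\<dots> \<le> (\<Sum>k\<in>lp_box n. cmod (v s k - v t k))"
          using sg_le_1 by (intro sum_mono) (simp add: D_def mul_def norm_mult mult_left_le_one_le)
        finally show ?thesis using d(2)[OF s(1) False _ True] s(2) by (simp add: dist_real_def)
      next
        case n: False
        have "cmod (tev (D n (\<lambda>k. v s k - v t k)) x) \<le> (B + B) * 2 powr (- b1 * real n)"
          by (rule bbD[OF bb_diff[OF v(2)[OF s(1)] v(2)[OF t]]])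
        also have "\<dots> = ((2 * B) * 2 powr (- (b1 - b) * real n)) * 2 powr (- b * real n)"
          by (simp add: algebra_simps flip: powr_add)
        also have "\<dots> \<le> e * 2 powr (- b * real n)" using N[of n] n by (intro mult_right_mono) auto
        finally show ?thesis .
      qed
    qed
  qed
  then show ?thesis using d(1) by blast
qed

lemma ccont_on_interpolation:
  assumes v: "cf {0<..} v" "\<And>r T. 0 < r \<Longrightarrow> \<exists>B. \<forall>t\<in>{r..T}. bb b1 B (v t)" and b: "b < b1"
  shows "ccont_on {0<..} b v"
  unfolding ccont_on_def
proof (intro conjI ballI allI impI)
  fix t :: real assume t: "t \<in> {0<..}"
  then obtain B where "bb b1 B (v t)" using v(2)[of t t] by auto
  then show "in_C b (v t)" using bb_in_C(1)[OF bb_weaken] b by (meson less_imp_le)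
next
  fix t e :: real assume t: "t \<in> {0<..}" and e: "0 < e"
  let ?S = "{t/2..t+1}"
  obtain B where "\<forall>s\<in>?S. bb b1 B (v s)" using v(2)[of "t/2" "t+1"] t by auto
  then have B: "\<And>s. s \<in> ?S \<Longrightarrow> bb b1 B (v s)" by blast
  have c: "cf ?S v" by (rule cf_subset[OF v(1)]) (use t in auto)
  have "2 powr b * e / 2 > 0" using e by simp
  moreover have "t \<in> ?S" using t by auto
  ultimately have "\<exists>d>0. \<forall>s\<in>?S. \<bar>s - t\<bar> < d \<longrightarrow> bb b (2 powr b * e / 2) (\<lambda>k. v s k - v t k)"
    using interpolation_cont[OF c B b] by blast
  then obtain d where d: "d > 0" "\<And>s. s \<in> ?S \<Longrightarrow> \<bar>s - t\<bar> < d \<Longrightarrow> bb b (2 powr b * e / 2) (\<lambda>k. v s k - v t k)" by blast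
  show "\<exists>\<delta>>0. \<forall>s\<in>{0<..}. \<bar>s - t\<bar> < \<delta> \<longrightarrow> Cnorm b (\<lambda>k. v s k - v t k) < e"
  proof (intro exI[of _ "min d (min (t/2) 1)"] conjI ballI impI)
    show "0 < min d (min (t/2) 1)" using d t by simp
    fix s :: real assume s: "s \<in> {0<..}" "\<bar>s - t\<bar> < min d (min (t/2) 1)"
    have "\<bar>s - t\<bar> < d" "\<bar>s - t\<bar> < t / 2" "\<bar>s - t\<bar> < 1" using s(2) by auto
    then have "\<bar>s - t\<bar> < d" "s \<in> ?S" unfolding atLeastAtMost_iff by linarith+
    then have "Cnorm b (\<lambda>k. v s k - v t k) \<le> 2 powr (-b) * (2 powr b * e / 2)" by (intro bb_in_C(2) d(2))
    also have "\<dots> = e / 2" by (simp flip: powr_add mult.assoc)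
    finally show "Cnorm b (\<lambda>k. v s k - v t k) < e" using e by simp
  qed
qed

lemma ccont_on_subset: "ccont_on S a u \<Longrightarrow> T \<subseteq> S \<Longrightarrow> ccont_on T a u"
  unfolding ccont_on_def by (meson subsetD)

section \<open>Back to mild solutions\<close>

context mild begin

lemma sol_cong: assumes v: "sol u0 N T v" and e: "\<And>t. t \<in> {0<..T} \<Longrightarrow> w t = v t" shows "sol u0 N T w"
proof -
  obtain B where B: "B \<ge> 1" "wb T B v" and eq: "\<And>t. t \<in> {0<..T} \<Longrightarrow> v t = Phi u0 N v t" using v unfolding sol_def by blast
  have "continuous_on {0<..T} (\<lambda>t. w t k)" for k
  proof -
    have "continuous_on {0<..T} (\<lambda>t. v t k)" using B(2) unfolding wb_def cf_def by blast
    then show ?thesis by (rule continuous_on_eq) (simp add: e)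
  qed
  then have "wb T B w" using B(2) e unfolding wb_def cf_def by auto
  moreover have "w t = Phi u0 N w t" if t: "t \<in> {0<..T}" for t
  proof -
    have "duhamel \<mu> (\<lambda>s. N s (w s)) t = duhamel \<mu> (\<lambda>s. N s (v s)) t" by (rule duh_cong) (use e t in auto)
    then have "Phi u0 N w t = Phi u0 N v t" by (intro ext) (simp add: Phi_def)
    then show ?thesis using eq[OF t] e[OF t] by simp
  qed
  ultimately show ?thesis unfolding sol_def using B(1) by blast
qed

lemma ga_less_1: "ga < 1"
proof -
  have "1 * ga \<le> real p * ga" using p ga by (intro mult_right_mono) auto
  then show ?thesis using pga by linarith
qed

text \<open>\<open>sol\<close> asks only for coefficientwise continuity, so continuity in norm is
  stated separately. Integrability, on the other hand, follows from the weighted bound.\<close>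

lemma mild_solution_iff:
  assumes pm: "p = 2 * m + 1" and ab: "al < be" and L: "in_L m Z Zh" and al1: "al < 1" and T: "0 < T"
  shows "mild_solution m \<mu> \<nu> \<tau> be ga u0 Z Zh T v \<longleftrightarrow>
    ccont_on {0<..T} be v \<and> sol u0 (\<lambda>t v. PsiW m \<nu> \<tau> v (\<lambda>a b. Zcol m Z Zh a b t)) T v"
    (is "?M \<longleftrightarrow> ?C \<and> sol u0 ?N T v")
proof -
  obtain K where "coeff_bound m al ga T K (Zcol m Z Zh)" using ZB_Zcol[OF L al al1 ga ga_less_1 T] by blast
  then obtain NLc where N: "NL T NLc ?N" using NL_PsiW[OF pm ab] by blast
  have F: "(\<lambda>s. exp (complex_of_real (t - s) * heat_symbol \<mu> k) * Psi m \<nu> \<tau> Z Zh (v s) s k) = (\<lambda>s. hs \<mu> (t - s) k * ?N s (v s) k)" for t k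
    by (simp add: hs_def Psi_PsiW)
  have E: "(v t = Phi u0 ?N v t) = (\<forall>k. v t k = exp (complex_of_real t * heat_symbol \<mu> k) * u0 k +
           integral {0..t} (\<lambda>s. exp (complex_of_real (t - s) * heat_symbol \<mu> k) * Psi m \<nu> \<tau> Z Zh (v s) s k))" for t
    unfolding F fun_eq_iff Phi_def duhamel_def hs_def ..
  show ?thesis
  proof
    assume M: ?M
    then have c: ?C and b: "bdd_above ((\<lambda>t. t powr ga * Cnorm be (v t)) ` {0<..T})"
      and eq: "\<And>t. t \<in> {0<..T} \<Longrightarrow> v t = Phi u0 ?N v t" unfolding mild_solution_def E by auto
    obtain K where K: "K \<ge> 0" "\<forall>t\<in>{0<..T}. bb be (K * t powr (-ga)) (v t)" using Cnorm_weighted_bb[OF c b] by blast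
    then have "wb T K v" using ccont_cf[OF c] by (simp add: wb_def)
    then have "wb T (max 1 K) v" by (rule wb_mono) simp
    then show "?C \<and> sol u0 ?N T v" unfolding sol_def using c eq by (auto intro!: exI[of _ "max 1 K"])
  next
    assume "?C \<and> sol u0 ?N T v"
    then have c: ?C and s: "sol u0 ?N T v" by auto
    obtain B where B: "B \<ge> 1" "wb T B v" and eq: "\<And>t. t \<in> {0<..T} \<Longrightarrow> v t = Phi u0 ?N v t" using s unfolding sol_def by blast
    have "t powr ga * Cnorm be (v t) \<le> 2 powr (-be) * B" if t: "t \<in> {0<..T}" for t
    proof -
      have "Cnorm be (v t) \<le> 2 powr (-be) * (B * t powr (-ga))" using B(2) t unfolding wb_def by (intro bb_in_C(2)) auto
      then have "t powr ga * Cnorm be (v t) \<le> t powr ga * (2 powr (-be) * (B * t powr (-ga)))" by (intro mult_left_mono) auto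
      also have "\<dots> = 2 powr (-be) * B" using t by (simp add: powr_minus)
      finally show ?thesis .
    qed
    then have "bdd_above ((\<lambda>t. t powr ga * Cnorm be (v t)) ` {0<..T})" by (intro bdd_aboveI2)
    moreover have "(\<lambda>s. hs \<mu> (t - s) k * ?N s (v s) k) integrable_on {0..t}" if t: "t \<in> {0<..T}" for t k
      using FB_sub[OF wb_FB[OF N B(2,1) order_refl], of t] t by (intro duh_integrable[OF _ pga]) auto
    ultimately show ?M unfolding mild_solution_def F using c eq unfolding E F by auto
  qed
qed

lemma exists_sol:
  assumes pm: "p = 2 * m + 1" and m: "1 \<le> m" and ab: "al < be" and als: "al < 1 / (2 * real m)" and L: "in_L m Z Zh"
    and nu: "Re \<nu> > 0" and a11: "a1 < 1" and cond: "(1 / a1 - 1)\<^sup>2 < \<mu>\<^sup>2 * (2 * (1 / a1) - 1)" and u0: "bb (-a1) U u0"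
  shows "\<exists>v. \<forall>T>0. sol u0 (\<lambda>t v. PsiW m \<nu> \<tau> v (\<lambda>a b. Zcol m Z Zh a b t)) T v"
proof -
  let ?N = "\<lambda>t v. PsiW m \<nu> \<tau> v (\<lambda>a b. Zcol m Z Zh a b t)"
  have al1: "al < 1"
  proof -
    have "1 / (2 * real m) \<le> 1" using m by simp
    then show ?thesis using als by linarith
  qed
  have NLx: "\<exists>Lc. NL T Lc ?N" and ex: "\<exists>v. sol u0 ?N T v" if T: "0 < T" for T
  proof -
    obtain K where Z: "coeff_bound m al ga T K (Zcol m Z Zh)" using ZB_Zcol[OF L al al1 ga ga_less_1 T] by blast
    show "\<exists>Lc. NL T Lc ?N" by (rule NL_PsiW[OF pm ab Z])
    then obtain Lc where Lc: "NL T Lc ?N" by blast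
    have one: "Zcol m Z Zh 0 0 t = done_one" for t by (simp add: Zcol_def)
    show "\<exists>v. sol u0 ?N T v"
      by (rule global_exist[OF Lc T u0]) (rule apriori_bound[OF pm m ab als Z one nu a11 cond])
  qed
  obtain V where V: "\<And>n. sol u0 ?N (real (Suc n)) (V n)" using ex[of "real (Suc _)"] by (metis of_nat_0_less_iff zero_less_Suc)
  \<comment> \<open>\<open>V n\<close> solves on (0, n + 1], so the index nat \<lceil>t\<rceil>
    certainly covers t; uniqueness makes the choices compatible.\<close>
  define v where "v t = V (nat \<lceil>t\<rceil>) t" for t
  have "sol u0 ?N T v" if T: "T > 0" for T
  proof -
    define n where "n = nat \<lceil>T\<rceil>"
    have n: "T \<le> real (Suc n)" unfolding n_def by linarith
    show ?thesis
    proof (rule sol_cong[OF sol_sub[OF V n]])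
      fix t assume t: "t \<in> {0<..T}"
      have "t \<le> real (Suc (nat \<lceil>t\<rceil>))" by linarith
      then have s: "sol u0 ?N t (V (nat \<lceil>t\<rceil>))" "sol u0 ?N t (V n)" using sol_sub[OF V] n t by auto
      obtain Lc where "NL t Lc ?N" using NLx t by auto
      then show "v t = V n t" unfolding v_def using unique[OF _ s] t by auto
    qed
  qed
  then show ?thesis by blast
qed

end

text \<open>The roots of x^2 - 2 \<mu>^2 x - \<mu>^2 are \<mu>^2 - \<mu> s and \<mu>^2 + \<mu> s
  with s = sqrt (1 + \<mu>^2); the first is negative, so x lies strictly between them.\<close>

lemma elliptic_range:
  fixes \<mu> a x :: real
  assumes "\<mu> > 0" "0 < x" "x < \<mu> * (\<mu> + sqrt (1 + \<mu>\<^sup>2))"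
  shows "x\<^sup>2 < \<mu>\<^sup>2 * (2 * x + 1)"
proof -
  define s where "s = sqrt (1 + \<mu>\<^sup>2)"
  have s2: "s\<^sup>2 = 1 + \<mu>\<^sup>2" by (simp add: s_def)
  have "\<mu> < s" unfolding s_def by (rule real_less_rsqrt) simp
  then have "\<mu> * \<mu> < \<mu> * s" using assms(1) by simp
  moreover have "x < \<mu> * \<mu> + \<mu> * s" using assms(3) unfolding s_def by (simp add: distrib_left)
  ultimately have "0 < x - (\<mu> * \<mu> - \<mu> * s)" "x - (\<mu> * \<mu> + \<mu> * s) < 0" using assms(2) by linarith+
  then have "(x - (\<mu> * \<mu> + \<mu> * s)) * (x - (\<mu> * \<mu> - \<mu> * s)) < 0" by (simp add: mult_neg_pos)
  also have "(x - (\<mu> * \<mu> + \<mu> * s)) * (x - (\<mu> * \<mu> - \<mu> * s)) = x\<^sup>2 - 2 * \<mu>\<^sup>2 * x + \<mu>\<^sup>2 * \<mu>\<^sup>2 - \<mu>\<^sup>2 * s\<^sup>2"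
    by (simp add: power2_eq_square algebra_simps)
  finally show ?thesis unfolding s2 by (simp add: algebra_simps)
qed

theorem mainTheorem8:
  fixes m :: nat and \<nu> \<tau> :: complex and \<mu> \<alpha>0 \<beta> \<gamma> :: real
    and u0 :: distr and Z :: "real \<Rightarrow> distr" and Zh :: "nat \<Rightarrow> nat \<Rightarrow> real \<Rightarrow> distr"
  assumes "m \<ge> 1" and "Re \<nu> > 0" and "\<mu> > 0"
    and "2 + 2 * \<mu> * (\<mu> + sqrt (1 + \<mu>^2)) > 2 * real m + 1"
    and "1 / (1 + \<mu> * (\<mu> + sqrt (1 + \<mu>^2))) \<le> \<alpha>0" and "\<alpha>0 \<le> 2 / (2 * real m + 1)"
    and "\<beta> > 0" and "(\<alpha>0 + \<beta>) / 2 < \<gamma>" and "\<gamma> < 1 / (2 * real m + 1)"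
    and "in_C (- \<alpha>0) u0" and "in_L m Z Zh"
  shows "\<exists>v. ccont_on {0<..} \<beta> v \<and> (\<forall>T>0. mild_solution m \<mu> \<nu> \<tau> \<beta> \<gamma> u0 Z Zh T v) \<and>
           (\<forall>w. ccont_on {0<..} \<beta> w \<and> (\<forall>T>0. mild_solution m \<mu> \<nu> \<tau> \<beta> \<gamma> u0 Z Zh T w)
                \<longrightarrow> (\<forall>t>0. w t = v t))"
proof -
  \<comment> \<open>Half of the slack in the condition on \<gamma>. Raising both \<alpha>0 and
    \<beta> by \<eta> raises their mean by \<eta> and keeps it below \<gamma>.\<close>
  define \<eta> where "\<eta> = (\<gamma> - (\<alpha>0 + \<beta>) / 2) / 2"
  have \<eta>: "\<eta> > 0" "(\<alpha>0 + \<beta>) / 2 + 2 * \<eta> = \<gamma>" using assms(8) by (auto simp: \<eta>_def field_simps)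
  define a1 where "a1 = \<alpha>0 + \<eta>"
  define b1 where "b1 = \<beta> + \<eta>"
  define q where "q = \<mu> * (\<mu> + sqrt (1 + \<mu>\<^sup>2))"
  have q: "q > 0" unfolding q_def using assms(3) by (intro mult_pos_pos add_pos_nonneg) auto
  have a0: "\<alpha>0 > 0" using assms(5) q unfolding q_def[symmetric] by (smt (verit) divide_pos_pos)
  have ab: "(a1 + b1) / 2 < \<gamma>" "0 < a1" "0 < b1" "\<beta> < b1" "\<alpha>0 \<le> a1" using \<eta> a0 assms(7) by (auto simp: a1_def b1_def field_simps)
  have m3: "2 * real m + 1 \<ge> 3" using assms(1) by simp
  have g3: "(2 * real m + 1) * \<gamma> < 1" using assms(9) by (simp add: field_simps)
  have "0 < (a1 + b1) / 2" using ab(2,3) by simp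
  then have g0: "0 < \<gamma>" using ab(1) by (rule less_trans)
  \<comment> \<open>\<gamma> < 1/3 forces a1 < 1, that is r > 1 in the energy estimate.\<close>
  have "3 * \<gamma> \<le> (2 * real m + 1) * \<gamma>" using m3 g0 by (intro mult_right_mono) auto
  then have "3 * \<gamma> < 1" using g3 by linarith
  moreover have "a1 + b1 < 2 * \<gamma>" using ab(1) by simp
  ultimately have a11: "a1 < 1" using ab(3) g0 by linarith
  \<comment> \<open>The smallness of the coefficient exponent: below \<beta> for the products, below
    a1 for the time exponents, below 1/(2m) for the duality estimate.\<close>
  define al where "al = min (min \<beta> a1) (1 / (2 * real m)) / 2"
  have "0 < 1 / (2 * real m)" using assms(1) by simp
  then have "0 < min (min \<beta> a1) (1 / (2 * real m))" using assms(7) ab(2) by simp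
  moreover have "min (min \<beta> a1) (1 / (2 * real m)) \<le> \<beta>" "min (min \<beta> a1) (1 / (2 * real m)) \<le> a1"
    "min (min \<beta> a1) (1 / (2 * real m)) \<le> 1 / (2 * real m)" by auto
  ultimately have al: "0 < al" "al < \<beta>" "al < a1" "al < 1 / (2 * real m)" unfolding al_def by linarith+
  have cond: "(1 / a1 - 1)\<^sup>2 < \<mu>\<^sup>2 * (2 * (1 / a1) - 1)"
  proof -
    have "1 / (1 + q) < a1" using assms(5) \<eta> unfolding q_def a1_def by linarith
    then have "1 < a1 * (1 + q)" using q by (simp add: field_simps)
    then have "1 / a1 - 1 < q" "0 < 1 / a1 - 1" using ab a11 by (auto simp: field_simps)
    from elliptic_range[OF assms(3) this(2) this(1)[unfolded q_def]] show ?thesis by (simp add: algebra_simps)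
  qed
  have sub: "(al + b) / 2 + (real (2 * m + 1) - 1) * \<gamma> < 1" "(al + b) / 2 < 1" "(a1 + b) / 2 < \<gamma>" if "b \<le> b1" for b
  proof -
    have "a1 + b1 < 2 * \<gamma>" using ab(1) by simp
    then have "al + b < 2 * \<gamma>" using al(3) that by linarith
    then have "(al + b) / 2 < \<gamma>" by simp
    moreover have "(real (2 * m + 1) - 1) * \<gamma> + \<gamma> < 1" using g3 by (simp add: algebra_simps)
    moreover have "0 \<le> (real (2 * m + 1) - 1) * \<gamma>" using g0 by simp
    ultimately show "(al + b) / 2 + (real (2 * m + 1) - 1) * \<gamma> < 1" "(al + b) / 2 < 1" by linarith+
    show "(a1 + b) / 2 < \<gamma>" using \<open>a1 + b1 < 2 * \<gamma>\<close> that by simp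
  qed
  have pg: "real (2 * m + 1) * \<gamma> < 1" using g3 by (simp add: add.commute)
  \<comment> \<open>Two instances: existence is carried out at the higher regularity b1, which gives
    norm continuity in C^\<beta>; uniqueness must hold among all solutions of regularity
    \<beta>.\<close>
  interpret A: mild \<mu> al \<beta> \<gamma> a1 "2 * m + 1"
    by unfold_locales (use assms(3,7) al ab g0 pg sub[of \<beta>] in auto)
  interpret B: mild \<mu> al b1 \<gamma> a1 "2 * m + 1"
    by unfold_locales (use assms(3) al ab g0 pg sub[of b1] in auto)
  let ?N = "\<lambda>t v. PsiW m \<nu> \<tau> v (\<lambda>a b. Zcol m Z Zh a b t)"
  have "bb (-a1) (2 powr (- \<alpha>0) * Cnorm (- \<alpha>0) u0) u0" using in_C_bb[OF assms(10)] ab(5) by (auto intro: bb_weaken)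
  then obtain v where v: "\<And>T. T > 0 \<Longrightarrow> B.sol u0 ?N T v"
    using B.exists_sol[OF refl assms(1) less_trans[OF al(2) ab(4)] al(4) assms(11,2) a11 cond] by blast
  have vB: "\<exists>B\<ge>1. B.wb T B v" if "T > 0" for T using v[OF that] unfolding B.sol_def by blast
  have cfv: "cf {0<..} v"
  proof (rule cf_open_cover)
    fix t :: real assume t: "t \<in> {0<..}"
    then have "cf {0<..t + 1} v" using vB[of "t + 1"] unfolding B.wb_def by auto
    then have "cf ({0<..} \<inter> {..<t + 1}) v" by (rule cf_subset) auto
    then show "\<exists>U. open U \<and> t \<in> U \<and> cf ({0<..} \<inter> U) v" by (intro exI[of _ "{..<t + 1}"]) auto
  qed
  have "\<exists>B. \<forall>t\<in>{r..T}. bb b1 B (v t)" if r: "0 < r" for r T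
  proof -
    have "0 < max r T" using r by simp
    from vB[OF this] obtain B where B: "B \<ge> 1" "B.wb (max r T) B v" by blast
    have "bb b1 (B * r powr (-\<gamma>)) (v t)" if t: "t \<in> {r..T}" for t
    proof (rule bb_mono)
      show "bb b1 (B * t powr (-\<gamma>)) (v t)" using B(2) t r unfolding B.wb_def by auto
      show "B * t powr (-\<gamma>) \<le> B * r powr (-\<gamma>)" using t r g0 B(1) by (intro mult_left_mono powr_mono2') auto
    qed
    then show ?thesis by blast
  qed
  then have cc: "ccont_on {0<..} \<beta> v" by (rule ccont_on_interpolation[OF cfv _ ab(4)])
  have al1: "al < 1" using al a11 by linarith
  note iff = A.mild_solution_iff[OF refl al(2) assms(11) al1]
  have sA: "A.sol u0 ?N T v" if T: "T > 0" for T
  proof -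
    obtain B where "B \<ge> 1" "B.wb T B v" using vB[OF T] by blast
    then have "A.wb T B v" unfolding A.wb_def B.wb_def using ab(4) by (auto intro: bb_weaken)
    moreover have "\<forall>t\<in>{0<..T}. v t = A.Phi u0 ?N v t" using v[OF T] unfolding B.sol_def by blast
    ultimately show ?thesis unfolding A.sol_def using \<open>B \<ge> 1\<close> by blast
  qed
  have ms: "mild_solution m \<mu> \<nu> \<tau> \<beta> \<gamma> u0 Z Zh T v" if T: "T > 0" for T
    unfolding iff[OF T] by (intro conjI sA[OF T] ccont_on_subset[OF cc]) auto
  have "w t = v t" if w: "\<forall>T>0. mild_solution m \<mu> \<nu> \<tau> \<beta> \<gamma> u0 Z Zh T w" and t: "t > 0" for w t
  proof -
    obtain K where K: "coeff_bound m al \<gamma> t K (Zcol m Z Zh)" using ZB_Zcol[OF assms(11) al(1) al1 g0 A.ga_less_1 t] by blast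
    obtain L where NL: "A.NL t L ?N" using A.NL_PsiW[OF refl al(2) K] by blast
    have "A.sol u0 ?N t w" using w t iff[OF t] by blast
    from A.unique[OF NL this sA[OF t]] show ?thesis using t by auto
  qed
  then show ?thesis using cc ms by blast
qed

end
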